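(* Let $1\le d\le D$ and $m\ge1$ be integers and let $U\subseteq\mathbb{R}^m$ be open and bounded. For a map $A$ on $U$ with values in $M_{D,d}(\mathbb{C})$ write $\sigma_*(A)=\sigma\circ A$. Then: (1) For each $1\le q<\infty$, the map $\sigma_*:W^{1,q}(U,M_{D,d}(\mathbb{C}))\to W^{1,q}(U,\mathbb{R}^d)$ is continuous. (2) The map $\sigma_*:C^{0,1}(\overline U,M_{D,d}(\mathbb{C}))\to C^{0,1}_q(\overline U,\mathbb{R}^d)$ is continuous, for all $1\le q<\infty$. (3) Assume additionally that $U$ is a Lipschitz domain. Then the map $\sigma_*:C^{0,1}(\overline U,M_{D,d}(\mathbb{C}))\to C^{0,\alpha}(\overline U,\mathbb{R}^d)$ is continuous, for all $0<\alpha<1$, but not for $\alpha=1$. (4) If $A_n\to A$ in $C^{0,1}(\overline U,M_{D,d}(\mathbb{C}))$, then $\partial_j(\sigma_*(A_n))(x)\to\partial_j(\sigma_*(A))(x)$ as $n\to\infty$, for each $1\le j\le m$ and almost every $x\in U$.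
   Context: $M_{D,d}(\mathbb{C})$ is the space of complex $D\times d$ matrices with the Frobenius norm $\|A\|_2=(\sum_{i,j}|a_{ij}|^2)^{1/2}$. The singular values $\sigma_1(A)\ge\dots\ge\sigma_d(A)\ge0$ of $A$ are the nonnegative square roots of the eigenvalues of $A^*A$ (with multiplicity); $\sigma=(\sigma_1,\dots,\sigma_d):M_{D,d}(\mathbb{C})\to\mathbb{R}^d$ is $1$-Lipschitz for the $2$-norms. For a finite-dimensional real Euclidean space $V$: $W^{1,q}(U,V)$ has the norm $\|f\|_{L^q}+\sum_i\|\partial_if\|_{L^q}$ with $\|f\|_{L^q}=\big\|\,\|f\|_2\,\big\|_{L^q(U)}$; for $\alpha\in(0,1]$, $C^{0,\alpha}(\overline U,V)$ has the norm $\sup_{x\in U}\|f(x)\|_2+\sup_{x\ne y\in U}\frac{\|f(x)-f(y)\|_2}{\|x-y\|_2^\alpha}$. $C^{0,1}_q(\overline U,\mathbb{R}^d)$ is the set $C^{0,1}(\overline U,\mathbb{R}^d)$ with the topology induced by the norm of $W^{1,q}(U,\mathbb{R}^d)$. A Lipschitz domain is a nonempty open set with Lipschitz boundary. *)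

theory Defs
  imports "HOL-Analysis.Analysis" "HOL-Computational_Algebra.Computational_Algebra"
begin

section \<open>Singular values\<close>

text \<open>Complex \<open>D \<times> d\<close> matrices are elements of \<open>complex ^ 'd ^ 'D\<close>; the library norm of
  this type is the Frobenius norm.\<close>

definition conjugate_transpose :: "complex ^ 'n ^ 'm \<Rightarrow> complex ^ 'm ^ 'n" where
  "conjugate_transpose A = map_matrix cnj (transpose A)"

definition charpoly :: "complex ^ 'n ^ 'n \<Rightarrow> complex poly" where
  "charpoly A = det (mat [:0, 1:] - map_matrix (\<lambda>a. [:a:]) A)"

definition eigenvalues_mset :: "complex ^ 'n ^ 'n \<Rightarrow> complex multiset" where
  "eigenvalues_mset A = proots (charpoly A)"

text \<open>The eigenvalues of \<open>A\<^sup>*A\<close> are real and nonnegative, so \<open>Re\<close> loses nothing.\<close>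

definition singular_value_list :: "complex ^ 'd ^ 'D \<Rightarrow> real list" where
  "singular_value_list A =
     rev (sorted_list_of_multiset
       (image_mset (\<lambda>z. sqrt (Re z)) (eigenvalues_mset (conjugate_transpose A ** A))))"

text \<open>The finite linear order \<open>'d\<close> plays the role of \<open>{1, \<dots>, d}\<close>; the zero-based position of
  \<open>i\<close> is the number of its strict predecessors.\<close>

definition singular_values :: "complex ^ ('d :: {finite,linorder}) ^ 'D \<Rightarrow> real ^ ('d :: {finite,linorder})" where
  "singular_values A = (\<chi> i. singular_value_list A ! card {j. j < i})"

definition sigma_star ::
  "('a \<Rightarrow> complex ^ ('d :: {finite,linorder}) ^ 'D) \<Rightarrow> 'a \<Rightarrow> real ^ ('d :: {finite,linorder})" where
  "sigma_star A = singular_values \<circ> A"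

section \<open>Function spaces\<close>

text \<open>The topology induced on a set \<open>S\<close> of functions by a (semi)norm \<open>N\<close>. Elements of the
  function spaces below are functions on the whole of \<open>\<real>\<^sup>m\<close>, representing their restrictions
  (for Sobolev spaces, their classes modulo equality almost everywhere on \<open>U\<close>). The topologies
  do not distinguish different representatives, so a map is continuous if and only if the map
  that it induces on the classes is.\<close>

definition seminorm_topology ::
  "('a \<Rightarrow> 'v :: ab_group_add) set \<Rightarrow> (('a \<Rightarrow> 'v) \<Rightarrow> real) \<Rightarrow> ('a \<Rightarrow> 'v) topology" where
  "seminorm_topology S N =
     topology_generated_by {{g \<in> S. N (\<lambda>x. g x - f x) < r} | f r. f \<in> S \<and> 0 < r}"

definition has_partial ::
  "'m \<Rightarrow> (real ^ 'm \<Rightarrow> 'v :: real_normed_vector) \<Rightarrow> real ^ 'm \<Rightarrow> bool" where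
  "has_partial j f x \<longleftrightarrow> (\<lambda>t :: real. f (x + t *\<^sub>R axis j 1)) differentiable (at 0)"

definition partial ::
  "'m \<Rightarrow> (real ^ 'm \<Rightarrow> 'v :: real_normed_vector) \<Rightarrow> real ^ 'm \<Rightarrow> 'v" where
  "partial j f x = vector_derivative (\<lambda>t :: real. f (x + t *\<^sub>R axis j 1)) (at 0)"

primrec continuously_diff :: "nat \<Rightarrow> (real ^ 'm \<Rightarrow> real) \<Rightarrow> bool" where
  "continuously_diff 0 f \<longleftrightarrow> continuous_on UNIV f"
| "continuously_diff (Suc k) f \<longleftrightarrow>
     continuous_on UNIV f \<and> (\<forall>j. (\<forall>x. has_partial j f x) \<and> continuously_diff k (partial j f))"

definition test_functions :: "(real ^ 'm) set \<Rightarrow> (real ^ 'm \<Rightarrow> real) set" where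
  "test_functions U =
     {\<phi>. (\<forall>k. continuously_diff k \<phi>) \<and>
         compact (closure {x. \<phi> x \<noteq> 0}) \<and> closure {x. \<phi> x \<noteq> 0} \<subseteq> U}"

definition locally_integrable :: "(real ^ 'm) set \<Rightarrow> (real ^ 'm \<Rightarrow> 'v :: euclidean_space) \<Rightarrow> bool"
  where
  "locally_integrable U f \<longleftrightarrow> (\<forall>K. compact K \<and> K \<subseteq> U \<longrightarrow> integrable (lebesgue_on K) f)"

definition is_weak_partial ::
  "(real ^ 'm) set \<Rightarrow> 'm \<Rightarrow> (real ^ 'm \<Rightarrow> 'v :: euclidean_space) \<Rightarrow> (real ^ 'm \<Rightarrow> 'v) \<Rightarrow> bool" where
  "is_weak_partial U j f g \<longleftrightarrow>
     locally_integrable U f \<and> locally_integrable U g \<and>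
     (\<forall>\<phi> \<in> test_functions U.
        (LINT x|lebesgue_on U. partial j \<phi> x *\<^sub>R f x) = - (LINT x|lebesgue_on U. \<phi> x *\<^sub>R g x))"

text \<open>Weak partial derivatives are unique up to equality almost everywhere on \<open>U\<close>.\<close>

definition weak_partial ::
  "(real ^ 'm) set \<Rightarrow> 'm \<Rightarrow> (real ^ 'm \<Rightarrow> 'v :: euclidean_space) \<Rightarrow> real ^ 'm \<Rightarrow> 'v" where
  "weak_partial U j f = (SOME g. is_weak_partial U j f g)"

definition Lq_space :: "(real ^ 'm) set \<Rightarrow> real \<Rightarrow> (real ^ 'm \<Rightarrow> 'v :: euclidean_space) set" where
  "Lq_space U q =
     {f. f \<in> borel_measurable (lebesgue_on U) \<and> integrable (lebesgue_on U) (\<lambda>x. norm (f x) powr q)}"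

definition Lq_norm :: "(real ^ 'm) set \<Rightarrow> real \<Rightarrow> (real ^ 'm \<Rightarrow> 'v :: euclidean_space) \<Rightarrow> real" where
  "Lq_norm U q f = (LINT x|lebesgue_on U. norm (f x) powr q) powr (1 / q)"

definition sobolev_space :: "(real ^ 'm) set \<Rightarrow> real \<Rightarrow> (real ^ 'm \<Rightarrow> 'v :: euclidean_space) set"
  where
  "sobolev_space U q =
     {f \<in> Lq_space U q. \<forall>j. \<exists>g \<in> Lq_space U q. is_weak_partial U j f g}"

definition sobolev_norm :: "(real ^ 'm) set \<Rightarrow> real \<Rightarrow> (real ^ 'm \<Rightarrow> 'v :: euclidean_space) \<Rightarrow> real"
  where
  "sobolev_norm U q f = Lq_norm U q f + (\<Sum>j\<in>UNIV. Lq_norm U q (weak_partial U j f))"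

definition sobolev_topology ::
  "(real ^ 'm) set \<Rightarrow> real \<Rightarrow> (real ^ 'm \<Rightarrow> 'v :: euclidean_space) topology" where
  "sobolev_topology U q = seminorm_topology (sobolev_space U q) (sobolev_norm U q)"

definition holder_space ::
  "(real ^ 'm) set \<Rightarrow> real \<Rightarrow> (real ^ 'm \<Rightarrow> 'v :: euclidean_space) set" where
  "holder_space U \<alpha> =
     {f. continuous_on (closure U) f \<and> bounded (f ` U) \<and>
         (\<exists>C. \<forall>x\<in>U. \<forall>y\<in>U. norm (f x - f y) \<le> C * norm (x - y) powr \<alpha>)}"

text \<open>The case distinction is needed as the supremum of the empty set of reals is unspecified.\<close>

definition holder_norm ::
  "(real ^ 'm) set \<Rightarrow> real \<Rightarrow> (real ^ 'm \<Rightarrow> 'v :: euclidean_space) \<Rightarrow> real" where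
  "holder_norm U \<alpha> f =
     (if U = {} then 0
      else (SUP x\<in>U. norm (f x)) +
           (SUP (x, y)\<in>{(x, y). x \<in> U \<and> y \<in> U \<and> x \<noteq> y}. norm (f x - f y) / norm (x - y) powr \<alpha>))"

definition holder_topology ::
  "(real ^ 'm) set \<Rightarrow> real \<Rightarrow> (real ^ 'm \<Rightarrow> 'v :: euclidean_space) topology" where
  "holder_topology U \<alpha> = seminorm_topology (holder_space U \<alpha>) (holder_norm U \<alpha>)"

text \<open>\<open>C\<^sup>0\<^sup>,\<^sup>1\<close> with the topology of the norm of \<open>W\<^sup>1\<^sup>,\<^sup>q\<close>.\<close>

definition lipschitz_sobolev_topology ::
  "(real ^ 'm) set \<Rightarrow> real \<Rightarrow> (real ^ 'm \<Rightarrow> 'v :: euclidean_space) topology" where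
  "lipschitz_sobolev_topology U q = seminorm_topology (holder_space U 1) (sobolev_norm U q)"

section \<open>Lipschitz domains\<close>

text \<open>Near every boundary point, \<open>U\<close> is the strict epigraph of a Lipschitz function in a suitable
  orthonormal coordinate system, whose last axis is \<open>v\<close>; the function \<open>\<gamma>\<close> is defined on the
  hyperplane orthogonal to \<open>v\<close>.\<close>

definition lipschitz_boundary :: "(real ^ 'm) set \<Rightarrow> bool" where
  "lipschitz_boundary U \<longleftrightarrow>
     (\<forall>p \<in> frontier U. \<exists>r > 0. \<exists>v L. \<exists>\<gamma> :: real ^ 'm \<Rightarrow> real.
        norm v = 1 \<and> L-lipschitz_on {y. y \<bullet> v = 0} \<gamma> \<and>
        U \<inter> ball p r = {x \<in> ball p r. x \<bullet> v > \<gamma> (x - (x \<bullet> v) *\<^sub>R v)})"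

definition lipschitz_domain :: "(real ^ 'm) set \<Rightarrow> bool" where
  "lipschitz_domain U \<longleftrightarrow> U \<noteq> {} \<and> open U \<and> lipschitz_boundary U"

end

theory Submission
  imports Defs
begin

text \<open>By Ky Fan's principle the sum of the \<open>k\<close> largest singular values is a convex Lipschitz function of
  the matrix, so every component of \<open>\<sigma>\<close> is a difference of two convex Lipschitz functions \<open>N\<close>.
  Such an \<open>N\<close> has one-sided directional derivatives everywhere. If \<open>f\<close> is weakly differentiable,
  the two one-sided derivatives of \<open>N\<close> at \<open>f x\<close> in direction \<open>\<partial>\<^sub>jf x\<close> are both weak derivatives of
  \<open>N \<circ> f\<close>, hence coincide for almost every \<open>x\<close>, which gives a chain rule.
  At pairs (point, direction) where the derivative of a convex function is two-sided, it depends
  continuously on the pair, because the tangent lies below the graph. This stability gives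
  pointwise convergence of the derivatives, and dominated convergence gives convergence in
  \<open>L\<^sup>q\<close>. Hoelder continuity follows by interpolating between the uniform and the Lipschitz bound.\<close>

section \<open>Lipschitz functions are differentiable along lines\<close>

text \<open>A Sobolev map \<open>f\<close> may send a set of positive measure into the matrices at
  which \<sigma> is not differentiable (coinciding or vanishing singular values). A theorem on
  almost everywhere differentiability in the space of matrices therefore says nothing about the
  composition. What can be saved is differentiability at \<open>f x\<close> in the single direction
  of the partial derivative of \<open>f\<close>, and convexity is what provides one-sided limits at
  every point, so that there is something to compare. A single singular value beyond the largest is
  not convex in general; this forces the detour through sums of the largest ones and differences of
  them. Stability of derivatives is pointwise, never uniform: a corner can move across a point. Two
  notions of derivative occur, weak ones for Sobolev maps and classical ones for Lipschitz maps.
  They are identified through almost everywhere differentiability along coordinate lines, which is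
  the purpose of the first section.\<close>

lemma interval_measure_complementary:
  fixes u :: "real \<Rightarrow> real"
  assumes mono: "\<And>x y. x \<le> y \<Longrightarrow> u x \<le> u y"
    and lip: "\<And>x y. x \<le> y \<Longrightarrow> u y - u x \<le> K * (y - x)"
    and cont: "\<And>x. isCont u x"
    and S: "S \<in> sets borel"
  shows "measure (interval_measure u) (S \<inter> {a<..b}) + measure (interval_measure (\<lambda>x. K * x - u x)) (S \<inter> {a<..b})
    = K * measure lborel (S \<inter> {a<..b})"
proof -
  \<comment> \<open>Both distribution functions are increasing, by \<open>mono\<close> and
    \<open>lip\<close>, and they add up to \<open>K * x\<close>. So the two Stieltjes measures add
    up to \<open>K\<close> times Lebesgue measure on half-open intervals, and a Dynkin system
    argument extends this to Borel sets.\<close>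
  define M1 where "M1 = interval_measure u"
  define M2 where "M2 = interval_measure (\<lambda>x. K * x - u x)"
  have cont2: "isCont (\<lambda>x. K * x - u x) x" for x
    using cont by (intro continuous_intros)
  have mono2: "K * x - u x \<le> K * y - u y" if "x \<le> y" for x y
    using lip[OF that] by (simp add: algebra_simps)
  have r1: "continuous (at_right x) u" and r2: "continuous (at_right x) (\<lambda>x. K * x - u x)" for x
    using cont[of x] cont2[of x] continuous_at_imp_continuous_within by blast+
  have [simp]: "sets M1 = sets borel" "sets M2 = sets borel" "space M1 = UNIV" "space M2 = UNIV"
    by (auto simp: M1_def M2_def)
  have e1: "emeasure M1 {c<..d} = ennreal (if c \<le> d then u d - u c else 0)" for c d
    unfolding M1_def by (subst emeasure_interval_measure_Ioc_eq) (use mono r1 in auto)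
  have e2: "emeasure M2 {c<..d} = ennreal (if c \<le> d then (K * d - u d) - (K * c - u c) else 0)" for c d
    unfolding M2_def by (subst emeasure_interval_measure_Ioc_eq) (use mono2 r2 in auto)
  have e3: "emeasure lborel {c<..d} = ennreal (if c \<le> d then d - c else 0)" for c d :: real
    by auto
  have m: "measure M1 {c<..d} + measure M2 {c<..d} = K * measure lborel {c<..d}" for c d :: real
    unfolding measure_def e1 e2 e3 using mono[of c d] mono2[of c d] by (auto simp: algebra_simps)
  \<comment> \<open>Cutting down to a bounded interval keeps all three measures finite. Without it
    \<open>measure\<close> would silently return 0 on sets of infinite measure, and complements
    could not be subtracted.\<close>
  let ?Q = "{a<..b}"
  have fin: "emeasure M1 (T \<inter> ?Q) \<noteq> \<infinity>" "emeasure M2 (T \<inter> ?Q) \<noteq> \<infinity>" "emeasure lborel (T \<inter> ?Q) \<noteq> \<infinity>"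
    if "T \<in> sets borel" for T
  proof -
    have "emeasure M1 (T \<inter> ?Q) \<le> emeasure M1 ?Q" "emeasure M2 (T \<inter> ?Q) \<le> emeasure M2 ?Q"
      "emeasure lborel (T \<inter> ?Q) \<le> emeasure lborel ?Q"
      using that by (auto intro!: emeasure_mono)
    then show "emeasure M1 (T \<inter> ?Q) \<noteq> \<infinity>" "emeasure M2 (T \<inter> ?Q) \<noteq> \<infinity>" "emeasure lborel (T \<inter> ?Q) \<noteq> \<infinity>"
      unfolding e1 e2 e3 by (auto simp: top_unique)
  qed
  have Smem: "S \<in> sigma_sets UNIV (range (\<lambda>(a, b). {a <.. b::real}))"
    using S by (subst (asm) borel_sigma_sets_Ioc) auto
  have "Int_stable (range (\<lambda>(a, b). {a <.. b::real}))"
    by (auto simp: Int_stable_def)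
  moreover have "range (\<lambda>(a, b). {a <.. b::real}) \<subseteq> Pow UNIV" by simp
  ultimately have "measure M1 (S \<inter> ?Q) + measure M2 (S \<inter> ?Q) = K * measure lborel (S \<inter> ?Q)"
    using Smem
  proof (induction rule: sigma_sets_induct_disjoint)
    case (basic A)
    then obtain c d where "A = {c<..d}" by auto
    then have "A \<inter> ?Q = {max c a<..min d b}" by auto
    then show ?case using m by simp
  next
    case empty then show ?case by simp
  next
    case (compl A)
    then have A: "A \<in> sets borel" by (subst borel_sigma_sets_Ioc) auto
    have eq: "(UNIV - A) \<inter> ?Q = ?Q - A \<inter> ?Q" by auto
    have "measure M (?Q - A \<inter> ?Q) = measure M ?Q - measure M (A \<inter> ?Q)"
      if "sets M = sets borel" "emeasure M (UNIV \<inter> ?Q) \<noteq> \<infinity>" for M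
      using that A by (intro measure_Diff) (auto simp: )
    then have d: "measure M1 (?Q - A \<inter> ?Q) = measure M1 ?Q - measure M1 (A \<inter> ?Q)"
      "measure M2 (?Q - A \<inter> ?Q) = measure M2 ?Q - measure M2 (A \<inter> ?Q)"
      "measure lborel (?Q - A \<inter> ?Q) = measure lborel ?Q - measure lborel (A \<inter> ?Q)"
      using fin[of UNIV] by simp_all
    have "x1 - y1 + (x2 - y2) = K * (x3 - y3)" if "x1 + x2 = K * x3" "y1 + y2 = K * y3" for x1 x2 x3 y1 y2 y3
      using that by (simp add: right_diff_distrib)
    from this[OF m compl(2)] show ?case unfolding eq d by simp
  next
    case (union A)
    have A: "A i \<in> sets borel" for i using union(2) by (subst borel_sigma_sets_Ioc) auto
    have eq: "(\<Union>i. A i) \<inter> ?Q = (\<Union>i. A i \<inter> ?Q)" by auto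
    have dis: "disjoint_family (\<lambda>i. A i \<inter> ?Q)" using union(1) by (auto simp: disjoint_family_on_def)
    have fin': "emeasure M1 (\<Union>i. A i \<inter> ?Q) \<noteq> \<infinity>" "emeasure M2 (\<Union>i. A i \<inter> ?Q) \<noteq> \<infinity>" "emeasure lborel (\<Union>i. A i \<inter> ?Q) \<noteq> \<infinity>"
      unfolding eq[symmetric] using A by (intro fin; auto)+
    have s: "(\<lambda>i. measure M1 (A i \<inter> ?Q)) sums measure M1 (\<Union>i. A i \<inter> ?Q)"
      "(\<lambda>i. measure M2 (A i \<inter> ?Q)) sums measure M2 (\<Union>i. A i \<inter> ?Q)"
      "(\<lambda>i. measure lborel (A i \<inter> ?Q)) sums measure lborel (\<Union>i. A i \<inter> ?Q)"
      using A dis fin' by (intro measure_UNION; auto)+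
    show ?case unfolding eq
      using sums_unique2[OF sums_add[OF s(1,2)]] sums_mult[OF s(3), of K] union(3) by simp
  qed
  then show ?thesis unfolding M1_def M2_def .
qed

text \<open>Compares the Stieltjes measure of \<open>u\<close> with Lebesgue measure through a Vitali covering by intervals
  on which \<open>u\<close> has small mean slope; such an interval need only contain \<open>x\<close> in its interior.\<close>

lemma interval_measure_le_lborel:
  fixes u :: "real \<Rightarrow> real"
  assumes mono: "\<And>x y. x \<le> y \<Longrightarrow> u x \<le> u y"
    and lip: "\<And>x y. x \<le> y \<Longrightarrow> u y - u x \<le> K * (y - x)"
    and cont: "\<And>x. isCont u x"
    and S: "S \<in> sets borel" "S \<subseteq> {a<..<b}"
    and r: "0 \<le> r"
    and fine: "\<And>x d. x \<in> S \<Longrightarrow> 0 < d \<Longrightarrow> \<exists>p q. p < x \<and> x < q \<and> q - p < d \<and> u q - u p \<le> r * (q - p)"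
  shows "measure (interval_measure u) S \<le> r * measure lborel S"
proof -
  define M where "M = interval_measure u"
  have [simp]: "sets M = sets borel" "space M = UNIV" by (auto simp: M_def)
  have [measurable]: "S \<in> sets borel" by fact
  have Icc: "emeasure M {c..d} = ennreal (u d - u c)" if "c \<le> d" for c d
    unfolding M_def using that mono cont by (intro emeasure_interval_measure_Icc) (auto simp: continuous_at_imp_continuous_on)
  have Ioc: "emeasure M {c<..d} = ennreal (if c \<le> d then u d - u c else 0)" for c d
    unfolding M_def by (subst emeasure_interval_measure_Ioc_eq)
      (use mono cont in \<open>auto intro: continuous_at_imp_continuous_within\<close>)
  have fin: "emeasure M T \<noteq> \<infinity>" "emeasure lborel T \<noteq> \<infinity>" if "T \<subseteq> {a<..<b}" "T \<in> sets borel" for T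
  proof -
    have "emeasure M T \<le> emeasure M {a<..b}" "emeasure lborel T \<le> emeasure lborel {a<..b}"
      using that by (auto intro!: emeasure_mono)
    then show "emeasure M T \<noteq> \<infinity>" "emeasure lborel T \<noteq> \<infinity>" using Ioc[of a b]
      by (auto simp: top_unique split: if_splits)
  qed
  \<comment> \<open>Absolute continuity: a complementary pair of nonnegative measures adds up to a
    multiple of Lebesgue measure, so Lebesgue null sets are null for \<open>M\<close>. This disposes
    of the part that a Vitali covering leaves uncovered.\<close>
  have null: "emeasure M N = 0" if "N \<subseteq> {a<..<b}" "N \<in> sets borel" "emeasure lborel N = 0" for N
  proof -
    have eq: "N \<inter> {a<..b} = N" using that by auto
    have "measure M N + measure (interval_measure (\<lambda>x. K * x - u x)) N = K * measure lborel N"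
      using interval_measure_complementary[OF mono lip cont that(2), of a b] by (simp add: eq M_def)
    moreover have "measure lborel N = 0" using that by (simp add: measure_def)
    ultimately have "measure M N = 0" using measure_nonneg[of M N] measure_nonneg[of "interval_measure (\<lambda>x. K * x - u x)" N]
      by (simp add: add_nonneg_eq_0_iff)
    then show ?thesis using fin(1)[OF that(1,2)] by (simp add: measure_eq_0_null_sets emeasure_eq_ennreal_measure)
  qed
  have "emeasure M S \<le> ennreal r * emeasure lborel S + ennreal e'" if "0 < e'" for e'
  proof -
    \<comment> \<open>The denominator \<open>r + 1\<close> gives \<open>r * e \<le> e'\<close> also
      when \<open>r = 0\<close>.\<close>
    define e where "e = e' / (r + 1)"
    have e: "e > 0" "r * e \<le> e'" using that r by (auto simp: e_def field_simps)
    obtain U where U: "open U" "S \<subseteq> U" "emeasure lborel (U - S) < e"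
      using outer_regular_lborel[OF S(1) e(1)] by blast
    define O' where "O' = U \<inter> {a<..<b}"
    have O': "open O'" "S \<subseteq> O'" using U S by (auto simp: O'_def)
    \<comment> \<open>Pairs of centre and radius, as the covering theorem speaks of balls. Intervals
      inside \<open>O'\<close> have a union of length at most that of \<open>U\<close>, hence at
      most that of \<open>S\<close> plus \<open>e\<close>.\<close>
    define I where "I = {(c, d) | c d. 0 < d \<and> {c - d..c + d} \<subseteq> O' \<and> u (c + d) - u (c - d) \<le> r * (2 * d)}"
    have pos: "0 < snd i" if "i \<in> I" for i using that by (auto simp: I_def)
    have ex: "\<exists>i. i \<in> I \<and> x \<in> cball (fst i) (snd i) \<and> snd i < \<delta>" if x: "x \<in> S" and \<delta>: "0 < \<delta>" for x \<delta>
    proof -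
      obtain \<eta> where \<eta>: "\<eta> > 0" "ball x \<eta> \<subseteq> O'" using O' x openE by blast
      obtain p q where pq: "p < x" "x < q" "q - p < min \<delta> \<eta>" "u q - u p \<le> r * (q - p)"
        using fine[OF x, of "min \<delta> \<eta>"] \<delta> \<eta> by auto
      let ?i = "((p + q) / 2, (q - p) / 2)"
      have 1: "(p + q) / 2 - (q - p) / 2 = p" "(p + q) / 2 + (q - p) / 2 = q" by (auto simp: field_simps)
      have two2: "2 * ((q - p) / 2) = q - p" by simp
      have "{p..q} \<subseteq> ball x \<eta>" using pq by (auto simp: dist_real_def)
      then have "{(p + q) / 2 - (q - p) / 2..(p + q) / 2 + (q - p) / 2} \<subseteq> O'"
        unfolding 1 using \<eta> by blast
      moreover have "u ((p + q) / 2 + (q - p) / 2) - u ((p + q) / 2 - (q - p) / 2) \<le> r * (2 * ((q - p) / 2))"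
        using pq(4) unfolding 1 by (simp only: two2)
      moreover have "0 < (q - p) / 2" using pq by simp
      ultimately have "?i \<in> I" unfolding I_def by blast
      moreover have "x \<in> cball (fst ?i) (snd ?i)" using pq by (auto simp: dist_real_def abs_le_iff field_simps)
      moreover have "snd ?i < \<delta>" using pq by auto
      ultimately show ?thesis by blast
    qed
    obtain C where C: "countable C" "C \<subseteq> I"
      "pairwise (\<lambda>i j. disjnt (cball (fst i) (snd i)) (cball (fst j) (snd j))) C"
      "negligible (S - (\<Union>i\<in>C. cball (fst i) (snd i)))"
      by (rule Vitali_covering_theorem_cballs[of I snd S fst, OF pos ex])
    let ?B = "\<lambda>i. cball (fst i) (snd i) :: real set"
    let ?N = "S - (\<Union>i\<in>C. ?B i)"
    have UB[measurable]: "(\<Union>i\<in>C. ?B i) \<in> sets borel" using C(1) by (intro sets.countable_UN') auto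
    have N: "?N \<in> sets borel" by measurable
    have "emeasure lebesgue ?N = 0" using C(4) by (simp add: negligible_iff_emeasure0 N)
    then have N0: "emeasure lborel ?N = 0" using N by simp
    have MN: "emeasure M ?N = 0" using null[OF _ N N0] S by auto
    have "emeasure M S \<le> emeasure M ((\<Union>i\<in>C. ?B i) \<union> ?N)" by (intro emeasure_mono) auto
    also have "\<dots> \<le> emeasure M (\<Union>i\<in>C. ?B i) + emeasure M ?N" by (intro emeasure_subadditive) auto
    also have "\<dots> = emeasure M (\<Union>i\<in>C. ?B i)" using MN by simp
    also have "\<dots> = (\<integral>\<^sup>+i. emeasure M (?B i) \<partial>count_space C)"
      using C by (intro emeasure_UN_countable) (auto simp: disjoint_family_on_def pairwise_def disjnt_def)
    also have "\<dots> \<le> (\<integral>\<^sup>+i. ennreal r * emeasure lborel (?B i) \<partial>count_space C)"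
    proof (intro nn_integral_mono)
      fix i assume "i \<in> space (count_space C)"
      then have "i \<in> I" using C by auto
      then have i: "0 < snd i" "u (fst i + snd i) - u (fst i - snd i) \<le> r * (2 * snd i)" by (auto simp: I_def)
      have "emeasure M (?B i) = ennreal (u (fst i + snd i) - u (fst i - snd i))"
        unfolding cball_eq_atLeastAtMost using i by (subst Icc) auto
      also have "\<dots> \<le> ennreal (r * (2 * snd i))" using i by (intro ennreal_leI) auto
      also have "\<dots> = ennreal r * emeasure lborel (?B i)"
        unfolding cball_eq_atLeastAtMost using i r by (simp add: ennreal_mult)
      finally show "emeasure M (?B i) \<le> ennreal r * emeasure lborel (?B i)" .
    qed
    also have "\<dots> = ennreal r * (\<integral>\<^sup>+i. emeasure lborel (?B i) \<partial>count_space C)" by (intro nn_integral_cmult) auto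
    also have "(\<integral>\<^sup>+i. emeasure lborel (?B i) \<partial>count_space C) = emeasure lborel (\<Union>i\<in>C. ?B i)"
      using C by (intro emeasure_UN_countable[symmetric]) (auto simp: disjoint_family_on_def pairwise_def disjnt_def)
    also have "\<dots> \<le> emeasure lborel (S \<union> (U - S))"
    proof (intro emeasure_mono)
      show "(\<Union>i\<in>C. ?B i) \<subseteq> S \<union> (U - S)"
      proof
        fix x assume "x \<in> (\<Union>i\<in>C. ?B i)"
        then obtain i where "i \<in> C" "x \<in> ?B i" by auto
        moreover have "{fst i - snd i..fst i + snd i} \<subseteq> O'" using subsetD[OF C(2) \<open>i \<in> C\<close>] by (cases i) (auto simp: I_def)
        ultimately have "x \<in> O'" unfolding cball_eq_atLeastAtMost by blast
        then show "x \<in> S \<union> (U - S)" by (auto simp: O'_def)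
      qed
      show "S \<union> (U - S) \<in> sets lborel" using U(1) by auto
    qed
    also have "\<dots> \<le> emeasure lborel S + emeasure lborel (U - S)" using U(1) by (intro emeasure_subadditive) auto
    also have "\<dots> \<le> emeasure lborel S + ennreal e" using U(3) by (intro add_left_mono) auto
    finally have "emeasure M S \<le> ennreal r * (emeasure lborel S + ennreal e)" by (simp add: mult_left_mono)
    also have "\<dots> \<le> ennreal r * emeasure lborel S + ennreal e'"
      unfolding distrib_left using e r by (intro add_left_mono) (simp add: ennreal_mult[symmetric] ennreal_leI)
    finally show ?thesis .
  qed
  then have "emeasure M S \<le> ennreal r * emeasure lborel S" by (rule ennreal_le_epsilon)
  also have "\<dots> = ennreal (r * measure lborel S)" using fin(2)[OF S(2,1)] r
    by (simp add: emeasure_eq_ennreal_measure ennreal_mult)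
  finally show ?thesis using fin(1)[OF S(2,1)] r
    by (simp add: emeasure_eq_ennreal_measure M_def)
qed

text \<open>Adding \<open>K * x\<close> makes \<open>u\<close> increasing. Small slopes bound the
  Stieltjes measure of \<open>u x + K * x\<close> on \<open>S\<close> by \<open>r + K\<close> times
  its length, large slopes bound that of the complementary function \<open>K * x - u x\<close> by
  \<open>K - s\<close> times its length. The two measures add up to \<open>2 * K\<close> times the
  length, so \<open>s - r\<close> times the length of \<open>S\<close> is at most 0. Passing to the
  complement turns a lower bound on slopes into an upper one, so one covering estimate serves
  both.\<close>

lemma lipschitz_derivate_gap_null:
  fixes u :: "real \<Rightarrow> real"
  assumes lip: "\<And>x y. \<bar>u x - u y\<bar> \<le> K * \<bar>x - y\<bar>"
    and rs: "r < s"
    and S: "S \<in> sets borel" "S \<subseteq> {a<..<b}"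
    and low: "\<And>x d. x \<in> S \<Longrightarrow> 0 < d \<Longrightarrow> \<exists>p q. p < x \<and> x < q \<and> q - p < d \<and> u q - u p < r * (q - p)"
    and high: "\<And>x d. x \<in> S \<Longrightarrow> 0 < d \<Longrightarrow> \<exists>p q. p < x \<and> x < q \<and> q - p < d \<and> u q - u p > s * (q - p)"
  shows "emeasure lborel S = 0"
proof (cases "S = {}")
  case False
  then obtain x where x: "x \<in> S" by auto
  define w where "w x = u x + K * x" for x
  define w' where "w' x = 2 * K * x - w x" for x
  have b: "u y - u x \<le> K * (y - x)" "u x - u y \<le> K * (y - x)" if "x \<le> y" for x y
    using lip[of x y] that by auto
  have mono: "w x \<le> w y" "w' x \<le> w' y" "w y - w x \<le> 2 * K * (y - x)" "w' y - w' x \<le> 2 * K * (y - x)"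
    if "x \<le> y" for x y
    using b[OF that] by (auto simp: w_def w'_def algebra_simps)
  have "K-lipschitz_on UNIV u"
    using lip lip[of 0 1] by (intro lipschitz_onI) (auto simp: dist_real_def)
  then have "isCont u x" for x
    using lipschitz_on_continuous_on continuous_on_eq_continuous_at by blast
  then have cont: "isCont w x" "isCont w' x" for x
    unfolding w_def w'_def by (auto intro!: continuous_intros)
  have r: "0 \<le> r + K"
  proof -
    obtain p q where "p < x" "x < q" "u q - u p < r * (q - p)" using low[OF x, of 1] by auto
    then have "0 < (r + K) * (q - p)" using b(2)[of p q] by (simp add: algebra_simps)
    then show ?thesis using \<open>p < x\<close> \<open>x < q\<close> by (simp add: zero_less_mult_iff)
  qed
  have s: "0 \<le> K - s"
  proof -
    obtain p q where "p < x" "x < q" "u q - u p > s * (q - p)" using high[OF x, of 1] by auto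
    then have "0 < (K - s) * (q - p)" using b(1)[of p q] by (simp add: algebra_simps)
    then show ?thesis using \<open>p < x\<close> \<open>x < q\<close> by (simp add: zero_less_mult_iff)
  qed
  have 1: "measure (interval_measure w) S \<le> (r + K) * measure lborel S"
  proof (rule interval_measure_le_lborel[OF mono(1) mono(3) cont(1) S r])
    fix x and d :: real assume "x \<in> S" "0 < d"
    from low[OF this] show "\<exists>p q. p < x \<and> x < q \<and> q - p < d \<and> w q - w p \<le> (r + K) * (q - p)"
      by (fastforce simp: w_def algebra_simps)
  qed
  have 2: "measure (interval_measure w') S \<le> (K - s) * measure lborel S"
  proof (rule interval_measure_le_lborel[OF mono(2) mono(4) cont(2) S s])
    fix x and d :: real assume "x \<in> S" "0 < d"
    from high[OF this] show "\<exists>p q. p < x \<and> x < q \<and> q - p < d \<and> w' q - w' p \<le> (K - s) * (q - p)"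
      by (fastforce simp: w_def w'_def algebra_simps)
  qed
  have eq: "S \<inter> {a<..b} = S" using S by auto
  have "measure (interval_measure w) S + measure (interval_measure w') S = 2 * K * measure lborel S"
    using interval_measure_complementary[OF mono(1) mono(3) cont(1) S(1), of a b] by (simp add: eq w'_def[abs_def])
  then have "(s - r) * measure lborel S \<le> 0" using 1 2 by (simp add: algebra_simps)
  then have "measure lborel S = 0" using rs measure_nonneg[of lborel S] by (simp add: mult_le_0_iff)
  moreover have "emeasure lborel S \<le> emeasure lborel {a<..<b}" using S by (intro emeasure_mono) auto
  then have "emeasure lborel S \<noteq> \<infinity>" using emeasure_bounded_finite[of "{a<..<b}"] by (auto simp: top_unique)
  ultimately show ?thesis by (simp add: emeasure_eq_ennreal_measure)
qed simp

text \<open>A difference quotient at 0 lives on an interval with endpoint 0. The inequality is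
  strict and \<open>u\<close> is continuous, so both ends can be moved outwards a little. With
  endpoints on both sides of the point, the condition becomes open in the position of the
  point.\<close>

lemma enlarge_interval:
  fixes u :: "real \<Rightarrow> real"
  assumes cont: "continuous_on UNIV u" and h: "h \<noteq> 0" "\<bar>h\<bar> < d" and lt: "(u h - u 0) / h < r"
  shows "\<exists>p q. p < 0 \<and> 0 < q \<and> q - p < d \<and> u q - u p < r * (q - p)"
proof -
  define a b where "a = min 0 h" and "b = max 0 h"
  have ab: "a \<le> 0" "0 \<le> b" "b - a = \<bar>h\<bar>" "a < b" using h by (auto simp: a_def b_def)
  have 0: "u b - u a < r * (b - a)"
    using lt h by (cases "h > 0") (auto simp: a_def b_def field_simps)
  have c: "isCont u x" for x using cont by (simp add: continuous_on_eq_continuous_at)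
  have "((\<lambda>\<eta>. r * ((b + \<eta>) - (a - \<eta>)) - (u (b + \<eta>) - u (a - \<eta>))) \<longlongrightarrow> r * ((b + 0) - (a - 0)) - (u (b + 0) - u (a - 0))) (at_right 0)"
    by (intro tendsto_intros isCont_tendsto_compose[OF c])
  then have "\<forall>\<^sub>F \<eta> in at_right 0. 0 < r * ((b + \<eta>) - (a - \<eta>)) - (u (b + \<eta>) - u (a - \<eta>))"
    using 0 by (intro order_tendstoD(1)) auto
  moreover have "\<forall>\<^sub>F \<eta> in at_right 0. \<eta> < (d - \<bar>h\<bar>) / 2"
    using h by (intro eventually_at_right_less[THEN eventually_mono] order_tendstoD(2)[OF tendsto_ident_at]) auto
  moreover have "\<forall>\<^sub>F \<eta>::real in at_right 0. 0 < \<eta>" by (rule eventually_at_right_less)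
  ultimately have "\<forall>\<^sub>F \<eta> in at_right 0. 0 < \<eta> \<and> \<eta> < (d - \<bar>h\<bar>) / 2 \<and> 0 < r * ((b + \<eta>) - (a - \<eta>)) - (u (b + \<eta>) - u (a - \<eta>))"
    by eventually_elim auto
  then obtain \<eta> where "0 < \<eta>" "\<eta> < (d - \<bar>h\<bar>) / 2" "0 < r * ((b + \<eta>) - (a - \<eta>)) - (u (b + \<eta>) - u (a - \<eta>))"
    using eventually_happens'[OF trivial_limit_at_right_real] by blast
  then show ?thesis using ab by (intro exI[of _ "a - \<eta>"] exI[of _ "b + \<eta>"]) auto
qed

text \<open>The difference quotients are bounded by \<open>K\<close>, so they accumulate at some
  \<open>l\<close> as the increment tends to 0. If \<open>l\<close> is not the limit, quotients at a
  fixed distance from \<open>l\<close> also recur, and two numbers fit into the gap. Choosing them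
  rational leaves only countably many cases.\<close>

lemma non_differentiable_derivate_gap:
  fixes u :: "real \<Rightarrow> real"
  assumes lip: "\<And>x y. \<bar>u x - u y\<bar> \<le> K * \<bar>x - y\<bar>" and nd: "\<not> u differentiable (at 0)"
  shows "\<exists>r\<in>\<rat>. \<exists>s\<in>\<rat>. r < s \<and> (\<forall>d>0. (\<exists>p q. p < 0 \<and> 0 < q \<and> q - p < d \<and> u q - u p < r * (q - p)) \<and>
    (\<exists>p q. p < 0 \<and> 0 < q \<and> q - p < d \<and> u q - u p > s * (q - p)))"
proof -
  define Q where "Q h = (u h - u 0) / h" for h
  have "K-lipschitz_on UNIV u"
    using lip lip[of 0 1] by (intro lipschitz_onI) (auto simp: dist_real_def)
  then have cont: "continuous_on UNIV u" using lipschitz_on_continuous_on by blast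
  then have cont': "continuous_on UNIV (\<lambda>x. - u x)" by (intro continuous_intros)
  have up: "\<exists>p q. p < 0 \<and> 0 < q \<and> q - p < d \<and> u q - u p < r * (q - p)"
    if "h \<noteq> 0" "\<bar>h\<bar> < d" "Q h < r" for h d r
    using enlarge_interval[OF cont that(1,2)] that(3) by (simp add: Q_def)
  have down: "\<exists>p q. p < 0 \<and> 0 < q \<and> q - p < d \<and> u q - u p > r * (q - p)"
    if "h \<noteq> 0" "\<bar>h\<bar> < d" "Q h > r" for h d r
  proof -
    have "(- u h - - u 0) / h < - r" using that(3) by (simp add: Q_def field_simps minus_divide_left[symmetric] diff_divide_distrib)
    from enlarge_interval[OF cont' that(1,2) this] obtain p q where
      "p < 0" "0 < q" "q - p < d" "- u q - - u p < - r * (q - p)" by blast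
    then show ?thesis by (intro exI[of _ p] exI[of _ q]) auto
  qed
  have "Q (1 / real (Suc n)) \<in> {-K..K}" for n
  proof -
    have "\<bar>Q (1 / real (Suc n))\<bar> \<le> K"
      using lip[of "1 / real (Suc n)" 0] by (simp add: Q_def abs_mult divide_simps) (simp add: algebra_simps)?
    then show ?thesis by auto
  qed
  then obtain l \<phi> where l: "strict_mono \<phi>" "((\<lambda>n. Q (1 / real (Suc n))) \<circ> \<phi>) \<longlonglongrightarrow> l"
    using compact_Icc[of "-K" K] unfolding compact_def by (metis (no_types, lifting))
  have near: "\<exists>h. h \<noteq> 0 \<and> \<bar>h\<bar> < d \<and> \<bar>Q h - l\<bar> < \<epsilon>" if "d > 0" "\<epsilon> > 0" for d \<epsilon>
  proof -
    have "(\<lambda>n. 1 / real (Suc n)) \<longlonglongrightarrow> 0" using LIMSEQ_inverse_real_of_nat by (simp add: inverse_eq_divide)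
    then have "((\<lambda>n. 1 / real (Suc n)) \<circ> \<phi>) \<longlonglongrightarrow> 0" by (rule LIMSEQ_subseq_LIMSEQ[OF _ l(1)])
    then have "\<forall>\<^sub>F n in sequentially. dist (((\<lambda>n. 1 / real (Suc n)) \<circ> \<phi>) n) 0 < d" using that by (intro tendstoD)
    moreover have "\<forall>\<^sub>F n in sequentially. dist (((\<lambda>n. Q (1 / real (Suc n))) \<circ> \<phi>) n) l < \<epsilon>"
      using that l by (intro tendstoD)
    ultimately have "\<forall>\<^sub>F n in sequentially. 1 / real (Suc (\<phi> n)) < d \<and> \<bar>Q (1 / real (Suc (\<phi> n))) - l\<bar> < \<epsilon>"
      by eventually_elim (auto simp: dist_real_def)
    then obtain n where "1 / real (Suc (\<phi> n)) < d \<and> \<bar>Q (1 / real (Suc (\<phi> n))) - l\<bar> < \<epsilon>"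
      using eventually_happens'[OF sequentially_bot] by blast
    then show ?thesis by (intro exI[of _ "1 / real (Suc (\<phi> n))"]) auto
  qed
  have "\<not> (u has_field_derivative l) (at 0)" using nd
    by (auto simp: real_differentiable_def)
  then have "\<not> (Q \<longlongrightarrow> l) (at 0)" by (simp add: has_field_derivative_iff Q_def[abs_def])
  then obtain \<epsilon> where \<epsilon>0: "\<epsilon> > 0" "\<forall>d. d \<le> 0 \<or> (\<exists>h. h \<noteq> 0 \<and> \<bar>h\<bar> < d \<and> \<epsilon> \<le> \<bar>Q h - l\<bar>)"
    unfolding LIM_eq by (auto simp: not_less)
  have \<epsilon>2: "\<exists>h. h \<noteq> 0 \<and> \<bar>h\<bar> < d \<and> \<bar>Q h - l\<bar> \<ge> \<epsilon>" if "d > 0" for d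
    using \<epsilon>0(2)[rule_format, of d] that by auto
  note \<epsilon> = \<epsilon>0(1) \<epsilon>2
  obtain r where r: "r \<in> \<rat>" "l + \<epsilon>/3 < r" "r < l + \<epsilon>/2" using Rats_dense_in_real[of "l + \<epsilon>/3" "l + \<epsilon>/2"] \<epsilon> by auto
  obtain s where s: "s \<in> \<rat>" "l + \<epsilon>/2 < s" "s < l + \<epsilon>" using Rats_dense_in_real[of "l + \<epsilon>/2" "l + \<epsilon>"] \<epsilon> by auto
  obtain r' where r': "r' \<in> \<rat>" "l - \<epsilon> < r'" "r' < l - \<epsilon>/2" using Rats_dense_in_real[of "l - \<epsilon>" "l - \<epsilon>/2"] \<epsilon> by auto
  obtain s' where s': "s' \<in> \<rat>" "l - \<epsilon>/2 < s'" "s' < l - \<epsilon>/3" using Rats_dense_in_real[of "l - \<epsilon>/2" "l - \<epsilon>/3"] \<epsilon> by auto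
  \<comment> \<open>Either large quotients recur, or all quotients near 0 stay below
    \<open>l + \<epsilon>\<close>, and then those at distance at least \<epsilon> from
    \<open>l\<close> lie below \<open>l - \<epsilon>\<close>.\<close>
  consider "\<forall>d>0. \<exists>h. h \<noteq> 0 \<and> \<bar>h\<bar> < d \<and> Q h \<ge> l + \<epsilon>" | d0 where "d0 > 0" "\<forall>h. h \<noteq> 0 \<and> \<bar>h\<bar> < d0 \<longrightarrow> Q h < l + \<epsilon>"
    by (meson not_less)
  then show ?thesis
  proof cases
    case 1
    show ?thesis
    proof (rule bexI[OF _ r(1)], rule bexI[OF _ s(1)], intro conjI allI impI)
      show "r < s" using r s by simp
      fix d :: real assume d: "d > 0"
      obtain h where h0: "h \<noteq> 0" "\<bar>h\<bar> < d" "\<bar>Q h - l\<bar> < \<epsilon>/3" using near[OF d, of "\<epsilon>/3"] \<epsilon> by auto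
      have "Q h < l + \<epsilon>/3" "l - \<epsilon>/3 < Q h" using h0(3) by linarith+
      with h0(1,2) show "\<exists>p q. p < 0 \<and> 0 < q \<and> q - p < d \<and> u q - u p < r * (q - p)" using r by (intro up[of h]) auto
      obtain h where "h \<noteq> 0" "\<bar>h\<bar> < d" "Q h \<ge> l + \<epsilon>" using 1 d by auto
      then show "\<exists>p q. p < 0 \<and> 0 < q \<and> q - p < d \<and> u q - u p > s * (q - p)" using s by (intro down[of h]) auto
    qed
  next
    case 2
    show ?thesis
    proof (rule bexI[OF _ r'(1)], rule bexI[OF _ s'(1)], intro conjI allI impI)
      show "r' < s'" using r' s' by simp
      fix d :: real assume d: "d > 0"
      obtain h where h0: "h \<noteq> 0" "\<bar>h\<bar> < d" "\<bar>Q h - l\<bar> < \<epsilon>/3" using near[OF d, of "\<epsilon>/3"] \<epsilon> by auto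
      have "Q h < l + \<epsilon>/3" "l - \<epsilon>/3 < Q h" using h0(3) by linarith+
      with h0(1,2) show "\<exists>p q. p < 0 \<and> 0 < q \<and> q - p < d \<and> u q - u p > s' * (q - p)" using s' by (intro down[of h]) auto
      obtain h where h: "h \<noteq> 0" "\<bar>h\<bar> < min d d0" "\<bar>Q h - l\<bar> \<ge> \<epsilon>" using \<epsilon>(2)[of "min d d0"] d 2 by auto
      then have "Q h < l + \<epsilon>" using 2(2) by auto
      then have "Q h \<le> l - \<epsilon>" using h by auto
      then show "\<exists>p q. p < 0 \<and> 0 < q \<and> q - p < d \<and> u q - u p < r' * (q - p)" using r' h by (intro up[of h]) auto
    qed
  qed
qed

lemma nn_integral_lborel_translation:
  fixes f :: "'a::euclidean_space \<Rightarrow> ennreal"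
  assumes [measurable]: "f \<in> borel_measurable borel"
  shows "(\<integral>\<^sup>+x. f (x + c) \<partial>lborel) = (\<integral>\<^sup>+x. f x \<partial>lborel)"
  by (subst (2) lborel_distr_plus[symmetric, of c], subst nn_integral_distr) (auto simp: add.commute)

text \<open>Integrate the indicator of \<open>E\<close> at \<open>x + t *\<^sub>R e\<close> over
  \<open>x\<close> and over \<open>t\<close> between 0 and 1. Integrating over \<open>x\<close>
  first gives the measure of \<open>E\<close>, by translation invariance; integrating over
  \<open>t\<close> first gives 0. No coordinates adapted to \<open>e\<close> have to be
  chosen.\<close>

lemma null_lines_imp_null:
  fixes E :: "'a::euclidean_space set"
  assumes E[measurable]: "E \<in> sets borel"
    and lines: "\<And>x. emeasure lborel {t \<in> {0<..<1}. x + t *\<^sub>R e \<in> E} = 0"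
  shows "emeasure lborel E = 0"
proof -
  let ?f = "\<lambda>x t. indicator {0<..<1::real} t * indicator E (x + t *\<^sub>R e) :: ennreal"
  have "(\<integral>\<^sup>+x. ?f x t \<partial>lborel) = indicator {0<..<1} t * emeasure lborel E" for t
    by (subst nn_integral_cmult) (auto simp: nn_integral_lborel_translation[of "indicator E"])
  then have "(\<integral>\<^sup>+t. \<integral>\<^sup>+x. ?f x t \<partial>lborel \<partial>lborel) = emeasure lborel E"
    by (simp add: nn_integral_multc)
  moreover have "(\<integral>\<^sup>+t. \<integral>\<^sup>+x. ?f x t \<partial>lborel \<partial>lborel) = (\<integral>\<^sup>+x. \<integral>\<^sup>+t. ?f x t \<partial>lborel \<partial>lborel)"
    by (rule lborel_pair.Fubini') measurable
  moreover have "(\<integral>\<^sup>+t. ?f x t \<partial>lborel) = 0" for x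
  proof -
    have "(\<integral>\<^sup>+t. ?f x t \<partial>lborel) = (\<integral>\<^sup>+t. indicator {t \<in> {0<..<1}. x + t *\<^sub>R e \<in> E} t \<partial>lborel)"
      by (intro nn_integral_cong) (auto simp: indicator_def)
    also have "\<dots> = 0" by (subst nn_integral_indicator) (use lines[of x] in \<open>auto\<close>)
    finally show ?thesis .
  qed
  ultimately show ?thesis by simp
qed

text \<open>The exceptional set is contained in a countable union over rational \<open>r < s\<close>
  of the sets \<open>D r s\<close> where slopes below \<open>r\<close> and above \<open>s\<close>
  both recur at all scales; each of these is null on every line parallel to
  \<open>e\<close>.\<close>

theorem lipschitz_directionally_differentiable_AE:
  fixes F :: "'a::euclidean_space \<Rightarrow> real"
  assumes lip: "K-lipschitz_on UNIV F"
  shows "AE x in lborel. (\<lambda>t. F (x + t *\<^sub>R e)) differentiable (at 0)"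
proof -
  have K: "0 \<le> K" using lip by (rule lipschitz_on_nonneg)
  have contF: "continuous_on UNIV F" using lip by (rule lipschitz_on_continuous_on)
  define lo where "lo r x d \<longleftrightarrow> (\<exists>p q. p < 0 \<and> 0 < q \<and> q - p < d \<and> F (x + q *\<^sub>R e) - F (x + p *\<^sub>R e) < r * (q - p))" for r x and d :: real
  define hi where "hi s x d \<longleftrightarrow> (\<exists>p q. p < 0 \<and> 0 < q \<and> q - p < d \<and> F (x + q *\<^sub>R e) - F (x + p *\<^sub>R e) > s * (q - p))" for s x and d :: real
  define D where "D r s = {x. \<forall>d>0. lo r x d \<and> hi s x d}" for r s
  \<comment> \<open>\<open>lo\<close> and \<open>hi\<close> become weaker as \<open>d\<close> grows,
    so countably many scales suffice. This exhibits \<open>D r s\<close> as a countable intersection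
    of open sets.\<close>
  have all_d: "(\<forall>d>0. lo r x d \<and> hi s x d) \<longleftrightarrow> (\<forall>n. lo r x (1 / Suc n) \<and> hi s x (1 / Suc n))" for r s x
  proof safe
    fix d :: real assume d: "d > 0" and *: "\<forall>n. lo r x (1 / Suc n) \<and> hi s x (1 / Suc n)"
    obtain n where n: "1 / real (Suc n) < d" using d by (metis nat_approx_posE)
    show "lo r x d" using *[rule_format, of n] n unfolding lo_def by force
    show "hi s x d" using *[rule_format, of n] n unfolding hi_def by force
  qed auto
  have oplo: "open {x. lo r x d}" for r d
  proof -
    have "{x. lo r x d} = (\<Union>(p,q)\<in>{(p,q). p < 0 \<and> 0 < q \<and> q - p < d}. {x. F (x + q *\<^sub>R e) - F (x + p *\<^sub>R e) < r * (q - p)})"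
      by (auto simp: lo_def)
    also have "open \<dots>"
      by (auto intro!: open_UN open_Collect_less continuous_intros continuous_on_compose2[OF contF])
    finally show ?thesis .
  qed
  have ophi: "open {x. hi r x d}" for r d
  proof -
    have "{x. hi r x d} = (\<Union>(p,q)\<in>{(p,q). p < 0 \<and> 0 < q \<and> q - p < d}. {x. r * (q - p) < F (x + q *\<^sub>R e) - F (x + p *\<^sub>R e)})"
      by (auto simp: hi_def)
    also have "open \<dots>"
      by (auto intro!: open_UN open_Collect_less continuous_intros continuous_on_compose2[OF contF])
    finally show ?thesis .
  qed
  have D_borel: "D r s \<in> sets borel" for r s
  proof -
    have "D r s = (\<Inter>n. {x. lo r x (1 / Suc n)} \<inter> {x. hi s x (1 / Suc n)})" by (auto simp: D_def all_d)
    also have "\<dots> \<in> sets borel" using oplo ophi by (intro sets.countable_INT'') auto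
    finally show ?thesis .
  qed
  have lipu: "\<bar>F (x + a *\<^sub>R e) - F (x + b *\<^sub>R e)\<bar> \<le> (K * norm e) * \<bar>a - b\<bar>" for x a b
    using lipschitz_onD[OF lip, of "x + a *\<^sub>R e" "x + b *\<^sub>R e"]
    by (simp add: dist_norm scaleR_diff_left[symmetric] mult_ac)
  have null: "emeasure lborel (D r s) = 0" if "r < s" for r s
  proof (rule null_lines_imp_null[OF D_borel])
    fix x
    show "emeasure lborel {t \<in> {0<..<1}. x + t *\<^sub>R e \<in> D r s} = 0"
    proof (rule lipschitz_derivate_gap_null[OF lipu[of x] that])
      have [measurable]: "D r s \<in> sets borel" by (rule D_borel)
      show "{t \<in> {0<..<1}. x + t *\<^sub>R e \<in> D r s} \<in> sets borel" by measurable
      show "{t \<in> {0<..<1}. x + t *\<^sub>R e \<in> D r s} \<subseteq> {0<..<1}" by auto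
      fix t and d :: real assume t: "t \<in> {t \<in> {0<..<1}. x + t *\<^sub>R e \<in> D r s}" and d: "0 < d"
      then have "lo r (x + t *\<^sub>R e) d" "hi s (x + t *\<^sub>R e) d" by (auto simp: D_def)
      then obtain p q p' q' where
        "p < 0" "0 < q" "q - p < d" "F (x + (t + q) *\<^sub>R e) - F (x + (t + p) *\<^sub>R e) < r * (q - p)"
        "p' < 0" "0 < q'" "q' - p' < d" "F (x + (t + q') *\<^sub>R e) - F (x + (t + p') *\<^sub>R e) > s * (q' - p')"
        unfolding lo_def hi_def by (auto simp: scaleR_add_left add.assoc)
      then show "\<exists>p q. p < t \<and> t < q \<and> q - p < d \<and> F (x + q *\<^sub>R e) - F (x + p *\<^sub>R e) < r * (q - p)"
        by (intro exI[of _ "t + p"] exI[of _ "t + q"]) simp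
      show "\<exists>p q. p < t \<and> t < q \<and> q - p < d \<and> s * (q - p) < F (x + q *\<^sub>R e) - F (x + p *\<^sub>R e)"
        using \<open>p' < 0\<close> \<open>0 < q'\<close> \<open>q' - p' < d\<close> \<open>F (x + (t + q') *\<^sub>R e) - F (x + (t + p') *\<^sub>R e) > s * (q' - p')\<close>
        by (intro exI[of _ "t + p'"] exI[of _ "t + q'"]) simp
    qed
  qed
  define N where "N = (\<Union>(r, s)\<in>{(r, s). r \<in> \<rat> \<and> s \<in> \<rat> \<and> r < s}. D r s)"
  have "N \<in> null_sets lborel"
    unfolding N_def
  proof (intro null_sets_UN')
    have "countable ((\<rat> \<times> \<rat>) :: (real \<times> real) set)" using countable_rat by (intro countable_SIGMA) auto
    then show "countable {(r::real, s). r \<in> \<rat> \<and> s \<in> \<rat> \<and> r < s}" by (rule countable_subset[rotated]) auto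
  qed (use null D_borel in \<open>auto intro!: null_setsI\<close>)
  moreover have "{x \<in> space lborel. \<not> (\<lambda>t. F (x + t *\<^sub>R e)) differentiable (at 0)} \<subseteq> N"
  proof safe
    fix x assume "\<not> (\<lambda>t. F (x + t *\<^sub>R e)) differentiable (at 0)"
    from non_differentiable_derivate_gap[OF lipu[of x] this]
    show "x \<in> N" unfolding N_def D_def lo_def hi_def by auto
  qed
  ultimately show ?thesis by (rule AE_I')
qed

section \<open>Ky Fan norms\<close>

definition hinner :: "complex ^ 'n \<Rightarrow> complex ^ 'n \<Rightarrow> complex" where
  "hinner x y = (\<Sum>i\<in>UNIV. cnj (x $ i) * y $ i)"

lemma hinner_add_left: "hinner (x + y) z = hinner x z + hinner y z"
  and hinner_add_right: "hinner z (x + y) = hinner z x + hinner z y"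
  and hinner_diff_left: "hinner (x - y) z = hinner x z - hinner y z"
  and hinner_diff_right: "hinner z (x - y) = hinner z x - hinner z y"
  by (simp_all add: hinner_def algebra_simps sum.distrib sum_subtractf)

lemma hinner_smult_left [simp]: "hinner (c *s x) y = cnj c * hinner x y"
  and hinner_smult_right [simp]: "hinner x (c *s y) = c * hinner x y"
  by (simp_all add: hinner_def sum_distrib_left mult_ac)

lemma hinner_zero [simp]: "hinner 0 x = 0" "hinner x 0 = 0"
  by (simp_all add: hinner_def)

lemma hinner_sum_left: "hinner (\<Sum>i\<in>I. f i) x = (\<Sum>i\<in>I. hinner (f i) x)"
  by (induction I rule: infinite_finite_induct) (auto simp: hinner_add_left)

lemma hinner_sum_right: "hinner x (\<Sum>i\<in>I. f i) = (\<Sum>i\<in>I. hinner x (f i))"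
  by (induction I rule: infinite_finite_induct) (auto simp: hinner_add_right)

lemma cnj_hinner: "cnj (hinner x y) = hinner y x"
  by (simp add: hinner_def mult.commute)

lemma cmod_hinner_commute: "cmod (hinner x y) = cmod (hinner y x)"
  by (metis cnj_hinner complex_mod_cnj)

lemma Re_hinner: "Re (hinner x y) = inner x y"
  by (simp add: hinner_def inner_vec_def inner_complex_def)

lemma hinner_self: "hinner x x = of_real ((norm x)\<^sup>2)"
proof -
  have "Im (hinner x x) = 0" by (simp add: hinner_def mult.commute)
  moreover have "Re (hinner x x) = (norm x)\<^sup>2" by (simp add: Re_hinner power2_norm_eq_inner)
  ultimately show ?thesis by (simp add: complex_eq_iff)
qed

lemma hinner_adjoint: "hinner x (A *v y) = hinner (conjugate_transpose A *v x) y"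
proof -
  have "hinner x (A *v y) = (\<Sum>i\<in>UNIV. \<Sum>j\<in>UNIV. cnj (x $ i) * (A $ i $ j * y $ j))"
    by (simp add: hinner_def matrix_vector_mult_def sum_distrib_left)
  also have "\<dots> = (\<Sum>j\<in>UNIV. \<Sum>i\<in>UNIV. cnj (x $ i) * (A $ i $ j * y $ j))"
    by (rule sum.swap)
  also have "\<dots> = hinner (conjugate_transpose A *v x) y"
    by (simp add: hinner_def matrix_vector_mult_def sum_distrib_right sum_distrib_left conjugate_transpose_def transpose_def mult_ac)
  finally show ?thesis .
qed

lemma norm_smult_complex: "norm (c *s x) = cmod c * norm (x :: complex ^ 'n)"
proof -
  have "complex_of_real ((norm (c *s x))\<^sup>2) = of_real ((cmod c * norm x)\<^sup>2)"
    using hinner_smult_left[of c x "c *s x"] hinner_smult_right[of x c x] complex_norm_square[of c]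
    by (simp add: hinner_self power_mult_distrib mult_ac)
  then have "(norm (c *s x))\<^sup>2 = (cmod c * norm x)\<^sup>2" by (simp only: of_real_eq_iff)
  then show ?thesis by (simp add: power2_eq_iff_nonneg)
qed

text \<open>A dimension count in matrix form: the matrix with rows conjugate to \<open>e j\<close>
  for \<open>j\<close> in \<open>J\<close> and zero rows elsewhere has row \<open>i\<close> equal to
  zero, so it is not invertible and has a nontrivial kernel.\<close>

lemma exists_orthogonal_vector:
  fixes e :: "'n \<Rightarrow> complex ^ 'n"
  assumes "i \<notin> J"
  shows "\<exists>w. w \<noteq> 0 \<and> (\<forall>j\<in>J. hinner (e j) w = 0)"
proof (rule ccontr)
  assume *: "\<not> ?thesis"
  define M :: "complex ^ 'n ^ 'n" where "M = (\<chi> k l. if k \<in> J then cnj (e k $ l) else 0)"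
  have "(M *v w) $ k = (if k \<in> J then hinner (e k) w else 0)" for w k
    by (simp add: M_def matrix_vector_mult_def hinner_def)
  then have "M *v w = 0 \<longrightarrow> w = 0" for w using * by (metis zero_index)
  then obtain B where "B ** M = mat 1" using matrix_left_invertible_ker by blast
  then have "M ** B = mat 1" by (simp add: matrix_left_right_inverse)
  then have "(M ** B) $ i $ i = 1" by (simp add: mat_def)
  moreover have "(M ** B) $ i $ i = 0" using assms by (simp add: matrix_matrix_mult_def M_def)
  ultimately show False by simp
qed

text \<open>The first-order condition at a maximum: near \<open>t = 0\<close> a nonzero linear term
  beats any quadratic one.\<close>

lemma linear_dominated_by_quadratic:
  fixes a c :: real
  assumes "\<And>t. 2 * t * a \<le> t\<^sup>2 * c"
  shows "a = 0"
proof (rule ccontr)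
  assume a: "a \<noteq> 0"
  let ?k = "\<bar>c\<bar> + 1"
  have "2 * (a / ?k) * a \<le> (a / ?k)\<^sup>2 * c" by (rule assms)
  then have "2 * (a / ?k) * a * ?k\<^sup>2 \<le> (a / ?k)\<^sup>2 * c * ?k\<^sup>2" by (rule mult_right_mono) simp
  moreover have "2 * (a / ?k) * a * ?k\<^sup>2 = a\<^sup>2 * (2 * ?k)" "(a / ?k)\<^sup>2 * c * ?k\<^sup>2 = a\<^sup>2 * c"
    by (simp_all add: power2_eq_square)
  ultimately have "a\<^sup>2 * (2 * ?k) \<le> a\<^sup>2 * c" by simp
  then have "2 * ?k \<le> c" using a by (subst (asm) mult_le_cancel_left_pos) auto
  then show False by simp
qed

text \<open>The quadratic form of \<open>H\<close> attains its maximum \<open>l\<close> on the unit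
  sphere of the orthogonal complement \<open>W\<close> of the eigenvectors found so far.
  \<open>W\<close> is invariant under \<open>H\<close>, so the residual \<open>z\<close> of the
  eigenvalue equation lies in \<open>W\<close> and may be used as the direction of variation. The
  first-order condition in that direction is \<open>inner z z = 0\<close>.\<close>

lemma hermitian_eigenvector:
  fixes H :: "complex ^ 'n ^ 'n"
  assumes sa: "\<And>x y. hinner x (H *v y) = hinner (H *v x) y"
    and eig: "\<And>j. j \<in> J \<Longrightarrow> H *v e j = of_real (d j) *s e j"
    and i: "(i :: 'n) \<notin> J"
  shows "\<exists>x (l::real). norm x = 1 \<and> (\<forall>j\<in>J. hinner (e j) x = 0) \<and> H *v x = of_real l *s x"
proof -
  define W where "W = {w. \<forall>j\<in>J. hinner (e j) w = 0}"
  define q where "q x = inner x (H *v x)" for x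
  have inv: "H *v w \<in> W" if "w \<in> W" for w
    using that by (auto simp: W_def sa eig)
  have Wadd: "x + y \<in> W" "x - y \<in> W" "c *s x \<in> W" "r *\<^sub>R x \<in> W" if "x \<in> W" "y \<in> W" for x y c r
  proof -
    have "r *\<^sub>R x = complex_of_real r *s x" by (simp add: vec_eq_iff scaleR_conv_of_real[where 'a = complex])
    then show "x + y \<in> W" "x - y \<in> W" "c *s x \<in> W" "r *\<^sub>R x \<in> W"
      using that by (auto simp: W_def hinner_add_right hinner_diff_right)
  qed
  have contH: "continuous_on S ((*v) H)" for S
    by (intro continuous_on_vec_lambda continuous_intros)
      (simp add: matrix_vector_mult_def[abs_def], intro continuous_on_vec_lambda continuous_intros)?
  have conth: "continuous_on UNIV (\<lambda>w. hinner (e j) w)" for j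
    unfolding hinner_def by (intro continuous_intros)
  have "closed W"
  proof -
    have "W = (\<Inter>j\<in>J. {w. hinner (e j) w = 0})" by (auto simp: W_def)
    also have "closed \<dots>" by (intro closed_INT ballI closed_Collect_eq conth continuous_intros)
    finally show ?thesis .
  qed
  then have cpt: "compact (sphere 0 1 \<inter> W)" by (intro compact_Int_closed) auto
  obtain w where w: "w \<noteq> 0" "w \<in> W" using exists_orthogonal_vector[of i J e] i by (auto simp: W_def)
  have "(1 / norm w) *\<^sub>R w \<in> sphere 0 1 \<inter> W" using w Wadd(4)[OF w(2) w(2)] by auto
  then have ne: "sphere 0 1 \<inter> W \<noteq> {}" by blast
  have "continuous_on (sphere 0 1 \<inter> W) q" unfolding q_def by (intro continuous_intros contH)
  then obtain x where x: "x \<in> sphere 0 1 \<inter> W" "\<And>y. y \<in> sphere 0 1 \<inter> W \<Longrightarrow> q y \<le> q x"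
    using continuous_attains_sup[OF cpt ne] by blast
  define l where "l = q x"
  have nx: "norm x = 1" "x \<in> W" using x by auto
  have Hscale: "H *v (r *\<^sub>R y) = r *\<^sub>R (H *v y)" for r y
    by (simp add: vec_eq_iff matrix_vector_mult_def scaleR_sum_right)
  have quad: "q y \<le> l * (norm y)\<^sup>2" if "y \<in> W" for y
  proof (cases "y = 0")
    case True then show ?thesis by (simp add: q_def)
  next
    case False
    have "q ((1 / norm y) *\<^sub>R y) \<le> l" unfolding l_def using False Wadd(4)[OF that that] by (intro x(2)) auto
    moreover have "q ((1 / norm y) *\<^sub>R y) = q y / (norm y)\<^sup>2"
      by (simp add: q_def Hscale power2_eq_square)
    ultimately show ?thesis using False by (simp add: field_simps)
  qed
  define z where "z = H *v x - of_real l *s x"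
  have lx: "complex_of_real l *s x = l *\<^sub>R x" by (simp add: vec_eq_iff scaleR_conv_of_real[where 'a = complex])
  have zW: "z \<in> W" unfolding z_def by (rule Wadd(2)[OF inv[OF nx(2)] Wadd(3)[OF nx(2) nx(2)]])
  have sym: "inner a (H *v b) = inner (H *v a) b" for a b
    using sa[of a b] Re_hinner by metis
  have "inner z z = 0"
  proof (rule linear_dominated_by_quadratic)
    fix t :: real
    have "q (x + t *\<^sub>R z) \<le> l * (norm (x + t *\<^sub>R z))\<^sup>2" by (rule quad[OF Wadd(1)[OF nx(2) Wadd(4)[OF zW zW]]])
    moreover have "q (x + t *\<^sub>R z) = l + 2 * t * inner z (H *v x) + t\<^sup>2 * q z"
      using sym[of x z] by (simp add: q_def l_def matrix_vector_right_distrib Hscale inner_add_left inner_add_right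
          inner_commute power2_eq_square algebra_simps)
    moreover have "(norm (x + t *\<^sub>R z))\<^sup>2 = 1 + 2 * t * inner z x + t\<^sup>2 * (norm z)\<^sup>2"
      unfolding power2_norm_eq_inner using nx(1)
      by (simp add: inner_add_left inner_add_right inner_commute[of x z] power2_eq_square algebra_simps norm_eq_1)
    ultimately have "2 * t * (inner z (H *v x) - l * inner z x) \<le> t\<^sup>2 * (l * (norm z)\<^sup>2 - q z)"
      by (simp add: algebra_simps)
    moreover have "inner z z = inner z (H *v x) - l * inner z x"
      by (subst (2) z_def) (simp add: lx inner_diff_right)
    ultimately show "2 * t * inner z z \<le> t\<^sup>2 * (l * (norm z)\<^sup>2 - q z)" by simp
  qed
  then have "H *v x = of_real l *s x" by (simp add: z_def)
  then show ?thesis using nx by (auto simp: W_def)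
qed

theorem hermitian_spectral:
  fixes H :: "complex ^ 'n ^ 'n"
  assumes sa: "\<And>x y. hinner x (H *v y) = hinner (H *v x) y"
  obtains e :: "'n \<Rightarrow> complex ^ 'n" and d :: "'n \<Rightarrow> real"
  where "\<And>i j. hinner (e i) (e j) = (if i = j then 1 else 0)" "\<And>i. H *v e i = of_real (d i) *s e i"
proof -
  have "\<exists>e (d :: 'n \<Rightarrow> real). (\<forall>i\<in>J. \<forall>j\<in>J. hinner (e i) (e j) = (if i = j then 1 else 0)) \<and> (\<forall>i\<in>J. H *v e i = of_real (d i) *s e i)"
    if "finite J" for J :: "'n set"
    using that
  proof (induction J rule: finite_induct)
    case (insert i J)
    then obtain e d where e: "\<And>i j. i \<in> J \<Longrightarrow> j \<in> J \<Longrightarrow> hinner (e i) (e j) = (if i = j then 1 else 0)"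
      "\<And>i. i \<in> J \<Longrightarrow> H *v e i = of_real (d i :: real) *s e i" by blast
    obtain x l where x: "norm x = 1" "\<And>j. j \<in> J \<Longrightarrow> hinner (e j) x = 0" "H *v x = of_real (l::real) *s x"
      using hermitian_eigenvector[where J = J and e = e and d = d, OF sa e(2) insert(2)] by auto
    have "hinner x (e j) = 0" if "j \<in> J" for j using x(2)[OF that] cnj_hinner by (metis complex_cnj_zero)
    moreover have "hinner x x = 1" using x(1) by (simp add: hinner_self)
    ultimately show ?case using insert(2) e x
      by (intro exI[of _ "e(i := x)"] exI[of _ "d(i := l)"]) auto
  qed auto
  from this[of UNIV] show ?thesis using that by auto
qed

lemma map_matrix_const_mult:
  fixes A :: "complex ^ 'n ^ 'm" and B :: "complex ^ 'k ^ 'n"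
  shows "map_matrix (\<lambda>a. [:a:]) (A ** B) = map_matrix (\<lambda>a. [:a:]) A ** map_matrix (\<lambda>a. [:a:]) B"
proof -
  have "[:\<Sum>k\<in>S. f k:] = (\<Sum>k\<in>S. [:f k:])" for f :: "'n \<Rightarrow> complex" and S
  proof (induction S rule: infinite_finite_induct)
    case (insert x F)
    have "[:f x + sum f F:] = [:f x:] + [:sum f F:]" by simp
    then show ?case using insert by (simp del: add_pCons)
  qed auto
  then show ?thesis by (simp add: vec_eq_iff matrix_matrix_mult_def mult.commute)
qed

text \<open>\<open>H\<close> is conjugate to the diagonal matrix \<open>G\<close> through the matrix
  \<open>V\<close> of eigenvectors. The computation takes place over the polynomial ring: both sides
  of \<open>H ** V = V ** G\<close> are lifted to constant polynomials, and
  \<open>det (?C V)\<close> is nonzero, so it can be cancelled in an integral domain.\<close>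

lemma eigenvalues_mset_orthonormal:
  fixes H :: "complex ^ 'n ^ 'n"
  assumes on: "\<And>i j. hinner (e i) (e j) = (if i = j then 1 else 0)" and eig: "\<And>i. H *v e i = of_real (d i) *s e i"
  shows "eigenvalues_mset H = image_mset (\<lambda>i. of_real (d i)) (mset_set (UNIV :: 'n set))"
proof -
  let ?C = "map_matrix (\<lambda>a::complex. [:a:])"
  define V :: "complex ^ 'n ^ 'n" where "V = (\<chi> i j. e j $ i)"
  define G :: "complex ^ 'n ^ 'n" where "G = (\<chi> i j. if i = j then of_real (d i) else 0)"
  let ?X = "mat [:0, 1:] :: complex poly ^ 'n ^ 'n"
  have VV: "conjugate_transpose V ** V = mat 1"
    using on by (simp add: vec_eq_iff matrix_matrix_mult_def conjugate_transpose_def transpose_def V_def mat_def hinner_def)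
  have HV: "H ** V = V ** G"
  proof -
    have "(\<Sum>k\<in>UNIV. H $ i $ k * e j $ k) = of_real (d j) * e j $ i" for i j
      using eig[of j] by (simp add: vec_eq_iff matrix_vector_mult_def)
    then show ?thesis
      by (simp add: vec_eq_iff matrix_matrix_mult_def V_def G_def if_distrib[of "\<lambda>x. _ * x"] mult.commute cong: if_cong)
  qed
  have "det (?C (conjugate_transpose V)) * det (?C V) = det (?C (mat 1 :: complex ^ 'n ^ 'n))"
    by (simp only: det_mul[symmetric] map_matrix_const_mult[symmetric] VV)
  also have "?C (mat 1 :: complex ^ 'n ^ 'n) = mat 1" by (simp add: vec_eq_iff mat_def)
  finally have nz: "det (?C V) \<noteq> 0" by auto
  have "?C V ** (?X - ?C G) = (?X - ?C H) ** ?C V"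
  proof -
    have "?C V ** (?X - ?C G) = ?C V ** ?X - ?C V ** ?C G"
      by (simp add: vec_eq_iff matrix_matrix_mult_def right_diff_distrib sum_subtractf)
    also have "?C V ** ?X = ?X ** ?C V"
      by (simp add: vec_eq_iff matrix_matrix_mult_def mat_def if_distrib[of "\<lambda>x. _ * x"] if_distrib[of "\<lambda>x. x * _"] mult.commute cong: if_cong)
    also have "?C V ** ?C G = ?C H ** ?C V" by (simp only: map_matrix_const_mult[symmetric] HV)
    also have "?X ** ?C V - ?C H ** ?C V = (?X - ?C H) ** ?C V"
      by (simp add: vec_eq_iff matrix_matrix_mult_def left_diff_distrib sum_subtractf smult_diff_right)
    finally show ?thesis .
  qed
  then have "det (?C V) * det (?X - ?C G) = det (?X - ?C H) * det (?C V)" by (simp only: det_mul[symmetric])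
  then have "charpoly H = det (?X - ?C G)" using nz by (simp add: charpoly_def mult.commute)
  also have "\<dots> = (\<Prod>i\<in>UNIV. [:- of_real (d i), 1:])"
    by (subst det_diagonal) (auto simp: mat_def G_def)
  finally have "eigenvalues_mset H = (\<Sum>i\<in>UNIV. {#of_real (d i)#})"
    by (simp add: eigenvalues_mset_def proots_prod)
  also have "\<dots> = image_mset (\<lambda>i. of_real (d i)) (mset_set UNIV)"
  proof -
    have "(\<Sum>i\<in>S. {#f i#}) = image_mset f (mset_set S)" if "finite S" for f :: "'n \<Rightarrow> complex" and S
      using that by (induction S rule: finite_induct) auto
    then show ?thesis by simp
  qed
  finally show ?thesis .
qed

section \<open>Singular value decomposition and Ky Fan's variational principle\<close>

text \<open>Bessel's inequality instead of orthonormality: the left singular vectors belonging to the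
  singular value 0 may then be taken to be zero, so that no completion to an orthonormal family
  (hence no relation between the two dimensions) is needed.\<close>

definition bessel :: "'i set \<Rightarrow> ('i \<Rightarrow> complex ^ 'n) \<Rightarrow> bool" where
  "bessel I u \<longleftrightarrow> (\<forall>x. (\<Sum>i\<in>I. (cmod (hinner (u i) x))\<^sup>2) \<le> (norm x)\<^sup>2)"

lemma besselD: "bessel I u \<Longrightarrow> (\<Sum>i\<in>I. (cmod (hinner (u i) x))\<^sup>2) \<le> (norm x)\<^sup>2"
  by (simp add: bessel_def)

text \<open>Expand the squared distance from \<open>x\<close> to the combination \<open>y\<close> of
  the \<open>u i\<close> with coefficients \<open>hinner (u i) x\<close>. Vectors shorter than 1, in
  particular zero vectors, only make the quadratic term smaller.\<close>

lemma bessel_orthogonal: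
  assumes I: "finite I" and orth: "\<And>i j. i \<in> I \<Longrightarrow> j \<in> I \<Longrightarrow> i \<noteq> j \<Longrightarrow> hinner (u i) (u j) = 0"
    and nrm: "\<And>i. i \<in> I \<Longrightarrow> norm (u i) \<le> 1"
  shows "bessel I u"
  unfolding bessel_def
proof
  fix x
  define c where "c i = hinner (u i) x" for i
  define y where "y = (\<Sum>i\<in>I. c i *s u i)"
  have xy: "hinner y x = of_real (\<Sum>i\<in>I. (cmod (c i))\<^sup>2)"
    unfolding y_def hinner_sum_left of_real_sum
    by (intro sum.cong refl) (simp add: c_def[symmetric] complex_norm_square[symmetric] mult.commute[of "cnj _"])
  have yx: "hinner x y = of_real (\<Sum>i\<in>I. (cmod (c i))\<^sup>2)"
    using xy cnj_hinner by (metis complex_cnj_complex_of_real)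
  have "hinner y y = (\<Sum>i\<in>I. \<Sum>j\<in>I. cnj (c i) * (c j * hinner (u i) (u j)))"
    unfolding y_def hinner_sum_left by (simp add: hinner_sum_right sum_distrib_left mult_ac)
  also have "\<dots> = (\<Sum>i\<in>I. cnj (c i) * (c i * hinner (u i) (u i)))"
  proof (intro sum.cong refl)
    fix i assume i: "i \<in> I"
    have "(\<Sum>j\<in>I. cnj (c i) * (c j * hinner (u i) (u j))) = (\<Sum>j\<in>I. if j = i then cnj (c i) * (c i * hinner (u i) (u i)) else 0)"
      using orth[OF i] by (intro sum.cong refl) auto
    then show "(\<Sum>j\<in>I. cnj (c i) * (c j * hinner (u i) (u j))) = cnj (c i) * (c i * hinner (u i) (u i))"
      using I i by simp
  qed
  also have "\<dots> = of_real (\<Sum>i\<in>I. (cmod (c i))\<^sup>2 * (norm (u i))\<^sup>2)"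
    unfolding of_real_sum by (intro sum.cong refl) (simp add: hinner_self complex_norm_square[symmetric] mult.commute[of "cnj _"])
  finally have yy: "hinner y y = of_real (\<Sum>i\<in>I. (cmod (c i))\<^sup>2 * (norm (u i))\<^sup>2)" .
  have "complex_of_real ((norm (x - y))\<^sup>2) = hinner x x - hinner x y - hinner y x + hinner y y"
    by (simp only: hinner_self[symmetric] hinner_diff_left hinner_diff_right) simp
  also have "\<dots> = of_real ((norm x)\<^sup>2 - 2 * (\<Sum>i\<in>I. (cmod (c i))\<^sup>2) + (\<Sum>i\<in>I. (cmod (c i))\<^sup>2 * (norm (u i))\<^sup>2))"
    unfolding xy yx yy hinner_self[of x] by simp
  finally have "(norm (x - y))\<^sup>2 = (norm x)\<^sup>2 - 2 * (\<Sum>i\<in>I. (cmod (c i))\<^sup>2) + (\<Sum>i\<in>I. (cmod (c i))\<^sup>2 * (norm (u i))\<^sup>2)"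
    by (simp only: of_real_eq_iff)
  moreover have "(\<Sum>i\<in>I. (cmod (c i))\<^sup>2 * (norm (u i))\<^sup>2) \<le> (\<Sum>i\<in>I. (cmod (c i))\<^sup>2)"
    using nrm by (intro sum_mono) (simp add: mult_left_le power_le_one)
  ultimately show "(\<Sum>i\<in>I. (cmod (hinner (u i) x))\<^sup>2) \<le> (norm x)\<^sup>2"
    using zero_le_power2[of "norm (x - y)"] unfolding c_def by linarith
qed

lemma cmod_hinner_le: "cmod (hinner x y) \<le> norm x * norm y"
proof -
  have "cmod (hinner x y) \<le> (\<Sum>i\<in>UNIV. \<bar>cmod (x $ i)\<bar> * \<bar>cmod (y $ i)\<bar>)"
    unfolding hinner_def by (intro order_trans[OF norm_sum] sum_mono) (simp add: norm_mult)
  also have "\<dots> \<le> norm x * norm y" unfolding norm_vec_def by (rule L2_set_mult_ineq)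
  finally show ?thesis .
qed

text \<open>Testing the inequality with \<open>u i\<close> itself gives that the fourth power of the
  norm is at most the square.\<close>

lemma bessel_norm_le:
  assumes "bessel I u" "finite I" "i \<in> I"
  shows "norm (u i) \<le> 1"
proof (rule ccontr)
  assume *: "\<not> norm (u i) \<le> 1"
  have "(cmod (hinner (u i) (u i)))\<^sup>2 \<le> (\<Sum>i'\<in>I. (cmod (hinner (u i') (u i)))\<^sup>2)"
    using assms by (intro member_le_sum) auto
  also have "\<dots> \<le> (norm (u i))\<^sup>2" by (rule besselD[OF assms(1)])
  finally have "((norm (u i))\<^sup>2)\<^sup>2 \<le> (norm (u i))\<^sup>2" by (simp add: hinner_self norm_power)
  moreover have "1 < (norm (u i))\<^sup>2" using * by (simp add: one_less_power)
  moreover have "x < x\<^sup>2" if "1 < x" for x :: real using that by (simp add: power2_eq_square)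
  ultimately show False by fastforce
qed

lemma norm_matrix_vector_le:
  fixes A :: "complex ^ 'n ^ 'm"
  shows "norm (A *v x) \<le> norm A * norm x"
proof -
  have "norm (A *v x) \<le> L2_set (\<lambda>i. norm (A $ i) * norm x) UNIV"
    unfolding norm_vec_def[of "A *v x"]
  proof (rule L2_set_mono)
    fix i
    have "cmod ((A *v x) $ i) \<le> (\<Sum>j\<in>UNIV. \<bar>cmod (A $ i $ j)\<bar> * \<bar>cmod (x $ j)\<bar>)"
      unfolding matrix_vector_mult_def by (simp, intro order_trans[OF norm_sum] sum_mono) (simp add: norm_mult)
    also have "\<dots> \<le> norm (A $ i) * norm x"
      unfolding norm_vec_def[of "A $ i"] norm_vec_def[of x] by (rule L2_set_mult_ineq)
    finally show "cmod ((A *v x) $ i) \<le> norm (A $ i) * norm x" .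
  qed auto
  also have "\<dots> = norm A * norm x" unfolding norm_vec_def[of A] by (simp add: L2_set_left_distrib)
  finally show ?thesis .
qed

text \<open>The Ky Fan norm of order \<open>k\<close>. It is meaningful for \<open>k\<close> up to
  the number of columns; beyond the end of the list \<open>!\<close> is unspecified. The value 0 at
  \<open>k = 0\<close> makes the largest singular value a difference like all others.\<close>

definition kyfan :: "nat \<Rightarrow> complex ^ 'd ^ 'D \<Rightarrow> real" where
  "kyfan k A = (\<Sum>i<k. singular_value_list A ! i)"

text \<open>A decomposition in which \<open>f i\<close> vanishes when \<open>s i = 0\<close>. The
  column index type carries no order here, so the list \<open>xs\<close> records an enumeration of
  the indices along which \<open>s\<close> decreases.\<close>

definition is_svd :: "complex ^ 'd ^ 'D \<Rightarrow> ('d \<Rightarrow> complex ^ 'd) \<Rightarrow> ('d \<Rightarrow> complex ^ 'D) \<Rightarrow> ('d \<Rightarrow> real) \<Rightarrow> 'd list \<Rightarrow> bool" where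
  "is_svd A e f s xs \<longleftrightarrow>
    (\<forall>i j. hinner (e i) (e j) = (if i = j then 1 else 0)) \<and> (\<forall>x. (\<Sum>l\<in>UNIV. hinner (e l) x *s e l) = x) \<and>
    (\<forall>i j. i \<noteq> j \<longrightarrow> hinner (f i) (f j) = 0) \<and> (\<forall>i. norm (f i) = (if s i = 0 then 0 else 1)) \<and>
    (\<forall>i. s i \<ge> 0) \<and> (\<forall>i. A *v e i = of_real (s i) *s f i) \<and>
    distinct xs \<and> set xs = UNIV \<and> singular_value_list A = map s xs \<and> sorted_wrt (\<ge>) (map s xs)"

lemma is_svdD:
  assumes "is_svd A e f s xs"
  shows "\<And>i j. hinner (e i) (e j) = (if i = j then 1 else 0)" "\<And>x. (\<Sum>l\<in>UNIV. hinner (e l) x *s e l) = x"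
    "\<And>i j. i \<noteq> j \<Longrightarrow> hinner (f i) (f j) = 0" "\<And>i. norm (f i) = (if s i = 0 then 0 else 1)"
    "\<And>i. s i \<ge> 0" "\<And>i. A *v e i = of_real (s i) *s f i"
    "distinct xs" "set xs = UNIV" "singular_value_list A = map s xs" "sorted_wrt (\<ge>) (map s xs)"
  using assms unfolding is_svd_def by simp_all

text \<open>\<open>A\<close> maps an orthonormal eigenbasis of its Gram matrix \<open>H\<close> to
  orthogonal vectors whose norms are the square roots of the eigenvalues; normalizing the images
  gives \<open>f\<close>.\<close>

lemma svd_exists:
  fixes A :: "complex ^ 'd ^ 'D"
  shows "\<exists>e f s xs. is_svd A e f s xs"
proof -
  define H where "H = conjugate_transpose A ** A"
  have H: "hinner x (H *v y) = hinner (A *v x) (A *v y)" for x y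
  proof -
    have "conjugate_transpose (conjugate_transpose A) = A"
      by (simp add: conjugate_transpose_def transpose_def vec_eq_iff)
    then show ?thesis unfolding H_def matrix_vector_mul_assoc[symmetric] by (simp add: hinner_adjoint)
  qed
  have H': "hinner (H *v x) y = hinner (A *v x) (A *v y)" for x y
    using H[of y x] cnj_hinner by metis
  have sa: "hinner x (H *v y) = hinner (H *v x) y" for x y by (simp only: H H')
  obtain e :: "'d \<Rightarrow> complex ^ 'd" and d :: "'d \<Rightarrow> real"
    where e: "\<And>i j. hinner (e i) (e j) = (if i = j then 1 else 0)" "\<And>i. H *v e i = of_real (d i) *s e i"
    using hermitian_spectral[OF sa] by blast
  have AA: "hinner (A *v e i) (A *v e j) = (if i = j then of_real (d j) else 0)" for i j
    unfolding H[symmetric] using e by simp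
  have d: "d i = (norm (A *v e i))\<^sup>2" for i
  proof -
    have "complex_of_real (d i) = of_real ((norm (A *v e i))\<^sup>2)" using AA[of i i] by (simp only: hinner_self) simp
    then show ?thesis by (simp only: of_real_eq_iff)
  qed
  define s where "s i = norm (A *v e i)" for i
  \<comment> \<open>When \<open>s i = 0\<close> the quotient \<open>1 / s i\<close> is 0, so
    \<open>f i\<close> is the zero vector.\<close>
  define f where "f i = complex_of_real (1 / s i) *s (A *v e i)" for i
  have e_span: "x = (\<Sum>l\<in>UNIV. hinner (e l) x *s e l)" for x
  proof -
    define V :: "complex ^ 'd ^ 'd" where "V = (\<chi> i j. e j $ i)"
    have "conjugate_transpose V ** V = mat 1"
      using e(1) by (simp add: vec_eq_iff matrix_matrix_mult_def conjugate_transpose_def transpose_def V_def mat_def hinner_def)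
    then have "V ** conjugate_transpose V = mat 1" by (simp add: matrix_left_right_inverse)
    then have "x = V *v (conjugate_transpose V *v x)" by (simp add: matrix_vector_mul_assoc)
    also have "\<dots> = (\<Sum>l\<in>UNIV. hinner (e l) x *s e l)"
      by (simp add: vec_eq_iff matrix_vector_mult_def V_def conjugate_transpose_def transpose_def hinner_def mult.commute)
    finally show ?thesis .
  qed
  obtain ys :: "'d list" where ys: "set ys = UNIV" "distinct ys" using finite_distinct_list[of "UNIV :: 'd set"] by auto
  define xs where "xs = rev (sort_key s ys)"
  have m: "mset ys = mset_set UNIV" using ys mset_set_set by metis
  have "singular_value_list A = rev (sorted_list_of_multiset (image_mset (\<lambda>z. sqrt (Re z)) (image_mset (\<lambda>i. of_real (d i)) (mset_set UNIV))))"
    unfolding singular_value_list_def H_def[symmetric] by (simp only: eigenvalues_mset_orthonormal[OF e])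
  also have "image_mset (\<lambda>z. sqrt (Re z)) (image_mset (\<lambda>i. of_real (d i)) (mset_set UNIV)) = mset (map s ys)"
    by (simp add: m image_mset.compositionality comp_def d s_def[abs_def])
  also have "rev (sorted_list_of_multiset (mset (map s ys))) = rev (sort (map s ys))" by (simp only: sorted_list_of_multiset_mset)
  also have "sort (map s ys) = map s (sort_key s ys)" by (intro properties_for_sort) auto
  finally have L: "singular_value_list A = map s xs" by (simp add: xs_def rev_map)
  have "is_svd A e f s xs"
    unfolding is_svd_def
  proof (intro conjI allI impI)
    show "hinner (f i) (f j) = 0" if "i \<noteq> j" for i j using that AA[of i j] by (simp add: f_def)
    show "norm (f i) = (if s i = 0 then 0 else 1)" for i by (simp add: f_def norm_smult_complex s_def norm_divide)
    show "A *v e i = of_real (s i) *s f i" for i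
      by (cases "s i = 0") (simp_all add: f_def s_def vec_eq_iff)
    show "distinct xs" "set xs = UNIV" using ys by (auto simp: xs_def)
    have "sorted (map s (sort_key s ys))" by simp
    then show "sorted_wrt (\<ge>) (map s xs)" by (simp add: xs_def rev_map[symmetric] sorted_wrt_rev)
    show "(\<Sum>l\<in>UNIV. hinner (e l) x *s e l) = x" for x by (rule e_span[symmetric])
  qed (use e(1) L in \<open>auto simp: s_def\<close>)
  then show ?thesis by blast
qed

text \<open>With weights between 0 and 1 of total at most \<open>k\<close>, the best choice is to
  put weight 1 on the \<open>k\<close> largest values. Subtract the threshold \<open>t\<close>:
  earlier terms then gain from weight 1, later terms are nonpositive.\<close>

lemma weighted_sum_le_top:
  fixes L c :: "nat \<Rightarrow> real"
  assumes dec: "\<And>i j. i \<le> j \<Longrightarrow> j < n \<Longrightarrow> L j \<le> L i" and L: "\<And>i. i < n \<Longrightarrow> 0 \<le> L i"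
    and c: "\<And>i. i < n \<Longrightarrow> 0 \<le> c i" "\<And>i. i < n \<Longrightarrow> c i \<le> 1" "(\<Sum>i<n. c i) \<le> real k" and k: "k \<le> n"
  shows "(\<Sum>i<n. L i * c i) \<le> (\<Sum>i<k. L i)"
proof -
  \<comment> \<open>For \<open>k = n\<close> no entry follows the first \<open>k\<close>, and
    nonnegativity of \<open>L\<close> allows the threshold 0.\<close>
  define t where "t = (if k < n then L k else 0)"
  have t: "0 \<le> t" using L by (auto simp: t_def)
  have "(\<Sum>i<n. L i * c i) = (\<Sum>i<n. (L i - t) * c i) + t * (\<Sum>i<n. c i)"
    by (simp add: sum_distrib_left sum.distrib[symmetric] algebra_simps)
  also have "\<dots> \<le> (\<Sum>i<n. if i < k then L i - t else 0) + t * real k"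
  proof (intro add_mono sum_mono mult_left_mono c(3) t)
    fix i assume "i \<in> {..<n}"
    then have i: "i < n" by simp
    show "(L i - t) * c i \<le> (if i < k then L i - t else 0)"
    proof (cases "i < k")
      case True
      then have "t \<le> L i" using dec[of i k] i L[OF i] by (auto simp: t_def)
      then show ?thesis using True c(2)[OF i] by (simp add: mult_left_le)
    next
      case False
      then have "L i \<le> t" using dec[of k i] i by (auto simp: t_def)
      then show ?thesis using False c(1)[OF i] by (simp add: mult_nonpos_nonneg)
    qed
  qed
  also have "(\<Sum>i<n. if i < k then L i - t else 0) = (\<Sum>i<k. L i - t)"
    using k by (subst sum.inter_filter[symmetric]) (auto intro!: sum.cong)
  also have "\<dots> + t * real k = (\<Sum>i<k. L i)" by (simp add: sum_subtractf)
  finally show ?thesis .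
qed

text \<open>Together with \<open>kyfan_attained\<close> this is Ky Fan's variational principle. It exhibits the sum of the
  \<open>k\<close> largest singular values as a maximum of linear functionals, hence as a convex function.\<close>

lemma kyfan_upper:
  fixes A :: "complex ^ 'd ^ 'D"
  assumes k: "k \<le> CARD('d)" and u: "bessel {..<k} u" and v: "bessel {..<k} v"
  shows "(\<Sum>i<k. Re (hinner (u i) (A *v v i))) \<le> kyfan k A"
proof -
  obtain e f s xs where svd: "is_svd A e f s xs" using svd_exists by blast
  note e = is_svdD(1,2)[OF svd] and f = is_svdD(3,4)[OF svd] and s = is_svdD(5,6)[OF svd] and xs = is_svdD(7-10)[OF svd]
  have ne: "norm (e i) = 1" for i
  proof -
    have "complex_of_real ((norm (e i))\<^sup>2) = of_real 1" using e(1)[of i i] by (simp only: hinner_self) simp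
    then have "(norm (e i))\<^sup>2 = 1" by (simp only: of_real_eq_iff)
    then show ?thesis using norm_ge_zero[of "e i"] by (auto simp: power2_eq_1_iff)
  qed
  have be: "bessel UNIV e" using e(1) ne by (intro bessel_orthogonal) auto
  have bf: "bessel UNIV f" using f by (intro bessel_orthogonal) auto
  \<comment> \<open>Doubly substochastic weights: each \<open>c l\<close> is at most 1 by Bessel's
    inequality for \<open>u\<close> and \<open>v\<close>, and their total is at most
    \<open>k\<close> by Bessel's inequality for \<open>e\<close> and \<open>f\<close>. Both use
    \<open>am\<close> to split the products into squares.\<close>
  define c where "c l = (\<Sum>i<k. cmod (hinner (e l) (v i)) * cmod (hinner (u i) (f l)))" for l
  have am: "a * b \<le> (a\<^sup>2 + b\<^sup>2) / 2" for a b :: real using sum_squares_bound[of a b] by simp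
  have lin: "A *v (\<Sum>l\<in>S. g l) = (\<Sum>l\<in>S. A *v g l)" for S and g :: "'d \<Rightarrow> complex ^ 'd"
    by (induction S rule: infinite_finite_induct) (auto simp: matrix_vector_right_distrib)
  have "hinner (u i) (A *v v i) = (\<Sum>l\<in>UNIV. hinner (e l) (v i) * (of_real (s l) * hinner (u i) (f l)))" for i
    by (subst e(2)[of "v i", symmetric]) (simp add: lin hinner_sum_right vector_scalar_commute s(2) mult.assoc)
  then have "(\<Sum>i<k. Re (hinner (u i) (A *v v i))) = (\<Sum>i<k. \<Sum>l\<in>UNIV. s l * Re (hinner (e l) (v i) * hinner (u i) (f l)))"
    by (simp add: algebra_simps)
  also have "\<dots> \<le> (\<Sum>i<k. \<Sum>l\<in>UNIV. s l * (cmod (hinner (e l) (v i)) * cmod (hinner (u i) (f l))))"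
    by (intro sum_mono mult_left_mono s(1)) (metis complex_Re_le_cmod norm_mult)
  also have "\<dots> = (\<Sum>l\<in>UNIV. s l * c l)"
    by (subst sum.swap) (simp add: c_def sum_distrib_left)
  also have "\<dots> = (\<Sum>j<length xs. s (xs ! j) * c (xs ! j))"
    using xs(1,2) by (intro sum.reindex_bij_betw[symmetric]) (metis bij_betw_nth)
  also have "\<dots> \<le> (\<Sum>j<k. s (xs ! j))"
  proof (rule weighted_sum_le_top)
    have len: "length xs = CARD('d)" using xs(1,2) distinct_card by metis
    then show "k \<le> length xs" using k by simp
    show "s (xs ! j) \<le> s (xs ! i)" if "i \<le> j" "j < length xs" for i j
      using sorted_wrt_nth_less[OF xs(4), of i j] that by (cases "i = j") auto
    show "0 \<le> c l" for l unfolding c_def by (intro sum_nonneg) auto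
    show "c l \<le> 1" for l
    proof -
      have "c l \<le> (\<Sum>i<k. ((cmod (hinner (v i) (e l)))\<^sup>2 + (cmod (hinner (u i) (f l)))\<^sup>2) / 2)"
        unfolding c_def using am by (intro sum_mono) (simp add: cmod_hinner_commute[of "e l"])
      also have "\<dots> \<le> ((norm (e l))\<^sup>2 + (norm (f l))\<^sup>2) / 2"
        using besselD[OF v, of "e l"] besselD[OF u, of "f l"]
        by (simp add: sum_divide_distrib[symmetric] sum.distrib)
      also have "\<dots> \<le> 1" using ne f(2) by simp
      finally show ?thesis .
    qed
    have "(\<Sum>j<length xs. c (xs ! j)) = (\<Sum>l\<in>UNIV. c l)"
      using xs(1,2) by (intro sum.reindex_bij_betw) (metis bij_betw_nth)
    also have "\<dots> = (\<Sum>i<k. \<Sum>l\<in>UNIV. cmod (hinner (e l) (v i)) * cmod (hinner (u i) (f l)))"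
      unfolding c_def by (rule sum.swap)
    also have "\<dots> \<le> (\<Sum>i<k. 1)"
    proof (rule sum_mono)
      fix i assume i: "i \<in> {..<k}"
      have "(\<Sum>l\<in>UNIV. cmod (hinner (e l) (v i)) * cmod (hinner (u i) (f l)))
          \<le> (\<Sum>l\<in>UNIV. ((cmod (hinner (e l) (v i)))\<^sup>2 + (cmod (hinner (f l) (u i)))\<^sup>2) / 2)"
        using am by (intro sum_mono) (simp add: cmod_hinner_commute[of "u i"])
      also have "\<dots> \<le> ((norm (v i))\<^sup>2 + (norm (u i))\<^sup>2) / 2"
        using besselD[OF be, of "v i"] besselD[OF bf, of "u i"]
        by (simp add: sum_divide_distrib[symmetric] sum.distrib)
      also have "\<dots> \<le> (1 + 1) / 2"
        using bessel_norm_le[OF v _ i] bessel_norm_le[OF u _ i] by (intro divide_right_mono add_mono power_le_one) auto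
      finally show "(\<Sum>l\<in>UNIV. cmod (hinner (e l) (v i)) * cmod (hinner (u i) (f l))) \<le> 1" by simp
    qed
    finally show "(\<Sum>j<length xs. c (xs ! j)) \<le> real k" by simp
  qed (use s in auto)
  also have "\<dots> = kyfan k A"
  proof -
    have "length xs = CARD('d)" using xs(1,2) distinct_card by metis
    then show ?thesis using k by (simp add: kyfan_def xs(3))
  qed
  finally show ?thesis .
qed

lemma kyfan_attained:
  fixes A :: "complex ^ 'd ^ 'D"
  assumes k: "k \<le> CARD('d)"
  obtains u :: "nat \<Rightarrow> complex ^ 'D" and v :: "nat \<Rightarrow> complex ^ 'd"
  where "bessel {..<k} u" "bessel {..<k} v" "(\<Sum>i<k. Re (hinner (u i) (A *v v i))) = kyfan k A"
proof -
  obtain e f s xs where svd: "is_svd A e f s xs" using svd_exists by blast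
  note e = is_svdD(1,2)[OF svd] and f = is_svdD(3,4)[OF svd] and s = is_svdD(5,6)[OF svd] and xs = is_svdD(7-10)[OF svd]
  have len: "length xs = CARD('d)" using xs(1,2) distinct_card by metis
  have ne: "norm (e i) \<le> 1" for i
  proof -
    have "complex_of_real ((norm (e i))\<^sup>2) = of_real 1" using e(1)[of i i] by (simp only: hinner_self) simp
    then have "(norm (e i))\<^sup>2 = 1" by (simp only: of_real_eq_iff)
    then show ?thesis using norm_ge_zero[of "e i"] by (auto simp: power2_eq_1_iff)
  qed
  have inj: "xs ! i \<noteq> xs ! j" if "i < k" "j < k" "i \<noteq> j" for i j
    using that xs(1) k len by (simp add: nth_eq_iff_index_eq)
  have "bessel {..<k} (\<lambda>i. f (xs ! i))" using inj f by (intro bessel_orthogonal) auto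
  moreover have "bessel {..<k} (\<lambda>i. e (xs ! i))" using inj e ne by (intro bessel_orthogonal) auto
  moreover have "(\<Sum>i<k. Re (hinner (f (xs ! i)) (A *v e (xs ! i)))) = kyfan k A"
    unfolding kyfan_def using k len by (intro sum.cong refl) (auto simp: s(2) hinner_self f(2) xs(3))
  ultimately show ?thesis using that by blast
qed

lemma kyfan_convex:
  assumes k: "k \<le> CARD('d)"
  shows "convex_on UNIV (kyfan k :: complex ^ 'd ^ 'D \<Rightarrow> real)"
proof (intro convex_onI)
  fix t :: real and A B :: "complex ^ 'd ^ 'D" assume t: "0 < t" "t < 1"
  obtain u v where uv: "bessel {..<k} u" "bessel {..<k} v"
    "(\<Sum>i<k. Re (hinner (u i) (((1 - t) *\<^sub>R A + t *\<^sub>R B) *v v i))) = kyfan k ((1 - t) *\<^sub>R A + t *\<^sub>R B)"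
    using kyfan_attained[OF k] by blast
  have "(r *\<^sub>R A) *v x = r *\<^sub>R (A *v x)" for r and A :: "complex ^ 'd ^ 'D" and x
    by (simp add: vec_eq_iff matrix_vector_mult_def scaleR_sum_right)
  then have "((1 - t) *\<^sub>R A + t *\<^sub>R B) *v x = (1 - t) *\<^sub>R (A *v x) + t *\<^sub>R (B *v x)" for x
    by (simp add: matrix_vector_mult_add_rdistrib)
  then have "kyfan k ((1 - t) *\<^sub>R A + t *\<^sub>R B) =
      (1 - t) * (\<Sum>i<k. Re (hinner (u i) (A *v v i))) + t * (\<Sum>i<k. Re (hinner (u i) (B *v v i)))"
    unfolding uv(3)[symmetric] by (simp add: Re_hinner inner_add_right sum.distrib sum_distrib_left)
  also have "\<dots> \<le> (1 - t) * kyfan k A + t * kyfan k B"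
    using t by (intro add_mono mult_left_mono kyfan_upper[OF k uv(1,2)]) auto
  finally show "kyfan k ((1 - t) *\<^sub>R A + t *\<^sub>R B) \<le> (1 - t) * kyfan k A + t * kyfan k B" .
qed auto

text \<open>A maximizing pair of families for \<open>A\<close> is a competitor for \<open>B\<close>.
  Each of the \<open>k\<close> terms of the resulting functional of \<open>A - B\<close> is bounded
  by the Frobenius norm, since the vectors have norm at most 1.\<close>

lemma kyfan_lipschitz:
  assumes k: "k \<le> CARD('d)"
  shows "(real k)-lipschitz_on UNIV (kyfan k :: complex ^ 'd ^ 'D \<Rightarrow> real)"
proof (intro lipschitz_onI)
  have le: "kyfan k A - kyfan k B \<le> real k * norm (A - B)" for A B :: "complex ^ 'd ^ 'D"
  proof -
    obtain u v where uv: "bessel {..<k} u" "bessel {..<k} v" "(\<Sum>i<k. Re (hinner (u i) (A *v v i))) = kyfan k A"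
      using kyfan_attained[OF k] by blast
    have "kyfan k A - kyfan k B \<le> (\<Sum>i<k. Re (hinner (u i) (A *v v i))) - (\<Sum>i<k. Re (hinner (u i) (B *v v i)))"
      using kyfan_upper[OF k uv(1,2), of B] uv(3) by simp
    also have "\<dots> = (\<Sum>i<k. Re (hinner (u i) ((A - B) *v v i)))"
      by (simp add: matrix_vector_mult_diff_rdistrib hinner_diff_right sum_subtractf)
    also have "\<dots> \<le> (\<Sum>i<k. norm (A - B))"
    proof (rule sum_mono)
      fix i assume i: "i \<in> {..<k}"
      have "Re (hinner (u i) ((A - B) *v v i)) \<le> norm (u i) * norm ((A - B) *v v i)"
        using complex_Re_le_cmod cmod_hinner_le order_trans by blast
      also have "\<dots> \<le> 1 * (norm (A - B) * 1)"
        using bessel_norm_le[OF uv(1) _ i] bessel_norm_le[OF uv(2) _ i]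
        by (intro mult_mono order_trans[OF norm_matrix_vector_le] mult_left_mono) auto
      finally show "Re (hinner (u i) ((A - B) *v v i)) \<le> norm (A - B)" by simp
    qed
    finally show ?thesis by simp
  qed
  show "dist (kyfan k A) (kyfan k B) \<le> real k * dist A B" for A B :: "complex ^ 'd ^ 'D"
    using le[of A B] le[of B A] by (simp add: dist_norm abs_le_iff norm_minus_commute)
qed auto

lemma kyfan_zero: "k \<le> CARD('d) \<Longrightarrow> kyfan k (0 :: complex ^ 'd ^ 'D) = 0"
  using kyfan_attained[of k "0 :: complex ^ 'd ^ 'D"] by fastforce

text \<open>The upper bound is the Lipschitz estimate against the zero matrix, the lower one comes
  from the two coordinate vectors as test vectors, with the sign \<open>b\<close> of
  \<open>a\<close> put on the left one. It is the computation behind the counterexample in the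
  Lipschitz norm.\<close>

lemma kyfan_one_single:
  fixes i :: "'D::finite" and j :: "'d::finite"
  shows "kyfan 1 ((\<chi> k l. if k = i \<and> l = j then of_real a else 0) :: complex ^ 'd ^ 'D) = \<bar>a\<bar>"
proof -
  let ?A = "(\<chi> k l. if k = i \<and> l = j then of_real a else 0) :: complex ^ 'd ^ 'D"
  have k: "1 \<le> CARD('d)" by (simp add: Suc_leI)
  have n1: "norm (axis m (1::complex) :: complex ^ 'k) = 1" for m :: "'k::finite" by (simp add: norm_axis_1)
  have row: "?A $ k = (if k = i then axis j (of_real a) else 0)" for k
    by (simp add: vec_eq_iff axis_def)
  have "norm ?A = \<bar>a\<bar>"
  proof -
    have "?A = axis i (axis j (of_real a))" by (simp add: vec_eq_iff axis_def)
    then show ?thesis by (simp add: norm_eq_sqrt_inner inner_axis_axis inner_complex_def)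
  qed
  moreover have "\<bar>kyfan 1 ?A - kyfan 1 (0 :: complex ^ 'd ^ 'D)\<bar> \<le> norm ?A"
    using lipschitz_onD[OF kyfan_lipschitz[OF k], of ?A 0] by (simp add: dist_norm)
  moreover have "kyfan 1 (0 :: complex ^ 'd ^ 'D) = 0" by (rule kyfan_zero[OF k])
  ultimately have 1: "kyfan 1 ?A \<le> \<bar>a\<bar>" by linarith
  define b :: complex where "b = (if a \<ge> 0 then 1 else -1)"
  have bes: "bessel {..<1} (\<lambda>_::nat. b *s axis i 1 :: complex ^ 'D)" "bessel {..<1} (\<lambda>_::nat. axis j 1 :: complex ^ 'd)"
    using n1 by (auto intro!: bessel_orthogonal simp: norm_smult_complex b_def)
  have "?A *v axis j 1 = of_real a *s axis i 1"
    by (simp add: vec_eq_iff matrix_vector_mult_def axis_def if_distrib[of "\<lambda>x. _ * x"] cong: if_cong)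
  then have "Re (hinner (b *s axis i 1) (?A *v axis j 1)) = \<bar>a\<bar>"
    by (simp add: b_def hinner_self n1)
  then show ?thesis using kyfan_upper[OF k bes, of ?A] 1 by simp
qed

lemma singular_values_kyfan:
  fixes A :: "complex ^ ('d :: {finite,linorder}) ^ 'D"
  shows "singular_values A $ i = kyfan (Suc (card {j. j < i})) A - kyfan (card {j. j < i}) A"
  by (simp add: singular_values_def kyfan_def)

lemma card_less_CARD: "Suc (card {j. j < (i :: 'd :: {finite,linorder})}) \<le> CARD('d)"
proof -
  have "{j. j < i} \<subset> UNIV" by auto
  then show ?thesis using psubset_card_mono[of "UNIV :: 'd set" "{j. j < i}"] by simp
qed

section \<open>Test functions and weak derivatives\<close>

text \<open>\<open>flat 1\<close> is the classical smooth function that is exp(-1/x) for positive x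
  and 0 otherwise. The polynomial in 1/x is what repeated differentiation produces.\<close>

definition flat :: "real poly \<Rightarrow> real \<Rightarrow> real" where
  "flat p x = (if x > 0 then poly p (1 / x) * exp (- (1 / x)) else 0)"

lemma poly_times_exp_tendsto_0:
  fixes p :: "real poly"
  shows "((\<lambda>y. poly p y * exp (- y)) \<longlongrightarrow> 0) at_top"
proof -
  have eq: "(\<lambda>y. poly p y * exp (- y)) = (\<lambda>y. \<Sum>i\<le>degree p. coeff p i * (y ^ i / exp y))"
    by (simp add: poly_altdef sum_distrib_right exp_minus sum_divide_distrib divide_inverse mult.assoc)
  have "((\<lambda>y. \<Sum>i\<le>degree p. coeff p i * (y ^ i / exp y)) \<longlongrightarrow> (\<Sum>i\<le>degree p. coeff p i * 0)) at_top"
    by (intro tendsto_sum tendsto_mult tendsto_const tendsto_power_div_exp_0)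
  then show ?thesis by (simp add: eq)
qed

text \<open>With y = 1/x the chain rule gives y^2 (p(y) - p'(y)) exp(-y), and
  \<open>[:0, 0, 1:]\<close> is the polynomial y^2. At 0 the right difference quotient is y p(y)
  exp(-y), which tends to 0 as y tends to infinity.\<close>

lemma flat_has_derivative:
  "(flat p has_real_derivative flat ([:0, 0, 1:] * (p - pderiv p)) x) (at x)"
proof -
  consider "x > 0" | "x < 0" | "x = 0" by linarith
  then show ?thesis
  proof cases
    case 1
    have d1: "((\<lambda>x. 1 / x) has_real_derivative - (1 / x\<^sup>2)) (at x)"
      using 1 by (auto intro!: derivative_eq_intros simp: power2_eq_square)
    have d2: "((\<lambda>x. poly p (1 / x)) has_real_derivative poly (pderiv p) (1 / x) * - (1 / x\<^sup>2)) (at x)"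
      by (rule DERIV_chain2[OF poly_DERIV d1])
    have d3: "((\<lambda>x. exp (- (1 / x))) has_real_derivative exp (- (1 / x)) * (1 / x\<^sup>2)) (at x)"
      using DERIV_chain2[OF DERIV_exp DERIV_minus[OF d1]] by simp
    have "((\<lambda>x. poly p (1 / x) * exp (- (1 / x))) has_real_derivative
       poly (pderiv p) (1 / x) * - (1 / x\<^sup>2) * exp (- (1 / x)) + exp (- (1 / x)) * (1 / x\<^sup>2) * poly p (1 / x)) (at x)"
      by (rule DERIV_mult[OF d2 d3])
    also have "poly (pderiv p) (1 / x) * - (1 / x\<^sup>2) * exp (- (1 / x)) + exp (- (1 / x)) * (1 / x\<^sup>2) * poly p (1 / x)
       = flat ([:0, 0, 1:] * (p - pderiv p)) x"
      using 1 by (simp add: flat_def field_simps power2_eq_square)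
    finally show ?thesis
      by (rule has_field_derivative_transform_within_open[where S = "{0<..}"]) (use 1 in \<open>auto simp: flat_def\<close>)
  next
    case 2
    have "((\<lambda>_. 0) has_real_derivative flat ([:0, 0, 1:] * (p - pderiv p)) x) (at x)"
      using 2 by (simp add: flat_def)
    then show ?thesis
      by (rule has_field_derivative_transform_within_open[where S = "{..<0}"]) (use 2 in \<open>auto simp: flat_def\<close>)
  next
    case 3
    have l: "((\<lambda>y. (flat p y - flat p 0) / (y - 0)) \<longlongrightarrow> 0) (at_left 0)"
    proof (rule tendsto_eventually)
      show "\<forall>\<^sub>F y in at_left 0. (flat p y - flat p 0) / (y - 0) = 0"
        using eventually_at_left_real[of "-1" 0] by (auto simp: flat_def elim: eventually_mono)
    qed
    have "((\<lambda>y. poly (p * [:0, 1:]) (inverse y) * exp (- inverse y)) \<longlongrightarrow> 0) (at_right 0)"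
      by (rule filterlim_compose[OF poly_times_exp_tendsto_0 filterlim_inverse_at_top_right])
    moreover have "\<forall>\<^sub>F y in at_right 0. poly (p * [:0, 1:]) (inverse y) * exp (- inverse y) = (flat p y - flat p 0) / (y - 0)"
      using eventually_at_right_less[of 0] by eventually_elim (simp add: flat_def field_simps)
    ultimately have r: "((\<lambda>y. (flat p y - flat p 0) / (y - 0)) \<longlongrightarrow> 0) (at_right 0)"
      by (rule Lim_transform_eventually)
    show ?thesis unfolding 3 has_field_derivative_iff using filterlim_split_at[OF l r] by (simp add: flat_def)
  qed
qed

text \<open>Closed under partial derivatives, since the derivative of \<open>flat p\<close> is again of the form \<open>flat p'\<close>.\<close>

inductive_set smooth_class :: "(real ^ 'm \<Rightarrow> real) set" where
  base: "(\<lambda>x. flat p (c * x $ i + d)) \<in> smooth_class"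
| const: "(\<lambda>x. c) \<in> smooth_class"
| add: "f \<in> smooth_class \<Longrightarrow> g \<in> smooth_class \<Longrightarrow> (\<lambda>x. f x + g x) \<in> smooth_class"
| mult: "f \<in> smooth_class \<Longrightarrow> g \<in> smooth_class \<Longrightarrow> (\<lambda>x. f x * g x) \<in> smooth_class"

lemma smooth_class_has_partial:
  assumes "f \<in> smooth_class"
  shows "continuous_on UNIV f \<and>
    (\<exists>f'\<in>smooth_class. \<forall>x. ((\<lambda>t. f (x + t *\<^sub>R axis j 1)) has_real_derivative f' x) (at 0))"
  using assms
proof induction
  case (base p c i d)
  have "isCont (flat p) x" for x using flat_has_derivative DERIV_isCont by blast
  then have "continuous_on UNIV (flat p)" by (simp add: continuous_on_eq_continuous_at)
  then have 1: "continuous_on UNIV (\<lambda>x. flat p (c * x $ i + d))"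
    by (rule continuous_on_compose2) (auto intro!: continuous_intros)
  define q where "q = [:0, 0, 1:] * (p - pderiv p)"
  let ?f' = "\<lambda>x. (if i = j then c else 0) * flat q (c * x $ i + d)"
  have "?f' \<in> smooth_class" by (rule smooth_class.mult[OF smooth_class.const smooth_class.base])
  moreover have "((\<lambda>t. flat p (c * (x + t *\<^sub>R axis j 1) $ i + d)) has_real_derivative ?f' x) (at 0)" for x
  proof -
    have "((\<lambda>t. c * (x + t *\<^sub>R axis j 1) $ i + d) has_real_derivative (if i = j then c else 0)) (at 0)"
      by (auto intro!: derivative_eq_intros simp: axis_def)
    from DERIV_chain2[OF flat_has_derivative this, of p] show ?thesis by (simp add: q_def mult.commute)
  qed
  ultimately show ?case using 1 by (intro conjI bexI[of _ ?f'] allI)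
next
  case (const c)
  have "(\<lambda>x. 0) \<in> smooth_class" by (rule smooth_class.const)
  then show ?case by (auto intro!: bexI[of _ "\<lambda>x. 0"])
next
  case (add f g)
  then obtain f' g' where "f' \<in> smooth_class" "g' \<in> smooth_class"
    "\<And>x. ((\<lambda>t. f (x + t *\<^sub>R axis j 1)) has_real_derivative f' x) (at 0)"
    "\<And>x. ((\<lambda>t. g (x + t *\<^sub>R axis j 1)) has_real_derivative g' x) (at 0)" by blast
  then show ?case using add smooth_class.add
    by (intro conjI bexI[of _ "\<lambda>x. f' x + g' x"]) (auto intro!: continuous_intros DERIV_add)
next
  case (mult f g)
  then obtain f' g' where *: "f' \<in> smooth_class" "g' \<in> smooth_class"
    "\<And>x. ((\<lambda>t. f (x + t *\<^sub>R axis j 1)) has_real_derivative f' x) (at 0)"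
    "\<And>x. ((\<lambda>t. g (x + t *\<^sub>R axis j 1)) has_real_derivative g' x) (at 0)" by blast
  have "(\<lambda>x. f' x * g x + g' x * f x) \<in> smooth_class"
    using * mult by (intro smooth_class.add smooth_class.mult)
  moreover have "((\<lambda>t. f (x + t *\<^sub>R axis j 1) * g (x + t *\<^sub>R axis j 1)) has_real_derivative f' x * g x + g' x * f x) (at 0)" for x
    using DERIV_mult[OF *(3)[of x] *(4)[of x]] by simp
  ultimately show ?case using mult by (intro conjI bexI[of _ "\<lambda>x. f' x * g x + g' x * f x"]) (auto intro!: continuous_intros)
qed

lemma smooth_class_continuously_diff:
  "f \<in> smooth_class \<Longrightarrow> continuously_diff k f"
proof (induction k arbitrary: f)
  case 0 then show ?case using smooth_class_has_partial by auto
next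
  case (Suc k)
  have "(\<forall>x. has_partial j f x) \<and> continuously_diff k (partial j f)" for j
  proof -
    obtain f' where f': "f' \<in> smooth_class" "\<And>x. ((\<lambda>t. f (x + t *\<^sub>R axis j 1)) has_real_derivative f' x) (at 0)"
      using smooth_class_has_partial[OF Suc.prems] by blast
    have "has_partial j f x" "partial j f x = f' x" for x
      using f'(2)[of x] unfolding has_partial_def partial_def
      by (auto simp: real_differentiable_def has_real_derivative_iff_has_vector_derivative vector_derivative_at)
    then show ?thesis using Suc.IH[OF f'(1)] by presburger
  qed
  then show ?case using smooth_class_has_partial[OF Suc.prems] by auto
qed

text \<open>Smooth functions that are positive exactly on the open box and converge to its indicator
  as \<open>n\<close> grows, because exp(-1/(n s)) tends to 1 for every positive s. The arguments
  are spelled out in the affine form that \<open>smooth_class.base\<close> expects.\<close>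

definition box_bump :: "nat \<Rightarrow> real ^ 'm \<Rightarrow> real ^ 'm \<Rightarrow> real ^ 'm \<Rightarrow> real" where
  "box_bump n a b x = (\<Prod>i\<in>UNIV. flat 1 (real (Suc n) * x $ i + - (real (Suc n) * a $ i)) * flat 1 (- real (Suc n) * x $ i + real (Suc n) * b $ i))"

lemma flat_1_bounds: "0 \<le> flat 1 x" "flat 1 x \<le> 1" "flat 1 x \<noteq> 0 \<longleftrightarrow> x > 0"
  by (auto simp: flat_def)

lemma box_bump_bounds: "0 \<le> box_bump n a b x" "box_bump n a b x \<le> 1"
  unfolding box_bump_def by (auto intro!: prod_nonneg prod_le_1 mult_le_one mult_nonneg_nonneg flat_1_bounds)

lemma box_bump_nonzero: "box_bump n a b x \<noteq> 0 \<longleftrightarrow> x \<in> box a b"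
proof -
  have 1: "flat 1 (real (Suc n) * x $ i + - (real (Suc n) * a $ i)) \<noteq> 0 \<longleftrightarrow> a $ i < x $ i" for i
  proof -
    have "real (Suc n) * x $ i + - (real (Suc n) * a $ i) = real (Suc n) * (x $ i - a $ i)" by (simp add: algebra_simps)
    then show ?thesis unfolding flat_1_bounds by (simp only: zero_less_mult_iff) auto
  qed
  have 2: "flat 1 (- real (Suc n) * x $ i + real (Suc n) * b $ i) \<noteq> 0 \<longleftrightarrow> x $ i < b $ i" for i
  proof -
    have "- real (Suc n) * x $ i + real (Suc n) * b $ i = real (Suc n) * (b $ i - x $ i)" by (simp add: algebra_simps)
    then show ?thesis unfolding flat_1_bounds by (simp only: zero_less_mult_iff) auto
  qed
  have "box_bump n a b x \<noteq> 0 \<longleftrightarrow> (\<forall>i. flat 1 (real (Suc n) * x $ i + - (real (Suc n) * a $ i)) \<noteq> 0 \<and> flat 1 (- real (Suc n) * x $ i + real (Suc n) * b $ i) \<noteq> 0)"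
    by (simp add: box_bump_def del: of_nat_Suc)
  then show ?thesis unfolding 1 2 mem_box_cart by auto
qed

lemma box_bump_test_function:
  assumes "cbox a b \<subseteq> U"
  shows "box_bump n a b \<in> test_functions U"
proof -
  have "(\<lambda>x. \<Prod>i\<in>I. flat 1 (real (Suc n) * x $ i + - (real (Suc n) * a $ i)) * flat 1 (- real (Suc n) * x $ i + real (Suc n) * b $ i)) \<in> smooth_class" for I
  proof (induction I rule: infinite_finite_induct)
    case (insert i I)
    show ?case unfolding prod.insert[OF insert(1,2)]
      by (intro smooth_class.mult smooth_class.base insert(3))
  qed (simp_all add: smooth_class.const)
  then have "box_bump n a b \<in> smooth_class" unfolding box_bump_def .
  then have 1: "continuously_diff k (box_bump n a b)" for k by (rule smooth_class_continuously_diff)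
  have 2: "closure {x. box_bump n a b x \<noteq> 0} \<subseteq> cbox a b"
    unfolding box_bump_nonzero by (intro closure_minimal) (auto simp: box_subset_cbox)
  have "compact (closure {x. box_bump n a b x \<noteq> 0})"
    using 2 compact_cbox bounded_subset bounded_cbox by (metis closed_closure compact_eq_bounded_closed)
  with 1 2 assms show ?thesis unfolding test_functions_def by blast
qed

lemma box_bump_tendsto:
  fixes a b x :: "real ^ 'm"
  shows "(\<lambda>n. box_bump n a b x) \<longlonglongrightarrow> indicator (box a b) x"
proof (cases "x \<in> box a b")
  case False
  then have "box_bump n a b x = 0" for n using box_bump_nonzero by blast
  then show ?thesis using False by simp
next
  case True
  have fl: "(\<lambda>n. flat 1 (real (Suc n) * s)) \<longlonglongrightarrow> 1" if s: "s > 0" for s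
  proof -
    have "(\<lambda>n. exp (- (inverse (real (Suc n)) * (1 / s)))) \<longlonglongrightarrow> exp (- (0 * (1 / s)))"
      by (intro tendsto_intros LIMSEQ_inverse_real_of_nat)
    moreover have "flat 1 (real (Suc n) * s) = exp (- (inverse (real (Suc n)) * (1 / s)))" for n
      using s by (simp add: flat_def field_simps add_pos_nonneg)
    ultimately show ?thesis by simp
  qed
  have eq: "box_bump n a b x = (\<Prod>i\<in>UNIV. flat 1 (real (Suc n) * (x $ i - a $ i)) * flat 1 (real (Suc n) * (b $ i - x $ i)))" for n
    unfolding box_bump_def by (simp add: algebra_simps)
  have "(\<lambda>n. flat 1 (real (Suc n) * (x $ i - a $ i)) * flat 1 (real (Suc n) * (b $ i - x $ i))) \<longlonglongrightarrow> 1 * 1" for i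
    using True by (intro tendsto_mult; intro fl) (auto simp: mem_box_cart)
  then have "(\<lambda>n. box_bump n a b x) \<longlonglongrightarrow> (\<Prod>i\<in>(UNIV :: 'm set). 1 * 1)"
    unfolding eq by (rule tendsto_prod)
  then show ?thesis using True by simp
qed

lemma test_functionsD:
  assumes "\<phi> \<in> test_functions U"
  shows "continuous_on UNIV \<phi>" "has_partial j \<phi> x" "continuous_on UNIV (partial j \<phi>)"
    "compact (closure {x. \<phi> x \<noteq> 0})" "closure {x. \<phi> x \<noteq> 0} \<subseteq> U"
    "x \<notin> closure {x. \<phi> x \<noteq> 0} \<Longrightarrow> \<phi> x = 0" "x \<notin> closure {x. \<phi> x \<noteq> 0} \<Longrightarrow> partial j \<phi> x = 0"
    "((\<lambda>t. \<phi> (y + t *\<^sub>R axis j 1)) has_real_derivative partial j \<phi> (y + s *\<^sub>R axis j 1)) (at s)"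
proof -
  have k: "continuously_diff k \<phi>" for k using assms by (simp add: test_functions_def)
  have c: "compact (closure {x. \<phi> x \<noteq> 0})" "closure {x. \<phi> x \<noteq> 0} \<subseteq> U"
    using assms by (auto simp: test_functions_def)
  then show "compact (closure {x. \<phi> x \<noteq> 0})" "closure {x. \<phi> x \<noteq> 0} \<subseteq> U" by blast+
  show hp: "has_partial j \<phi> x" for x using k[of "Suc 0"] by auto
  show "continuous_on UNIV \<phi>" "continuous_on UNIV (partial j \<phi>)" using k[of "Suc 0"] by auto
  show "\<phi> x = 0" if "x \<notin> closure {x. \<phi> x \<noteq> 0}" using that closure_subset[of "{x. \<phi> x \<noteq> 0}"] by auto
  have d0: "((\<lambda>t. \<phi> (z + t *\<^sub>R axis j 1)) has_real_derivative partial j \<phi> z) (at 0)" for z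
    using hp[of z] unfolding has_partial_def partial_def
    by (simp add: vector_derivative_works has_real_derivative_iff_has_vector_derivative)
  show "((\<lambda>t. \<phi> (y + t *\<^sub>R axis j 1)) has_real_derivative partial j \<phi> (y + s *\<^sub>R axis j 1)) (at s)"
  proof -
    have "((\<lambda>t. \<phi> (y + s *\<^sub>R axis j 1 + (t - s) *\<^sub>R axis j 1)) has_real_derivative partial j \<phi> (y + s *\<^sub>R axis j 1) * 1) (at s)"
      by (rule DERIV_chain2[where g = "\<lambda>t. t - s"]) (use d0 in \<open>auto intro!: derivative_eq_intros\<close>)
    then show ?thesis by (simp add: scaleR_left_diff_distrib)
  qed
  show "partial j \<phi> x = 0" if x: "x \<notin> closure {x. \<phi> x \<noteq> 0}"
  proof -
    let ?S = "(\<lambda>t. x + t *\<^sub>R axis j 1) -` (- closure {x. \<phi> x \<noteq> 0})"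
    have o: "open ?S" by (intro open_vimage) (auto intro!: continuous_intros)
    have z: "0 \<in> ?S" using x by simp
    have e: "\<phi> (x + t *\<^sub>R axis j 1) = 0" if "t \<in> ?S" for t
      using that closure_subset[of "{x. \<phi> x \<noteq> 0}"] by auto
    have "((\<lambda>t. \<phi> (x + t *\<^sub>R axis j 1)) has_real_derivative 0) (at 0)"
      by (rule has_field_derivative_transform_within_open[OF DERIV_const o z]) (rule e[symmetric])
    then show ?thesis using d0[of x] DERIV_unique by blast
  qed
qed

lemma test_function_bounded:
  assumes "\<phi> \<in> test_functions U"
  obtains C where "0 \<le> C" "\<And>x. \<bar>\<phi> x\<bar> \<le> C" "\<And>x. \<bar>partial j \<phi> x\<bar> \<le> C"
proof -
  let ?K = "closure {x. \<phi> x \<noteq> 0}"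
  note t = test_functionsD[OF assms]
  have "compact (\<phi> ` ?K)" "compact (partial j \<phi> ` ?K)"
    by (rule compact_continuous_image[OF continuous_on_subset[OF t(1) subset_UNIV] t(4)]
        compact_continuous_image[OF continuous_on_subset[OF t(3) subset_UNIV] t(4)])+
  then have "bounded (\<phi> ` ?K)" "bounded (partial j \<phi> ` ?K)" by (simp_all only: compact_imp_bounded)
  then obtain C1 C2 where C: "\<And>x. x \<in> ?K \<Longrightarrow> \<bar>\<phi> x\<bar> \<le> C1" "\<And>x. x \<in> ?K \<Longrightarrow> \<bar>partial j \<phi> x\<bar> \<le> C2"
    unfolding bounded_iff by auto
  show ?thesis
  proof (rule that[of "max 0 (max C1 C2)"])
    show "\<bar>\<phi> x\<bar> \<le> max 0 (max C1 C2)" for x using C(1)[of x] t(6)[of x] by (cases "x \<in> ?K") auto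
    show "\<bar>partial j \<phi> x\<bar> \<le> max 0 (max C1 C2)" for x using C(2)[of x] t(7)[of x] by (cases "x \<in> ?K") auto
  qed auto
qed

lemma partial_translate: "partial j (\<lambda>x. f (x + c)) x = partial j f (x + c)"
  "has_partial j (\<lambda>x. f (x + c)) x \<longleftrightarrow> has_partial j f (x + c)"
  by (simp_all add: partial_def has_partial_def algebra_simps)

lemma continuously_diff_translate:
  "continuously_diff k f \<Longrightarrow> continuously_diff k (\<lambda>x. f (x + c))"
proof (induction k arbitrary: f)
  case 0
  then show ?case by (auto intro!: continuous_on_compose2[of UNIV f] continuous_intros)
next
  case (Suc k)
  have "partial j (\<lambda>x. f (x + c)) = (\<lambda>x. partial j f (x + c))" for j by (simp add: fun_eq_iff partial_translate)
  then show ?case using Suc by (auto simp: partial_translate intro!: continuous_on_compose2[of UNIV f] continuous_intros)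
qed

lemma test_function_translate:
  assumes "\<phi> \<in> test_functions V" and V: "\<And>x. x \<in> V \<Longrightarrow> x - c \<in> U"
  shows "(\<lambda>x. \<phi> (x + c)) \<in> test_functions U"
proof -
  have "{x. \<phi> (x + c) \<noteq> 0} = (+) (-c) ` {x. \<phi> x \<noteq> 0}" by (force simp: image_iff)
  then have eq: "closure {x. \<phi> (x + c) \<noteq> 0} = (+) (-c) ` closure {x. \<phi> x \<noteq> 0}" by (simp only: closure_translation)
  note t = test_functionsD[OF assms(1)]
  have "compact (closure {x. \<phi> (x + c) \<noteq> 0})" unfolding eq by (rule compact_translation[OF t(4)])
  moreover have "closure {x. \<phi> (x + c) \<noteq> 0} \<subseteq> U" unfolding eq using t(5) V by (auto simp: algebra_simps)
  ultimately show ?thesis using assms(1) continuously_diff_translate unfolding test_functions_def by blast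
qed

section \<open>Completed Lebesgue measure and Borel representatives\<close>

lemma borel_Int_space_lebesgue: "S \<in> sets borel \<Longrightarrow> S \<inter> space lebesgue \<in> sets lebesgue"
  by simp

lemma AE_lebesgue_on_iff:
  "S \<in> sets borel \<Longrightarrow> (AE x in lebesgue_on S. P x) \<longleftrightarrow> (AE x in lborel. x \<in> S \<longrightarrow> P x)"
  by (subst AE_restrict_space_iff[OF borel_Int_space_lebesgue]) (simp_all add: AE_completion_iff)

lemma integral_lebesgue_on_borel:
  fixes f :: "'a::euclidean_space \<Rightarrow> 'b::{banach,second_countable_topology}"
  assumes S: "S \<in> sets borel" and f: "f \<in> borel_measurable borel"
  shows "(LINT x|lebesgue_on S. f x) = (LINT x|lborel. indicator S x *\<^sub>R f x)"
    and "integrable (lebesgue_on S) f \<longleftrightarrow> integrable lborel (\<lambda>x. indicator S x *\<^sub>R f x)"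
proof -
  have m: "(\<lambda>x. indicator S x *\<^sub>R f x) \<in> borel_measurable lborel" using S f by simp
  show "(LINT x|lebesgue_on S. f x) = (LINT x|lborel. indicator S x *\<^sub>R f x)"
    using integral_restrict_space[OF borel_Int_space_lebesgue[OF S], of f] integral_completion[OF m] by simp
  show "integrable (lebesgue_on S) f \<longleftrightarrow> integrable lborel (\<lambda>x. indicator S x *\<^sub>R f x)"
    using integrable_restrict_space[OF borel_Int_space_lebesgue[OF S], of f] integrable_completion[OF m] by simp
qed

text \<open>Completeness of Lebesgue measure: preimages under \<open>f\<close> and \<open>f'\<close>
  differ only inside a null set, all of whose subsets are measurable.\<close>

lemma borel_measurable_lebesgue_AE:
  assumes f': "f' \<in> borel_measurable lebesgue" and ae: "AE x in lebesgue. f x = f' x"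
  shows "f \<in> borel_measurable (lebesgue :: 'a::euclidean_space measure)"
proof (rule measurableI)
  fix A :: "'b set" assume A: "A \<in> sets borel"
  have "AE x in lborel. f x = f' x" using ae by (simp only: AE_completion_iff)
  then obtain N where N0: "{x \<in> space lborel. \<not> f x = f' x} \<subseteq> N" "emeasure lborel N = 0" "N \<in> sets lborel"
    by (rule AE_E)
  then have N: "N \<in> null_sets lborel" "{x \<in> space lborel. \<not> f x = f' x} \<subseteq> N" by (auto intro: null_setsI)
  have 1: "(f' -` A \<inter> space lebesgue) - N \<in> sets lebesgue"
    using measurable_sets[OF f' A] N(1) by (intro sets.Diff) auto
  have 2: "(f -` A \<inter> N) \<in> sets lebesgue"
    by (rule null_sets_completion_subset[THEN null_setsD2, OF _ null_sets_completionI[OF N(1)]]) auto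
  have "f -` A \<inter> space lebesgue = ((f' -` A \<inter> space lebesgue) - N) \<union> (f -` A \<inter> N)"
    using N(2) by auto
  then show "f -` A \<inter> space lebesgue \<in> sets lebesgue" using 1 2 by (metis sets.Un)
qed simp

lemma borel_measurable_lebesgue_on_AE:
  fixes f :: "'a::euclidean_space \<Rightarrow> 'b::real_normed_vector"
  assumes S: "S \<in> sets borel" and f': "f' \<in> borel_measurable (lebesgue_on S)" and ae: "AE x in lborel. x \<in> S \<longrightarrow> f x = f' x"
  shows "f \<in> borel_measurable (lebesgue_on S)"
proof -
  have "(\<lambda>x. indicator S x *\<^sub>R f' x) \<in> borel_measurable lebesgue"
    using f' borel_measurable_restrict_space_iff[OF borel_Int_space_lebesgue[OF S]] by blast
  moreover have "AE x in lebesgue. indicator S x *\<^sub>R f x = indicator S x *\<^sub>R f' x"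
    using AE_completion[OF ae] by eventually_elim (auto simp: indicator_def)
  ultimately have "(\<lambda>x. indicator S x *\<^sub>R f x) \<in> borel_measurable lebesgue"
    by (rule borel_measurable_lebesgue_AE)
  then show ?thesis using borel_measurable_restrict_space_iff[OF borel_Int_space_lebesgue[OF S]] by blast
qed

lemma borel_representative:
  fixes f :: "'a::euclidean_space \<Rightarrow> 'b::euclidean_space"
  assumes S: "S \<in> sets borel" and f: "f \<in> borel_measurable (lebesgue_on S)"
  obtains f' where "f' \<in> borel_measurable borel" "AE x in lborel. x \<in> S \<longrightarrow> f x = f' x"
proof -
  have m: "(\<lambda>x. indicator S x *\<^sub>R f x) \<in> borel_measurable lebesgue"
    using f borel_measurable_restrict_space_iff[OF borel_Int_space_lebesgue[OF S]] by blast
  have "\<exists>g'\<in>borel_measurable lborel. AE x in lborel. (indicator S x *\<^sub>R f x) \<bullet> b = g' x" for b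
    by (rule completion_ex_borel_measurable_real) (use m in measurable)
  then obtain g where g: "\<And>b. g b \<in> borel_measurable lborel" "\<And>b. AE x in lborel. (indicator S x *\<^sub>R f x) \<bullet> b = g b x"
    by metis
  define f' where "f' x = (\<Sum>b\<in>Basis. g b x *\<^sub>R b)" for x
  have "f' \<in> borel_measurable borel" unfolding f'_def using g(1) by measurable
  moreover have "AE x in lborel. \<forall>b\<in>Basis. (indicator S x *\<^sub>R f x) \<bullet> b = g b x"
    using g(2) by (intro AE_finite_allI) auto
  then have "AE x in lborel. x \<in> S \<longrightarrow> f x = f' x"
  proof eventually_elim
    fix x assume "\<forall>b\<in>Basis. (indicator S x *\<^sub>R f x) \<bullet> b = g b x"
    then have "f' x = (\<Sum>b\<in>Basis. ((indicator S x *\<^sub>R f x) \<bullet> b) *\<^sub>R b)" unfolding f'_def by (intro sum.cong) auto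
    then have "f' x = indicator S x *\<^sub>R f x" by (simp only: euclidean_representation)
    then show "x \<in> S \<longrightarrow> f x = f' x" by simp
  qed
  ultimately show ?thesis using that by blast
qed

text \<open>Integrability on a compact set includes measurability there, and \<open>U\<close> is
  exhausted by an increasing sequence of compact sets.\<close>

lemma locally_integrable_measurable:
  fixes f :: "real ^ 'm \<Rightarrow> 'v::euclidean_space"
  assumes U: "open U" and f: "locally_integrable U f"
  shows "f \<in> borel_measurable (lebesgue_on U)"
proof -
  obtain C where C: "\<And>n::nat. compact (C n)" "\<And>n. C n \<subseteq> U" "\<And>n. C n \<subseteq> interior (C (Suc n))" "\<Union>(range C) = U"
    using open_Union_compact_subsets[OF U] by metis
  have mono: "C n \<subseteq> C m" if "n \<le> m" for n m
    using that by (rule lift_Suc_mono_le[rotated]) (use C(3) interior_subset in blast)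
  have bor: "S \<in> sets borel" if "compact S" for S :: "(real ^ 'm) set" using that by (simp add: borel_closed compact_imp_closed)
  have "(\<lambda>x. indicator (C n) x *\<^sub>R f x) \<in> borel_measurable lebesgue" for n
  proof -
    have "f \<in> borel_measurable (lebesgue_on (C n))"
      using f C(1,2)[of n] unfolding locally_integrable_def by (intro borel_measurable_integrable) blast
    then show ?thesis using borel_measurable_restrict_space_iff[OF borel_Int_space_lebesgue[OF bor[OF C(1)]]] by blast
  qed
  moreover have "(\<lambda>n. indicator (C n) x *\<^sub>R f x) \<longlonglongrightarrow> indicator U x *\<^sub>R f x" for x
  proof (cases "x \<in> U")
    case True
    then obtain N where "x \<in> C N" using C(4) by blast
    then have "\<forall>n\<ge>N. indicator (C n) x *\<^sub>R f x = indicator U x *\<^sub>R f x" using mono True by (auto simp: indicator_def)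
    then have "\<forall>\<^sub>F n in sequentially. indicator (C n) x *\<^sub>R f x = indicator U x *\<^sub>R f x"
      unfolding eventually_sequentially by blast
    then show ?thesis by (rule tendsto_eventually)
  next
    case False
    then have "x \<notin> C n" for n using C(2) by blast
    then show ?thesis using False by simp
  qed
  ultimately have "(\<lambda>x. indicator U x *\<^sub>R f x) \<in> borel_measurable lebesgue" by (rule borel_measurable_LIMSEQ_metric)
  then show ?thesis using borel_measurable_restrict_space_iff[OF borel_Int_space_lebesgue[OF borel_open[OF U]]] by blast
qed

lemma integrable_lebesgue_on_cong_AE:
  fixes f f' :: "'a::euclidean_space \<Rightarrow> 'b::{banach,second_countable_topology}"
  assumes S: "S \<in> sets borel" and f': "integrable (lebesgue_on S) f'" and ae: "AE x in lborel. x \<in> S \<longrightarrow> f x = f' x"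
  shows "integrable (lebesgue_on S) f"
proof -
  have m: "f \<in> borel_measurable (lebesgue_on S)"
    by (rule borel_measurable_lebesgue_on_AE[OF S borel_measurable_integrable[OF f'] ae])
  have "AE x in lebesgue_on S. f x = f' x" using ae AE_lebesgue_on_iff[OF S] by blast
  then show ?thesis using integrable_cong_AE[OF m borel_measurable_integrable[OF f']] f' by blast
qed

lemma locally_integrable_cong_AE:
  assumes f': "locally_integrable U f'" and ae: "AE x in lborel. x \<in> U \<longrightarrow> f x = f' x"
  shows "locally_integrable U f"
  unfolding locally_integrable_def
proof safe
  fix K assume K: "compact K" "K \<subseteq> U"
  have "AE x in lborel. x \<in> K \<longrightarrow> f x = f' x" using ae by eventually_elim (use K in auto)
  then show "integrable (lebesgue_on K) f"
    using f' K unfolding locally_integrable_def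
    by (intro integrable_lebesgue_on_cong_AE[of K f' f]) (auto simp: borel_closed compact_imp_closed)
qed

lemma is_weak_partial_cong_AE:
  assumes U: "open U" and w: "is_weak_partial U j f' g'"
    and ae: "AE x in lborel. x \<in> U \<longrightarrow> f x = f' x" "AE x in lborel. x \<in> U \<longrightarrow> g x = g' x"
  shows "is_weak_partial U j f g"
proof -
  have l': "locally_integrable U f'" "locally_integrable U g'" using w by (auto simp: is_weak_partial_def)
  have l: "locally_integrable U f" "locally_integrable U g"
    by (rule locally_integrable_cong_AE[OF l'(1) ae(1)], rule locally_integrable_cong_AE[OF l'(2) ae(2)])
  note [measurable] = l[THEN locally_integrable_measurable[OF U]] l'[THEN locally_integrable_measurable[OF U]]
  have aeU: "AE x in lebesgue_on U. f x = f' x" "AE x in lebesgue_on U. g x = g' x"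
    using ae AE_lebesgue_on_iff[OF borel_open[OF U]] by blast+
  have "(LINT x|lebesgue_on U. partial j \<phi> x *\<^sub>R f x) = - (LINT x|lebesgue_on U. \<phi> x *\<^sub>R g x)" if "\<phi> \<in> test_functions U" for \<phi>
  proof -
    have "\<phi> \<in> borel_measurable borel" "partial j \<phi> \<in> borel_measurable borel"
      using test_functionsD(1,3)[OF that] by (auto intro: borel_measurable_continuous_onI)
    then have [measurable]: "\<phi> \<in> borel_measurable (lebesgue_on U)" "partial j \<phi> \<in> borel_measurable (lebesgue_on U)"
      by (auto intro!: measurable_restrict_space1 measurable_completion)
    have "(LINT x|lebesgue_on U. partial j \<phi> x *\<^sub>R f x) = (LINT x|lebesgue_on U. partial j \<phi> x *\<^sub>R f' x)"
      by (rule integral_cong_AE) (measurable, use aeU(1) in \<open>eventually_elim, simp\<close>)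
    also have "\<dots> = - (LINT x|lebesgue_on U. \<phi> x *\<^sub>R g' x)" using w that by (auto simp: is_weak_partial_def)
    also have "(LINT x|lebesgue_on U. \<phi> x *\<^sub>R g' x) = (LINT x|lebesgue_on U. \<phi> x *\<^sub>R g x)"
      by (rule integral_cong_AE) (measurable, use aeU(2) in \<open>eventually_elim, simp\<close>)
    finally show ?thesis .
  qed
  then show ?thesis using l by (simp add: is_weak_partial_def)
qed

text \<open>A Borel measurable version of \<open>locally_integrable\<close>, so that composition with Borel functions
  stays measurable.\<close>

definition locint :: "(real ^ 'm) set \<Rightarrow> (real ^ 'm \<Rightarrow> 'v::euclidean_space) \<Rightarrow> bool" where
  "locint U f \<longleftrightarrow> f \<in> borel_measurable borel \<and> (\<forall>K. compact K \<longrightarrow> K \<subseteq> U \<longrightarrow> integrable lborel (\<lambda>x. indicator K x *\<^sub>R f x))"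

lemma locintD: "locint U f \<Longrightarrow> f \<in> borel_measurable borel"
  "locint U f \<Longrightarrow> compact K \<Longrightarrow> K \<subseteq> U \<Longrightarrow> integrable lborel (\<lambda>x. indicator K x *\<^sub>R f x)"
  by (auto simp: locint_def)

lemma locint_iff:
  assumes f: "f \<in> borel_measurable borel"
  shows "locally_integrable U f \<longleftrightarrow> locint U f"
proof -
  have "integrable (lebesgue_on K) f \<longleftrightarrow> integrable lborel (\<lambda>x. indicator K x *\<^sub>R f x)" if "compact K" for K
    by (rule integral_lebesgue_on_borel(2)[OF borel_closed[OF compact_imp_closed[OF that]] f])
  then have "(compact K \<and> K \<subseteq> U \<longrightarrow> integrable (lebesgue_on K) f) \<longleftrightarrow>
      (compact K \<longrightarrow> K \<subseteq> U \<longrightarrow> integrable lborel (\<lambda>x. indicator K x *\<^sub>R f x))" for K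
    by blast
  then show ?thesis unfolding locally_integrable_def locint_def using f by simp
qed

text \<open>A test function and its partial derivative vanish off \<open>U\<close>, so the integrals
  may be taken over the whole space, where translation invariance is available.\<close>

lemma weak_partial_borel_iff:
  assumes U: "open U" and f: "f \<in> borel_measurable borel" and g: "g \<in> borel_measurable borel"
  shows "is_weak_partial U j f g \<longleftrightarrow> locint U f \<and> locint U g \<and>
    (\<forall>\<phi> \<in> test_functions U. (LINT x|lborel. partial j \<phi> x *\<^sub>R f x) = - (LINT x|lborel. \<phi> x *\<^sub>R g x))"
proof -
  have "(LINT x|lebesgue_on U. partial j \<phi> x *\<^sub>R f x) = (LINT x|lborel. partial j \<phi> x *\<^sub>R f x)"
    "(LINT x|lebesgue_on U. \<phi> x *\<^sub>R g x) = (LINT x|lborel. \<phi> x *\<^sub>R g x)" if "\<phi> \<in> test_functions U" for \<phi>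
  proof -
    note t = test_functionsD[OF that]
    have m: "\<phi> \<in> borel_measurable borel" "partial j \<phi> \<in> borel_measurable borel"
      using t(1,3) by (auto intro: borel_measurable_continuous_onI)
    have z: "indicator U x *\<^sub>R partial j \<phi> x *\<^sub>R f x = partial j \<phi> x *\<^sub>R f x" "indicator U x *\<^sub>R \<phi> x *\<^sub>R g x = \<phi> x *\<^sub>R g x" for x
      using t(5) t(6)[of x] t(7)[of x j] by (cases "x \<in> U"; auto)+
    have m2: "(\<lambda>x. partial j \<phi> x *\<^sub>R f x) \<in> borel_measurable borel" "(\<lambda>x. \<phi> x *\<^sub>R g x) \<in> borel_measurable borel"
      using m f g by measurable
    show "(LINT x|lebesgue_on U. partial j \<phi> x *\<^sub>R f x) = (LINT x|lborel. partial j \<phi> x *\<^sub>R f x)"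
      "(LINT x|lebesgue_on U. \<phi> x *\<^sub>R g x) = (LINT x|lborel. \<phi> x *\<^sub>R g x)"
      using integral_lebesgue_on_borel(1)[OF borel_open[OF U] m2(1)] integral_lebesgue_on_borel(1)[OF borel_open[OF U] m2(2)]
      unfolding z .
  qed
  then show ?thesis unfolding is_weak_partial_def using locint_iff[OF f] locint_iff[OF g] by auto
qed

section \<open>The fundamental lemma of the calculus of variations\<close>

lemma AE_zero_of_set_integrals_zero:
  fixes k :: "'a \<Rightarrow> real"
  assumes k: "integrable M k" and z: "\<And>S. S \<in> sets M \<Longrightarrow> (LINT x|M. indicator S x * k x) = 0"
  shows "AE x in M. k x = 0"
proof -
  have [measurable]: "k \<in> borel_measurable M" using k by simp
  have pos: "AE x in M. \<not> 0 < r * k x" if r: "r = 1 \<or> r = -1" for r :: real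
  proof -
    define S where "S = {x \<in> space M. 0 < r * k x}"
    have S[measurable]: "S \<in> sets M" unfolding S_def by measurable
    have i: "integrable M (\<lambda>x. indicator S x * k x)" using integrable_mult_indicator[OF S k] by simp
    then have i': "integrable M (\<lambda>x. r * (indicator S x * k x))" by simp
    have "(LINT x|M. r * (indicator S x * k x)) = 0" using z[OF S] by simp
    moreover have "AE x in M. 0 \<le> r * (indicator S x * k x)" by (auto simp: S_def indicator_def)
    ultimately have "AE x in M. r * (indicator S x * k x) = 0" using integral_nonneg_eq_0_iff_AE[OF i'] by simp
    moreover have "AE x in M. x \<in> space M" by simp
    ultimately show ?thesis by eventually_elim (use r in \<open>auto simp: S_def indicator_def\<close>)
  qed
  from pos[of 1] pos[of "-1"] show ?thesis by (auto elim!: eventually_elim2)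
qed

text \<open>The bumps converge to the indicator of the box and are dominated by the indicator of the
  closed box, on which \<open>h\<close> is integrable.\<close>

lemma box_integral_zero:
  fixes h :: "real ^ 'm \<Rightarrow> real"
  assumes h: "locint U h" and z: "\<And>\<phi>. \<phi> \<in> test_functions U \<Longrightarrow> (LINT x|lborel. \<phi> x * h x) = 0"
    and cd: "cbox c d \<subseteq> U"
  shows "(LINT x|lborel. indicator (box c d) x * h x) = 0"
proof -
  have hm[measurable]: "h \<in> borel_measurable borel" by (rule locintD(1)[OF h])
  have k: "integrable lborel (\<lambda>x. indicator (cbox c d) x *\<^sub>R h x)" by (rule locintD(2)[OF h compact_cbox cd])
  have bm[measurable]: "box_bump n c d \<in> borel_measurable borel" for n
    by (rule borel_measurable_continuous_onI[OF test_functionsD(1)[OF box_bump_test_function[OF cd]]])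
  have "(\<lambda>n. LINT x|lborel. box_bump n c d x * h x) \<longlonglongrightarrow> (LINT x|lborel. indicator (box c d) x * h x)"
  proof (rule integral_dominated_convergence[where w = "\<lambda>x. norm (indicator (cbox c d) x *\<^sub>R h x)"])
    show "integrable lborel (\<lambda>x. norm (indicator (cbox c d) x *\<^sub>R h x))" using k by (rule integrable_norm)
    show "AE x in lborel. (\<lambda>n. box_bump n c d x * h x) \<longlonglongrightarrow> indicator (box c d) x * h x"
      by (intro AE_I2 tendsto_mult box_bump_tendsto tendsto_const)
    show "AE x in lborel. norm (box_bump n c d x * h x) \<le> norm (indicator (cbox c d) x *\<^sub>R h x)" for n
    proof (rule AE_I2)
      fix x
      show "norm (box_bump n c d x * h x) \<le> norm (indicator (cbox c d) x *\<^sub>R h x)"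
      proof (cases "x \<in> box c d")
        case True
        then have "x \<in> cbox c d" using box_subset_cbox by blast
        then show ?thesis using box_bump_bounds[of n c d x] by (simp add: abs_mult mult_left_le_one_le)
      next
        case False
        then have "box_bump n c d x = 0" using box_bump_nonzero by blast
        then show ?thesis by simp
      qed
    qed
  qed measurable
  moreover have "(LINT x|lborel. box_bump n c d x * h x) = 0" for n
    by (rule z[OF box_bump_test_function[OF cd]])
  ultimately show ?thesis using LIMSEQ_unique[OF _ tendsto_const] by auto
qed

text \<open>Vanishing integrals over open boxes extend to all Borel sets, as boxes form an
  intersection-stable generator; hence \<open>h\<close> vanishes almost everywhere on every box
  whose closure lies in \<open>U\<close>. Countably many such boxes cover \<open>U\<close> by
  Lindelof's theorem.\<close>

lemma locint_zero:
  fixes h :: "real ^ 'm \<Rightarrow> real"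
  assumes U: "open U" and h: "locint U h" and z: "\<And>\<phi>. \<phi> \<in> test_functions U \<Longrightarrow> (LINT x|lborel. \<phi> x * h x) = 0"
  shows "AE x in lborel. x \<in> U \<longrightarrow> h x = 0"
proof -
  have hm[measurable]: "h \<in> borel_measurable borel" by (rule locintD(1)[OF h])
  have box: "AE x in lborel. x \<in> box a b \<longrightarrow> h x = 0" if ab: "cbox a b \<subseteq> U" for a b
  proof -
    define k where "k x = indicator (box a b) x * h x" for x
    have "integrable lborel (\<lambda>x. indicator (box a b) x *\<^sub>R (indicator (cbox a b) x *\<^sub>R h x))"
      by (rule integrable_mult_indicator[OF _ locintD(2)[OF h compact_cbox ab]]) simp
    moreover have "(\<lambda>x. indicator (box a b) x *\<^sub>R (indicator (cbox a b) x *\<^sub>R h x)) = k"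
      using box_subset_cbox by (auto simp: k_def indicator_def fun_eq_iff)
    ultimately have k: "integrable lborel k" by simp
    have box0: "(LINT x|lborel. indicator (box c d) x * k x) = 0" for c d
    proof -
      obtain c' d' where cd: "box c d \<inter> box a b = box c' d'" using box_Int_box by blast
      have eq: "indicator (box c d) x * k x = indicator (box c' d') x * h x" for x
        unfolding cd[symmetric] k_def by (simp add: indicator_inter_arith mult.assoc)
      show ?thesis
      proof (cases "box c' d' = {}")
        case True then show ?thesis unfolding eq by simp
      next
        case False
        have "box c' d' \<subseteq> cbox a b" using cd box_subset_cbox by blast
        then have "closure (box c' d') \<subseteq> cbox a b" by (rule closure_minimal) (rule closed_cbox)
        then have c: "cbox c' d' \<subseteq> U" using closure_box[OF False] ab by simp
        show ?thesis unfolding eq by (rule box_integral_zero[OF h _ c]) (rule z)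
      qed
    qed
    have k0: "(LINT x|lborel. k x) = 0"
    proof -
      have "indicator (box a b) x * k x = k x" for x by (simp add: k_def indicator_def)
      then show ?thesis using box0[of a b] by (simp only:)
    qed
    have zS: "(LINT x|lborel. indicator S x * k x) = 0" if S: "S \<in> sets lborel" for S
    proof -
      have "Int_stable (range (\<lambda>(a, b). box a b :: (real ^ 'm) set))"
        unfolding Int_stable_def
      proof (intro ballI)
        fix A B assume "A \<in> range (\<lambda>(a, b). box a b :: (real ^ 'm) set)" "B \<in> range (\<lambda>(a, b). box a b :: (real ^ 'm) set)"
        then obtain p q r s where "A = box p q" "B = box r s" by auto
        then obtain c d where "A \<inter> B = box c d" using box_Int_box by blast
        then have "A \<inter> B = (\<lambda>(a, b). box a b) (c, d)" by simp
        then show "A \<inter> B \<in> range (\<lambda>(a, b). box a b)" by (rule range_eqI)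
      qed
      moreover have "range (\<lambda>(a, b). box a b :: (real ^ 'm) set) \<subseteq> Pow UNIV" by simp
      moreover have "S \<in> sigma_sets UNIV (range (\<lambda>(a, b). box a b))"
        using S by (simp add: borel_eq_box)
      ultimately show ?thesis
      proof (induction rule: sigma_sets_induct_disjoint)
        case (basic A) then show ?case using box0 by auto
      next
        case empty then show ?case by simp
      next
        case (compl A)
        have A: "A \<in> sets lborel" using compl(1) by (simp add: borel_eq_box)
        have i: "integrable lborel (\<lambda>x. indicator A x * k x)" using integrable_mult_indicator[OF A k] by simp
        have "indicator (UNIV - A) x * k x = k x - indicator A x * k x" for x by (simp add: indicator_def)
        then show ?case using Bochner_Integration.integral_diff[OF k i] k0 compl(2) by simp
      next
        case (union A)
        have A: "A i \<in> sets lborel" for i using union(2) by (simp add: borel_eq_box) blast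
        have "(LINT x:(\<Union>i. A i)|lborel. k x) = (\<Sum>i. (LINT x:A i|lborel. k x))"
        proof (rule lebesgue_integral_countable_add[OF A])
          show "A i \<inter> A j = {}" if "i \<noteq> j" for i j using union(1) that by (auto simp: disjoint_family_on_def)
          show "set_integrable lborel (\<Union> (range A)) k"
            unfolding set_integrable_def using A by (intro integrable_mult_indicator k) auto
        qed
        then show ?case using union(3) by (simp add: set_lebesgue_integral_def)
      qed
    qed
    have "AE x in lborel. k x = 0" by (rule AE_zero_of_set_integrals_zero[OF k zS])
    then show ?thesis
      by eventually_elim (auto simp: k_def indicator_def split: if_splits)
  qed
  define F where "F = {box a b | a b. cbox a b \<subseteq> U}"
  have "S \<in> F \<Longrightarrow> open S" for S by (auto simp: F_def open_box)
  then obtain F' where F': "F' \<subseteq> F" "countable F'" "\<Union>F' = \<Union>F" using Lindelof by metis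
  have "U \<subseteq> \<Union>F"
  proof
    fix x assume "x \<in> U"
    then obtain e where e: "e > 0" "cball x e \<subseteq> U" using U open_contains_cball by blast
    obtain a b where ab: "x \<in> box a b" "box a b \<subseteq> ball x e" using rational_boxes[OF e(1), of x] by blast
    have "box a b \<noteq> {}" using ab by auto
    moreover have "closure (box a b) \<subseteq> cball x e" using ab(2) by (intro closure_minimal) auto
    ultimately have "cbox a b \<subseteq> U" using e closure_box by (metis order_trans)
    then show "x \<in> \<Union>F" using ab by (auto simp: F_def)
  qed
  have "AE x in lborel. \<forall>S\<in>F'. x \<in> S \<longrightarrow> h x = 0"
    using box F' unfolding F_def by (subst AE_ball_countable[OF F'(2)]) auto
  then show ?thesis
  proof eventually_elim
    case (elim x)
    show ?case
    proof
      assume "x \<in> U"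
      then have "x \<in> \<Union>F'" using F'(3) \<open>U \<subseteq> \<Union>F\<close> by auto
      then show "h x = 0" using elim by auto
    qed
  qed
qed

section \<open>Difference quotients of weakly differentiable functions\<close>

lemma lborel_integral_translation:
  fixes f :: "'a::euclidean_space \<Rightarrow> 'b::{banach,second_countable_topology}"
  assumes f: "f \<in> borel_measurable borel"
  shows "(LINT x|lborel. f (x + c)) = (LINT x|lborel. f x)"
    and "integrable lborel (\<lambda>x. f (x + c)) \<longleftrightarrow> integrable lborel f"
proof -
  have eq: "lborel = distr lborel borel ((+) c)" by (rule lborel_distr_plus[symmetric])
  show "(LINT x|lborel. f (x + c)) = (LINT x|lborel. f x)"
    by (subst (2) eq, subst integral_distr) (use f in \<open>auto simp: add.commute\<close>)
  show "integrable lborel (\<lambda>x. f (x + c)) \<longleftrightarrow> integrable lborel f"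
    by (subst (2) eq, subst integrable_distr_eq) (use f in \<open>auto simp: add.commute\<close>)
qed

definition L1_modulus :: "('a::euclidean_space \<Rightarrow> real) \<Rightarrow> 'a \<Rightarrow> real" where
  "L1_modulus f h = (LINT x|lborel. \<bar>f (x + h) - f x\<bar>)"

lemma L1_modulus_nonneg: "0 \<le> L1_modulus f h"
  unfolding L1_modulus_def by (intro integral_nonneg_AE) auto

lemma L1_modulus_integrable:
  fixes f :: "'a::euclidean_space \<Rightarrow> real"
  assumes f: "integrable lborel f"
  shows "integrable lborel (\<lambda>x. f (x + h))" "integrable lborel (\<lambda>x. \<bar>f (x + h) - f x\<bar>)"
proof -
  have "f \<in> borel_measurable borel" using borel_measurable_integrable[OF f] by simp
  then show "integrable lborel (\<lambda>x. f (x + h))" using lborel_integral_translation(2)[of f h] f by blast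
  then show "integrable lborel (\<lambda>x. \<bar>f (x + h) - f x\<bar>)" using f by simp
qed

lemma L1_modulus_add:
  assumes f: "integrable lborel f" and g: "integrable lborel g"
  shows "L1_modulus (\<lambda>x. f x + g x) h \<le> L1_modulus f h + L1_modulus g h"
proof -
  have "L1_modulus (\<lambda>x. f x + g x) h \<le> (LINT x|lborel. \<bar>f (x + h) - f x\<bar> + \<bar>g (x + h) - g x\<bar>)"
    unfolding L1_modulus_def
    by (rule integral_mono) (use f g in \<open>auto intro!: L1_modulus_integrable Bochner_Integration.integrable_add\<close>)
  also have "\<dots> = L1_modulus f h + L1_modulus g h"
    unfolding L1_modulus_def by (rule Bochner_Integration.integral_add) (intro L1_modulus_integrable f g)+
  finally show ?thesis .
qed

lemma L1_modulus_le:
  assumes f: "integrable lborel f"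
  shows "L1_modulus f h \<le> 2 * (LINT x|lborel. \<bar>f x\<bar>)"
proof -
  have a: "integrable lborel (\<lambda>x. \<bar>f x\<bar>)" using f by simp
  then have m: "(\<lambda>x. \<bar>f x\<bar>) \<in> borel_measurable borel" using borel_measurable_integrable[OF a] by simp
  have "L1_modulus f h \<le> (LINT x|lborel. \<bar>f (x + h)\<bar> + \<bar>f x\<bar>)"
    unfolding L1_modulus_def
    by (rule integral_mono) (use f a L1_modulus_integrable[OF a] in \<open>auto intro!: L1_modulus_integrable Bochner_Integration.integrable_add\<close>)
  also have "\<dots> = (LINT x|lborel. \<bar>f (x + h)\<bar>) + (LINT x|lborel. \<bar>f x\<bar>)"
    using a L1_modulus_integrable[OF a] by (intro Bochner_Integration.integral_add) auto
  finally show ?thesis using lborel_integral_translation(1)[OF m, of h] by simp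
qed

text \<open>The indicator and its translate have the same integral, so the integral of their
  absolute difference is twice that of the positive part of the original minus the translate. This
  positive part is dominated by the fixed function \<open>indicator S\<close> whatever the shift,
  and it vanishes for small shifts because \<open>S\<close> is open.\<close>

lemma L1_modulus_open:
  fixes S :: "'a::euclidean_space set"
  assumes S: "open S" and fin: "emeasure lborel S < \<infinity>"
  shows "(L1_modulus (indicator S) \<longlongrightarrow> 0) (at 0)"
proof -
  let ?f = "indicator S :: 'a \<Rightarrow> real"
  have [measurable]: "S \<in> sets borel" using S by simp
  have f: "integrable lborel ?f" using fin by (intro integrable_real_indicator) auto
  have eq: "L1_modulus ?f h = 2 * (LINT x|lborel. max 0 (?f x - ?f (x + h)))" for h
  proof -
    have fh: "integrable lborel (\<lambda>x. ?f (x + h))" by (rule L1_modulus_integrable(1)[OF f])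
    have d: "integrable lborel (\<lambda>x. ?f x - ?f (x + h))" by (rule Bochner_Integration.integrable_diff[OF f fh])
    have "\<bar>?f (x + h) - ?f x\<bar> = 2 * max 0 (?f x - ?f (x + h)) - (?f x - ?f (x + h))" for x
      by (auto simp: max_def)
    then have "L1_modulus ?f h = (LINT x|lborel. 2 * max 0 (?f x - ?f (x + h)) - (?f x - ?f (x + h)))"
      unfolding L1_modulus_def by simp
    also have "\<dots> = (LINT x|lborel. 2 * max 0 (?f x - ?f (x + h))) - (LINT x|lborel. ?f x - ?f (x + h))"
      using d by (intro Bochner_Integration.integral_diff) auto
    also have "(LINT x|lborel. ?f x - ?f (x + h)) = 0"
      using Bochner_Integration.integral_diff[OF f fh] lborel_integral_translation(1)[of ?f h] by simp
    finally show ?thesis by simp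
  qed
  have "((\<lambda>h. LINT x|lborel. max 0 (?f x - ?f (x + h))) \<longlongrightarrow> 0) (at 0)"
    unfolding tendsto_at_iff_sequentially comp_def
  proof (intro allI impI)
    fix X :: "nat \<Rightarrow> 'a" assume X: "\<forall>i. X i \<in> UNIV - {0}" "X \<longlonglongrightarrow> 0"
    have "(\<lambda>n. LINT x|lborel. max 0 (?f x - ?f (x + X n))) \<longlonglongrightarrow> (LINT x|(lborel :: 'a measure). 0)"
    proof (rule integral_dominated_convergence[where w = ?f])
      show "integrable lborel ?f" by (rule f)
      show "AE x in lborel. (\<lambda>n. max 0 (?f x - ?f (x + X n))) \<longlonglongrightarrow> 0"
      proof (rule AE_I2)
        fix x
        show "(\<lambda>n. max 0 (?f x - ?f (x + X n))) \<longlonglongrightarrow> 0"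
        proof (cases "x \<in> S")
          case True
          have "(\<lambda>n. x + X n) \<longlonglongrightarrow> x + 0" by (intro tendsto_intros X)
          then have "\<forall>\<^sub>F n in sequentially. x + X n \<in> S" using topological_tendstoD[OF _ S] True by fastforce
          then have "\<forall>\<^sub>F n in sequentially. max 0 (?f x - ?f (x + X n)) = 0" by eventually_elim (simp add: True)
          then show ?thesis by (rule tendsto_eventually)
        next
          case False
          then have "max 0 (?f x - ?f (x + X n)) = 0" for n by (auto simp: max_def indicator_def)
          then show ?thesis by simp
        qed
      qed
      show "AE x in lborel. norm (max 0 (?f x - ?f (x + X n))) \<le> ?f x" for n
        by (rule AE_I2) (auto simp: indicator_def)
    qed auto
    then show "(\<lambda>n. LINT x|lborel. max 0 (?f x - ?f (x + X n))) \<longlonglongrightarrow> 0" by simp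
  qed
  then have "((\<lambda>h. 2 * (LINT x|lborel. max 0 (?f x - ?f (x + h)))) \<longlongrightarrow> 2 * 0) (at 0)" by (intro tendsto_intros)
  then show ?thesis by (simp add: eq[abs_def])
qed

lemma L1_modulus_approx:
  fixes f :: "'a::euclidean_space \<Rightarrow> real"
  assumes f: "integrable lborel f"
    and ap: "\<And>e. e > 0 \<Longrightarrow> \<exists>g. integrable lborel g \<and> (L1_modulus g \<longlongrightarrow> 0) (at 0) \<and> (LINT x|lborel. \<bar>f x - g x\<bar>) < e"
  shows "(L1_modulus f \<longlongrightarrow> 0) (at 0)"
proof (rule tendstoI)
  fix e :: real assume e: "e > 0"
  obtain g where g: "integrable lborel g" "(L1_modulus g \<longlongrightarrow> 0) (at 0)" "(LINT x|lborel. \<bar>f x - g x\<bar>) < e / 4"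
    using ap[of "e / 4"] e by auto
  have d: "integrable lborel (\<lambda>x. f x - g x)" using f g(1) by simp
  have le: "L1_modulus f h \<le> L1_modulus g h + e / 2" for h
    using L1_modulus_add[OF g(1) d, of h] L1_modulus_le[OF d, of h] g(3) by simp
  have "\<forall>\<^sub>F h in at 0. dist (L1_modulus g h) 0 < e / 2" using tendstoD[OF g(2), of "e / 2"] e by simp
  then show "\<forall>\<^sub>F h in at 0. dist (L1_modulus f h) 0 < e"
  proof eventually_elim
    case (elim h)
    then show ?case using le[of h] L1_modulus_nonneg[of f h] L1_modulus_nonneg[of g h] by (simp add: dist_real_def)
  qed
qed

text \<open>Open sets approximate sets of finite measure by outer regularity; sums and dominated
  limits then reach every integrable function.\<close>

theorem L1_modulus_tendsto:
  fixes f :: "'a::euclidean_space \<Rightarrow> real"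
  assumes "integrable lborel f"
  shows "(L1_modulus f \<longlongrightarrow> 0) (at 0)"
  using assms
proof (induction rule: integrable_induct)
  case (base A c)
  have A[measurable]: "A \<in> sets borel" using base by simp
  have iA: "integrable lborel (indicator A :: 'a \<Rightarrow> real)" using base by (intro integrable_real_indicator) auto
  have "(L1_modulus (indicator A :: 'a \<Rightarrow> real) \<longlongrightarrow> 0) (at 0)"
  proof (rule L1_modulus_approx[OF iA])
    fix e :: real assume e: "e > 0"
    obtain S where S: "open S" "A \<subseteq> S" "emeasure lborel (S - A) < ennreal e"
      using outer_regular_lborel[OF A e] by blast
    have [measurable]: "S \<in> sets borel" using S by simp
    have "emeasure lborel S \<le> emeasure lborel A + emeasure lborel (S - A)"
      using emeasure_subadditive[of A lborel "S - A"] S(2) by (simp add: Un_absorb1)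
    also have "\<dots> < \<infinity>" using base(2) S(3) by (simp add: less_top ennreal_add_eq_top)
      (metis ennreal_less_top order_less_trans less_irrefl)
    finally have fin: "emeasure lborel S < \<infinity>" .
    have "\<bar>indicator A x - indicator S x\<bar> = (indicator (S - A) x :: real)" for x using S(2) by (auto simp: indicator_def)
    then have "(LINT x|lborel. \<bar>indicator A x - indicator S x :: real\<bar>) = measure lborel (S - A)" by simp
    also have "\<dots> < e"
    proof -
      have "emeasure lborel (S - A) \<noteq> \<infinity>" using S(3) by (auto simp: top_unique)
      then have "ennreal (measure lborel (S - A)) < ennreal e" using S(3) by (simp add: emeasure_eq_ennreal_measure)
      then show ?thesis using e by (simp add: ennreal_less_iff)
    qed
    finally show "\<exists>g. integrable lborel g \<and> (L1_modulus g \<longlongrightarrow> 0) (at 0) \<and> (LINT x|lborel. \<bar>indicator A x - g x\<bar>) < e"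
      using fin S(1) L1_modulus_open[OF S(1) fin] by (intro exI[of _ "indicator S"]) (auto intro!: integrable_real_indicator)
  qed
  then have "((\<lambda>h. \<bar>c\<bar> * L1_modulus (indicator A :: 'a \<Rightarrow> real) h) \<longlongrightarrow> \<bar>c\<bar> * 0) (at 0)" by (intro tendsto_intros)
  moreover have "L1_modulus (\<lambda>x. indicator A x *\<^sub>R c) h = \<bar>c\<bar> * L1_modulus (indicator A :: 'a \<Rightarrow> real) h" for h
  proof -
    have "\<bar>indicator A (x + h) *\<^sub>R c - indicator A x *\<^sub>R c\<bar> = \<bar>c\<bar> * \<bar>indicator A (x + h) - indicator A x\<bar>" for x
      by (simp add: abs_mult[symmetric] algebra_simps)
    then show ?thesis unfolding L1_modulus_def by simp
  qed
  ultimately show ?case by simp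
next
  case (add f g)
  have "((\<lambda>h. L1_modulus f h + L1_modulus g h) \<longlongrightarrow> 0 + 0) (at 0)" using add by (intro tendsto_add)
  then have lim: "((\<lambda>h. L1_modulus f h + L1_modulus g h) \<longlongrightarrow> 0) (at 0)" by simp
  show ?case
  proof (rule tendsto_sandwich[OF _ _ tendsto_const lim])
    show "\<forall>\<^sub>F h in at 0. 0 \<le> L1_modulus (\<lambda>x. f x + g x) h"
      by (intro always_eventually allI L1_modulus_nonneg)
    show "\<forall>\<^sub>F h in at 0. L1_modulus (\<lambda>x. f x + g x) h \<le> L1_modulus f h + L1_modulus g h"
      by (intro always_eventually allI L1_modulus_add add(1,2))
  qed
next
  case (lim f s)
  show ?case
  proof (rule L1_modulus_approx)
    show "integrable lborel f" using lim by simp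
    fix e :: real assume e: "e > 0"
    have f: "integrable lborel f" using lim by simp
    have "(\<lambda>i. LINT x|lborel. \<bar>f x - s i x\<bar>) \<longlonglongrightarrow> (LINT x|(lborel :: 'a measure). 0)"
    \<comment> \<open>The approximants satisfy
      \<open>\<bar>s i x\<bar> \<le> 2 * \<bar>f x\<bar>\<close>, whence the factor 3 for the
      difference.\<close>
    proof (rule integral_dominated_convergence[where w = "\<lambda>x. 3 * \<bar>f x\<bar>"])
      show "AE x in lborel. (\<lambda>i. \<bar>f x - s i x\<bar>) \<longlonglongrightarrow> 0"
      proof (rule AE_I2)
        fix x
        have "(\<lambda>i. s i x) \<longlonglongrightarrow> f x" using lim(2) by simp
        then have "(\<lambda>i. \<bar>f x - s i x\<bar>) \<longlonglongrightarrow> \<bar>f x - f x\<bar>" by (intro tendsto_intros)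
        then show "(\<lambda>i. \<bar>f x - s i x\<bar>) \<longlonglongrightarrow> 0" by simp
      qed
      show "AE x in lborel. norm \<bar>f x - s i x\<bar> \<le> 3 * \<bar>f x\<bar>" for i
      proof (rule AE_I2)
        fix x
        have "\<bar>s i x\<bar> \<le> 2 * \<bar>f x\<bar>" using lim(3)[of x i] by simp
        then show "norm \<bar>f x - s i x\<bar> \<le> 3 * \<bar>f x\<bar>" by simp
      qed
    qed (use f lim in auto)
    then have "\<forall>\<^sub>F i in sequentially. (LINT x|lborel. \<bar>f x - s i x\<bar>) < e" using order_tendstoD(2) e by fastforce
    then obtain i where "(LINT x|lborel. \<bar>f x - s i x\<bar>) < e" using eventually_happens'[OF sequentially_bot] by blast
    then show "\<exists>g. integrable lborel g \<and> (L1_modulus g \<longlongrightarrow> 0) (at 0) \<and> (LINT x|lborel. \<bar>f x - g x\<bar>) < e"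
      using lim by blast
  qed
qed

lemma integrable_bounded_mult:
  fixes F B :: "'a \<Rightarrow> real"
  assumes F: "integrable M F" and B: "B \<in> borel_measurable M" and C: "\<And>z. \<bar>B z\<bar> \<le> C"
  shows "integrable M (\<lambda>z. B z * F z)"
proof (rule Bochner_Integration.integrable_bound)
  show "integrable M (\<lambda>z. C * F z)" using F by simp
  show "(\<lambda>z. B z * F z) \<in> borel_measurable M" using B borel_measurable_integrable[OF F] by measurable
  show "AE z in M. norm (B z * F z) \<le> norm (C * F z)"
  proof (rule AE_I2)
    fix z
    have "\<bar>B z\<bar> \<le> \<bar>C\<bar>" using C[of z] by linarith
    then show "norm (B z * F z) \<le> norm (C * F z)" by (simp add: abs_mult mult_right_mono)
  qed
qed

section \<open>Weak derivatives as limits of difference quotients\<close>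

lemma strip_integrable:
  fixes f :: "real ^ 'm \<Rightarrow> real"
  assumes f: "integrable lborel f"
  shows "integrable (lborel \<Otimes>\<^sub>M lborel) (\<lambda>(s, x). indicator {0..t} s * f (x + s *\<^sub>R v))"
proof -
  have m[measurable]: "f \<in> borel_measurable borel" using borel_measurable_integrable[OF f] by simp
  have fs: "integrable lborel (\<lambda>x. f (x + c))" for c by (rule L1_modulus_integrable(1)[OF f])
  have "integrable (lborel \<Otimes>\<^sub>M lborel) (\<lambda>z. indicator {0..t} (fst z) * f (snd z + fst z *\<^sub>R v))"
  proof (rule lborel_pair.Fubini_integrable)
    show "(\<lambda>z. indicator {0..t} (fst z) * f (snd z + fst z *\<^sub>R v)) \<in> borel_measurable (lborel \<Otimes>\<^sub>M lborel)"
      by measurable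
    have "(LINT x|lborel. norm (indicator {0..t} (fst (s, x)) * f (snd (s, x) + fst (s, x) *\<^sub>R v))) = indicator {0..t} s * (LINT x|lborel. norm (f x))" for s
      using lborel_integral_translation(1)[of "\<lambda>x. norm (f x)" "s *\<^sub>R v"] by (simp add: abs_mult)
    then show "integrable lborel (\<lambda>s. LINT x|lborel. norm (indicator {0..t} (fst (s, x)) * f (snd (s, x) + fst (s, x) *\<^sub>R v)))"
      by (simp add: emeasure_lborel_Icc_eq)
    show "AE s in lborel. integrable lborel (\<lambda>x. indicator {0..t} (fst (s, x)) * f (snd (s, x) + fst (s, x) *\<^sub>R v))"
      by (rule AE_I2) (simp add: fs)
  qed
  then show ?thesis by (simp add: case_prod_unfold)
qed

lemma test_mult_integrable:
  fixes f :: "real ^ 'm \<Rightarrow> 'v::euclidean_space"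
  assumes \<phi>: "\<phi> \<in> test_functions U" and f: "locint U f"
  shows "integrable lborel (\<lambda>x. \<phi> x *\<^sub>R f x)" "integrable lborel (\<lambda>x. partial j \<phi> x *\<^sub>R f x)"
proof -
  note t = test_functionsD[OF \<phi>]
  let ?K = "closure {x. \<phi> x \<noteq> 0}"
  have [measurable]: "f \<in> borel_measurable borel" by (rule locintD(1)[OF f])
  have [measurable]: "\<phi> \<in> borel_measurable borel" "partial j \<phi> \<in> borel_measurable borel"
    by (rule borel_measurable_continuous_onI[OF t(1)], rule borel_measurable_continuous_onI[OF t(3)])
  have i: "integrable lborel (\<lambda>x. indicator ?K x *\<^sub>R f x)" by (rule locintD(2)[OF f t(4,5)])
  have "integrable lborel (\<lambda>x. B x *\<^sub>R f x)"
    if [measurable]: "B \<in> borel_measurable borel" and C: "\<And>x. \<bar>B x\<bar> \<le> C" and z: "\<And>x. x \<notin> ?K \<Longrightarrow> B x = 0" for B :: "real ^ 'm \<Rightarrow> real" and C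
  proof (rule Bochner_Integration.integrable_bound)
    show "integrable lborel (\<lambda>x. C *\<^sub>R (indicator ?K x *\<^sub>R f x))" by (rule integrable_scaleR_right[OF i])
    show "(\<lambda>x. B x *\<^sub>R f x) \<in> borel_measurable lborel" by measurable
    show "AE x in lborel. norm (B x *\<^sub>R f x) \<le> norm (C *\<^sub>R (indicator ?K x *\<^sub>R f x))"
    proof (rule AE_I2)
      fix x
      have "\<bar>B x\<bar> \<le> \<bar>C\<bar>" using C[of x] by linarith
      then show "norm (B x *\<^sub>R f x) \<le> norm (C *\<^sub>R (indicator ?K x *\<^sub>R f x))"
        using z[of x] by (cases "x \<in> ?K") (simp_all add: mult_right_mono)
    qed
  qed
  note * = this
  obtain C where C: "\<And>x. \<bar>\<phi> x\<bar> \<le> C" "\<And>x. \<bar>partial j \<phi> x\<bar> \<le> C" using test_function_bounded[OF \<phi>, of j] by metis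
  show "integrable lborel (\<lambda>x. \<phi> x *\<^sub>R f x)" by (rule *[OF _ C(1) t(6)]) simp
  show "integrable lborel (\<lambda>x. partial j \<phi> x *\<^sub>R f x)" by (rule *[OF _ C(2) t(7)]) simp
qed

lemma test_function_shift_FTC:
  assumes \<phi>: "\<phi> \<in> test_functions V" and t: "0 \<le> t" and v: "v = \<sigma> *\<^sub>R axis j 1"
  shows "(LINT s|lborel. indicator {0..t} s * (- \<sigma> * partial j \<phi> (x - s *\<^sub>R v))) = \<phi> (x - t *\<^sub>R v) - \<phi> x"
proof -
  note D = test_functionsD[OF \<phi>]
  have eq: "x + (- \<sigma> * s) *\<^sub>R axis j 1 = x - s *\<^sub>R v" for s by (simp add: v mult.commute)
  have d: "((\<lambda>s. \<phi> (x - s *\<^sub>R v)) has_real_derivative - \<sigma> * partial j \<phi> (x - s *\<^sub>R v)) (at s)" for s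
  proof -
    have "((\<lambda>s. - \<sigma> * s) has_real_derivative - \<sigma>) (at s)" by (auto intro!: derivative_eq_intros)
    from DERIV_chain2[OF D(8)[of x j "- \<sigma> * s"] this] show ?thesis unfolding eq by (simp add: mult.commute)
  qed
  have c: "isCont (\<lambda>s. - \<sigma> * partial j \<phi> (x - s *\<^sub>R v)) s" for s
  proof -
    have "continuous_on UNIV (\<lambda>s. partial j \<phi> (x - s *\<^sub>R v))"
      by (rule continuous_on_compose2[OF D(3)]) (auto intro!: continuous_intros)
    then show ?thesis by (intro continuous_intros) (simp add: continuous_on_eq_continuous_at)
  qed
  have "(LINT s|lborel. (- \<sigma> * partial j \<phi> (x - s *\<^sub>R v)) * indicator {0..t} s) = \<phi> (x - t *\<^sub>R v) - \<phi> (x - 0 *\<^sub>R v)"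
    by (rule integral_FTC_Icc_real[OF t]) (rule d c)+
  then show ?thesis by (simp add: mult.commute)
qed

text \<open>The fundamental theorem of calculus along \<open>v\<close> for a weakly differentiable
  function. Tested against \<phi> supported in \<open>V\<close>, the shift of \<open>f\<close> moves
  to \<phi>, where the classical theorem applies. Every intermediate translate of \<phi> is still a
  test function on \<open>U\<close>, so its derivative may be traded for \<open>g\<close> under the
  integral over \<open>s\<close>, and Fubini's theorem returns the right-hand side. The sign
  \<sigma> covers both orientations of the axis.\<close>

lemma weak_shift_identity:
  fixes f g :: "real ^ 'm \<Rightarrow> real"
  assumes U: "open U" and f: "locint U f" and g: "locint U g"
    and wk: "\<And>\<phi>. \<phi> \<in> test_functions U \<Longrightarrow> (LINT x|lborel. partial j \<phi> x * f x) = - (LINT x|lborel. \<phi> x * g x)"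
    and V: "open V" and K2: "compact K2" "K2 \<subseteq> U" and t: "0 \<le> t"
    and VK: "\<And>x s. x \<in> V \<Longrightarrow> \<bar>s\<bar> \<le> t \<Longrightarrow> x + s *\<^sub>R axis j 1 \<in> K2"
    and \<sigma>: "\<sigma> = 1 \<or> \<sigma> = -1" and v: "v = \<sigma> *\<^sub>R axis j 1"
  shows "AE x in lborel. x \<in> V \<longrightarrow> f (x + t *\<^sub>R v) - f x = \<sigma> * (LINT s|lborel. indicator {0..t} s * (indicator K2 (x + s *\<^sub>R v) * g (x + s *\<^sub>R v)))"
proof -
  have K2b[measurable]: "K2 \<in> sets borel" using K2(1) by (simp add: borel_closed compact_imp_closed)
  have [measurable]: "f \<in> borel_measurable borel" "g \<in> borel_measurable borel"
    by (rule locintD(1)[OF f], rule locintD(1)[OF g])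
  \<comment> \<open>Cutting off by \<open>K2\<close> makes the functions integrable on the whole
    space. By \<open>VK\<close> nothing is changed on the segments starting in
    \<open>V\<close>.\<close>
  define f0 where "f0 x = indicator K2 x * f x" for x
  define g0 where "g0 x = indicator K2 x * g x" for x
  have f0: "integrable lborel f0" using locintD(2)[OF f K2] by (simp add: f0_def[abs_def])
  have g0: "integrable lborel g0" using locintD(2)[OF g K2] by (simp add: g0_def[abs_def])
  have [measurable]: "f0 \<in> borel_measurable borel" "g0 \<in> borel_measurable borel"
    using borel_measurable_integrable[OF f0] borel_measurable_integrable[OF g0] by simp_all
  define G where "G x = (LINT s|lborel. indicator {0..t} s * g0 (x + s *\<^sub>R v))" for x
  have strip_g: "integrable (lborel \<Otimes>\<^sub>M lborel) (\<lambda>(s, x). indicator {0..t} s * g0 (x + s *\<^sub>R v))" by (rule strip_integrable[OF g0])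
  have strip_f: "integrable (lborel \<Otimes>\<^sub>M lborel) (\<lambda>(s, x). indicator {0..t} s * f0 x)"
    using strip_integrable[OF f0, of t 0] by simp
  have G: "integrable lborel G" unfolding G_def by (rule lborel_pair.integrable_snd[OF strip_g])
  have f0t: "integrable lborel (\<lambda>x. f0 (x + t *\<^sub>R v))" by (rule L1_modulus_integrable(1)[OF f0])
  define w where "w x = f0 (x + t *\<^sub>R v) - f0 x - \<sigma> * G x" for x
  have w: "integrable lborel w" unfolding w_def using f0 f0t G by simp
  have inK: "x + s *\<^sub>R v \<in> K2" if "x \<in> V" "\<bar>s\<bar> \<le> t" for x s
    using VK[OF that(1), of "s * \<sigma>"] that(2) \<sigma> by (auto simp: v)
  have "AE x in lborel. x \<in> V \<longrightarrow> w x = 0"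
  proof (rule locint_zero[OF V])
    show "locint V w"
      unfolding locint_def using borel_measurable_integrable[OF w]
      by (auto intro!: integrable_mult_indicator w simp: borel_closed compact_imp_closed simp del: real_scaleR_def)
  next
    fix \<phi> assume \<phi>: "\<phi> \<in> test_functions V"
    note D = test_functionsD[OF \<phi>]
    obtain C where C: "\<And>x. \<bar>\<phi> x\<bar> \<le> C" "\<And>x. \<bar>partial j \<phi> x\<bar> \<le> C" using test_function_bounded[OF \<phi>, of j] by metis
    have [measurable]: "\<phi> \<in> borel_measurable borel" "partial j \<phi> \<in> borel_measurable borel"
      by (rule borel_measurable_continuous_onI[OF D(1)], rule borel_measurable_continuous_onI[OF D(3)])
    have bm: "integrable lborel (\<lambda>x. \<phi> (x - c) * F x)" if "integrable lborel F" for F c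
      by (rule integrable_bounded_mult[OF that _ C(1)]) measurable
    have bm0: "integrable lborel (\<lambda>x. \<phi> x * F x)" if "integrable lborel F" for F
      using bm[OF that, of 0] by simp
    have A: "(LINT x|lborel. \<phi> x * f0 (x + t *\<^sub>R v)) = (LINT x|lborel. \<phi> (x - t *\<^sub>R v) * f0 x)"
      using lborel_integral_translation(1)[of "\<lambda>x. \<phi> (x - t *\<^sub>R v) * f0 x" "t *\<^sub>R v"] by simp
    have inner: "(LINT x|lborel. - \<sigma> * partial j \<phi> (x - s *\<^sub>R v) * f0 x) = \<sigma> * (LINT x|lborel. \<phi> x * g0 (x + s *\<^sub>R v))"
      if s: "0 \<le> s" "s \<le> t" for s
    proof -
      \<comment> \<open>The translate carries the support of \<phi> into \<open>K2\<close>, where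
        \<open>f\<close> and \<open>f0\<close> agree, so the weak derivative identity on
        \<open>U\<close> can be applied to it.\<close>
      define \<psi> where "\<psi> x = \<phi> (x + (- s *\<^sub>R v))" for x
      have sK: "x + s *\<^sub>R v \<in> K2" if "x \<in> V" for x using inK[OF that] s by simp
      have \<psi>: "\<psi> \<in> test_functions U" unfolding \<psi>_def
        by (rule test_function_translate[OF \<phi>]) (use sK K2(2) in auto)
      have p\<psi>: "partial j \<psi> x = partial j \<phi> (x - s *\<^sub>R v)" for x
        unfolding \<psi>_def partial_translate(1) by simp
      have z: "x - s *\<^sub>R v \<notin> closure {x. \<phi> x \<noteq> 0}" if "x \<notin> K2" for x
      proof
        assume "x - s *\<^sub>R v \<in> closure {x. \<phi> x \<noteq> 0}"
        then have "x - s *\<^sub>R v \<in> V" using D(5) by blast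
        then show False using sK[of "x - s *\<^sub>R v"] that by simp
      qed
      have e1: "partial j \<psi> x * f x = partial j \<phi> (x - s *\<^sub>R v) * f0 x" for x
        unfolding p\<psi> f0_def using D(7)[OF z, of x j] by (cases "x \<in> K2") auto
      have e2: "\<psi> x * g x = \<phi> (x - s *\<^sub>R v) * g0 x" for x
        unfolding \<psi>_def g0_def using D(6)[OF z, of x] by (cases "x \<in> K2") auto
      have "(LINT x|lborel. - \<sigma> * partial j \<phi> (x - s *\<^sub>R v) * f0 x) = (LINT x|lborel. - \<sigma> * (partial j \<psi> x * f x))"
        unfolding e1 by (simp only: mult.assoc)
      also have "\<dots> = \<sigma> * (LINT x|lborel. \<psi> x * g x)" using wk[OF \<psi>] by simp
      also have "(LINT x|lborel. \<psi> x * g x) = (LINT x|lborel. \<phi> x * g0 (x + s *\<^sub>R v))"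
        unfolding e2 using lborel_integral_translation(1)[of "\<lambda>x. \<phi> (x - s *\<^sub>R v) * g0 x" "s *\<^sub>R v"] by simp
      finally show ?thesis .
    qed
    have "integrable (lborel \<Otimes>\<^sub>M lborel) (\<lambda>z. (- \<sigma> * partial j \<phi> (snd z - fst z *\<^sub>R v)) * (case z of (s, x) \<Rightarrow> indicator {0..t} s * f0 x))"
    proof (rule integrable_bounded_mult[OF strip_f, where C = C])
      show "\<bar>- \<sigma> * partial j \<phi> (snd z - fst z *\<^sub>R v)\<bar> \<le> C" for z :: "real \<times> (real ^ 'm)"
        using C(2) \<sigma> by auto
    qed measurable
    then have F1: "integrable (lborel \<Otimes>\<^sub>M lborel) (\<lambda>(s, x). indicator {0..t} s * (- \<sigma> * partial j \<phi> (x - s *\<^sub>R v)) * f0 x)"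
      by (simp add: case_prod_unfold mult_ac)
    have "integrable (lborel \<Otimes>\<^sub>M lborel) (\<lambda>z. (\<sigma> * \<phi> (snd z)) * (case z of (s, x) \<Rightarrow> indicator {0..t} s * g0 (x + s *\<^sub>R v)))"
    proof (rule integrable_bounded_mult[OF strip_g, where C = C])
      show "\<bar>\<sigma> * \<phi> (snd z)\<bar> \<le> C" for z :: "real \<times> (real ^ 'm)" using C(1) \<sigma> by auto
    qed measurable
    then have F2: "integrable (lborel \<Otimes>\<^sub>M lborel) (\<lambda>(s, x). \<sigma> * \<phi> x * (indicator {0..t} s * g0 (x + s *\<^sub>R v)))"
      by (simp add: case_prod_unfold)
    have "(LINT x|lborel. \<phi> x * f0 (x + t *\<^sub>R v)) - (LINT x|lborel. \<phi> x * f0 x) = (LINT x|lborel. \<phi> (x - t *\<^sub>R v) * f0 x - \<phi> x * f0 x)"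
      unfolding A by (rule Bochner_Integration.integral_diff[symmetric]) (rule bm[OF f0] bm0[OF f0])+
    also have "\<dots> = (LINT x|lborel. LINT s|lborel. indicator {0..t} s * (- \<sigma> * partial j \<phi> (x - s *\<^sub>R v)) * f0 x)"
    proof (rule Bochner_Integration.integral_cong[OF refl])
      fix x
      show "\<phi> (x - t *\<^sub>R v) * f0 x - \<phi> x * f0 x = (LINT s|lborel. indicator {0..t} s * (- \<sigma> * partial j \<phi> (x - s *\<^sub>R v)) * f0 x)"
        using test_function_shift_FTC[OF \<phi> t v, of x] by (simp only: integral_mult_left_zero left_diff_distrib)
    qed
    also have "\<dots> = (LINT s|lborel. LINT x|lborel. indicator {0..t} s * (- \<sigma> * partial j \<phi> (x - s *\<^sub>R v)) * f0 x)"
      by (rule lborel_pair.Fubini_integral[OF F1])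
    also have "\<dots> = (LINT s|lborel. LINT x|lborel. \<sigma> * \<phi> x * (indicator {0..t} s * g0 (x + s *\<^sub>R v)))"
    proof (rule Bochner_Integration.integral_cong[OF refl])
      fix s
      show "(LINT x|lborel. indicator {0..t} s * (- \<sigma> * partial j \<phi> (x - s *\<^sub>R v)) * f0 x) = (LINT x|lborel. \<sigma> * \<phi> x * (indicator {0..t} s * g0 (x + s *\<^sub>R v)))"
      proof (cases "s \<in> {0..t}")
        case True
        then show ?thesis using inner[of s] by (simp add: mult.assoc)
      next
        case False
        then show ?thesis by simp
      qed
    qed
    also have "\<dots> = (LINT x|lborel. LINT s|lborel. \<sigma> * \<phi> x * (indicator {0..t} s * g0 (x + s *\<^sub>R v)))"
      by (rule lborel_pair.Fubini_integral[OF F2, symmetric])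
    also have "\<dots> = (LINT x|lborel. \<phi> x * (\<sigma> * G x))" by (simp add: G_def mult_ac)
    finally have main: "(LINT x|lborel. \<phi> x * f0 (x + t *\<^sub>R v)) - (LINT x|lborel. \<phi> x * f0 x) = (LINT x|lborel. \<phi> x * (\<sigma> * G x))" .
    have i1: "integrable lborel (\<lambda>x. \<phi> x * f0 (x + t *\<^sub>R v))" by (rule bm0[OF f0t])
    have i2: "integrable lborel (\<lambda>x. \<phi> x * f0 x)" by (rule bm0[OF f0])
    have i3: "integrable lborel (\<lambda>x. \<phi> x * (\<sigma> * G x))" by (rule bm0) (use G in simp)
    have "(LINT x|lborel. \<phi> x * w x) = (LINT x|lborel. \<phi> x * f0 (x + t *\<^sub>R v) - \<phi> x * f0 x - \<phi> x * (\<sigma> * G x))"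
      unfolding w_def right_diff_distrib ..
    also have "\<dots> = (LINT x|lborel. \<phi> x * f0 (x + t *\<^sub>R v)) - (LINT x|lborel. \<phi> x * f0 x) - (LINT x|lborel. \<phi> x * (\<sigma> * G x))"
      using Bochner_Integration.integral_diff[OF Bochner_Integration.integrable_diff[OF i1 i2] i3] Bochner_Integration.integral_diff[OF i1 i2] by simp
    finally show "(LINT x|lborel. \<phi> x * w x) = 0" using main by simp
  qed
  then show ?thesis
  proof eventually_elim
    case (elim x)
    show ?case
    proof
      assume x: "x \<in> V"
      have "x \<in> K2" "x + t *\<^sub>R v \<in> K2" using inK[OF x, of 0] inK[OF x, of t] t by simp_all
      then show "f (x + t *\<^sub>R v) - f x = \<sigma> * (LINT s|lborel. indicator {0..t} s * (indicator K2 (x + s *\<^sub>R v) * g (x + s *\<^sub>R v)))"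
        using elim x by (simp add: w_def f0_def G_def g0_def)
    qed
  qed
qed

text \<open>The factor 2 leaves room for two moves of length \<delta>: one that thickens
  \<open>K\<close> to an open set, and one along the coordinate axis.\<close>

lemma compact_neighbourhood:
  fixes K U :: "'a::euclidean_space set"
  assumes K: "compact K" "K \<subseteq> U" and U: "open U"
  obtains \<delta> K2 where "0 < \<delta>" "compact K2" "K2 \<subseteq> U" "\<And>x y. x \<in> K \<Longrightarrow> norm y \<le> 2 * \<delta> \<Longrightarrow> x + y \<in> K2"
proof -
  obtain e where e: "e > 0" "(\<Union>x\<in>K. cball x e) \<subseteq> U"
    using compact_subset_open_imp_cball_epsilon_subset[OF K(1) U K(2)] by blast
  let ?K2 = "{x + y | x y. x \<in> K \<and> y \<in> cball 0 e}"
  have "compact ?K2" by (rule compact_sums[OF K(1) compact_cball])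
  moreover have "?K2 \<subseteq> U"
  proof
    fix z assume "z \<in> ?K2"
    then obtain x y where "z = x + y" "x \<in> K" "norm y \<le> e" by auto
    then have "x \<in> K" "z \<in> cball x e" by (simp_all add: dist_norm)
    then have "z \<in> (\<Union>x\<in>K. cball x e)" by blast
    then show "z \<in> U" using e(2) by blast
  qed
  moreover have "x + y \<in> ?K2" if "x \<in> K" "norm y \<le> 2 * (e / 2)" for x y using that by auto
  ultimately show ?thesis using that[of "e / 2" ?K2] e(1) by simp
qed

text \<open>By the shift identity the quotient minus its limit is, up to sign, the average over
  \<open>s\<close> in \<open>{0..t}\<close> of \<open>g0 (x + s *\<^sub>R v) - g0 x\<close>. Its
  integral is at most the average of the translation modulus of \<open>g0\<close> over shifts of
  length at most \<open>t\<close>, which tends to 0.\<close>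

lemma weak_difference_quotient:
  fixes f g :: "real ^ 'm \<Rightarrow> real"
  assumes U: "open U" and f: "locint U f" and g: "locint U g"
    and wk: "\<And>\<phi>. \<phi> \<in> test_functions U \<Longrightarrow> (LINT x|lborel. partial j \<phi> x * f x) = - (LINT x|lborel. \<phi> x * g x)"
    and K: "compact K" "K \<subseteq> U" and \<sigma>: "\<sigma> = 1 \<or> \<sigma> = -1" and v: "v = \<sigma> *\<^sub>R axis j 1"
  shows "\<forall>\<^sub>F t in at_right 0. integrable lborel (\<lambda>x. indicator K x * \<bar>(f (x + t *\<^sub>R v) - f x) / t - \<sigma> * g x\<bar>)"
    and "((\<lambda>t. LINT x|lborel. indicator K x * \<bar>(f (x + t *\<^sub>R v) - f x) / t - \<sigma> * g x\<bar>) \<longlongrightarrow> 0) (at_right 0)"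
proof -
  obtain \<delta> K2 where \<delta>: "0 < \<delta>" and K2: "compact K2" "K2 \<subseteq> U" and KK2: "\<And>x y. x \<in> K \<Longrightarrow> norm y \<le> 2 * \<delta> \<Longrightarrow> x + y \<in> K2"
    by (rule compact_neighbourhood[OF K U]) blast
  have Kb[measurable]: "K \<in> sets borel" "K2 \<in> sets borel" using K(1) K2(1) by (simp_all add: borel_closed compact_imp_closed)
  have [measurable]: "f \<in> borel_measurable borel" "g \<in> borel_measurable borel"
    by (rule locintD(1)[OF f], rule locintD(1)[OF g])
  have nv: "norm v = 1" using \<sigma> by (auto simp: v norm_axis_1)
  define V where "V = (\<Union>x\<in>K. ball x \<delta>)"
  have V: "open V" "K \<subseteq> V" unfolding V_def using \<delta> by auto
  have VK: "x + s *\<^sub>R w \<in> K2" if x: "x \<in> V" and s: "\<bar>s\<bar> \<le> \<delta>" and w: "norm w = 1" for x s w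
  proof -
    obtain k where k: "k \<in> K" "dist k x < \<delta>" using x by (auto simp: V_def)
    have "norm ((x - k) + s *\<^sub>R w) \<le> norm (x - k) + norm (s *\<^sub>R w)" by (rule norm_triangle_ineq)
    also have "\<dots> \<le> 2 * \<delta>" using k(2) s w by (simp add: dist_norm norm_minus_commute)
    finally have "k + ((x - k) + s *\<^sub>R w) \<in> K2" by (rule KK2[OF k(1)])
    then show ?thesis by (simp add: algebra_simps)
  qed
  define g0 where "g0 x = indicator K2 x * g x" for x
  have g0: "integrable lborel g0" using locintD(2)[OF g K2] by (simp add: g0_def[abs_def])
  have g0m[measurable]: "g0 \<in> borel_measurable borel" using borel_measurable_integrable[OF g0] by simp
  define D where "D t x = indicator K x * \<bar>(f (x + t *\<^sub>R v) - f x) / t - \<sigma> * g x\<bar>" for t x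
  define R where "R t s x = indicator {0..t} s * (g0 (x + s *\<^sub>R v) - g0 x)" for t s :: real and x
  have Dm[measurable]: "D t \<in> borel_measurable borel" for t unfolding D_def by measurable
  have strip: "integrable (lborel \<Otimes>\<^sub>M lborel) (\<lambda>(s, x). \<bar>R t s x\<bar>)" for t
  proof -
    have "integrable (lborel \<Otimes>\<^sub>M lborel) (\<lambda>z. (case z of (s, x) \<Rightarrow> indicator {0..t} s * g0 (x + s *\<^sub>R v)) - (case z of (s, x) \<Rightarrow> indicator {0..t} s * g0 (x + s *\<^sub>R 0)))"
      by (rule Bochner_Integration.integrable_diff[OF strip_integrable[OF g0] strip_integrable[OF g0]])
    then have "integrable (lborel \<Otimes>\<^sub>M lborel) (\<lambda>(s, x). R t s x)"
      by (simp add: R_def case_prod_unfold right_diff_distrib)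
    then show ?thesis using integrable_abs by (simp add: case_prod_unfold)
  qed
  define B where "B t x = (1 / t) * (LINT s|lborel. \<bar>R t s x\<bar>)" for t x
  have iB: "integrable lborel (B t)" for t
    unfolding B_def by (rule integrable_mult_right[OF lborel_pair.integrable_snd[OF strip]])
  have le: "AE x in lborel. D t x \<le> B t x" if t: "0 < t" "t \<le> \<delta>" for t
  proof -
    have "AE x in lborel. x \<in> V \<longrightarrow> f (x + t *\<^sub>R v) - f x = \<sigma> * (LINT s|lborel. indicator {0..t} s * (indicator K2 (x + s *\<^sub>R v) * g (x + s *\<^sub>R v)))"
    proof (rule weak_shift_identity[OF U f g wk V(1) K2 _ _ \<sigma> v])
      show "x + s *\<^sub>R axis j 1 \<in> K2" if "x \<in> V" "\<bar>s\<bar> \<le> t" for x s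
        using VK[OF that(1), of s "axis j 1"] that(2) t(2) by (simp add: norm_axis_1)
    qed (use t in auto)
    moreover have "AE x in lborel. integrable lborel (\<lambda>s. indicator {0..t} s * g0 (x + s *\<^sub>R v))"
      using lborel_pair.AE_integrable_snd[OF strip_integrable[OF g0, of t v]] by simp
    ultimately show ?thesis
    proof eventually_elim
      case (elim x)
      show ?case
      proof (cases "x \<in> K")
        case False
        have "0 \<le> B t x" unfolding B_def using t by (intro mult_nonneg_nonneg integral_nonneg_AE) auto
        then show ?thesis using False by (simp add: D_def)
      next
        case True
        then have xV: "x \<in> V" using V by blast
        have xK2: "x \<in> K2" using KK2[OF True, of 0] \<delta> by simp
        have i2: "integrable lborel (\<lambda>s. indicator {0..t} s * g0 x)" using t by simp
        have c: "(LINT s|lborel. indicator {0..t} s * g0 x) = t * g0 x" using t by simp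
        have "(f (x + t *\<^sub>R v) - f x) / t - \<sigma> * g x = (\<sigma> / t) * ((LINT s|lborel. indicator {0..t} s * g0 (x + s *\<^sub>R v)) - t * g0 x)"
          using elim(1) xV t xK2 by (simp add: g0_def field_simps)
        also have "(LINT s|lborel. indicator {0..t} s * g0 (x + s *\<^sub>R v)) - t * g0 x = (LINT s|lborel. R t s x)"
          unfolding R_def right_diff_distrib c[symmetric] by (rule Bochner_Integration.integral_diff[OF elim(2) i2, symmetric])
        finally have "\<bar>(f (x + t *\<^sub>R v) - f x) / t - \<sigma> * g x\<bar> = (1 / t) * \<bar>LINT s|lborel. R t s x\<bar>"
          using t \<sigma> by (auto simp: abs_mult)
        also have "\<dots> \<le> B t x" unfolding B_def using t integral_norm_bound[of lborel "\<lambda>s. R t s x"]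
          by (intro mult_left_mono) auto
        finally show ?thesis using True by (simp add: D_def)
      qed
    qed
  qed
  have iD: "integrable lborel (D t)" if t: "0 < t" "t \<le> \<delta>" for t
  proof (rule Bochner_Integration.integrable_bound[OF iB[of t]])
    show "AE x in lborel. norm (D t x) \<le> norm (B t x)"
      using le[OF t]
    proof eventually_elim
      case (elim x)
      have "0 \<le> D t x" by (simp add: D_def)
      then show ?case using elim by simp
    qed
  qed simp
  have ev: "\<forall>\<^sub>F t in at_right 0. 0 < t \<and> t \<le> \<delta>"
    using eventually_at_right_less[of "0::real"] order_tendstoD(2)[OF tendsto_ident_at \<delta>, of "{0<..}"]
    by eventually_elim auto
  then show "\<forall>\<^sub>F t in at_right 0. integrable lborel (\<lambda>x. indicator K x * \<bar>(f (x + t *\<^sub>R v) - f x) / t - \<sigma> * g x\<bar>)"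
    by eventually_elim (use iD in \<open>auto simp: D_def[abs_def]\<close>)
  have "((\<lambda>t. LINT x|lborel. D t x) \<longlongrightarrow> 0) (at_right 0)"
  proof (rule tendstoI)
    fix \<epsilon> :: real assume \<epsilon>: "\<epsilon> > 0"
    have "\<forall>\<^sub>F h in at 0. dist (L1_modulus g0 h) 0 < \<epsilon> / 2" using tendstoD[OF L1_modulus_tendsto[OF g0], of "\<epsilon> / 2"] \<epsilon> by simp
    then obtain d where d: "d > 0" "\<And>h. h \<noteq> 0 \<Longrightarrow> dist h 0 < d \<Longrightarrow> dist (L1_modulus g0 h) 0 < \<epsilon> / 2"
      unfolding eventually_at by auto
    have small: "L1_modulus g0 h \<le> \<epsilon> / 2" if "norm h < d" for h
    proof (cases "h = 0")
      case True then show ?thesis using \<epsilon> by (simp add: L1_modulus_def)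
    next
      case False then show ?thesis using d(2)[of h] that by (simp add: dist_norm)
    qed
    have "\<forall>\<^sub>F t in at_right 0. t < d"
      by (rule order_tendstoD(2)[OF tendsto_ident_at d(1)])
    with ev show "\<forall>\<^sub>F t in at_right 0. dist (LINT x|lborel. D t x) 0 < \<epsilon>"
    proof eventually_elim
      case (elim t)
      then have t: "0 < t" "t \<le> \<delta>" "t < d" by auto
      have D_le: "(LINT x|lborel. D t x) \<le> (LINT x|lborel. B t x)" by (rule integral_mono_AE[OF iD[OF t(1,2)] iB le[OF t(1,2)]])
      have B_eq: "(LINT x|lborel. B t x) = (1 / t) * (LINT x|lborel. LINT s|lborel. \<bar>R t s x\<bar>)" unfolding B_def by simp
      have "(LINT x|lborel. LINT s|lborel. \<bar>R t s x\<bar>) = (LINT s|lborel. LINT x|lborel. \<bar>R t s x\<bar>)"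
        by (rule lborel_pair.Fubini_integral[OF strip])
      also have "\<dots> \<le> (LINT s|lborel. indicator {0..t} s * (\<epsilon> / 2))"
      proof (rule integral_mono)
        show "integrable lborel (\<lambda>s. LINT x|lborel. \<bar>R t s x\<bar>)" by (rule lborel_pair.integrable_fst[OF strip])
        show "integrable lborel (\<lambda>s. indicator {0..t} s * (\<epsilon> / 2))" using t by simp
        fix s
        have "(LINT x|lborel. \<bar>R t s x\<bar>) = indicator {0..t} s * L1_modulus g0 (s *\<^sub>R v)"
          by (simp add: R_def L1_modulus_def abs_mult)
        also have "\<dots> \<le> indicator {0..t} s * (\<epsilon> / 2)"
        proof (cases "s \<in> {0..t}")
          case True
          then show ?thesis using small[of "s *\<^sub>R v"] nv t by simp
        qed simp
        finally show "(LINT x|lborel. \<bar>R t s x\<bar>) \<le> indicator {0..t} s * (\<epsilon> / 2)" .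
      qed
      also have "(LINT s|lborel. indicator {0..t} s * (\<epsilon> / 2)) = t * (\<epsilon> / 2)" using t by simp
      finally have "(1 / t) * (LINT x|lborel. LINT s|lborel. \<bar>R t s x\<bar>) \<le> (1 / t) * (t * (\<epsilon> / 2))"
        using t by (intro mult_left_mono) auto
      moreover have "(1 / t) * (t * (\<epsilon> / 2)) = \<epsilon> / 2" using t by simp
      ultimately have I: "(1 / t) * (LINT x|lborel. LINT s|lborel. \<bar>R t s x\<bar>) \<le> \<epsilon> / 2" by (simp only:)
      have "(LINT x|lborel. D t x) \<le> \<epsilon> / 2" by (rule order_trans[OF D_le[unfolded B_eq] I])
      moreover have "0 \<le> (LINT x|lborel. D t x)" by (intro integral_nonneg_AE) (simp add: D_def)
      ultimately show ?case using \<epsilon> by (simp add: dist_real_def)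
    qed
  qed
  then show "((\<lambda>t. LINT x|lborel. indicator K x * \<bar>(f (x + t *\<^sub>R v) - f x) / t - \<sigma> * g x\<bar>) \<longlongrightarrow> 0) (at_right 0)"
    by (simp add: D_def)
qed

text \<open>The converse direction, by discrete integration by parts: the quotients of
  \<open>u\<close> against \<phi> equal backward quotients of \<phi> against \<open>u\<close>. The
  latter converge boundedly to the negative partial derivative. The steps \<tau> may have either
  sign, so one-sided limits from the right and from the left are both identified with weak
  derivatives.\<close>

lemma weak_partial_of_difference_quotients:
  fixes u h :: "real ^ 'm \<Rightarrow> real"
  assumes U: "open U" and u: "locint U u" and h: "locint U h"
    and \<tau>: "\<tau> \<longlonglongrightarrow> 0" "\<And>n. \<tau> n \<noteq> 0"
    and conv: "\<And>K. compact K \<Longrightarrow> K \<subseteq> U \<Longrightarrow>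
      (\<lambda>n. LINT x|lborel. indicator K x * \<bar>(u (x + \<tau> n *\<^sub>R axis j 1) - u x) / \<tau> n - h x\<bar>) \<longlonglongrightarrow> 0"
    and \<phi>: "\<phi> \<in> test_functions U"
  shows "(LINT x|lborel. partial j \<phi> x * u x) = - (LINT x|lborel. \<phi> x * h x)"
proof -
  let ?e = "axis j 1 :: real ^ 'm"
  note T = test_functionsD[OF \<phi>]
  define K where "K = closure {x. \<phi> x \<noteq> 0}"
  have K: "compact K" "K \<subseteq> U" using T(4,5) by (simp_all add: K_def)
  obtain \<delta> K2 where \<delta>: "0 < \<delta>" and K2: "compact K2" "K2 \<subseteq> U" and KK2: "\<And>x y. x \<in> K \<Longrightarrow> norm y \<le> 2 * \<delta> \<Longrightarrow> x + y \<in> K2"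
    by (rule compact_neighbourhood[OF K U]) blast
  have ne: "norm ?e = 1" by (simp add: norm_axis_1)
  have Kb[measurable]: "K \<in> sets borel" "K2 \<in> sets borel" using K(1) K2(1) by (simp_all add: borel_closed compact_imp_closed)
  have [measurable]: "u \<in> borel_measurable borel" "h \<in> borel_measurable borel"
    by (rule locintD(1)[OF u], rule locintD(1)[OF h])
  have [measurable]: "\<phi> \<in> borel_measurable borel" "partial j \<phi> \<in> borel_measurable borel"
    by (rule borel_measurable_continuous_onI[OF T(1)], rule borel_measurable_continuous_onI[OF T(3)])
  obtain C where C: "0 \<le> C" "\<And>x. \<bar>\<phi> x\<bar> \<le> C" "\<And>x. \<bar>partial j \<phi> x\<bar> \<le> C" using test_function_bounded[OF \<phi>, of j] by metis
  define u0 where "u0 x = indicator K2 x * u x" for x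
  have u0: "integrable lborel u0" using locintD(2)[OF u K2] by (simp add: u0_def[abs_def])
  have u0m[measurable]: "u0 \<in> borel_measurable borel" using borel_measurable_integrable[OF u0] by simp
  have bm: "integrable lborel (\<lambda>x. \<phi> (x - c) * F x)" if "integrable lborel F" for F c
    by (rule integrable_bounded_mult[OF that _ C(2)]) measurable
  have bm0: "integrable lborel (\<lambda>x. \<phi> x * F x)" if "integrable lborel F" for F
    using bm[OF that, of 0] by simp
  have \<phi>0: "\<phi> x = 0" if "x \<notin> K" for x by (rule T(6)) (use that in \<open>simp add: K_def\<close>)
  have ih: "integrable lborel (\<lambda>x. \<phi> x * h x)" using test_mult_integrable(1)[OF \<phi> h] by simp
  have u0eq: "u0 x = u x" if "x \<in> K" for x using KK2[OF that, of 0] \<delta> by (simp add: u0_def)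
  have L1: "(\<lambda>n. LINT x|lborel. (\<phi> (x - \<tau> n *\<^sub>R ?e) - \<phi> x) / \<tau> n * u0 x) \<longlonglongrightarrow> (LINT x|lborel. - partial j \<phi> x * u0 x)"
  proof (rule integral_dominated_convergence[where w = "\<lambda>x. C * \<bar>u0 x\<bar>"])
    show "integrable lborel (\<lambda>x. C * \<bar>u0 x\<bar>)" using u0 by simp
    show "AE x in lborel. (\<lambda>n. (\<phi> (x - \<tau> n *\<^sub>R ?e) - \<phi> x) / \<tau> n * u0 x) \<longlonglongrightarrow> - partial j \<phi> x * u0 x"
    proof (rule AE_I2)
      fix x
      have d: "((\<lambda>t. \<phi> (x + t *\<^sub>R ?e)) has_real_derivative partial j \<phi> x) (at 0)" using T(8)[of x j 0] by simp
      have "((\<lambda>t. \<phi> (x + (- t) *\<^sub>R ?e)) has_real_derivative partial j \<phi> x * - 1) (at 0)"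
        by (rule DERIV_chain2[where g = uminus]) (use d in \<open>auto intro!: derivative_eq_intros\<close>)
      then have "((\<lambda>t. (\<phi> (x - t *\<^sub>R ?e) - \<phi> x) / t) \<longlongrightarrow> - partial j \<phi> x) (at 0)"
        by (simp add: has_field_derivative_iff)
      then have "(\<lambda>n. (\<phi> (x - \<tau> n *\<^sub>R ?e) - \<phi> x) / \<tau> n) \<longlonglongrightarrow> - partial j \<phi> x"
        by (rule filterlim_compose) (use \<tau> in \<open>auto simp: filterlim_at\<close>)
      then show "(\<lambda>n. (\<phi> (x - \<tau> n *\<^sub>R ?e) - \<phi> x) / \<tau> n * u0 x) \<longlonglongrightarrow> - partial j \<phi> x * u0 x"
        by (intro tendsto_mult tendsto_const)
    qed
    show "AE x in lborel. norm ((\<phi> (x - \<tau> n *\<^sub>R ?e) - \<phi> x) / \<tau> n * u0 x) \<le> C * \<bar>u0 x\<bar>" for n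
    proof (rule AE_I2)
      fix x
      have "\<bar>\<phi> (x + (- \<tau> n) *\<^sub>R ?e) - \<phi> (x + 0 *\<^sub>R ?e)\<bar> \<le> C * \<bar>- \<tau> n - 0\<bar>"
        \<comment> \<open>The mean value theorem bounds the quotients of \<phi> by \<open>C\<close>
          for every \<open>n\<close>, which yields the integrable majorant.\<close>
        using field_differentiable_bound[of UNIV "\<lambda>t. \<phi> (x + t *\<^sub>R ?e)" "\<lambda>t. partial j \<phi> (x + t *\<^sub>R ?e)" C "- \<tau> n" 0] T(8)[of x j] C(3)
        by simp
      then have "\<bar>(\<phi> (x - \<tau> n *\<^sub>R ?e) - \<phi> x) / \<tau> n\<bar> \<le> C" using \<tau>(2)[of n] by (simp add: field_simps)
      then show "norm ((\<phi> (x - \<tau> n *\<^sub>R ?e) - \<phi> x) / \<tau> n * u0 x) \<le> C * \<bar>u0 x\<bar>"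
        unfolding real_norm_def abs_mult by (rule mult_right_mono) simp
    qed
  qed measurable
  have shift: "(LINT x|lborel. (\<phi> (x - c *\<^sub>R ?e) - \<phi> x) / c * u0 x) = (LINT x|lborel. \<phi> x * ((u0 (x + c *\<^sub>R ?e) - u0 x) / c))"
    and shift_int: "integrable lborel (\<lambda>x. (u0 (x + c *\<^sub>R ?e) - u0 x) / c)" for c
  proof -
    have u0t: "integrable lborel (\<lambda>x. u0 (x + c *\<^sub>R ?e))" by (rule L1_modulus_integrable(1)[OF u0])
    then show "integrable lborel (\<lambda>x. (u0 (x + c *\<^sub>R ?e) - u0 x) / c)" using u0 by simp
    have A: "(LINT x|lborel. \<phi> x * u0 (x + c *\<^sub>R ?e)) = (LINT x|lborel. \<phi> (x - c *\<^sub>R ?e) * u0 x)"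
      using lborel_integral_translation(1)[of "\<lambda>x. \<phi> (x - c *\<^sub>R ?e) * u0 x" "c *\<^sub>R ?e"] by simp
    have "(LINT x|lborel. (\<phi> (x - c *\<^sub>R ?e) - \<phi> x) / c * u0 x) = (LINT x|lborel. (\<phi> (x - c *\<^sub>R ?e) * u0 x - \<phi> x * u0 x) / c)"
      by (simp add: left_diff_distrib diff_divide_distrib)
    also have "\<dots> = (LINT x|lborel. (\<phi> x * u0 (x + c *\<^sub>R ?e) - \<phi> x * u0 x) / c)"
      using Bochner_Integration.integral_diff[OF bm[OF u0, of "c *\<^sub>R ?e"] bm0[OF u0]]
        Bochner_Integration.integral_diff[OF bm0[OF u0t] bm0[OF u0]] A by simp
    also have "\<dots> = (LINT x|lborel. \<phi> x * ((u0 (x + c *\<^sub>R ?e) - u0 x) / c))"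
      by (simp add: right_diff_distrib diff_divide_distrib)
    finally show "(LINT x|lborel. (\<phi> (x - c *\<^sub>R ?e) - \<phi> x) / c * u0 x) = (LINT x|lborel. \<phi> x * ((u0 (x + c *\<^sub>R ?e) - u0 x) / c))" .
  qed
  have hK: "integrable lborel (\<lambda>x. indicator K x * h x)" using locintD(2)[OF h K] by simp
  have "\<forall>\<^sub>F n in sequentially. dist (\<tau> n) 0 < \<delta>" by (rule tendstoD[OF \<tau>(1) \<delta>])
  then have bound: "\<forall>\<^sub>F n in sequentially. norm ((LINT x|lborel. \<phi> x * ((u0 (x + \<tau> n *\<^sub>R ?e) - u0 x) / \<tau> n)) - (LINT x|lborel. \<phi> x * h x))
     \<le> C * (LINT x|lborel. indicator K x * \<bar>(u (x + \<tau> n *\<^sub>R ?e) - u x) / \<tau> n - h x\<bar>)"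
  proof eventually_elim
    case (elim n)
    have sh: "u0 (x + \<tau> n *\<^sub>R ?e) = u (x + \<tau> n *\<^sub>R ?e)" if "x \<in> K" for x
      using KK2[OF that, of "\<tau> n *\<^sub>R ?e"] elim \<delta> ne by (simp add: u0_def)
    have iq: "integrable lborel (\<lambda>x. indicator K x * \<bar>(u (x + \<tau> n *\<^sub>R ?e) - u x) / \<tau> n - h x\<bar>)"
    proof -
      have "integrable lborel (\<lambda>x. \<bar>indicator K x * ((u0 (x + \<tau> n *\<^sub>R ?e) - u0 x) / \<tau> n) - indicator K x * h x\<bar>)"
        using integrable_real_mult_indicator[OF _ shift_int] hK by (intro integrable_abs Bochner_Integration.integrable_diff) (simp_all add: mult.commute)
      moreover have "\<bar>indicator K x * ((u0 (x + \<tau> n *\<^sub>R ?e) - u0 x) / \<tau> n) - indicator K x * h x\<bar> = indicator K x * \<bar>(u (x + \<tau> n *\<^sub>R ?e) - u x) / \<tau> n - h x\<bar>" for x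
        using sh[of x] u0eq[of x] by (cases "x \<in> K") auto
      ultimately show ?thesis by simp
    qed
    have i1: "integrable lborel (\<lambda>x. \<phi> x * ((u0 (x + \<tau> n *\<^sub>R ?e) - u0 x) / \<tau> n))" by (rule bm0[OF shift_int])
    have "norm ((LINT x|lborel. \<phi> x * ((u0 (x + \<tau> n *\<^sub>R ?e) - u0 x) / \<tau> n)) - (LINT x|lborel. \<phi> x * h x))
      = norm (LINT x|lborel. \<phi> x * ((u0 (x + \<tau> n *\<^sub>R ?e) - u0 x) / \<tau> n) - \<phi> x * h x)"
      using Bochner_Integration.integral_diff[OF i1 ih] by simp
    also have "\<dots> \<le> (LINT x|lborel. norm (\<phi> x * ((u0 (x + \<tau> n *\<^sub>R ?e) - u0 x) / \<tau> n) - \<phi> x * h x))"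
      by (rule integral_norm_bound)
    also have "\<dots> \<le> (LINT x|lborel. C * (indicator K x * \<bar>(u (x + \<tau> n *\<^sub>R ?e) - u x) / \<tau> n - h x\<bar>))"
    proof (rule integral_mono)
      show "integrable lborel (\<lambda>x. norm (\<phi> x * ((u0 (x + \<tau> n *\<^sub>R ?e) - u0 x) / \<tau> n) - \<phi> x * h x))"
        by (rule integrable_norm[OF Bochner_Integration.integrable_diff[OF i1 ih]])
      show "integrable lborel (\<lambda>x. C * (indicator K x * \<bar>(u (x + \<tau> n *\<^sub>R ?e) - u x) / \<tau> n - h x\<bar>))"
        by (rule integrable_mult_right[OF iq])
      fix x
      show "norm (\<phi> x * ((u0 (x + \<tau> n *\<^sub>R ?e) - u0 x) / \<tau> n) - \<phi> x * h x) \<le> C * (indicator K x * \<bar>(u (x + \<tau> n *\<^sub>R ?e) - u x) / \<tau> n - h x\<bar>)"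
      proof (cases "x \<in> K")
        case True
        have "norm (\<phi> x * ((u0 (x + \<tau> n *\<^sub>R ?e) - u0 x) / \<tau> n) - \<phi> x * h x) = \<bar>\<phi> x\<bar> * \<bar>(u (x + \<tau> n *\<^sub>R ?e) - u x) / \<tau> n - h x\<bar>"
          unfolding sh[OF True] u0eq[OF True] by (simp only: right_diff_distrib[symmetric] real_norm_def abs_mult)
        also have "\<dots> \<le> C * \<bar>(u (x + \<tau> n *\<^sub>R ?e) - u x) / \<tau> n - h x\<bar>" by (rule mult_right_mono[OF C(2)]) simp
        finally show ?thesis using True by simp
      next
        case False
        then show ?thesis using \<phi>0 by simp
      qed
    qed
    also have "\<dots> = C * (LINT x|lborel. indicator K x * \<bar>(u (x + \<tau> n *\<^sub>R ?e) - u x) / \<tau> n - h x\<bar>)" by simp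
    finally show ?case .
  qed
  have "(\<lambda>n. C * (LINT x|lborel. indicator K x * \<bar>(u (x + \<tau> n *\<^sub>R ?e) - u x) / \<tau> n - h x\<bar>)) \<longlonglongrightarrow> C * 0"
    by (intro tendsto_mult tendsto_const conv[OF K])
  then have "(\<lambda>n. (LINT x|lborel. \<phi> x * ((u0 (x + \<tau> n *\<^sub>R ?e) - u0 x) / \<tau> n)) - (LINT x|lborel. \<phi> x * h x)) \<longlonglongrightarrow> 0"
    using Lim_null_comparison[OF bound] by simp
  then have L2: "(\<lambda>n. LINT x|lborel. \<phi> x * ((u0 (x + \<tau> n *\<^sub>R ?e) - u0 x) / \<tau> n)) \<longlonglongrightarrow> (LINT x|lborel. \<phi> x * h x)"
    by (simp only: LIM_zero_iff)
  have "(LINT x|lborel. - partial j \<phi> x * u0 x) = (LINT x|lborel. \<phi> x * h x)"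
    using L1 L2 unfolding shift by (rule LIMSEQ_unique)
  moreover have "- partial j \<phi> x * u0 x = - (partial j \<phi> x * u x)" for x
    using T(7)[of x j] u0eq[of x] by (cases "x \<in> K") (auto simp: K_def)
  ultimately have "(LINT x|lborel. - (partial j \<phi> x * u x)) = (LINT x|lborel. \<phi> x * h x)" by (simp only:)
  then show ?thesis by simp
qed

section \<open>Directional derivatives of convex functions\<close>

text \<open>For a convex function the quotients increase with \<open>t\<close>, and the Lipschitz
  bound keeps them above \<open>- C\<close>. So their infimum over positive \<open>t\<close> is the
  limit at 0.\<close>

lemma convex_right_derivative:
  fixes p :: "real \<Rightarrow> real"
  assumes cvx: "convex_on UNIV p" and lip: "\<And>s t. \<bar>p s - p t\<bar> \<le> C * \<bar>s - t\<bar>"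
  shows "\<exists>d. ((\<lambda>t. (p t - p 0) / t) \<longlongrightarrow> d) (at_right 0) \<and> \<bar>d\<bar> \<le> C"
proof -
  define q where "q t = (p t - p 0) / t" for t
  have mono: "q s \<le> q t" if "0 < s" "s \<le> t" for s t
  proof -
    have "p ((1 - s / t) *\<^sub>R 0 + (s / t) *\<^sub>R t) \<le> (1 - s / t) * p 0 + (s / t) * p t"
      by (rule convex_onD[OF cvx]) (use that in auto)
    moreover have "(1 - s / t) *\<^sub>R 0 + (s / t) *\<^sub>R t = s" using that by simp
    ultimately have "p s - p 0 \<le> (s / t) * (p t - p 0)" by (simp add: algebra_simps)
    then show ?thesis using that by (simp add: q_def field_simps)
  qed
  have bd: "\<bar>q t\<bar> \<le> C" if "0 < t" for t
    using lip[of t 0] that by (simp add: q_def field_simps)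
  have bdd: "bdd_below (q ` {0<..})" using bd by (intro bdd_belowI[of _ "- C"]) (auto simp: abs_le_iff minus_le_iff)
  define d where "d = Inf (q ` {0<..})"
  have lo: "d \<le> q t" if "0 < t" for t unfolding d_def using that by (intro cInf_lower bdd) auto
  have "(q \<longlongrightarrow> d) (at_right 0)"
  proof (rule order_tendstoI)
    fix a assume "a < d"
    show "\<forall>\<^sub>F t in at_right 0. a < q t"
      using eventually_at_right_less[of "0::real"]
    proof eventually_elim
      case (elim t) then show ?case using lo[of t] \<open>a < d\<close> by simp
    qed
  next
    fix a assume "d < a"
    then obtain t0 where t0: "0 < t0" "q t0 < a"
      using cInf_less_iff[OF _ bdd, of a] unfolding d_def by (metis greaterThan_iff imageE image_is_empty greaterThan_non_empty)
    have "\<forall>\<^sub>F t in at_right 0. t < t0" by (rule order_tendstoD(2)[OF tendsto_ident_at t0(1)])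
    with eventually_at_right_less[of "0::real"] show "\<forall>\<^sub>F t in at_right 0. q t < a"
    proof eventually_elim
      case (elim t) then show ?case using mono[of t t0] t0 by simp
    qed
  qed
  moreover have "\<bar>d\<bar> \<le> C"
  proof -
    have "d \<le> C" using lo[of 1] bd[of 1] by simp
    moreover have "- C \<le> d" unfolding d_def using bd by (intro cInf_greatest) (auto simp: abs_le_iff minus_le_iff)
    ultimately show ?thesis by simp
  qed
  ultimately show ?thesis unfolding q_def by blast
qed

lemma convex_on_line:
  fixes N :: "'v::real_vector \<Rightarrow> real"
  assumes "convex_on UNIV N"
  shows "convex_on UNIV (\<lambda>t::real. N (y + t *\<^sub>R z))"
proof (intro convex_onI)
  fix t s r :: real assume t: "0 < t" "t < 1"
  have "y + ((1 - t) *\<^sub>R s + t *\<^sub>R r) *\<^sub>R z = (1 - t) *\<^sub>R (y + s *\<^sub>R z) + t *\<^sub>R (y + r *\<^sub>R z)"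
    by (simp add: algebra_simps)
  then show "N (y + ((1 - t) *\<^sub>R s + t *\<^sub>R r) *\<^sub>R z) \<le> (1 - t) * N (y + s *\<^sub>R z) + t * N (y + r *\<^sub>R z)"
    using convex_onD[OF assms, of t "y + s *\<^sub>R z" "y + r *\<^sub>R z"] t by simp
qed simp

text \<open>The right-hand directional derivative, written as the limit of one fixed sequence of
  quotients so that it is measurable in point and direction as a pointwise limit of measurable
  functions.\<close>

definition dir_deriv :: "('v::real_normed_vector \<Rightarrow> real) \<Rightarrow> 'v \<Rightarrow> 'v \<Rightarrow> real" where
  "dir_deriv N y z = lim (\<lambda>n. (N (y + (1 / real (Suc n)) *\<^sub>R z) - N y) / (1 / real (Suc n)))"

lemma one_over_Suc_at_right: "filterlim (\<lambda>n. 1 / real (Suc n)) (at_right 0) sequentially"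
  using LIMSEQ_inverse_real_of_nat unfolding filterlim_at by (simp add: inverse_eq_divide)

context
  fixes N :: "'v::euclidean_space \<Rightarrow> real" and L :: real
  assumes cvx: "convex_on UNIV N" and lip: "L-lipschitz_on UNIV N"
begin

lemma lipschitz_norm_le: "\<bar>N a - N b\<bar> \<le> L * norm (a - b)"
  using lipschitz_onD[OF lip, of a b] by (simp add: dist_norm)

lemma lipschitz_line_le: "\<bar>N (y + s *\<^sub>R z) - N (y + t *\<^sub>R z)\<bar> \<le> (L * norm z) * \<bar>s - t\<bar>"
  using lipschitz_norm_le[of "y + s *\<^sub>R z" "y + t *\<^sub>R z"] by (simp add: scaleR_left_diff_distrib[symmetric] mult_ac)

lemma dir_deriv_tendsto: "((\<lambda>t. (N (y + t *\<^sub>R z) - N y) / t) \<longlongrightarrow> dir_deriv N y z) (at_right 0)"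
  and dir_deriv_bound: "\<bar>dir_deriv N y z\<bar> \<le> L * norm z"
proof -
  obtain d where d: "((\<lambda>t. (N (y + t *\<^sub>R z) - N y) / t) \<longlongrightarrow> d) (at_right 0)" "\<bar>d\<bar> \<le> L * norm z"
    using convex_right_derivative[OF convex_on_line[OF cvx] lipschitz_line_le, of y z] by auto
  have "(\<lambda>n. (N (y + (1 / real (Suc n)) *\<^sub>R z) - N y) / (1 / real (Suc n))) \<longlonglongrightarrow> d"
    by (rule filterlim_compose[OF d(1) one_over_Suc_at_right])
  then have "dir_deriv N y z = d" unfolding dir_deriv_def by (rule limI)
  then show "((\<lambda>t. (N (y + t *\<^sub>R z) - N y) / t) \<longlongrightarrow> dir_deriv N y z) (at_right 0)" "\<bar>dir_deriv N y z\<bar> \<le> L * norm z"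
    using d by simp_all
qed

lemma dir_deriv_seq: "(\<lambda>n. (N (y + (1 / real (Suc n)) *\<^sub>R z) - N y) / (1 / real (Suc n))) \<longlonglongrightarrow> dir_deriv N y z"
  by (rule filterlim_compose[OF dir_deriv_tendsto one_over_Suc_at_right])

lemma lipschitz_measurable [measurable]: "N \<in> borel_measurable borel"
  by (rule borel_measurable_continuous_onI[OF lipschitz_on_continuous_on[OF lip]])

lemma dir_deriv_measurable:
  assumes [measurable]: "f \<in> borel_measurable borel" "g \<in> borel_measurable borel"
  shows "(\<lambda>x. dir_deriv N (f x) (g x)) \<in> borel_measurable borel"
  by (rule borel_measurable_LIMSEQ_metric[OF _ dir_deriv_seq]) measurable

text \<open>The left derivative in direction \<open>z\<close> is the negative of the right
  derivative in direction \<open>- z\<close>; the hypothesis says that the two one-sided derivatives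
  agree.\<close>

lemma has_derivative_of_dir_deriv:
  assumes eq: "dir_deriv N y (- z) = - dir_deriv N y z"
  shows "((\<lambda>t. N (y + t *\<^sub>R z)) has_real_derivative dir_deriv N y z) (at 0)"
proof -
  have "((\<lambda>t. - ((N (y + t *\<^sub>R (- z)) - N y) / t)) \<longlongrightarrow> - dir_deriv N y (- z)) (at_right 0)"
    by (rule tendsto_minus[OF dir_deriv_tendsto])
  then have "((\<lambda>t. (N (y + (- t) *\<^sub>R z) - N y) / (- t)) \<longlongrightarrow> dir_deriv N y z) (at_right 0)"
    by (simp add: eq)
  then have "((\<lambda>t. (N (y + t *\<^sub>R z) - N y) / t) \<longlongrightarrow> dir_deriv N y z) (at_left 0)"
    unfolding at_left_minus[of 0] filterlim_filtermap by simp
  then have "((\<lambda>t. (N (y + t *\<^sub>R z) - N y) / t) \<longlongrightarrow> dir_deriv N y z) (at 0)"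
    using dir_deriv_tendsto by (rule filterlim_split_at)
  then show ?thesis by (simp add: has_field_derivative_iff)
qed

text \<open>The tangent inequality squeezes \<open>d n\<close> between the quotients
  \<open>qn n t\<close> with negative and with positive \<open>t\<close>. For fixed \<open>t\<close>
  these converge to the quotients of the limit problem, which lie close to \<open>d0\<close> for
  small \<open>t\<close>. So \<open>t\<close> is chosen before \<open>n\<close>, and two-sidedness
  at the limit is what makes both sides of the squeeze meet.\<close>

lemma convex_derivative_stable:
  fixes y z :: 'v
  assumes Y: "Y \<longlonglongrightarrow> y" and Z: "Z \<longlonglongrightarrow> z"
    and d: "\<And>n. ((\<lambda>t. N (Y n + t *\<^sub>R Z n)) has_real_derivative d n) (at 0)"
    and d0: "((\<lambda>t. N (y + t *\<^sub>R z)) has_real_derivative d0) (at 0)"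
  shows "d \<longlonglongrightarrow> d0"
proof -
  have contN: "isCont N x" for x
    using lipschitz_on_continuous_on[OF lip] by (simp add: continuous_on_eq_continuous_at)
  define q where "q t = (N (y + t *\<^sub>R z) - N y) / t" for t
  define qn where "qn n t = (N (Y n + t *\<^sub>R Z n) - N (Y n)) / t" for n t
  have qn: "(\<lambda>n. qn n t) \<longlonglongrightarrow> q t" if "t \<noteq> 0" for t
    unfolding qn_def q_def using that
    by (intro tendsto_intros isCont_tendsto_compose[OF contN] Y Z) auto
  have tangent: "d n * t \<le> N (Y n + t *\<^sub>R Z n) - N (Y n)" for n t
    using convex_on_imp_above_tangent[OF convex_on_line[OF cvx, of "Y n" "Z n"], of 0 t "d n"] d[of n] by simp
  have up: "d n \<le> qn n t" if "0 < t" for n t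
    using tangent[of n t] that by (simp add: qn_def field_simps)
  have dn: "qn n t \<le> d n" if "t < 0" for n t
    using tangent[of n t] that by (simp add: qn_def field_simps)
  have q: "(q \<longlongrightarrow> d0) (at 0)" using d0 by (simp add: has_field_derivative_iff q_def[abs_def])
  show ?thesis
  proof (rule order_tendstoI)
    fix a assume a: "a < d0"
    have "\<forall>\<^sub>F t in at 0. a < q t" by (rule order_tendstoD(1)[OF q a])
    then have "\<forall>\<^sub>F t in at_left 0. a < q t" by (rule filter_leD[OF at_le[OF subset_UNIV]])
    moreover have "\<forall>\<^sub>F t::real in at_left 0. t < 0" by (simp add: eventually_at_filter)
    ultimately have "\<forall>\<^sub>F t in at_left 0. a < q t \<and> t < 0" by eventually_elim auto
    then obtain t where t: "a < q t" "t < 0" using eventually_happens'[OF trivial_limit_at_left_real] by blast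
    have "\<forall>\<^sub>F n in sequentially. a < qn n t" using order_tendstoD(1)[OF qn t(1)] t(2) by simp
    then show "\<forall>\<^sub>F n in sequentially. a < d n" by eventually_elim (use dn[OF t(2)] less_le_trans in blast)
  next
    fix a assume a: "d0 < a"
    have "\<forall>\<^sub>F t in at 0. q t < a" by (rule order_tendstoD(2)[OF q a])
    then have "\<forall>\<^sub>F t in at_right 0. q t < a" by (rule filter_leD[OF at_le[OF subset_UNIV]])
    then have "\<forall>\<^sub>F t in at_right 0. q t < a \<and> 0 < t"
      using eventually_at_right_less[of "0::real"] by eventually_elim auto
    then obtain t where t: "q t < a" "0 < t" using eventually_happens'[OF trivial_limit_at_right_real] by blast
    have "\<forall>\<^sub>F n in sequentially. qn n t < a" using order_tendstoD(2)[OF qn t(1)] t(2) by simp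
    then show "\<forall>\<^sub>F n in sequentially. d n < a" by eventually_elim (use up[OF t(2)] le_less_trans in blast)
  qed
qed

text \<open>Difference quotients of \<open>f\<close> along \<open>v\<close> converge to
  \<open>\<sigma> *\<^sub>R g x\<close> locally in the mean. Since \<open>N\<close> is Lipschitz,
  the increment of \<open>f\<close> may be replaced by the straight increment in that direction at a
  cost controlled by \<open>L\<close>. The remaining quotients converge at every point by definition
  of \<open>dir_deriv\<close>, with majorant \<open>2 * L * norm (g x)\<close>.\<close>

lemma weak_partial_dir_deriv:
  fixes f g :: "real ^ 'm \<Rightarrow> 'v"
  assumes U: "open U" and f: "locint U f" and g: "locint U g"
    and wk: "\<And>\<phi>. \<phi> \<in> test_functions U \<Longrightarrow> (LINT x|lborel. partial j \<phi> x *\<^sub>R f x) = - (LINT x|lborel. \<phi> x *\<^sub>R g x)"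
    and \<sigma>: "\<sigma> = 1 \<or> \<sigma> = -1" and \<phi>: "\<phi> \<in> test_functions U"
  shows "locint U (\<lambda>x. N (f x))" "locint U (\<lambda>x. \<sigma> * dir_deriv N (f x) (\<sigma> *\<^sub>R g x))"
    "(LINT x|lborel. partial j \<phi> x * N (f x)) = - (LINT x|lborel. \<phi> x * (\<sigma> * dir_deriv N (f x) (\<sigma> *\<^sub>R g x)))"
proof -
  define v where "v = \<sigma> *\<^sub>R (axis j 1 :: real ^ 'm)"
  have fm[measurable]: "f \<in> borel_measurable borel" and gm[measurable]: "g \<in> borel_measurable borel"
    by (rule locintD(1)[OF f], rule locintD(1)[OF g])
  define H where "H x = dir_deriv N (f x) (\<sigma> *\<^sub>R g x)" for x
  have Hm[measurable]: "H \<in> borel_measurable borel" unfolding H_def by (rule dir_deriv_measurable) measurable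
  have n\<sigma>: "norm (\<sigma> *\<^sub>R w) = norm w" for w :: 'v using \<sigma> by auto
  have Hb: "\<bar>H x\<bar> \<le> L * norm (g x)" for x using dir_deriv_bound[of "f x" "\<sigma> *\<^sub>R g x"] unfolding H_def n\<sigma> .
  have L0: "0 \<le> L" by (rule lipschitz_on_nonneg[OF lip])
  have inf: "integrable lborel (\<lambda>x. indicator K x * norm (f x))" "integrable lborel (\<lambda>x. indicator K x * norm (g x))"
    if "compact K" "K \<subseteq> U" for K
    using integrable_norm[OF locintD(2)[OF f that]] integrable_norm[OF locintD(2)[OF g that]] by simp_all
  have Kb: "K \<in> sets borel" if "compact K" for K :: "(real ^ 'm) set" using that by (simp add: borel_closed compact_imp_closed)
  show lu: "locint U (\<lambda>x. N (f x))"
    unfolding locint_def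
  proof (intro conjI allI impI)
    show "(\<lambda>x. N (f x)) \<in> borel_measurable borel" by measurable
    fix K :: "(real ^ 'm) set" assume K: "compact K" "K \<subseteq> U"
    have [measurable]: "K \<in> sets borel" by (rule Kb[OF K(1)])
    show "integrable lborel (\<lambda>x. indicator K x *\<^sub>R N (f x))"
    proof (rule Bochner_Integration.integrable_bound)
      have "integrable lborel (indicator K :: _ \<Rightarrow> real)"
        by (rule integrable_real_indicator) (use emeasure_compact_finite[OF K(1)] in auto)
      then show "integrable lborel (\<lambda>x. indicator K x * \<bar>N 0\<bar> + L * (indicator K x * norm (f x)))"
        by (intro Bochner_Integration.integrable_add integrable_mult_left integrable_mult_right inf[OF K])
      show "AE x in lborel. norm (indicator K x *\<^sub>R N (f x)) \<le> norm (indicator K x * \<bar>N 0\<bar> + L * (indicator K x * norm (f x)))"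
      proof (rule AE_I2)
        fix x
        have "\<bar>N (f x)\<bar> \<le> \<bar>N 0\<bar> + L * norm (f x)" using lipschitz_norm_le[of "f x" 0] by simp
        then show "norm (indicator K x *\<^sub>R N (f x)) \<le> norm (indicator K x * \<bar>N 0\<bar> + L * (indicator K x * norm (f x)))"
          using L0 by (cases "x \<in> K") auto
      qed
    qed measurable
  qed
  have lH: "locint U H"
    unfolding locint_def
  proof (intro conjI allI impI Hm)
    fix K :: "(real ^ 'm) set" assume K: "compact K" "K \<subseteq> U"
    have [measurable]: "K \<in> sets borel" by (rule Kb[OF K(1)])
    show "integrable lborel (\<lambda>x. indicator K x *\<^sub>R H x)"
    proof (rule Bochner_Integration.integrable_bound)
      show "integrable lborel (\<lambda>x. L * (indicator K x * norm (g x)))" by (intro integrable_mult_right inf[OF K])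
      show "AE x in lborel. norm (indicator K x *\<^sub>R H x) \<le> norm (L * (indicator K x * norm (g x)))"
        by (rule AE_I2) (use Hb L0 in \<open>auto simp: indicator_def abs_mult\<close>)
    qed measurable
  qed
  have l\<sigma>H: "locint U (\<lambda>x. \<sigma> * H x)"
    using lH unfolding locint_def by (auto simp: mult.left_commute[of _ \<sigma>])
  then show "locint U (\<lambda>x. \<sigma> * dir_deriv N (f x) (\<sigma> *\<^sub>R g x))" by (simp add: H_def)
  have comp: "locint U (\<lambda>x. f x \<bullet> b)" "locint U (\<lambda>x. g x \<bullet> b)" for b
    using f g unfolding locint_def by (auto simp: inner_scaleR_left[symmetric] simp del: inner_scaleR_left)
  have wkc: "(LINT x|lborel. partial j \<psi> x * (f x \<bullet> b)) = - (LINT x|lborel. \<psi> x * (g x \<bullet> b))" if \<psi>: "\<psi> \<in> test_functions U" for \<psi> b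
  proof -
    have "(LINT x|lborel. (partial j \<psi> x *\<^sub>R f x) \<bullet> b) = (LINT x|lborel. partial j \<psi> x *\<^sub>R f x) \<bullet> b"
      "(LINT x|lborel. (\<psi> x *\<^sub>R g x) \<bullet> b) = (LINT x|lborel. \<psi> x *\<^sub>R g x) \<bullet> b"
      by (rule integral_inner_left, rule test_mult_integrable(2)[OF \<psi> f])
         (rule integral_inner_left, rule test_mult_integrable(1)[OF \<psi> g])
    then show ?thesis using wk[OF \<psi>] by simp
  qed
  have conv: "(\<lambda>n. LINT x|lborel. indicator K x * \<bar>(N (f (x + (\<sigma> / real (Suc n)) *\<^sub>R axis j 1)) - N (f x)) / (\<sigma> / real (Suc n)) - \<sigma> * H x\<bar>) \<longlonglongrightarrow> 0"
    if K: "compact K" "K \<subseteq> U" for K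
  proof -
    have [measurable]: "K \<in> sets borel" by (rule Kb[OF K(1)])
    define t where "t n = 1 / real (Suc n)" for n
    have t0: "0 < t n" for n by (simp add: t_def)
    define E where "E b s x = indicator K x * \<bar>(f (x + s *\<^sub>R v) \<bullet> b - f x \<bullet> b) / s - \<sigma> * (g x \<bullet> b)\<bar>" for b s x
    define Q where "Q n x = indicator K x * \<bar>(N (f x + t n *\<^sub>R (\<sigma> *\<^sub>R g x)) - N (f x)) / t n - H x\<bar>" for n x
    have Qm[measurable]: "Q n \<in> borel_measurable borel" for n unfolding Q_def by measurable
    have Qb: "norm (Q n x) \<le> 2 * L * (indicator K x * norm (g x))" for n x
    proof -
      have nr: "norm (f x + t n *\<^sub>R (\<sigma> *\<^sub>R g x) - f x) = t n * norm (g x)" using t0[of n] \<sigma> by auto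
      have "\<bar>N (f x + t n *\<^sub>R (\<sigma> *\<^sub>R g x)) - N (f x)\<bar> \<le> L * (t n * norm (g x))"
        using lipschitz_norm_le[of "f x + t n *\<^sub>R (\<sigma> *\<^sub>R g x)" "f x"] unfolding nr .
      then have "\<bar>(N (f x + t n *\<^sub>R (\<sigma> *\<^sub>R g x)) - N (f x)) / t n\<bar> \<le> L * norm (g x)"
        using t0[of n] by (simp add: field_simps)
      then have "\<bar>(N (f x + t n *\<^sub>R (\<sigma> *\<^sub>R g x)) - N (f x)) / t n - H x\<bar> \<le> 2 * L * norm (g x)"
        using Hb[of x] by (simp only: abs_le_iff) linarith
      then show ?thesis by (cases "x \<in> K") (simp_all add: Q_def)
    qed
    have gint: "integrable lborel (\<lambda>x. 2 * L * (indicator K x * norm (g x)))" by (intro integrable_mult_right inf[OF K])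
    have Qi: "integrable lborel (Q n)" for n
      by (rule Bochner_Integration.integrable_bound[OF gint]) (use Qb[of n] in \<open>auto intro!: AE_I2 order_trans[OF _ abs_ge_self]\<close>)
    have "(\<lambda>n. LINT x|lborel. Q n x) \<longlonglongrightarrow> (LINT x|(lborel :: (real ^ 'm) measure). 0)"
    proof (rule integral_dominated_convergence[OF _ _ gint])
      show "AE x in lborel. (\<lambda>n. Q n x) \<longlonglongrightarrow> 0"
      proof (rule AE_I2)
        fix x
        have "(\<lambda>n. (N (f x + t n *\<^sub>R (\<sigma> *\<^sub>R g x)) - N (f x)) / t n) \<longlonglongrightarrow> H x"
          unfolding H_def t_def by (rule dir_deriv_seq)
        then have "(\<lambda>n. indicator K x * \<bar>(N (f x + t n *\<^sub>R (\<sigma> *\<^sub>R g x)) - N (f x)) / t n - H x\<bar>) \<longlonglongrightarrow> indicator K x * \<bar>H x - H x\<bar>"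
          by (intro tendsto_intros)
        then show "(\<lambda>n. Q n x) \<longlonglongrightarrow> 0" by (simp add: Q_def)
      qed
      show "AE x in lborel. norm (Q n x) \<le> 2 * L * (indicator K x * norm (g x))" for n by (rule AE_I2) (rule Qb)
    qed measurable
    then have Qlim: "(\<lambda>n. LINT x|lborel. Q n x) \<longlonglongrightarrow> 0" by simp
    have tr: "filterlim t (at_right 0) sequentially" unfolding t_def by (rule one_over_Suc_at_right)
    have Elim: "(\<lambda>n. LINT x|lborel. E b (t n) x) \<longlonglongrightarrow> 0" for b
      unfolding E_def
      by (rule filterlim_compose[OF weak_difference_quotient(2)[OF U comp wkc K \<sigma> v_def] tr])
    have Eint: "\<forall>\<^sub>F n in sequentially. integrable lborel (E b (t n))" for b
      using filterlim_iff[THEN iffD1, OF tr, rule_format, OF weak_difference_quotient(1)[OF U comp wkc K \<sigma> v_def]]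
      unfolding E_def .
    have all: "\<forall>\<^sub>F n in sequentially. \<forall>b\<in>Basis. integrable lborel (E b (t n))"
      by (rule eventually_ball_finite) (use Eint in auto)
    have bound: "\<forall>\<^sub>F n in sequentially. norm (LINT x|lborel. indicator K x * \<bar>(N (f (x + (\<sigma> / real (Suc n)) *\<^sub>R axis j 1)) - N (f x)) / (\<sigma> / real (Suc n)) - \<sigma> * H x\<bar>)
       \<le> L * (\<Sum>b\<in>Basis. LINT x|lborel. E b (t n) x) + (LINT x|lborel. Q n x)"
      using all
    proof eventually_elim
      case (elim n)
      have p: "x + (\<sigma> / real (Suc n)) *\<^sub>R axis j 1 = x + t n *\<^sub>R v" for x :: "real ^ 'm" by (simp add: v_def t_def)
      have le: "indicator K x * \<bar>(N (f (x + t n *\<^sub>R v)) - N (f x)) / (\<sigma> / real (Suc n)) - \<sigma> * H x\<bar> \<le> L * (\<Sum>b\<in>Basis. E b (t n) x) + Q n x" for x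
      proof (cases "x \<in> K")
        case False
        then show ?thesis by (simp add: E_def Q_def)
      next
        case True
        \<comment> \<open>The deviation of the quotient of \<open>f\<close> from its limit. Its norm
          is at most the sum of the coordinate errors \<open>E b (t n) x\<close>, whose integrals
          tend to 0.\<close>
        define w where "w = (1 / t n) *\<^sub>R (f (x + t n *\<^sub>R v) - f x) - \<sigma> *\<^sub>R g x"
        have wt: "f (x + t n *\<^sub>R v) = f x + t n *\<^sub>R (\<sigma> *\<^sub>R g x) + t n *\<^sub>R w"
          using t0[of n] by (simp add: w_def algebra_simps)
        have "\<bar>N (f (x + t n *\<^sub>R v)) - N (f x + t n *\<^sub>R (\<sigma> *\<^sub>R g x))\<bar> \<le> L * (t n * norm w)"
          using lipschitz_norm_le[of "f (x + t n *\<^sub>R v)" "f x + t n *\<^sub>R (\<sigma> *\<^sub>R g x)"] t0[of n] unfolding wt by simp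
        then have 1: "\<bar>(N (f (x + t n *\<^sub>R v)) - N (f x + t n *\<^sub>R (\<sigma> *\<^sub>R g x))) / t n\<bar> \<le> L * norm w"
          using t0[of n] by (simp add: field_simps)
        have "norm w \<le> (\<Sum>b\<in>Basis. \<bar>w \<bullet> b\<bar>)" by (rule norm_le_l1)
        also have "\<dots> = (\<Sum>b\<in>Basis. E b (t n) x)"
          using True by (intro sum.cong refl) (simp add: E_def w_def inner_diff_left)
        finally have 2: "L * norm w \<le> L * (\<Sum>b\<in>Basis. E b (t n) x)" using L0 by (rule mult_left_mono)
        \<comment> \<open>Dividing by \<open>\<sigma> / real (Suc n)\<close> instead of
          \<open>t n\<close> only introduces a factor \<sigma> of absolute value 1.\<close>
        have "\<bar>(N (f (x + t n *\<^sub>R v)) - N (f x)) / (\<sigma> / real (Suc n)) - \<sigma> * H x\<bar> = \<bar>(N (f (x + t n *\<^sub>R v)) - N (f x)) / t n - H x\<bar>"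
          using \<sigma> by (auto simp: t_def)
        also have "(N (f (x + t n *\<^sub>R v)) - N (f x)) / t n - H x = (N (f (x + t n *\<^sub>R v)) - N (f x + t n *\<^sub>R (\<sigma> *\<^sub>R g x))) / t n
            + ((N (f x + t n *\<^sub>R (\<sigma> *\<^sub>R g x)) - N (f x)) / t n - H x)"
          by (simp add: diff_divide_distrib)
        also have "\<bar>\<dots>\<bar> \<le> L * norm w + \<bar>(N (f x + t n *\<^sub>R (\<sigma> *\<^sub>R g x)) - N (f x)) / t n - H x\<bar>"
          using 1 by (intro order_trans[OF abs_triangle_ineq] add_right_mono)
        finally show ?thesis using 2 True by (simp add: Q_def)
      qed
      have i: "integrable lborel (\<lambda>x. L * (\<Sum>b\<in>Basis. E b (t n) x) + Q n x)"
        using elim Qi by (intro Bochner_Integration.integrable_add integrable_mult_right Bochner_Integration.integrable_sum) auto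
      have m: "(\<lambda>x. indicator K x * \<bar>(N (f (x + t n *\<^sub>R v)) - N (f x)) / (\<sigma> / real (Suc n)) - \<sigma> * H x\<bar>) \<in> borel_measurable lborel"
        by measurable
      have i': "integrable lborel (\<lambda>x. indicator K x * \<bar>(N (f (x + t n *\<^sub>R v)) - N (f x)) / (\<sigma> / real (Suc n)) - \<sigma> * H x\<bar>)"
      proof (rule Bochner_Integration.integrable_bound[OF i m], rule AE_I2)
        fix x
        have "0 \<le> indicator K x * \<bar>(N (f (x + t n *\<^sub>R v)) - N (f x)) / (\<sigma> / real (Suc n)) - \<sigma> * H x\<bar>" by simp
        then show "norm (indicator K x * \<bar>(N (f (x + t n *\<^sub>R v)) - N (f x)) / (\<sigma> / real (Suc n)) - \<sigma> * H x\<bar>) \<le> norm (L * (\<Sum>b\<in>Basis. E b (t n) x) + Q n x)"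
          using le[of x] by (simp only: real_norm_def abs_of_nonneg)
      qed
      have "norm (LINT x|lborel. indicator K x * \<bar>(N (f (x + t n *\<^sub>R v)) - N (f x)) / (\<sigma> / real (Suc n)) - \<sigma> * H x\<bar>)
        = (LINT x|lborel. indicator K x * \<bar>(N (f (x + t n *\<^sub>R v)) - N (f x)) / (\<sigma> / real (Suc n)) - \<sigma> * H x\<bar>)"
        unfolding real_norm_def by (rule abs_of_nonneg) (intro integral_nonneg_AE AE_I2 mult_nonneg_nonneg, auto)
      also have "\<dots> \<le> (LINT x|lborel. L * (\<Sum>b\<in>Basis. E b (t n) x) + Q n x)" by (rule integral_mono[OF i' i le])
      also have "\<dots> = L * (\<Sum>b\<in>Basis. LINT x|lborel. E b (t n) x) + (LINT x|lborel. Q n x)"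
        using elim Qi by (subst Bochner_Integration.integral_add) (auto simp: Bochner_Integration.integral_sum)
      finally show ?case unfolding p .
    qed
    have "(\<lambda>n. L * (\<Sum>b\<in>Basis. LINT x|lborel. E b (t n) x) + (LINT x|lborel. Q n x)) \<longlonglongrightarrow> L * (\<Sum>b\<in>(Basis :: 'v set). 0) + 0"
      by (intro tendsto_add tendsto_mult tendsto_const tendsto_sum Elim Qlim)
    then have "(\<lambda>n. L * (\<Sum>b\<in>Basis. LINT x|lborel. E b (t n) x) + (LINT x|lborel. Q n x)) \<longlonglongrightarrow> 0" by simp
    from Lim_null_comparison[OF bound this] show ?thesis .
  qed
  have "(\<lambda>n. \<sigma> / real (Suc n)) \<longlonglongrightarrow> 0"
    using tendsto_mult[OF tendsto_const[of \<sigma>] LIMSEQ_inverse_real_of_nat] by (simp add: divide_inverse)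
  from weak_partial_of_difference_quotients[OF U lu l\<sigma>H this _ conv \<phi>]
  show "(LINT x|lborel. partial j \<phi> x * N (f x)) = - (LINT x|lborel. \<phi> x * (\<sigma> * dir_deriv N (f x) (\<sigma> *\<^sub>R g x)))"
    using \<sigma> by (auto simp: H_def)
qed

end

section \<open>Linearity and uniqueness of weak partial derivatives\<close>

lemma locint_diff:
  assumes f: "locint U f" and g: "locint U g"
  shows "locint U (\<lambda>x. f x - g x)"
  unfolding locint_def
proof (intro conjI allI impI)
  show "(\<lambda>x. f x - g x) \<in> borel_measurable borel" using locintD(1)[OF f] locintD(1)[OF g] by measurable
  fix K assume K: "compact K" "K \<subseteq> U"
  show "integrable lborel (\<lambda>x. indicator K x *\<^sub>R (f x - g x))"
    unfolding scaleR_diff_right by (rule Bochner_Integration.integrable_diff[OF locintD(2)[OF f K] locintD(2)[OF g K]])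
qed

lemma locint_inner:
  assumes "locint U f"
  shows "locint U (\<lambda>x. f x \<bullet> b)"
  using assms unfolding locint_def by (auto simp: inner_scaleR_left[symmetric] simp del: inner_scaleR_left)

lemma weak_partial_components_iff:
  fixes f g :: "real ^ 'm \<Rightarrow> 'v::euclidean_space"
  assumes f: "locint U f" and g: "locint U g" and \<phi>: "\<phi> \<in> test_functions U"
  shows "(LINT x|lborel. partial j \<phi> x *\<^sub>R f x) = - (LINT x|lborel. \<phi> x *\<^sub>R g x) \<longleftrightarrow>
    (\<forall>b\<in>Basis. (LINT x|lborel. partial j \<phi> x * (f x \<bullet> b)) = - (LINT x|lborel. \<phi> x * (g x \<bullet> b)))"
proof -
  have "(LINT x|lborel. (partial j \<phi> x *\<^sub>R f x) \<bullet> b) = (LINT x|lborel. partial j \<phi> x *\<^sub>R f x) \<bullet> b"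
    "(LINT x|lborel. (\<phi> x *\<^sub>R g x) \<bullet> b) = (LINT x|lborel. \<phi> x *\<^sub>R g x) \<bullet> b" for b
    by (rule integral_inner_left, rule test_mult_integrable(2)[OF \<phi> f])
       (rule integral_inner_left, rule test_mult_integrable(1)[OF \<phi> g])
  then show ?thesis by (simp add: euclidean_eq_iff[where 'a = 'v])
qed

lemma borel_representatives_weak_partial:
  fixes f g :: "real ^ 'm \<Rightarrow> 'v::euclidean_space"
  assumes U: "open U" and w: "is_weak_partial U j f g"
  obtains f' g' where "f' \<in> borel_measurable borel" "AE x in lborel. x \<in> U \<longrightarrow> f x = f' x"
    "g' \<in> borel_measurable borel" "AE x in lborel. x \<in> U \<longrightarrow> g x = g' x"
    "is_weak_partial U j f' g'"
proof -
  have l: "locally_integrable U f" "locally_integrable U g" using w by (auto simp: is_weak_partial_def)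
  obtain f' where f': "f' \<in> borel_measurable borel" "AE x in lborel. x \<in> U \<longrightarrow> f x = f' x"
    by (rule borel_representative[OF borel_open[OF U] locally_integrable_measurable[OF U l(1)]])
  obtain g' where g': "g' \<in> borel_measurable borel" "AE x in lborel. x \<in> U \<longrightarrow> g x = g' x"
    by (rule borel_representative[OF borel_open[OF U] locally_integrable_measurable[OF U l(2)]])
  have "AE x in lborel. x \<in> U \<longrightarrow> f' x = f x" using f'(2) by eventually_elim auto
  moreover have "AE x in lborel. x \<in> U \<longrightarrow> g' x = g x" using g'(2) by eventually_elim auto
  ultimately have "is_weak_partial U j f' g'" by (rule is_weak_partial_cong_AE[OF U w])
  then show ?thesis by (rule that[OF f' g'])
qed

lemma is_weak_partial_diff:
  fixes f g :: "real ^ 'm \<Rightarrow> 'v::euclidean_space"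
  assumes U: "open U" and w1: "is_weak_partial U j f1 g1" and w2: "is_weak_partial U j f2 g2"
  shows "is_weak_partial U j (\<lambda>x. f1 x - f2 x) (\<lambda>x. g1 x - g2 x)"
proof -
  obtain F1 G1 where 1: "F1 \<in> borel_measurable borel" "AE x in lborel. x \<in> U \<longrightarrow> f1 x = F1 x"
    "G1 \<in> borel_measurable borel" "AE x in lborel. x \<in> U \<longrightarrow> g1 x = G1 x" "is_weak_partial U j F1 G1"
    by (rule borel_representatives_weak_partial[OF U w1])
  obtain F2 G2 where 2: "F2 \<in> borel_measurable borel" "AE x in lborel. x \<in> U \<longrightarrow> f2 x = F2 x"
    "G2 \<in> borel_measurable borel" "AE x in lborel. x \<in> U \<longrightarrow> g2 x = G2 x" "is_weak_partial U j F2 G2"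
    by (rule borel_representatives_weak_partial[OF U w2])
  note B1 = 1(5)[unfolded weak_partial_borel_iff[OF U 1(1,3)]] and B2 = 2(5)[unfolded weak_partial_borel_iff[OF U 2(1,3)]]
  have l: "locint U F1" "locint U G1" "locint U F2" "locint U G2" using B1 B2 by blast+
  have "is_weak_partial U j (\<lambda>x. F1 x - F2 x) (\<lambda>x. G1 x - G2 x)"
  proof (subst weak_partial_borel_iff[OF U])
    show "(\<lambda>x. F1 x - F2 x) \<in> borel_measurable borel" "(\<lambda>x. G1 x - G2 x) \<in> borel_measurable borel"
      using 1 2 by measurable
    have "(LINT x|lborel. partial j \<phi> x *\<^sub>R (F1 x - F2 x)) = - (LINT x|lborel. \<phi> x *\<^sub>R (G1 x - G2 x))" if \<phi>: "\<phi> \<in> test_functions U" for \<phi>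
      unfolding scaleR_diff_right
      using Bochner_Integration.integral_diff[OF test_mult_integrable(2)[OF \<phi> l(1)] test_mult_integrable(2)[OF \<phi> l(3)], where j2=j]
        Bochner_Integration.integral_diff[OF test_mult_integrable(1)[OF \<phi> l(2)] test_mult_integrable(1)[OF \<phi> l(4)]] B1 B2 \<phi>
      by simp
    then show "locint U (\<lambda>x. F1 x - F2 x) \<and> locint U (\<lambda>x. G1 x - G2 x) \<and>
      (\<forall>\<phi>\<in>test_functions U. (LINT x|lborel. partial j \<phi> x *\<^sub>R (F1 x - F2 x)) = - (LINT x|lborel. \<phi> x *\<^sub>R (G1 x - G2 x)))"
      using l locint_diff by blast
  qed
  moreover have "AE x in lborel. x \<in> U \<longrightarrow> f1 x - f2 x = F1 x - F2 x" using 1(2) 2(2) by eventually_elim auto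
  moreover have "AE x in lborel. x \<in> U \<longrightarrow> g1 x - g2 x = G1 x - G2 x" using 1(4) 2(4) by eventually_elim auto
  ultimately show ?thesis by (rule is_weak_partial_cong_AE[OF U])
qed

lemma is_weak_partial_unique:
  fixes f g :: "real ^ 'm \<Rightarrow> 'v::euclidean_space"
  assumes U: "open U" and w1: "is_weak_partial U j f g" and w2: "is_weak_partial U j f h"
  shows "AE x in lborel. x \<in> U \<longrightarrow> g x = h x"
proof -
  have "is_weak_partial U j (\<lambda>x. f x - f x) (\<lambda>x. g x - h x)" by (rule is_weak_partial_diff[OF U w1 w2])
  then obtain F G where F: "F \<in> borel_measurable borel" "AE x in lborel. x \<in> U \<longrightarrow> f x - f x = F x"
    "G \<in> borel_measurable borel" "AE x in lborel. x \<in> U \<longrightarrow> g x - h x = G x" "is_weak_partial U j F G"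
    by (rule borel_representatives_weak_partial[OF U])
  have "AE x in lborel. x \<in> U \<longrightarrow> (0::'v) = F x" using F(2) by eventually_elim auto
  moreover have "AE x in lborel. x \<in> U \<longrightarrow> G x = G x" by simp
  ultimately have "is_weak_partial U j (\<lambda>x. 0 :: 'v) G" by (rule is_weak_partial_cong_AE[OF U F(5)])
  then have B: "locint U (\<lambda>x::real^'m. 0 :: 'v)" "locint U G"
    "\<And>\<phi>. \<phi> \<in> test_functions U \<Longrightarrow> (LINT x|lborel. partial j \<phi> x *\<^sub>R (0 :: 'v)) = - (LINT x|lborel. \<phi> x *\<^sub>R G x)"
    using weak_partial_borel_iff[OF U _ F(3), of "\<lambda>x. 0"] by auto
  have "AE x in lborel. x \<in> U \<longrightarrow> G x \<bullet> b = 0" if b: "b \<in> Basis" for b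
  proof (rule locint_zero[OF U locint_inner[OF B(2)]])
    fix \<phi> assume \<phi>: "\<phi> \<in> test_functions U"
    have "(LINT x|lborel. partial j \<phi> x * ((0 :: 'v) \<bullet> b)) = - (LINT x|lborel. \<phi> x * (G x \<bullet> b))"
      using B(3)[OF \<phi>] weak_partial_components_iff[OF B(1,2) \<phi>] b by blast
    then show "(LINT x|lborel. \<phi> x * (G x \<bullet> b)) = 0" by simp
  qed
  then have "AE x in lborel. \<forall>b\<in>Basis. x \<in> U \<longrightarrow> G x \<bullet> b = 0" by (intro AE_finite_allI) auto
  then show ?thesis using F(4)
  proof eventually_elim
    case (elim x)
    show ?case
    proof
      assume x: "x \<in> U"
      have "G x = 0"
      proof (rule euclidean_eqI)
        fix b :: 'v assume "b \<in> Basis"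
        then show "G x \<bullet> b = 0 \<bullet> b" using elim(1) x by simp
      qed
      then show "g x = h x" using elim(2) x by simp
    qed
  qed
qed

text \<open>The difference quotients of \<open>N \<circ> f\<close> to the right and to the left converge to two one-sided
  expressions. Both are weak derivatives of \<open>N \<circ> f\<close>, so they agree almost everywhere: \<open>N\<close> is
  differentiable at \<open>f x\<close> in direction \<open>g x\<close> for almost all \<open>x\<close>.\<close>

lemma dir_deriv_symmetric_AE:
  fixes f g :: "real ^ 'm \<Rightarrow> 'v::euclidean_space"
  assumes cvx: "convex_on UNIV N" and lip: "L-lipschitz_on UNIV N" and U: "open U" and f: "locint U f" and g: "locint U g"
    and wk: "\<And>\<phi>. \<phi> \<in> test_functions U \<Longrightarrow> (LINT x|lborel. partial j \<phi> x *\<^sub>R f x) = - (LINT x|lborel. \<phi> x *\<^sub>R g x)"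
  shows "AE x in lborel. x \<in> U \<longrightarrow> dir_deriv N (f x) (- g x) = - dir_deriv N (f x) (g x)"
    and "locint U (\<lambda>x. dir_deriv N (f x) (g x))"
proof -
  \<comment> \<open>The statements about local integrability are drawn from a lemma that takes a
    test function. The bump over an empty box, the zero function, is a test function on every
    \<open>U\<close>.\<close>
  have "cbox 1 0 = ({} :: (real ^ 'm) set)" by (auto simp: mem_box_cart set_eq_iff)
  then have ex: "box_bump 0 1 0 \<in> test_functions U" by (intro box_bump_test_function) simp
  have l1: "locint U (\<lambda>x. dir_deriv N (f x) (g x))" and l2: "locint U (\<lambda>x. - dir_deriv N (f x) (- g x))"
    using weak_partial_dir_deriv(2)[OF cvx lip U f g wk _ ex, of 1] weak_partial_dir_deriv(2)[OF cvx lip U f g wk _ ex, of "-1"] by simp_all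
  show "locint U (\<lambda>x. dir_deriv N (f x) (g x))" by (rule l1)
  have "AE x in lborel. x \<in> U \<longrightarrow> dir_deriv N (f x) (g x) - - dir_deriv N (f x) (- g x) = 0"
  proof (rule locint_zero[OF U locint_diff[OF l1 l2]])
    fix \<phi> assume \<phi>: "\<phi> \<in> test_functions U"
    have "(LINT x|lborel. \<phi> x * dir_deriv N (f x) (g x)) = (LINT x|lborel. \<phi> x * - dir_deriv N (f x) (- g x))"
      using weak_partial_dir_deriv(3)[OF cvx lip U f g wk _ \<phi>, of 1] weak_partial_dir_deriv(3)[OF cvx lip U f g wk _ \<phi>, of "-1"] by simp
    then show "(LINT x|lborel. \<phi> x * (dir_deriv N (f x) (g x) - - dir_deriv N (f x) (- g x))) = 0"
      unfolding right_diff_distrib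
      using Bochner_Integration.integral_diff[OF test_mult_integrable(1)[OF \<phi> l1] test_mult_integrable(1)[OF \<phi> l2]] by simp
  qed
  then show "AE x in lborel. x \<in> U \<longrightarrow> dir_deriv N (f x) (- g x) = - dir_deriv N (f x) (g x)"
    by eventually_elim auto
qed

section \<open>Differences of convex functions\<close>

text \<open>The features of the singular value map that the analysis uses. A common constant
  \<open>L\<close> serves all coordinates, and \<open>T 0 = 0\<close> turns the Lipschitz bound into
  a bound on \<open>T\<close> without additive constant.\<close>

locale dc_map =
  fixes T :: "'v::euclidean_space \<Rightarrow> 'w::euclidean_space" and P Q :: "'w \<Rightarrow> 'v \<Rightarrow> real" and L :: real
  assumes P_convex: "\<And>b. b \<in> Basis \<Longrightarrow> convex_on UNIV (P b)" and P_lip: "\<And>b. b \<in> Basis \<Longrightarrow> L-lipschitz_on UNIV (P b)"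
    and Q_convex: "\<And>b. b \<in> Basis \<Longrightarrow> convex_on UNIV (Q b)" and Q_lip: "\<And>b. b \<in> Basis \<Longrightarrow> L-lipschitz_on UNIV (Q b)"
    and T_eq: "\<And>b y. b \<in> Basis \<Longrightarrow> T y \<bullet> b = P b y - Q b y"
    and T_zero: "T 0 = 0"
begin

text \<open>A crude Lipschitz constant for \<open>T\<close>: a difference of two functions with
  constant \<open>L\<close> in each coordinate, the norm being bounded by the sum of the
  coordinates.\<close>

definition C where "C = 2 * L * real DIM('w)"

lemma L_nonneg: "0 \<le> L"
  using P_lip lipschitz_on_nonneg nonempty_Basis by blast

lemma C_nonneg: "0 \<le> C"
  using L_nonneg by (simp add: C_def)

lemma T_lip: "norm (T y - T z) \<le> C * norm (y - z)"
proof -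
  have "\<bar>(T y - T z) \<bullet> b\<bar> \<le> 2 * L * norm (y - z)" if b: "b \<in> Basis" for b
  proof -
    have "(T y - T z) \<bullet> b = (P b y - P b z) - (Q b y - Q b z)" by (simp add: inner_diff_left T_eq[OF b])
    then show ?thesis using lipschitz_norm_le[OF P_convex[OF b] P_lip[OF b], of y z] lipschitz_norm_le[OF Q_convex[OF b] Q_lip[OF b], of y z]
      by linarith
  qed
  then have "(\<Sum>b\<in>Basis. \<bar>(T y - T z) \<bullet> b\<bar>) \<le> (\<Sum>b\<in>(Basis :: 'w set). 2 * L * norm (y - z))" by (rule sum_mono)
  then show ?thesis using norm_le_l1[of "T y - T z"] by (simp add: C_def mult_ac)
qed

lemma T_bound: "norm (T y) \<le> C * norm y"
  using T_lip[of y 0] by (simp add: T_zero)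

lemma T_continuous: "continuous_on UNIV T"
proof -
  have "C-lipschitz_on UNIV T" using T_lip C_nonneg by (intro lipschitz_onI) (auto simp: dist_norm)
  then show ?thesis by (rule lipschitz_on_continuous_on)
qed

text \<open>Two-sidedness is required of \<open>P b\<close> and \<open>Q b\<close> separately, not
  merely of their difference: the stability argument works for convex functions only.\<close>

definition smooth_at :: "'v \<Rightarrow> 'v \<Rightarrow> bool" where
  "smooth_at y z \<longleftrightarrow> (\<forall>b\<in>Basis. dir_deriv (P b) y (- z) = - dir_deriv (P b) y z \<and> dir_deriv (Q b) y (- z) = - dir_deriv (Q b) y z)"

lemma smooth_atD:
  assumes s: "smooth_at y z" and b: "b \<in> Basis"
  shows "((\<lambda>t. P b (y + t *\<^sub>R z)) has_real_derivative dir_deriv (P b) y z) (at 0)"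
    "((\<lambda>t. Q b (y + t *\<^sub>R z)) has_real_derivative dir_deriv (Q b) y z) (at 0)"
proof -
  have "dir_deriv (P b) y (- z) = - dir_deriv (P b) y z" "dir_deriv (Q b) y (- z) = - dir_deriv (Q b) y z"
    using s b unfolding smooth_at_def by blast+
  then show "((\<lambda>t. P b (y + t *\<^sub>R z)) has_real_derivative dir_deriv (P b) y z) (at 0)"
    "((\<lambda>t. Q b (y + t *\<^sub>R z)) has_real_derivative dir_deriv (Q b) y z) (at 0)"
    using has_derivative_of_dir_deriv[OF P_convex[OF b] P_lip[OF b]] has_derivative_of_dir_deriv[OF Q_convex[OF b] Q_lip[OF b]] by blast+
qed

text \<open>Defined everywhere through right-hand derivatives, hence measurable along measurable
  maps; it is a genuine two-sided derivative of \<open>T\<close> where \<open>smooth_at\<close>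
  holds.\<close>

definition DT :: "'v \<Rightarrow> 'v \<Rightarrow> 'w" where
  "DT y z = (\<Sum>b\<in>Basis. (dir_deriv (P b) y z - dir_deriv (Q b) y z) *\<^sub>R b)"

lemma DT_inner: "b \<in> Basis \<Longrightarrow> DT y z \<bullet> b = dir_deriv (P b) y z - dir_deriv (Q b) y z"
  unfolding DT_def by (rule inner_sum_left_Basis)

lemma DT_bound: "norm (DT y z) \<le> C * norm z"
proof -
  have "\<bar>DT y z \<bullet> b\<bar> \<le> 2 * L * norm z" if b: "b \<in> Basis" for b
    unfolding DT_inner[OF b]
    using dir_deriv_bound[OF P_convex[OF b] P_lip[OF b], of y z] dir_deriv_bound[OF Q_convex[OF b] Q_lip[OF b], of y z] by linarith
  then have "(\<Sum>b\<in>Basis. \<bar>DT y z \<bullet> b\<bar>) \<le> (\<Sum>b\<in>(Basis :: 'w set). 2 * L * norm z)" by (rule sum_mono)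
  then show ?thesis using norm_le_l1[of "DT y z"] by (simp add: C_def mult_ac)
qed

lemma T_has_vector_derivative:
  assumes s: "smooth_at y z"
  shows "((\<lambda>t. T (y + t *\<^sub>R z)) has_vector_derivative DT y z) (at 0)"
proof -
  have "((\<lambda>t. \<Sum>b\<in>Basis. (P b (y + t *\<^sub>R z) - Q b (y + t *\<^sub>R z)) *\<^sub>R b) has_vector_derivative DT y z) (at 0)"
    unfolding DT_def
  proof (intro has_vector_derivative_sum)
    fix b :: 'w assume b: "b \<in> Basis"
    from DERIV_diff[OF smooth_atD[OF s b]] have "((\<lambda>t. P b (y + t *\<^sub>R z) - Q b (y + t *\<^sub>R z)) has_real_derivative dir_deriv (P b) y z - dir_deriv (Q b) y z) (at 0)" .
    from has_vector_derivative_scaleR[OF this has_vector_derivative_const[of b]]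
    show "((\<lambda>t. (P b (y + t *\<^sub>R z) - Q b (y + t *\<^sub>R z)) *\<^sub>R b) has_vector_derivative (dir_deriv (P b) y z - dir_deriv (Q b) y z) *\<^sub>R b) (at 0)"
      by simp
  qed
  moreover have "(\<Sum>b\<in>Basis. (P b w - Q b w) *\<^sub>R b) = T w" for w
  proof -
    have "(\<Sum>b\<in>Basis. (P b w - Q b w) *\<^sub>R b) = (\<Sum>b\<in>Basis. (T w \<bullet> b) *\<^sub>R b)" by (intro sum.cong refl) (simp add: T_eq)
    then show ?thesis by (simp only: euclidean_representation)
  qed
  ultimately show ?thesis by simp
qed

lemma DT_stable:
  assumes Y: "Y \<longlonglongrightarrow> y" and Z: "Z \<longlonglongrightarrow> z" and s: "\<And>n. smooth_at (Y n) (Z n)" "smooth_at y z"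
  shows "(\<lambda>n. DT (Y n) (Z n)) \<longlonglongrightarrow> DT y z"
  unfolding DT_def
proof (intro tendsto_sum tendsto_scaleR tendsto_diff tendsto_const)
  fix b :: 'w assume b: "b \<in> Basis"
  have sP: "((\<lambda>t. P b (y + t *\<^sub>R z)) has_real_derivative dir_deriv (P b) y z) (at 0)"
    and sQ: "((\<lambda>t. Q b (y + t *\<^sub>R z)) has_real_derivative dir_deriv (Q b) y z) (at 0)" if "smooth_at y z" for y z
    using smooth_atD[OF that b] by blast+
  show "(\<lambda>n. dir_deriv (P b) (Y n) (Z n)) \<longlonglongrightarrow> dir_deriv (P b) y z"
    by (rule convex_derivative_stable[OF P_convex[OF b] P_lip[OF b] Y Z sP[OF s(1)] sP[OF s(2)]])
  show "(\<lambda>n. dir_deriv (Q b) (Y n) (Z n)) \<longlonglongrightarrow> dir_deriv (Q b) y z"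
    by (rule convex_derivative_stable[OF Q_convex[OF b] Q_lip[OF b] Y Z sQ[OF s(1)] sQ[OF s(2)]])
qed

theorem chain_rule:
  fixes f g :: "real ^ 'm \<Rightarrow> 'v"
  assumes U: "open U" and w: "is_weak_partial U j f g"
  shows "AE x in lborel. x \<in> U \<longrightarrow> smooth_at (f x) (g x)"
    and "is_weak_partial U j (\<lambda>x. T (f x)) (\<lambda>x. DT (f x) (g x))"
proof -
  \<comment> \<open>Composition with \<open>T\<close> and \<open>DT\<close> is carried out on Borel
    representatives; both conclusions are insensitive to changes on null sets.\<close>
  obtain F G where F: "F \<in> borel_measurable borel" "AE x in lborel. x \<in> U \<longrightarrow> f x = F x"
    "G \<in> borel_measurable borel" "AE x in lborel. x \<in> U \<longrightarrow> g x = G x" "is_weak_partial U j F G"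
    by (rule borel_representatives_weak_partial[OF U w])
  note [measurable] = F(1,3)
  have B: "locint U F" "locint U G"
    "\<And>\<phi>. \<phi> \<in> test_functions U \<Longrightarrow> (LINT x|lborel. partial j \<phi> x *\<^sub>R F x) = - (LINT x|lborel. \<phi> x *\<^sub>R G x)"
    using F(5) weak_partial_borel_iff[OF U F(1,3)] by blast+
  note symP = dir_deriv_symmetric_AE[OF P_convex P_lip U B] and symQ = dir_deriv_symmetric_AE[OF Q_convex Q_lip U B]
  have "AE x in lborel. \<forall>b\<in>Basis. x \<in> U \<longrightarrow> dir_deriv (P b) (F x) (- G x) = - dir_deriv (P b) (F x) (G x)"
    using symP(1) by (intro AE_finite_allI) auto
  moreover have "AE x in lborel. \<forall>b\<in>Basis. x \<in> U \<longrightarrow> dir_deriv (Q b) (F x) (- G x) = - dir_deriv (Q b) (F x) (G x)"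
    using symQ(1) by (intro AE_finite_allI) auto
  ultimately show "AE x in lborel. x \<in> U \<longrightarrow> smooth_at (f x) (g x)"
    using F(2,4)
  proof eventually_elim
    case (elim x)
    then show ?case unfolding smooth_at_def by simp
  qed
  have Tm[measurable]: "T \<in> borel_measurable borel" by (rule borel_measurable_continuous_onI[OF T_continuous])
  have DTm[measurable]: "(\<lambda>x. DT (F x) (G x)) \<in> borel_measurable borel"
    unfolding DT_def
    using dir_deriv_measurable[OF P_convex P_lip F(1,3)] dir_deriv_measurable[OF Q_convex Q_lip F(1,3)]
    by (intro borel_measurable_sum borel_measurable_scaleR borel_measurable_diff borel_measurable_const) auto
  have bound: "locint U h" if [measurable]: "h \<in> borel_measurable borel" and k: "locint U k" and b: "\<And>x. norm (h x) \<le> C * norm (k x)"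
    for h :: "real ^ 'm \<Rightarrow> 'w" and k :: "real ^ 'm \<Rightarrow> 'v"
    unfolding locint_def
  proof (intro conjI allI impI that(1))
    fix K :: "(real ^ 'm) set" assume K: "compact K" "K \<subseteq> U"
    have [measurable]: "K \<in> sets borel" using K by (simp add: borel_closed compact_imp_closed)
    show "integrable lborel (\<lambda>x. indicator K x *\<^sub>R h x)"
    proof (rule Bochner_Integration.integrable_bound)
      show "integrable lborel (\<lambda>x. C *\<^sub>R (indicator K x *\<^sub>R k x))" by (rule integrable_scaleR_right[OF locintD(2)[OF k K]])
      show "AE x in lborel. norm (indicator K x *\<^sub>R h x) \<le> norm (C *\<^sub>R (indicator K x *\<^sub>R k x))"
        by (rule AE_I2) (use b C_nonneg in \<open>auto simp: indicator_def\<close>)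
    qed measurable
  qed
  have lT: "locint U (\<lambda>x. T (F x))" by (rule bound[OF _ B(1) T_bound]) measurable
  have lD: "locint U (\<lambda>x. DT (F x) (G x))" by (rule bound[OF _ B(2) DT_bound]) measurable
  have "is_weak_partial U j (\<lambda>x. T (F x)) (\<lambda>x. DT (F x) (G x))"
  proof (subst weak_partial_borel_iff[OF U])
    show "(\<lambda>x. T (F x)) \<in> borel_measurable borel" "(\<lambda>x. DT (F x) (G x)) \<in> borel_measurable borel" by measurable
    have "(LINT x|lborel. partial j \<phi> x *\<^sub>R T (F x)) = - (LINT x|lborel. \<phi> x *\<^sub>R DT (F x) (G x))" if \<phi>: "\<phi> \<in> test_functions U" for \<phi>
      unfolding weak_partial_components_iff[OF lT lD \<phi>]
    proof
      fix b :: 'w assume b: "b \<in> Basis"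
      have wP: "(LINT x|lborel. partial j \<phi> x * P b (F x)) = - (LINT x|lborel. \<phi> x * dir_deriv (P b) (F x) (G x))"
        using weak_partial_dir_deriv(3)[OF P_convex[OF b] P_lip[OF b] U B _ \<phi>, of 1] by simp
      have wQ: "(LINT x|lborel. partial j \<phi> x * Q b (F x)) = - (LINT x|lborel. \<phi> x * dir_deriv (Q b) (F x) (G x))"
        using weak_partial_dir_deriv(3)[OF Q_convex[OF b] Q_lip[OF b] U B _ \<phi>, of 1] by simp
      have lP: "locint U (\<lambda>x. P b (F x))" using weak_partial_dir_deriv(1)[OF P_convex[OF b] P_lip[OF b] U B _ \<phi>, of 1] by simp
      have lQ: "locint U (\<lambda>x. Q b (F x))" using weak_partial_dir_deriv(1)[OF Q_convex[OF b] Q_lip[OF b] U B _ \<phi>, of 1] by simp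
      have 1: "(LINT x|lborel. partial j \<phi> x * P b (F x) - partial j \<phi> x * Q b (F x)) = (LINT x|lborel. partial j \<phi> x * P b (F x)) - (LINT x|lborel. partial j \<phi> x * Q b (F x))"
        using Bochner_Integration.integral_diff[OF test_mult_integrable(2)[OF \<phi> lP] test_mult_integrable(2)[OF \<phi> lQ]] by simp
      have 2: "(LINT x|lborel. \<phi> x * dir_deriv (P b) (F x) (G x) - \<phi> x * dir_deriv (Q b) (F x) (G x)) = (LINT x|lborel. \<phi> x * dir_deriv (P b) (F x) (G x)) - (LINT x|lborel. \<phi> x * dir_deriv (Q b) (F x) (G x))"
        using Bochner_Integration.integral_diff[OF test_mult_integrable(1)[OF \<phi> symP(2)[OF b b]] test_mult_integrable(1)[OF \<phi> symQ(2)[OF b b]]] by simp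
      show "(LINT x|lborel. partial j \<phi> x * (T (F x) \<bullet> b)) = - (LINT x|lborel. \<phi> x * (DT (F x) (G x) \<bullet> b))"
        unfolding T_eq[OF b] DT_inner[OF b] right_diff_distrib 1 2 wP wQ by simp
    qed
    then show "locint U (\<lambda>x. T (F x)) \<and> locint U (\<lambda>x. DT (F x) (G x)) \<and>
      (\<forall>\<phi>\<in>test_functions U. (LINT x|lborel. partial j \<phi> x *\<^sub>R T (F x)) = - (LINT x|lborel. \<phi> x *\<^sub>R DT (F x) (G x)))"
      using lT lD by blast
  qed
  moreover have "AE x in lborel. x \<in> U \<longrightarrow> T (f x) = T (F x)" using F(2) by eventually_elim auto
  moreover have "AE x in lborel. x \<in> U \<longrightarrow> DT (f x) (g x) = DT (F x) (G x)" using F(2,4) by eventually_elim auto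
  ultimately show "is_weak_partial U j (\<lambda>x. T (f x)) (\<lambda>x. DT (f x) (g x))" by (rule is_weak_partial_cong_AE[OF U])
qed

end

section \<open>Continuity in Sobolev spaces\<close>

lemma powr_add_le:
  fixes a b q :: real
  assumes "0 \<le> a" "0 \<le> b" "0 \<le> q"
  shows "(a + b) powr q \<le> 2 powr q * (a powr q + b powr q)"
proof -
  have "(a + b) powr q \<le> (2 * max a b) powr q" using assms by (intro powr_mono2) auto
  also have "\<dots> = 2 powr q * max a b powr q" by (rule powr_mult)
  also have "max a b powr q \<le> a powr q + b powr q" using assms by (auto simp: max_def)
  finally show ?thesis by (simp add: mult_left_mono)
qed

text \<open>Convexity of the power is invoked for positive arguments. When an argument vanishes, the
  claim reduces to \<open>s powr q \<le> s\<close> for \<open>s\<close> between 0 and 1.\<close>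

lemma powr_convex_combination:
  fixes a b t q :: real
  assumes a: "0 \<le> a" and b: "0 \<le> b" and t: "0 \<le> t" "t \<le> 1" and q: "1 \<le> q"
  shows "((1 - t) * a + t * b) powr q \<le> (1 - t) * a powr q + t * b powr q"
proof -
  have le: "s powr q \<le> s" if "0 \<le> s" "s \<le> 1" for s :: real
    using powr_mono'[of 1 q s] q that by (cases "s = 0") auto
  consider "a = 0" | "b = 0" | "0 < a" "0 < b" using a b by linarith
  then show ?thesis
  proof cases
    case 1
    have "(t * b) powr q = t powr q * b powr q" by (rule powr_mult)
    also have "\<dots> \<le> t * b powr q" using le[OF t] by (intro mult_right_mono) auto
    finally show ?thesis using 1 by simp
  next
    case 2
    have "((1 - t) * a) powr q = (1 - t) powr q * a powr q" by (rule powr_mult)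
    also have "\<dots> \<le> (1 - t) * a powr q" using le[of "1 - t"] t by (intro mult_right_mono) auto
    finally show ?thesis using 2 by simp
  next
    case 3
    then show ?thesis using convex_onD[OF powr_convex[OF q] t, of a b] by simp
  qed
qed

lemma Lq_norm_nonneg: "0 \<le> Lq_norm U q f"
  by (simp add: Lq_norm_def)

lemma Lq_spaceD:
  assumes "f \<in> Lq_space U q"
  shows "f \<in> borel_measurable (lebesgue_on U)" "integrable (lebesgue_on U) (\<lambda>x. norm (f x) powr q)"
  using assms by (auto simp: Lq_space_def)

lemma Lq_norm_powr:
  assumes "0 < q"
  shows "Lq_norm U q f powr q = (LINT x|lebesgue_on U. norm (f x) powr q)"
proof -
  have "0 \<le> (LINT x|lebesgue_on U. norm (f x) powr q)" by (intro integral_nonneg_AE) auto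
  then show ?thesis using assms by (simp add: Lq_norm_def powr_powr)
qed

lemma Lq_norm_le:
  assumes q: "0 < q" and B: "0 \<le> B" and le: "(LINT x|lebesgue_on U. norm (f x) powr q) \<le> B powr q"
  shows "Lq_norm U q f \<le> B"
proof -
  have "Lq_norm U q f powr q \<le> B powr q" using le by (simp add: Lq_norm_powr[OF q])
  then show ?thesis using q B Lq_norm_nonneg[of U q f] by (metis linorder_not_le powr_less_mono2)
qed

lemma Lq_dominated:
  fixes f :: "real ^ 'm \<Rightarrow> 'v::euclidean_space" and g :: "real ^ 'm \<Rightarrow> 'w::euclidean_space"
  assumes q: "0 < q" and f: "f \<in> borel_measurable (lebesgue_on U)" and g: "g \<in> Lq_space U q" and c: "0 \<le> c"
    and le: "AE x in lebesgue_on U. norm (f x) \<le> c * norm (g x)"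
  shows "f \<in> Lq_space U q" "Lq_norm U q f \<le> c * Lq_norm U q g"
proof -
  note [measurable] = f Lq_spaceD(1)[OF g]
  have gi: "integrable (lebesgue_on U) (\<lambda>x. c powr q * norm (g x) powr q)" using Lq_spaceD(2)[OF g] by simp
  have ae: "AE x in lebesgue_on U. norm (f x) powr q \<le> c powr q * norm (g x) powr q"
    using le
  proof eventually_elim
    case (elim x)
    have "norm (f x) powr q \<le> (c * norm (g x)) powr q" using elim q by (intro powr_mono2) auto
    then show ?case using c by (simp add: powr_mult)
  qed
  have fi: "integrable (lebesgue_on U) (\<lambda>x. norm (f x) powr q)"
  proof (rule Bochner_Integration.integrable_bound[OF gi])
    show "(\<lambda>x. norm (f x) powr q) \<in> borel_measurable (lebesgue_on U)" by measurable
    show "AE x in lebesgue_on U. norm (norm (f x) powr q) \<le> norm (c powr q * norm (g x) powr q)"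
      using ae by eventually_elim simp
  qed
  then show "f \<in> Lq_space U q" using f by (simp add: Lq_space_def)
  have "(LINT x|lebesgue_on U. norm (f x) powr q) \<le> (LINT x|lebesgue_on U. c powr q * norm (g x) powr q)"
    by (rule integral_mono_AE[OF fi gi ae])
  also have "\<dots> = (c * Lq_norm U q g) powr q"
    using c Lq_norm_nonneg[of U q g] by (simp add: powr_mult Lq_norm_powr[OF q])
  finally show "Lq_norm U q f \<le> c * Lq_norm U q g"
    using c Lq_norm_nonneg[of U q g] by (intro Lq_norm_le q) auto
qed

lemma Lq_cong_AE:
  fixes f g :: "real ^ 'm \<Rightarrow> 'v::euclidean_space"
  assumes q: "0 < q" and f: "f \<in> borel_measurable (lebesgue_on U)" and g: "g \<in> Lq_space U q"
    and ae: "AE x in lebesgue_on U. f x = g x"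
  shows "f \<in> Lq_space U q" "Lq_norm U q f = Lq_norm U q g"
proof -
  have 1: "AE x in lebesgue_on U. norm (f x) \<le> 1 * norm (g x)" using ae by eventually_elim simp
  have 2: "AE x in lebesgue_on U. norm (g x) \<le> 1 * norm (f x)" using ae by eventually_elim simp
  show fL: "f \<in> Lq_space U q" by (rule Lq_dominated(1)[OF q f g _ 1]) simp
  show "Lq_norm U q f = Lq_norm U q g"
    using Lq_dominated(2)[OF q f g _ 1] Lq_dominated(2)[OF q Lq_spaceD(1)[OF g] fL _ 2] by simp
qed

text \<open>Write the sum of the norms at \<open>x\<close> as \<alpha> + \<beta> times a convex
  combination of the normalized norms, with weights proportional to \<alpha> and \<beta>. Convexity
  of the power then gives the bound after integration, with no conjugate exponent.\<close>

lemma Lq_minkowski: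
  fixes f g :: "real ^ 'm \<Rightarrow> 'v::euclidean_space"
  assumes q: "1 \<le> q" and f: "f \<in> Lq_space U q" and g: "g \<in> Lq_space U q"
  shows "(\<lambda>x. f x + g x) \<in> Lq_space U q" "Lq_norm U q (\<lambda>x. f x + g x) \<le> Lq_norm U q f + Lq_norm U q g"
proof -
  have q0: "0 < q" using q by simp
  note [measurable] = Lq_spaceD(1)[OF f] Lq_spaceD(1)[OF g]
  note fi = Lq_spaceD(2)[OF f] and gi = Lq_spaceD(2)[OF g]
  have I: "integrable (lebesgue_on U) (\<lambda>x. 2 powr q * (norm (f x) powr q + norm (g x) powr q))"
    using fi gi by simp
  have si: "integrable (lebesgue_on U) (\<lambda>x. norm (f x + g x) powr q)"
  proof (rule Bochner_Integration.integrable_bound[OF I])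
    show "AE x in lebesgue_on U. norm (norm (f x + g x) powr q) \<le> norm (2 powr q * (norm (f x) powr q + norm (g x) powr q))"
    proof (rule AE_I2)
      fix x
      have "norm (f x + g x) powr q \<le> (norm (f x) + norm (g x)) powr q"
        using q0 by (intro powr_mono2 norm_triangle_ineq) auto
      also have "\<dots> \<le> 2 powr q * (norm (f x) powr q + norm (g x) powr q)" using q0 by (intro powr_add_le) auto
      finally show "norm (norm (f x + g x) powr q) \<le> norm (2 powr q * (norm (f x) powr q + norm (g x) powr q))" by simp
    qed
  qed measurable
  then show "(\<lambda>x. f x + g x) \<in> Lq_space U q" by (simp add: Lq_space_def)
  show "Lq_norm U q (\<lambda>x. f x + g x) \<le> Lq_norm U q f + Lq_norm U q g"
  proof (rule field_le_epsilon)
    fix e :: real assume e: "0 < e"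
    \<comment> \<open>The extra \<open>e / 2\<close> keeps the normalizing constants positive even
      when a norm is 0.\<close>
    define \<alpha> \<beta> where "\<alpha> = Lq_norm U q f + e / 2" and "\<beta> = Lq_norm U q g + e / 2"
    have p: "0 < \<alpha>" "0 < \<beta>" using e Lq_norm_nonneg[of U q f] Lq_norm_nonneg[of U q g] by (simp_all add: \<alpha>_def \<beta>_def add_nonneg_pos)
    define t where "t = \<beta> / (\<alpha> + \<beta>)"
    have t: "0 \<le> t" "t \<le> 1" "1 - t = \<alpha> / (\<alpha> + \<beta>)" using p by (simp_all add: t_def field_simps)
    define A B where "A = (\<alpha> + \<beta>) powr q * (1 - t) / \<alpha> powr q" and "B = (\<alpha> + \<beta>) powr q * t / \<beta> powr q"
    have AB: "0 \<le> A" "0 \<le> B" using t(1,2) by (simp_all add: A_def B_def)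
    have pt: "norm (f x + g x) powr q \<le> A * norm (f x) powr q + B * norm (g x) powr q" for x
    proof -
      have "norm (f x) + norm (g x) = (\<alpha> + \<beta>) * ((1 - t) * (norm (f x) / \<alpha>) + t * (norm (g x) / \<beta>))"
      proof -
        have "(\<alpha> + \<beta>) * (1 - t) = \<alpha>" "(\<alpha> + \<beta>) * t = \<beta>" using p unfolding t(3) by (simp_all add: t_def)
        then show ?thesis using p by (simp only: distrib_left mult.assoc[symmetric]) simp
      qed
      then have "norm (f x + g x) powr q \<le> ((\<alpha> + \<beta>) * ((1 - t) * (norm (f x) / \<alpha>) + t * (norm (g x) / \<beta>))) powr q"
        using q0 norm_triangle_ineq[of "f x" "g x"] by (intro powr_mono2) auto
      also have "\<dots> = (\<alpha> + \<beta>) powr q * ((1 - t) * (norm (f x) / \<alpha>) + t * (norm (g x) / \<beta>)) powr q"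
        by (rule powr_mult)
      also have "\<dots> \<le> (\<alpha> + \<beta>) powr q * ((1 - t) * (norm (f x) / \<alpha>) powr q + t * (norm (g x) / \<beta>) powr q)"
        using p t q by (intro mult_left_mono powr_convex_combination) auto
      also have "\<dots> = A * norm (f x) powr q + B * norm (g x) powr q"
        using p by (simp add: A_def B_def powr_divide distrib_left mult.assoc)
      finally show ?thesis .
    qed
    have "(LINT x|lebesgue_on U. norm (f x + g x) powr q) \<le> (LINT x|lebesgue_on U. A * norm (f x) powr q + B * norm (g x) powr q)"
      by (rule integral_mono[OF si _ pt]) (use fi gi in simp)
    also have "\<dots> = A * Lq_norm U q f powr q + B * Lq_norm U q g powr q"
      using fi gi by (simp add: Lq_norm_powr[OF q0])
    also have "\<dots> \<le> A * \<alpha> powr q + B * \<beta> powr q"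
      using AB e q0 Lq_norm_nonneg[of U q f] Lq_norm_nonneg[of U q g]
      by (intro add_mono mult_left_mono powr_mono2) (auto simp: \<alpha>_def \<beta>_def)
    also have "\<dots> = (\<alpha> + \<beta>) powr q"
    proof -
      have "\<alpha> powr q \<noteq> 0" "\<beta> powr q \<noteq> 0" using p by simp_all
      then have "A * \<alpha> powr q = (\<alpha> + \<beta>) powr q * (1 - t)" "B * \<beta> powr q = (\<alpha> + \<beta>) powr q * t"
        by (simp_all add: A_def B_def)
      then show ?thesis by (simp add: right_diff_distrib)
    qed
    finally have "Lq_norm U q (\<lambda>x. f x + g x) \<le> \<alpha> + \<beta>" using p by (intro Lq_norm_le q0) auto
    then show "Lq_norm U q (\<lambda>x. f x + g x) \<le> Lq_norm U q f + Lq_norm U q g + e" by (simp add: \<alpha>_def \<beta>_def)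
  qed
qed

lemma Lq_uminus:
  fixes f :: "real ^ 'm \<Rightarrow> 'v::euclidean_space"
  assumes f: "f \<in> Lq_space U q"
  shows "(\<lambda>x. - f x) \<in> Lq_space U q" "Lq_norm U q (\<lambda>x. - f x) = Lq_norm U q f"
  using f by (auto simp: Lq_space_def Lq_norm_def)

lemma Lq_diff:
  fixes f g :: "real ^ 'm \<Rightarrow> 'v::euclidean_space"
  assumes q: "1 \<le> q" and f: "f \<in> Lq_space U q" and g: "g \<in> Lq_space U q"
  shows "(\<lambda>x. f x - g x) \<in> Lq_space U q"
  using Lq_minkowski(1)[OF q f Lq_uminus(1)[OF g]] by simp

text \<open>\<open>weak_partial\<close> is an arbitrary choice; almost everywhere uniqueness
  transfers integrability from the witness in the definition of the space to the chosen
  derivative.\<close>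

lemma sobolevD:
  fixes f :: "real ^ 'm \<Rightarrow> 'v::euclidean_space"
  assumes U: "open U" and q: "0 < q" and f: "f \<in> sobolev_space U q"
  shows "f \<in> Lq_space U q" "is_weak_partial U j f (weak_partial U j f)" "weak_partial U j f \<in> Lq_space U q"
proof -
  show "f \<in> Lq_space U q" using f by (simp add: sobolev_space_def)
  obtain g where g: "g \<in> Lq_space U q" "is_weak_partial U j f g" using f unfolding sobolev_space_def by blast
  show w: "is_weak_partial U j f (weak_partial U j f)" unfolding weak_partial_def by (rule someI[where P = "is_weak_partial U j f", OF g(2)])
  have m: "weak_partial U j f \<in> borel_measurable (lebesgue_on U)"
    using w by (intro locally_integrable_measurable[OF U]) (simp add: is_weak_partial_def)
  have "AE x in lebesgue_on U. weak_partial U j f x = g x"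
    using is_weak_partial_unique[OF U w g(2)] AE_lebesgue_on_iff[OF borel_open[OF U]] by blast
  then show "weak_partial U j f \<in> Lq_space U q" by (rule Lq_cong_AE(1)[OF q m g(1)])
qed

lemma weak_partial_eq_AE:
  fixes f g :: "real ^ 'm \<Rightarrow> 'v::euclidean_space"
  assumes U: "open U" and w: "is_weak_partial U j f g"
  shows "AE x in lebesgue_on U. weak_partial U j f x = g x"
proof -
  have "is_weak_partial U j f (weak_partial U j f)" unfolding weak_partial_def by (rule someI[where P = "is_weak_partial U j f", OF w])
  then show ?thesis using is_weak_partial_unique[OF U _ w] AE_lebesgue_on_iff[OF borel_open[OF U]] by blast
qed

lemma sobolev_diff:
  fixes f g :: "real ^ 'm \<Rightarrow> 'v::euclidean_space"
  assumes U: "open U" and q: "1 \<le> q" and f: "f \<in> sobolev_space U q" and g: "g \<in> sobolev_space U q"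
  shows "(\<lambda>x. f x - g x) \<in> sobolev_space U q"
    "AE x in lebesgue_on U. weak_partial U j (\<lambda>x. f x - g x) x = weak_partial U j f x - weak_partial U j g x"
proof -
  have q0: "0 < q" using q by simp
  note f' = sobolevD[OF U q0 f] and g' = sobolevD[OF U q0 g]
  have w: "is_weak_partial U j (\<lambda>x. f x - g x) (\<lambda>x. weak_partial U j f x - weak_partial U j g x)" for j
    by (rule is_weak_partial_diff[OF U f'(2) g'(2)])
  show "(\<lambda>x. f x - g x) \<in> sobolev_space U q"
    unfolding sobolev_space_def using Lq_diff[OF q f'(1) g'(1)] Lq_diff[OF q f'(3) g'(3)] w by blast
  show "AE x in lebesgue_on U. weak_partial U j (\<lambda>x. f x - g x) x = weak_partial U j f x - weak_partial U j g x"
    by (rule weak_partial_eq_AE[OF U w])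
qed

lemma sobolev_norm_triangle:
  fixes f g h :: "real ^ 'm \<Rightarrow> 'v::euclidean_space"
  assumes U: "open U" and q: "1 \<le> q" and fgh: "f \<in> sobolev_space U q" "g \<in> sobolev_space U q" "h \<in> sobolev_space U q"
  shows "sobolev_norm U q (\<lambda>x. f x - h x) \<le> sobolev_norm U q (\<lambda>x. f x - g x) + sobolev_norm U q (\<lambda>x. g x - h x)"
proof -
  have q0: "0 < q" using q by simp
  note fg = sobolev_diff[OF U q fgh(1,2)] and gh = sobolev_diff[OF U q fgh(2,3)] and fh = sobolev_diff[OF U q fgh(1,3)]
  note fg' = sobolevD[OF U q0 fg(1)] and gh' = sobolevD[OF U q0 gh(1)] and fh' = sobolevD[OF U q0 fh(1)]
  have 1: "Lq_norm U q (\<lambda>x. f x - h x) \<le> Lq_norm U q (\<lambda>x. f x - g x) + Lq_norm U q (\<lambda>x. g x - h x)"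
    using Lq_minkowski(2)[OF q fg'(1) gh'(1)] by simp
  have 2: "Lq_norm U q (weak_partial U j (\<lambda>x. f x - h x)) \<le> Lq_norm U q (weak_partial U j (\<lambda>x. f x - g x)) + Lq_norm U q (weak_partial U j (\<lambda>x. g x - h x))" for j
  proof -
    have "AE x in lebesgue_on U. weak_partial U j (\<lambda>x. f x - h x) x = weak_partial U j (\<lambda>x. f x - g x) x + weak_partial U j (\<lambda>x. g x - h x) x"
      using fg(2)[of j] gh(2)[of j] fh(2)[of j] by eventually_elim simp
    then have "Lq_norm U q (weak_partial U j (\<lambda>x. f x - h x)) = Lq_norm U q (\<lambda>x. weak_partial U j (\<lambda>x. f x - g x) x + weak_partial U j (\<lambda>x. g x - h x) x)"
      by (rule Lq_cong_AE(2)[OF q0 Lq_spaceD(1)[OF fh'(3)] Lq_minkowski(1)[OF q fg'(3) gh'(3)]])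
    then show ?thesis using Lq_minkowski(2)[OF q fg'(3)[of j] gh'(3)[of j]] by simp
  qed
  have "(\<Sum>j\<in>UNIV. Lq_norm U q (weak_partial U j (\<lambda>x. f x - h x)))
    \<le> (\<Sum>j\<in>UNIV. Lq_norm U q (weak_partial U j (\<lambda>x. f x - g x)) + Lq_norm U q (weak_partial U j (\<lambda>x. g x - h x)))"
    by (rule sum_mono) (rule 2)
  then show ?thesis using 1 by (simp add: sobolev_norm_def sum.distrib)
qed

lemma sobolev_norm_zero:
  fixes f :: "real ^ 'm \<Rightarrow> 'v::euclidean_space"
  assumes U: "open U" and q: "1 \<le> q" and f: "f \<in> sobolev_space U q"
  shows "sobolev_norm U q (\<lambda>x. f x - f x) = 0"
proof -
  have q0: "0 < q" using q by simp
  note ff = sobolev_diff[OF U q f f]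
  have z: "(\<lambda>x. 0 :: 'v) \<in> Lq_space U q" using q0 by (simp add: Lq_space_def)
  have z0: "Lq_norm U q (\<lambda>x. 0 :: 'v) = 0" using q0 by (simp add: Lq_norm_def)
  have "AE x in lebesgue_on U. weak_partial U j (\<lambda>x. f x - f x) x = 0" for j using ff(2)[of j] by simp
  then have "Lq_norm U q (weak_partial U j (\<lambda>x. f x - f x)) = 0" for j
    using Lq_cong_AE(2)[OF q0 Lq_spaceD(1)[OF sobolevD(3)[OF U q0 ff(1)]] z] z0 by metis
  then show ?thesis using z0 by (simp add: sobolev_norm_def)
qed

lemma sobolev_norm_ge:
  "Lq_norm U q f \<le> sobolev_norm U q f" "Lq_norm U q (weak_partial U j f) \<le> sobolev_norm U q f"
proof -
  have s: "0 \<le> (\<Sum>j\<in>UNIV. Lq_norm U q (weak_partial U j f))" by (intro sum_nonneg Lq_norm_nonneg)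
  then show "Lq_norm U q f \<le> sobolev_norm U q f" by (simp add: sobolev_norm_def)
  have "Lq_norm U q (weak_partial U j f) \<le> (\<Sum>j\<in>UNIV. Lq_norm U q (weak_partial U j f))"
    by (rule member_le_sum) (auto simp: Lq_norm_nonneg)
  then show "Lq_norm U q (weak_partial U j f) \<le> sobolev_norm U q f"
    using Lq_norm_nonneg[of U q f] by (simp add: sobolev_norm_def)
qed

text \<open>The pointwise sum \<open>S\<close> has finite integral by monotone convergence. It is
  therefore finite almost everywhere, which makes the terms tend to 0, and it dominates every
  term.\<close>

lemma summable_integrals_AE:
  fixes F :: "nat \<Rightarrow> 'a \<Rightarrow> real"
  assumes F: "\<And>n. integrable M (F n)" "\<And>n x. 0 \<le> F n x" and le: "\<And>n. (LINT x|M. F n x) \<le> (1 / 2) ^ n"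
  obtains G where "integrable M G" "AE x in M. (\<lambda>n. F n x) \<longlonglongrightarrow> 0 \<and> (\<forall>n. F n x \<le> G x)"
proof -
  have [measurable]: "F n \<in> borel_measurable M" for n using F(1) by simp
  define S where "S x = (\<Sum>n. ennreal (F n x))" for x
  have Sm[measurable]: "S \<in> borel_measurable M" unfolding S_def by measurable
  have "(\<integral>\<^sup>+x. S x \<partial>M) = (\<Sum>n. \<integral>\<^sup>+x. ennreal (F n x) \<partial>M)" unfolding S_def by (rule nn_integral_suminf) measurable
  also have "\<dots> = (\<Sum>n. ennreal (LINT x|M. F n x))"
    using F by (intro suminf_cong nn_integral_eq_integral) auto
  also have "\<dots> \<le> (\<Sum>n. ennreal ((1 / 2) ^ n))" using le by (intro suminf_le ennreal_leI) auto
  also have "\<dots> = ennreal (\<Sum>n. (1 / 2) ^ n)" by (rule suminf_ennreal2) (auto simp: summable_geometric)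
  also have "\<dots> < \<infinity>" by simp
  finally have fin: "(\<integral>\<^sup>+x. S x \<partial>M) < \<infinity>" .
  have ae: "AE x in M. S x \<noteq> \<infinity>" using fin by (intro nn_integral_PInf_AE) auto
  define G where "G x = enn2real (S x)" for x
  have "integrable M G"
  proof (rule integrableI_bounded)
    show "G \<in> borel_measurable M" unfolding G_def by measurable
    have "(\<integral>\<^sup>+x. ennreal (norm (G x)) \<partial>M) \<le> (\<integral>\<^sup>+x. S x \<partial>M)"
      by (rule nn_integral_mono) (simp add: G_def ennreal_enn2real_if)
    then show "(\<integral>\<^sup>+x. ennreal (norm (G x)) \<partial>M) < \<infinity>" using fin by (rule le_less_trans)
  qed
  moreover have "AE x in M. (\<lambda>n. F n x) \<longlonglongrightarrow> 0 \<and> (\<forall>n. F n x \<le> G x)"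
    using ae
  proof eventually_elim
    case (elim x)
    have "summable (\<lambda>n. F n x)" using elim F(2) unfolding S_def by (intro summable_suminf_not_top) auto
    moreover have "F n x \<le> G x" for n
    proof -
      have "ennreal (F n x) \<le> S x" unfolding S_def using sum_le_suminf[of "\<lambda>n. ennreal (F n x)" "{n}"] by simp
      then have "enn2real (ennreal (F n x)) \<le> enn2real (S x)" using elim by (intro enn2real_mono) (auto simp: less_top)
      then show ?thesis using F(2)[of n x] by (simp add: G_def)
    qed
    ultimately show ?case using summable_LIMSEQ_zero by blast
  qed
  ultimately show ?thesis by (rule that)
qed

section \<open>Topologies generated by seminorm balls\<close>

lemma seminorm_topology_ball:
  "f \<in> S \<Longrightarrow> 0 < r \<Longrightarrow> openin (seminorm_topology S N) {g \<in> S. N (\<lambda>x. g x - f x) < r}"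
  unfolding seminorm_topology_def by (rule topology_generated_by_Basis) blast

lemma seminorm_topology_topspace:
  assumes "\<And>f. f \<in> S \<Longrightarrow> N (\<lambda>x. f x - f x) = 0"
  shows "topspace (seminorm_topology S N) = S"
proof
  show "topspace (seminorm_topology S N) \<subseteq> S"
    unfolding seminorm_topology_def topology_generated_by_topspace by blast
  show "S \<subseteq> topspace (seminorm_topology S N)"
  proof
    fix f assume f: "f \<in> S"
    then have "f \<in> {g \<in> S. N (\<lambda>x. g x - f x) < 1}" using assms by simp
    then show "f \<in> topspace (seminorm_topology S N)"
      using openin_subset[OF seminorm_topology_ball[OF f zero_less_one, of N]] by blast
  qed
qed

text \<open>Generating balls are centred at arbitrary points. The triangle inequality recentres a
  ball at the image point, with radius \<open>e\<close>, so that continuity need only be checked for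
  balls around the images \<open>T a\<close>.\<close>

lemma seminorm_topology_continuous_map:
  fixes S :: "('a \<Rightarrow> 'v::ab_group_add) set" and S' :: "('b \<Rightarrow> 'w::ab_group_add) set"
  assumes maps: "\<And>f. f \<in> S \<Longrightarrow> T f \<in> S'"
    and N0: "\<And>f. f \<in> S \<Longrightarrow> N (\<lambda>x. f x - f x) = 0" and N0': "\<And>f. f \<in> S' \<Longrightarrow> N' (\<lambda>x. f x - f x) = 0"
    and tri: "\<And>f g h. f \<in> S' \<Longrightarrow> g \<in> S' \<Longrightarrow> h \<in> S' \<Longrightarrow> N' (\<lambda>x. f x - h x) \<le> N' (\<lambda>x. f x - g x) + N' (\<lambda>x. g x - h x)"
    and cont: "\<And>f e. f \<in> S \<Longrightarrow> 0 < e \<Longrightarrow> \<exists>\<delta>>0. \<forall>g\<in>S. N (\<lambda>x. g x - f x) < \<delta> \<longrightarrow> N' (\<lambda>x. T g x - T f x) < e"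
  shows "continuous_map (seminorm_topology S N) (seminorm_topology S' N') T"
proof -
  show ?thesis
    unfolding seminorm_topology_def[of S' N']
  proof (rule continuous_on_generated_topo)
    have tS: "topspace (seminorm_topology S N) = S" by (rule seminorm_topology_topspace) (rule N0)
    show "T ` topspace (seminorm_topology S N) \<subseteq> \<Union>{{g \<in> S'. N' (\<lambda>x. g x - f x) < r} | f r. f \<in> S' \<and> 0 < r}"
      unfolding tS
    proof
      fix h assume "h \<in> T ` S"
      then have h: "h \<in> S'" using maps by auto
      then have "h \<in> {g \<in> S'. N' (\<lambda>x. g x - h x) < 1}" using N0' by simp
      moreover have "{g \<in> S'. N' (\<lambda>x. g x - h x) < 1} \<in> {{g \<in> S'. N' (\<lambda>x. g x - f x) < r} | f r. f \<in> S' \<and> 0 < r}"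
        using h zero_less_one by blast
      ultimately show "h \<in> \<Union>{{g \<in> S'. N' (\<lambda>x. g x - f x) < r} | f r. f \<in> S' \<and> 0 < r}" by (rule UnionI[rotated])
    qed
    fix B assume "B \<in> {{g \<in> S'. N' (\<lambda>x. g x - f x) < r} | f r. f \<in> S' \<and> 0 < r}"
    then obtain f r where B: "B = {g \<in> S'. N' (\<lambda>x. g x - f x) < r}" and f: "f \<in> S'" "0 < r" by blast
    show "openin (seminorm_topology S N) (T -` B \<inter> topspace (seminorm_topology S N))"
      unfolding tS
    proof (subst openin_subopen, intro ballI)
      fix a assume a: "a \<in> T -` B \<inter> S"
      define e where "e = r - N' (\<lambda>x. T a x - f x)"
      have aS: "a \<in> S" and "N' (\<lambda>x. T a x - f x) < r" using a by (auto simp: B)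
      then have e: "0 < e" by (simp add: e_def)
      obtain \<delta> where \<delta>: "\<delta> > 0" "\<And>g. g \<in> S \<Longrightarrow> N (\<lambda>x. g x - a x) < \<delta> \<Longrightarrow> N' (\<lambda>x. T g x - T a x) < e"
        using cont[OF aS e] by blast
      have "{g \<in> S. N (\<lambda>x. g x - a x) < \<delta>} \<subseteq> T -` B \<inter> S"
      proof
        fix g assume "g \<in> {g \<in> S. N (\<lambda>x. g x - a x) < \<delta>}"
        then have g: "g \<in> S" "N (\<lambda>x. g x - a x) < \<delta>" by auto
        have "N' (\<lambda>x. T g x - f x) \<le> N' (\<lambda>x. T g x - T a x) + N' (\<lambda>x. T a x - f x)"
          by (rule tri[OF maps[OF g(1)] maps[OF aS] f(1)])
        also have "\<dots> < r" using \<delta>(2)[OF g] by (simp add: e_def)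
        finally show "g \<in> T -` B \<inter> S" using g maps by (simp add: B)
      qed
      moreover have "a \<in> {g \<in> S. N (\<lambda>x. g x - a x) < \<delta>}" using aS N0 \<delta>(1) by simp
      ultimately show "\<exists>O'. openin (seminorm_topology S N) O' \<and> a \<in> O' \<and> O' \<subseteq> T -` B \<inter> S"
        using seminorm_topology_ball[OF aS \<delta>(1), of N] by blast
    qed
  qed
qed

text \<open>Induction over the generation of the topology, the triangle inequality again recentring
  generating balls. It extracts a quantitative statement from openness, as is needed to refute
  continuity.\<close>

lemma seminorm_topology_openD:
  fixes S :: "('a \<Rightarrow> 'v::ab_group_add) set"
  assumes tri: "\<And>f g h. f \<in> S \<Longrightarrow> g \<in> S \<Longrightarrow> h \<in> S \<Longrightarrow> N (\<lambda>x. f x - h x) \<le> N (\<lambda>x. f x - g x) + N (\<lambda>x. g x - h x)"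
    and V: "openin (seminorm_topology S N) V" and f: "f \<in> V" "f \<in> S"
  shows "\<exists>r>0. {g \<in> S. N (\<lambda>x. g x - f x) < r} \<subseteq> V"
proof -
  let ?B = "{{g \<in> S. N (\<lambda>x. g x - f x) < r} | f r. f \<in> S \<and> 0 < r}"
  have "generate_topology_on ?B V" using V by (simp only: seminorm_topology_def openin_topology_generated_by_iff)
  then have "f \<in> V \<longrightarrow> (\<exists>r>0. {g \<in> S. N (\<lambda>x. g x - f x) < r} \<subseteq> V)"
  proof induction
    case Empty
    show ?case by simp
  next
    case (Int V W)
    show ?case
    proof
      assume "f \<in> V \<inter> W"
      then obtain r s where r: "0 < r" "{g \<in> S. N (\<lambda>x. g x - f x) < r} \<subseteq> V" "0 < s" "{g \<in> S. N (\<lambda>x. g x - f x) < s} \<subseteq> W"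
        using Int.IH by blast
      have "{g \<in> S. N (\<lambda>x. g x - f x) < min r s} \<subseteq> V \<inter> W"
      proof
        fix g assume g: "g \<in> {g \<in> S. N (\<lambda>x. g x - f x) < min r s}"
        have "g \<in> V" by (rule subsetD[OF r(2)]) (use g in simp)
        moreover have "g \<in> W" by (rule subsetD[OF r(4)]) (use g in simp)
        ultimately show "g \<in> V \<inter> W" by simp
      qed
      moreover have "0 < min r s" using r by simp
      ultimately show "\<exists>r>0. {g \<in> S. N (\<lambda>x. g x - f x) < r} \<subseteq> V \<inter> W" by blast
    qed
  next
    case (UN K)
    show ?case
    proof
      assume "f \<in> \<Union>K"
      then obtain k where k: "k \<in> K" "f \<in> k" by blast
      then obtain r where "0 < r" "{g \<in> S. N (\<lambda>x. g x - f x) < r} \<subseteq> k" using UN.IH[OF k(1)] by blast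
      then show "\<exists>r>0. {g \<in> S. N (\<lambda>x. g x - f x) < r} \<subseteq> \<Union>K" using Union_upper[OF k(1)] order_trans by blast
    qed
  next
    case (Basis V)
    then obtain h r where h: "V = {g \<in> S. N (\<lambda>x. g x - h x) < r}" "h \<in> S" by blast
    show ?case
    proof
      assume "f \<in> V"
      then have pos: "0 < r - N (\<lambda>x. f x - h x)" by (simp add: h)
      have "{g \<in> S. N (\<lambda>x. g x - f x) < r - N (\<lambda>x. f x - h x)} \<subseteq> V"
      proof
        fix g assume "g \<in> {g \<in> S. N (\<lambda>x. g x - f x) < r - N (\<lambda>x. f x - h x)}"
        then have g: "g \<in> S" "N (\<lambda>x. g x - f x) < r - N (\<lambda>x. f x - h x)" by simp_all
        show "g \<in> V" using tri[OF g(1) f(2) h(2)] g by (simp add: h)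
      qed
      with pos show "\<exists>r>0. {g \<in> S. N (\<lambda>x. g x - f x) < r} \<subseteq> V" by blast
    qed
  qed
  then show ?thesis using f(1) by blast
qed

lemma seminorm_topology_limitin:
  fixes S :: "('a \<Rightarrow> 'v::ab_group_add) set"
  assumes N0: "\<And>f. f \<in> S \<Longrightarrow> N (\<lambda>x. f x - f x) = 0" and lim: "limitin (seminorm_topology S N) A f F" and e: "0 < e"
  shows "f \<in> S" "\<forall>\<^sub>F n in F. N (\<lambda>x. A n x - f x) < e"
proof -
  have "f \<in> topspace (seminorm_topology S N)" using lim by (rule limitin_topspace)
  then show f: "f \<in> S" unfolding seminorm_topology_def topology_generated_by_topspace by blast
  have "f \<in> {g \<in> S. N (\<lambda>x. g x - f x) < e}" using f e N0 by simp
  with lim seminorm_topology_ball[OF f e, of N]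
  have "\<forall>\<^sub>F n in F. A n \<in> {g \<in> S. N (\<lambda>x. g x - f x) < e}" unfolding limitin_def by blast
  then show "\<forall>\<^sub>F n in F. N (\<lambda>x. A n x - f x) < e" by eventually_elim simp
qed

section \<open>Continuity of composition between Sobolev spaces\<close>

context dc_map
begin

lemma sobolev_space_compose:
  fixes f :: "real ^ 'm \<Rightarrow> 'v"
  assumes U: "open U" and q: "1 \<le> q" and f: "f \<in> sobolev_space U q"
  shows "(\<lambda>x. T (f x)) \<in> sobolev_space U q"
proof -
  have q0: "0 < q" using q by simp
  note f' = sobolevD[OF U q0 f]
  have "(\<lambda>x. T (f x)) \<in> borel_measurable (lebesgue_on U)"
    by (rule measurable_compose[OF Lq_spaceD(1)[OF f'(1)] borel_measurable_continuous_onI[OF T_continuous]])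
  then have 1: "(\<lambda>x. T (f x)) \<in> Lq_space U q"
    by (rule Lq_dominated(1)[OF q0 _ f'(1) C_nonneg]) (intro AE_I2 T_bound)
  have "(\<lambda>x. DT (f x) (weak_partial U j f x)) \<in> Lq_space U q" for j
  proof (rule Lq_dominated(1)[OF q0 _ f'(3)[of j] C_nonneg])
    show "(\<lambda>x. DT (f x) (weak_partial U j f x)) \<in> borel_measurable (lebesgue_on U)"
      using chain_rule(2)[OF U f'(2)] by (intro locally_integrable_measurable[OF U]) (simp add: is_weak_partial_def)
  qed (intro AE_I2 DT_bound)
  then show ?thesis using 1 chain_rule(2)[OF U f'(2)] unfolding sobolev_space_def by blast
qed

text \<open>A sequence converging faster than \<open>2\<^bsup>-n\<^esup>\<close> converges almost everywhere with an integrable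
  majorant, without passing to a subsequence; then dominated convergence applies.\<close>

lemma sobolev_norm_continuous:
  fixes f :: "real ^ 'm \<Rightarrow> 'v"
  assumes U: "open U" and q: "1 \<le> q" and f: "f \<in> sobolev_space U q" and e: "0 < e"
  shows "\<exists>\<delta>>0. \<forall>g\<in>sobolev_space U q. sobolev_norm U q (\<lambda>x. g x - f x) < \<delta> \<longrightarrow> sobolev_norm U q (\<lambda>x. T (g x) - T (f x)) < e"
proof (rule ccontr)
  assume neg: "\<not> ?thesis"
  have q0: "0 < q" using q by simp
  let ?M = "lebesgue_on U"
  have "\<exists>g\<in>sobolev_space U q. sobolev_norm U q (\<lambda>x. g x - f x) < (1 / 2) ^ n \<and> \<not> sobolev_norm U q (\<lambda>x. T (g x) - T (f x)) < e" for n :: nat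
  proof -
    have "0 < (1 / 2 :: real) ^ n" by simp
    then show ?thesis using neg by blast
  qed
  then obtain g where g: "\<And>n. g n \<in> sobolev_space U q" "\<And>n. sobolev_norm U q (\<lambda>x. g n x - f x) < (1 / 2) ^ n"
    "\<And>n. \<not> sobolev_norm U q (\<lambda>x. T (g n x) - T (f x)) < e" by metis
  note f' = sobolevD[OF U q0 f] and g' = sobolevD[OF U q0 g(1)]
  note Tf = sobolev_space_compose[OF U q f] and Tg = sobolev_space_compose[OF U q g(1)]
  \<comment> \<open>A norm at most \<open>(1 / 2) ^ n\<close> has a \<open>q\<close>-th power
    bounded by the same number, since \<open>q\<close> is at least 1 and the base at most 1.\<close>
  have half: "(LINT x|?M. norm (h x) powr q) \<le> (1 / 2) ^ n" if h: "Lq_norm U q h \<le> (1 / 2) ^ n" for h :: "real ^ 'm \<Rightarrow> 'v" and n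
  proof -
    have "(LINT x|?M. norm (h x) powr q) = Lq_norm U q h powr q" by (simp add: Lq_norm_powr[OF q0])
    also have "\<dots> \<le> ((1 / 2) ^ n) powr q" using q0 h Lq_norm_nonneg by (intro powr_mono2) auto
    also have "\<dots> \<le> ((1 / 2) ^ n) powr 1" using q by (intro powr_mono') (auto simp: power_le_one)
    finally show ?thesis by simp
  qed
  have small: "Lq_norm U q (\<lambda>x. g n x - f x) \<le> (1 / 2) ^ n" "Lq_norm U q (weak_partial U j (\<lambda>x. g n x - f x)) \<le> (1 / 2) ^ n" for n j
    using sobolev_norm_ge(1)[of U q "\<lambda>x. g n x - f x"] sobolev_norm_ge(2)[of U q j "\<lambda>x. g n x - f x"] g(2)[of n] by linarith+
  have gf: "(\<lambda>x. g n x - f x) \<in> sobolev_space U q" for n by (rule sobolev_diff(1)[OF U q g(1) f])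
  note gf' = sobolevD[OF U q0 gf]
  have pow0: "v \<longlonglongrightarrow> w" if "(\<lambda>n. norm (v n - w) powr q) \<longlonglongrightarrow> 0" for v :: "nat \<Rightarrow> 'v" and w
  proof -
    have "(\<lambda>n. (norm (v n - w) powr q) powr (1 / q)) \<longlonglongrightarrow> 0"
      by (rule tendsto_zero_powrI[OF that tendsto_const]) (use q0 in auto)
    then have "(\<lambda>n. norm (v n - w)) \<longlonglongrightarrow> 0" using q0 by (simp add: powr_powr)
    then show ?thesis by (rule LIM_zero_cancel[OF tendsto_norm_zero_cancel])
  qed
  obtain G0 where G0: "integrable ?M G0" "AE x in ?M. (\<lambda>n. norm (g n x - f x) powr q) \<longlonglongrightarrow> 0 \<and> (\<forall>n. norm (g n x - f x) powr q \<le> G0 x)"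
    by (rule summable_integrals_AE[OF Lq_spaceD(2)[OF gf'(1)] _ half[OF small(1)]]) auto
  have Tpart: "(\<lambda>n. Lq_norm U q (\<lambda>x. T (g n x) - T (f x))) \<longlonglongrightarrow> 0"
  proof (rule tendsto_sandwich[OF _ _ tendsto_const])
    show "\<forall>\<^sub>F n in sequentially. 0 \<le> Lq_norm U q (\<lambda>x. T (g n x) - T (f x))" by (simp add: Lq_norm_nonneg)
    have "Lq_norm U q (\<lambda>x. T (g n x) - T (f x)) \<le> C * (1 / 2) ^ n" for n
    proof -
      have "Lq_norm U q (\<lambda>x. T (g n x) - T (f x)) \<le> C * Lq_norm U q (\<lambda>x. g n x - f x)"
        by (rule Lq_dominated(2)[OF q0 Lq_spaceD(1)[OF sobolevD(1)[OF U q0 sobolev_diff(1)[OF U q Tg Tf]]] gf'(1) C_nonneg])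
          (intro AE_I2 T_lip)
      also have "\<dots> \<le> C * (1 / 2) ^ n" by (intro mult_left_mono small C_nonneg)
      finally show ?thesis .
    qed
    then show "\<forall>\<^sub>F n in sequentially. Lq_norm U q (\<lambda>x. T (g n x) - T (f x)) \<le> C * (1 / 2) ^ n" by simp
    have "(\<lambda>n. C * (1 / 2) ^ n) \<longlonglongrightarrow> C * 0" by (intro tendsto_mult tendsto_const LIMSEQ_power_zero) simp
    then show "(\<lambda>n. C * (1 / 2) ^ n) \<longlonglongrightarrow> 0" by simp
  qed
  have Dpart: "(\<lambda>n. Lq_norm U q (weak_partial U j (\<lambda>x. T (g n x) - T (f x)))) \<longlonglongrightarrow> 0" for j
  proof -
    define a where "a n = weak_partial U j (\<lambda>x. g n x - f x)" for n
    define r where "r n = weak_partial U j (\<lambda>x. T (g n x) - T (f x))" for n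
    have Fi: "integrable ?M (\<lambda>x. norm (a n x) powr q)" for n unfolding a_def by (rule Lq_spaceD(2)[OF gf'(3)])
    have Fl: "(LINT x|?M. norm (a n x) powr q) \<le> (1 / 2) ^ n" for n unfolding a_def by (rule half[OF small(2)])
    obtain G where G: "integrable ?M G" "AE x in ?M. (\<lambda>n. norm (a n x) powr q) \<longlonglongrightarrow> 0 \<and> (\<forall>n. norm (a n x) powr q \<le> G x)"
      by (rule summable_integrals_AE[OF Fi _ Fl]) simp
    have aeU: "(AE x in lborel. x \<in> U \<longrightarrow> p x) \<Longrightarrow> AE x in ?M. p x" for p
      using AE_lebesgue_on_iff[OF borel_open[OF U]] by blast
    \<comment> \<open>The identities for all \<open>n\<close> hold outside one null set, so the
      pointwise argument can be run for the whole sequence at almost every \<open>x\<close>.\<close>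
    have a_eq: "AE x in ?M. \<forall>n. a n x = weak_partial U j (g n) x - weak_partial U j f x"
      unfolding AE_all_countable a_def by (intro allI sobolev_diff(2)[OF U q g(1) f])
    have r_eq: "AE x in ?M. \<forall>n. r n x = DT (g n x) (weak_partial U j (g n) x) - DT (f x) (weak_partial U j f x)"
      unfolding AE_all_countable r_def
      by (intro allI weak_partial_eq_AE[OF U is_weak_partial_diff[OF U chain_rule(2)[OF U g'(2)] chain_rule(2)[OF U f'(2)]]])
    have sm: "AE x in ?M. \<forall>n. smooth_at (g n x) (weak_partial U j (g n) x)"
      unfolding AE_all_countable by (intro allI aeU[OF chain_rule(1)[OF U g'(2)]])
    have sm0: "AE x in ?M. smooth_at (f x) (weak_partial U j f x)" by (rule aeU[OF chain_rule(1)[OF U f'(2)]])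
    have r_lim: "AE x in ?M. (\<lambda>n. norm (r n x) powr q) \<longlonglongrightarrow> 0"
      using a_eq r_eq sm sm0 G(2) G0(2)
    proof eventually_elim
      case (elim x)
      have Y: "(\<lambda>n. g n x) \<longlonglongrightarrow> f x" using elim(6) by (intro pow0) blast
      have "(\<lambda>n. norm (a n x) powr q) \<longlonglongrightarrow> 0" using elim(5) by blast
      then have Z: "(\<lambda>n. weak_partial U j (g n) x) \<longlonglongrightarrow> weak_partial U j f x" using elim(1) by (intro pow0) simp
      have "(\<lambda>n. DT (g n x) (weak_partial U j (g n) x)) \<longlonglongrightarrow> DT (f x) (weak_partial U j f x)"
        by (rule DT_stable[OF Y Z]) (use elim(3,4) in auto)
      then have "(\<lambda>n. r n x) \<longlonglongrightarrow> 0" using elim(2) by (simp add: LIM_zero)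
      then have "(\<lambda>n. norm (r n x)) \<longlonglongrightarrow> 0" by (rule tendsto_norm_zero)
      then show ?case by (rule tendsto_zero_powrI[OF _ tendsto_const]) (use q0 in auto)
    qed
    \<comment> \<open>Majorant for \<open>r n\<close>: the derivative of \<open>g n\<close> is
      \<open>a n\<close> plus that of \<open>f\<close>, and \<open>DT\<close> is bounded by
      \<open>C\<close> in its direction, so \<open>norm (r n x)\<close> is at most \<open>C\<close>
      times \<open>norm (a n x)\<close> plus twice the norm of the derivative of
      \<open>f\<close>.\<close>
    define w where "w x = C powr q * (2 powr q * (G x + (2 * norm (weak_partial U j f x)) powr q))" for x
    have wi: "integrable ?M w"
      unfolding w_def using G(1) Lq_spaceD(2)[OF f'(3)[of j]] by (simp add: powr_mult)
    have r_le: "AE x in ?M. norm (norm (r n x) powr q) \<le> w x" for n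
      using a_eq r_eq G(2)
    proof eventually_elim
      case (elim x)
      let ?p = "weak_partial U j f x"
      have "weak_partial U j (g n) x = a n x + ?p" using elim(1) by simp
      then have "norm (weak_partial U j (g n) x) \<le> norm (a n x) + norm ?p" using norm_triangle_ineq by metis
      then have "norm (r n x) \<le> C * (norm (a n x) + norm ?p) + C * norm ?p"
        using elim(2) norm_triangle_ineq4[of "DT (g n x) (weak_partial U j (g n) x)" "DT (f x) ?p"]
          DT_bound[of "g n x" "weak_partial U j (g n) x"] DT_bound[of "f x" ?p]
          mult_left_mono[OF _ C_nonneg, of "norm (weak_partial U j (g n) x)" "norm (a n x) + norm ?p"] by simp
      then have "norm (r n x) \<le> C * (norm (a n x) + 2 * norm ?p)" by (simp add: algebra_simps)
      then have "norm (r n x) powr q \<le> (C * (norm (a n x) + 2 * norm ?p)) powr q" using q0 by (intro powr_mono2) auto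
      also have "\<dots> = C powr q * (norm (a n x) + 2 * norm ?p) powr q" by (rule powr_mult)
      also have "\<dots> \<le> C powr q * (2 powr q * (norm (a n x) powr q + (2 * norm ?p) powr q))"
        using q0 by (intro mult_left_mono powr_add_le) auto
      also have "\<dots> \<le> w x" unfolding w_def using elim(3) by (intro mult_left_mono add_right_mono) auto
      finally show ?case by simp
    qed
    have rL: "r n \<in> Lq_space U q" for n unfolding r_def by (rule sobolevD(3)[OF U q0 sobolev_diff(1)[OF U q Tg Tf]])
    have "(\<lambda>n. LINT x|?M. norm (r n x) powr q) \<longlonglongrightarrow> (LINT x|?M. 0)"
      by (rule integral_dominated_convergence[OF _ _ wi r_lim r_le]) (use borel_measurable_integrable[OF Lq_spaceD(2)[OF rL]] in auto)
    then have "(\<lambda>n. LINT x|?M. norm (r n x) powr q) \<longlonglongrightarrow> 0" by simp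
    then have "(\<lambda>n. (LINT x|?M. norm (r n x) powr q) powr (1 / q)) \<longlonglongrightarrow> 0"
      by (rule tendsto_zero_powrI[OF _ tendsto_const]) (use q0 in auto)
    then show ?thesis by (simp add: r_def Lq_norm_def)
  qed
  have "(\<lambda>n. sobolev_norm U q (\<lambda>x. T (g n x) - T (f x))) \<longlonglongrightarrow> 0 + (\<Sum>j\<in>(UNIV :: 'm set). 0)"
    unfolding sobolev_norm_def by (intro tendsto_add tendsto_sum Tpart Dpart)
  then have "(\<lambda>n. sobolev_norm U q (\<lambda>x. T (g n x) - T (f x))) \<longlonglongrightarrow> 0" by simp
  then have "\<forall>\<^sub>F n in sequentially. sobolev_norm U q (\<lambda>x. T (g n x) - T (f x)) < e" using e by (rule order_tendstoD(2))
  then show False using g(3) eventually_happens'[OF sequentially_bot] by blast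
qed

theorem sobolev_continuous:
  fixes U :: "(real ^ 'm) set"
  assumes U: "open U" and q: "1 \<le> q"
  shows "continuous_map (sobolev_topology U q) (sobolev_topology U q) (\<lambda>f :: real ^ 'm \<Rightarrow> 'v. \<lambda>x. T (f x))"
  unfolding sobolev_topology_def
  by (rule seminorm_topology_continuous_map)
    (rule sobolev_space_compose[OF U q] sobolev_norm_zero[OF U q] sobolev_norm_triangle[OF U q] sobolev_norm_continuous[OF U q]; assumption)+

end

section \<open>Lipschitz functions and Hoelder norms\<close>

lemma lipschitz_extension_real:
  fixes f :: "'a::metric_space \<Rightarrow> real"
  assumes K: "0 \<le> K" and lip: "\<And>x y. x \<in> S \<Longrightarrow> y \<in> S \<Longrightarrow> \<bar>f x - f y\<bar> \<le> K * dist x y"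
  obtains F where "K-lipschitz_on UNIV F" "\<And>x. x \<in> S \<Longrightarrow> F x = f x"
proof (cases "S = {}")
  case True
  have "K-lipschitz_on UNIV (\<lambda>_. 0 :: real)" using K by (intro lipschitz_onI) auto
  then show ?thesis using that True by blast
next
  case False
  \<comment> \<open>McShane's extension, the largest function with Lipschitz constant
    \<open>K\<close> that agrees with \<open>f\<close> on \<open>S\<close>.\<close>
  define F where "F y = (INF x\<in>S. f x + K * dist x y)" for y
  have bdd: "bdd_below ((\<lambda>x. f x + K * dist x y) ` S)" for y
  proof -
    obtain x0 where x0: "x0 \<in> S" using False by blast
    show ?thesis
    proof (rule bdd_belowI2)
      fix x assume x: "x \<in> S"
      have "K * dist x x0 \<le> K * (dist x y + dist x0 y)" by (intro mult_left_mono K dist_triangle2)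
      then show "f x0 - K * dist x0 y \<le> f x + K * dist x y" using lip[OF x x0] by (simp add: algebra_simps abs_le_iff)
    qed
  qed
  have le: "F y \<le> F z + K * dist y z" for y z
  proof -
    have "F y - K * dist y z \<le> F z"
      unfolding F_def[of z]
    proof (rule cINF_greatest[OF False])
      fix x assume x: "x \<in> S"
      have "F y \<le> f x + K * dist x y" unfolding F_def by (rule cINF_lower[OF bdd x])
      moreover have "K * dist x y \<le> K * (dist x z + dist y z)" by (intro mult_left_mono K dist_triangle2)
      ultimately show "F y - K * dist y z \<le> f x + K * dist x z" by (simp add: algebra_simps)
    qed
    then show ?thesis by simp
  qed
  have "K-lipschitz_on UNIV F"
  proof (rule lipschitz_onI[OF _ K])
    fix x y
    show "dist (F x) (F y) \<le> K * dist x y"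
      using le[of x y] le[of y x] by (simp add: dist_real_def abs_le_iff dist_commute)
  qed
  moreover have "F y = f y" if y: "y \<in> S" for y
  proof (rule antisym)
    show "F y \<le> f y" unfolding F_def using cINF_lower[OF bdd y, of y] by simp
    show "f y \<le> F y" unfolding F_def
    proof (rule cINF_greatest[OF False])
      fix x assume "x \<in> S"
      then show "f y \<le> f x + K * dist x y" using lip[of x y] y by (simp add: abs_le_iff)
    qed
  qed
  ultimately show ?thesis by (rule that)
qed

text \<open>The quotients are bounded by \<open>K\<close> and converge almost everywhere, so they
  converge in the mean on compact sets, and the limit is a weak derivative. Taking \<open>h\<close>
  as the limit of a fixed sequence makes it Borel measurable on the whole space.\<close>

lemma lipschitz_weak_partial_real:
  fixes F :: "real ^ 'm \<Rightarrow> real"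
  assumes lip: "K-lipschitz_on UNIV F" and U: "open U"
  obtains h where "h \<in> borel_measurable borel"
    "AE x in lborel. ((\<lambda>t. F (x + t *\<^sub>R axis j 1)) has_real_derivative h x) (at 0)" "is_weak_partial U j F h"
proof -
  let ?e = "axis j 1 :: real ^ 'm"
  have K: "0 \<le> K" by (rule lipschitz_on_nonneg[OF lip])
  have cF: "continuous_on UNIV F" by (rule lipschitz_on_continuous_on[OF lip])
  have Fm[measurable]: "F \<in> borel_measurable borel" by (rule borel_measurable_continuous_onI[OF cF])
  define t where "t n = 1 / real (Suc n)" for n
  have t0: "0 < t n" for n by (simp add: t_def)
  have tlim: "t \<longlonglongrightarrow> 0" unfolding t_def using LIMSEQ_inverse_real_of_nat by (simp add: inverse_eq_divide)
  define D where "D n x = (F (x + t n *\<^sub>R ?e) - F x) / t n" for n x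
  have Dm[measurable]: "D n \<in> borel_measurable borel" for n unfolding D_def by measurable
  have Db: "\<bar>D n x\<bar> \<le> K" for n x
    using lipschitz_onD[OF lip, of "x + t n *\<^sub>R ?e" x] t0[of n] by (simp add: D_def dist_norm field_simps norm_axis_1)
  define h where "h x = lim (\<lambda>n. D n x)" for x
  have hm[measurable]: "h \<in> borel_measurable borel" unfolding h_def by (rule borel_measurable_lim_metric) measurable
  have ae: "AE x in lborel. ((\<lambda>t. F (x + t *\<^sub>R ?e)) has_real_derivative h x) (at 0) \<and> (\<lambda>n. D n x) \<longlonglongrightarrow> h x \<and> \<bar>h x\<bar> \<le> K"
    using lipschitz_directionally_differentiable_AE[OF lip, of ?e]
  proof eventually_elim
    case (elim x)
    then obtain d where d: "((\<lambda>t. F (x + t *\<^sub>R ?e)) has_real_derivative d) (at 0)" by (auto simp: real_differentiable_def)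
    then have "((\<lambda>s. (F (x + s *\<^sub>R ?e) - F x) / s) \<longlongrightarrow> d) (at 0)" by (simp add: has_field_derivative_iff)
    then have l: "(\<lambda>n. D n x) \<longlonglongrightarrow> d" unfolding D_def
      by (rule filterlim_compose) (use tlim t0 in \<open>auto simp: filterlim_at less_imp_neq[symmetric]\<close>)
    then have "h x = d" unfolding h_def by (rule limI)
    moreover have "\<bar>d\<bar> \<le> K"
      by (rule tendsto_upperbound[OF tendsto_rabs[OF l]]) (use Db in auto)
    ultimately show ?case using d l by simp
  qed
  have bounded_locint: "locint U k" if [measurable]: "k \<in> borel_measurable borel"
    and b: "\<And>A. compact A \<Longrightarrow> \<exists>c. AE x in lborel. x \<in> A \<longrightarrow> \<bar>k x\<bar> \<le> c" for k :: "real ^ 'm \<Rightarrow> real"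
    unfolding locint_def
  proof (intro conjI allI impI that(1))
    fix A :: "(real ^ 'm) set" assume A: "compact A" "A \<subseteq> U"
    obtain c where c: "AE x in lborel. x \<in> A \<longrightarrow> \<bar>k x\<bar> \<le> c" using b[OF A(1)] by blast
    have [measurable]: "A \<in> sets borel" using A by (simp add: borel_closed compact_imp_closed)
    show "integrable lborel (\<lambda>x. indicator A x *\<^sub>R k x)"
    proof (rule Bochner_Integration.integrable_bound)
      have "integrable lborel (indicator A :: _ \<Rightarrow> real)"
        by (rule integrable_real_indicator) (use emeasure_compact_finite[OF A(1)] in auto)
      then show "integrable lborel (\<lambda>x. indicator A x * c)" by simp
      show "AE x in lborel. norm (indicator A x *\<^sub>R k x) \<le> norm (indicator A x * c)"
        using c by eventually_elim (auto simp: indicator_def)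
    qed measurable
  qed
  have lF: "locint U F"
  proof (rule bounded_locint[OF Fm])
    fix A :: "(real ^ 'm) set" assume "compact A"
    then have "compact (F ` A)" using compact_continuous_image continuous_on_subset[OF cF subset_UNIV] by blast
    then obtain c where "\<And>x. x \<in> A \<Longrightarrow> \<bar>F x\<bar> \<le> c" using compact_imp_bounded[of "F ` A"] unfolding bounded_iff by auto
    then show "\<exists>c. AE x in lborel. x \<in> A \<longrightarrow> \<bar>F x\<bar> \<le> c" by auto
  qed
  have lh: "locint U h"
  proof (rule bounded_locint[OF hm])
    fix A :: "(real ^ 'm) set"
    have "AE x in lborel. x \<in> A \<longrightarrow> \<bar>h x\<bar> \<le> K" using ae by eventually_elim simp
    then show "\<exists>c. AE x in lborel. x \<in> A \<longrightarrow> \<bar>h x\<bar> \<le> c" by blast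
  qed
  have conv: "(\<lambda>n. LINT x|lborel. indicator A x * \<bar>(F (x + t n *\<^sub>R axis j 1) - F x) / t n - h x\<bar>) \<longlonglongrightarrow> 0"
    if A: "compact A" "A \<subseteq> U" for A
  proof -
    have [measurable]: "A \<in> sets borel" using A by (simp add: borel_closed compact_imp_closed)
    have wi: "integrable lborel (\<lambda>x. indicator A x * (2 * K))"
      by (intro integrable_mult_left integrable_real_indicator) (use emeasure_compact_finite[OF A(1)] in auto)
    have "(\<lambda>n. LINT x|lborel. indicator A x * \<bar>D n x - h x\<bar>) \<longlonglongrightarrow> (LINT x|(lborel :: (real ^ 'm) measure). 0)"
    proof (rule integral_dominated_convergence[OF _ _ wi])
      show "AE x in lborel. (\<lambda>n. indicator A x * \<bar>D n x - h x\<bar>) \<longlonglongrightarrow> 0"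
        using ae
      proof eventually_elim
        case (elim x)
        then have "(\<lambda>n. indicator A x * \<bar>D n x - h x\<bar>) \<longlonglongrightarrow> indicator A x * \<bar>h x - h x\<bar>" by (intro tendsto_intros) simp
        then show ?case by simp
      qed
      show "AE x in lborel. norm (indicator A x * \<bar>D n x - h x\<bar>) \<le> indicator A x * (2 * K)" for n
        using ae
      proof eventually_elim
        case (elim x)
        then have "\<bar>D n x - h x\<bar> \<le> 2 * K" using Db[of n x] by linarith
        then show ?case by (simp add: indicator_def)
      qed
    qed measurable
    then show ?thesis by (simp add: D_def)
  qed
  have "is_weak_partial U j F h"
    unfolding weak_partial_borel_iff[OF U Fm hm]
    using lF lh weak_partial_of_difference_quotients[OF U lF lh tlim _ conv] t0 by (simp add: less_imp_neq[symmetric])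
  moreover have "AE x in lborel. ((\<lambda>t. F (x + t *\<^sub>R ?e)) has_real_derivative h x) (at 0)" using ae by eventually_elim simp
  ultimately show ?thesis using that hm by blast
qed

lemma locint_of_components:
  fixes f :: "real ^ 'm \<Rightarrow> 'v::euclidean_space"
  assumes "\<And>b. b \<in> Basis \<Longrightarrow> locint U (F b)"
  shows "locint U (\<lambda>x. \<Sum>b\<in>(Basis :: 'v set). F b x *\<^sub>R b)"
  unfolding locint_def
proof (intro conjI allI impI)
  show "(\<lambda>x. \<Sum>b\<in>(Basis :: 'v set). F b x *\<^sub>R b) \<in> borel_measurable borel"
    using locintD(1)[OF assms] by (intro borel_measurable_sum borel_measurable_scaleR borel_measurable_const) auto
  fix K assume K: "compact K" "K \<subseteq> U"
  have "integrable lborel (\<lambda>x. \<Sum>b\<in>(Basis :: 'v set). (indicator K x *\<^sub>R F b x) *\<^sub>R b)"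
    by (intro Bochner_Integration.integrable_sum integrable_scaleR_left locintD(2)[OF assms K])
  then show "integrable lborel (\<lambda>x. indicator K x *\<^sub>R (\<Sum>b\<in>(Basis :: 'v set). F b x *\<^sub>R b))"
    by (simp add: scaleR_sum_right)
qed

text \<open>Each coordinate extends from \<open>U\<close> to a Lipschitz function on the whole
  space. Since \<open>U\<close> is open, the extension has the same partial derivatives at points of
  \<open>U\<close>.\<close>

lemma lipschitz_on_open_weak_partial:
  fixes f :: "real ^ 'm \<Rightarrow> 'v::euclidean_space"
  assumes U: "open U" and K: "0 \<le> K" and lip: "\<And>x y. x \<in> U \<Longrightarrow> y \<in> U \<Longrightarrow> norm (f x - f y) \<le> K * norm (x - y)"
  shows "AE x in lborel. x \<in> U \<longrightarrow> has_partial j f x" and "is_weak_partial U j f (partial j f)"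
proof -
  let ?e = "axis j 1 :: real ^ 'm"
  define G where "G b F h \<longleftrightarrow> (\<forall>x\<in>U. F x = f x \<bullet> b) \<and> F \<in> borel_measurable borel \<and> h \<in> borel_measurable borel \<and>
      (AE x in lborel. ((\<lambda>t. F (x + t *\<^sub>R ?e)) has_real_derivative h x) (at 0)) \<and> is_weak_partial U j F h" for b F h
  have "\<forall>b\<in>Basis. \<exists>F h. G b F h"
  proof
    fix b :: 'v assume b: "b \<in> Basis"
    have "\<bar>f x \<bullet> b - f y \<bullet> b\<bar> \<le> K * dist x y" if "x \<in> U" "y \<in> U" for x y
      using lip[OF that] Basis_le_norm[OF b, of "f x - f y"] by (simp add: inner_diff_left dist_norm)
    from lipschitz_extension_real[OF K this]
    obtain F where F: "K-lipschitz_on UNIV F" "\<And>x. x \<in> U \<Longrightarrow> F x = f x \<bullet> b" by blast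
    obtain h where h: "h \<in> borel_measurable borel"
      "AE x in lborel. ((\<lambda>t. F (x + t *\<^sub>R ?e)) has_real_derivative h x) (at 0)" "is_weak_partial U j F h"
      by (rule lipschitz_weak_partial_real[OF F(1) U])
    have "F \<in> borel_measurable borel" by (rule borel_measurable_continuous_onI[OF lipschitz_on_continuous_on[OF F(1)]])
    then have "G b F h" unfolding G_def using F(2) h by simp
    then show "\<exists>F h. G b F h" by blast
  qed
  from bchoice[OF this] obtain F where "\<forall>b\<in>Basis. \<exists>h. G b (F b) h" ..
  from bchoice[OF this] obtain h where Fh: "\<forall>b\<in>Basis. G b (F b) (h b)" ..
  have F: "\<And>b x. b \<in> Basis \<Longrightarrow> x \<in> U \<Longrightarrow> F b x = f x \<bullet> b" "\<And>b. b \<in> Basis \<Longrightarrow> F b \<in> borel_measurable borel"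
    and h: "\<And>b. b \<in> Basis \<Longrightarrow> h b \<in> borel_measurable borel"
      "\<And>b. b \<in> Basis \<Longrightarrow> AE x in lborel. ((\<lambda>t. F b (x + t *\<^sub>R ?e)) has_real_derivative h b x) (at 0)"
      "\<And>b. b \<in> Basis \<Longrightarrow> is_weak_partial U j (F b) (h b)"
    using Fh unfolding G_def by simp_all
  define FF where "FF x = (\<Sum>b\<in>Basis. F b x *\<^sub>R b)" for x
  define H where "H x = (\<Sum>b\<in>Basis. h b x *\<^sub>R b)" for x
  have feq: "FF x = f x" if "x \<in> U" for x
  proof -
    have "FF x = (\<Sum>b\<in>Basis. (f x \<bullet> b) *\<^sub>R b)" unfolding FF_def by (intro sum.cong refl) (simp add: F(1)[OF _ that])
    then show ?thesis by (simp only: euclidean_representation)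
  qed
  have "AE x in lborel. \<forall>b\<in>Basis. ((\<lambda>t. F b (x + t *\<^sub>R ?e)) has_real_derivative h b x) (at 0)"
    using h(2) by (intro AE_finite_allI) auto
  then have der: "AE x in lborel. x \<in> U \<longrightarrow> ((\<lambda>t. f (x + t *\<^sub>R ?e)) has_vector_derivative H x) (at 0)"
  proof eventually_elim
    case (elim x)
    show ?case
    proof
      assume x: "x \<in> U"
      have FFd: "((\<lambda>t. FF (x + t *\<^sub>R ?e)) has_vector_derivative H x) (at 0)"
        unfolding FF_def H_def
      proof (intro has_vector_derivative_sum)
        fix b :: 'v assume "b \<in> Basis"
        then have "((\<lambda>t. F b (x + t *\<^sub>R ?e)) has_real_derivative h b x) (at 0)" using elim by blast
        from has_vector_derivative_scaleR[OF this has_vector_derivative_const[of b]]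
        show "((\<lambda>t. F b (x + t *\<^sub>R ?e) *\<^sub>R b) has_vector_derivative h b x *\<^sub>R b) (at 0)" by simp
      qed
      let ?S = "(\<lambda>t. x + t *\<^sub>R ?e) -` U"
      have "open ?S" by (rule open_vimage[OF U]) (auto intro!: continuous_intros)
      moreover have "0 \<in> ?S" using x by simp
      ultimately show "((\<lambda>t. f (x + t *\<^sub>R ?e)) has_vector_derivative H x) (at 0)"
        by (rule has_vector_derivative_transform_within_open[OF FFd]) (simp add: feq)
    qed
  qed
  then show "AE x in lborel. x \<in> U \<longrightarrow> has_partial j f x"
  proof eventually_elim
    case (elim x)
    then show ?case unfolding has_partial_def using differentiableI_vector by blast
  qed
  have lF: "locint U (F b)" and lh: "locint U (h b)"
    and wk: "\<And>\<phi>. \<phi> \<in> test_functions U \<Longrightarrow> (LINT x|lborel. partial j \<phi> x * F b x) = - (LINT x|lborel. \<phi> x * h b x)"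
    if b: "b \<in> Basis" for b
    using h(3)[OF b] unfolding weak_partial_borel_iff[OF U F(2)[OF b] h(1)[OF b]] by auto
  have lFF: "locint U FF" unfolding FF_def by (rule locint_of_components[OF lF])
  have lH: "locint U H" unfolding H_def by (rule locint_of_components[OF lh])
  have "is_weak_partial U j FF H"
    unfolding weak_partial_borel_iff[OF U locintD(1)[OF lFF] locintD(1)[OF lH]]
  proof (intro conjI lFF lH ballI)
    fix \<phi> assume \<phi>: "\<phi> \<in> test_functions U"
    have "FF x \<bullet> b = F b x" "H x \<bullet> b = h b x" if "b \<in> Basis" for x b
      unfolding FF_def H_def by (rule inner_sum_left_Basis[OF that])+
    then show "(LINT x|lborel. partial j \<phi> x *\<^sub>R FF x) = - (LINT x|lborel. \<phi> x *\<^sub>R H x)"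
      unfolding weak_partial_components_iff[OF lFF lH \<phi>] using wk[OF _ \<phi>] by simp
  qed
  moreover have "AE x in lborel. x \<in> U \<longrightarrow> f x = FF x" by (rule AE_I2) (simp add: feq)
  moreover have "AE x in lborel. x \<in> U \<longrightarrow> partial j f x = H x"
    using der by eventually_elim (simp add: partial_def vector_derivative_at)
  ultimately show "is_weak_partial U j f (partial j f)" by (rule is_weak_partial_cong_AE[OF U])
qed

lemma has_partial_vector_derivative:
  "has_partial j f x \<Longrightarrow> ((\<lambda>t. f (x + t *\<^sub>R axis j 1)) has_vector_derivative partial j f x) (at 0)"
  unfolding has_partial_def partial_def by (simp add: vector_derivative_works)

text \<open>Pairing with the derivative \<open>D\<close> itself reduces the claim to real quotients
  bounded by \<open>K * norm D\<close>, whose limit is the square of the norm of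
  \<open>D\<close>.\<close>

lemma partial_norm_le:
  fixes f :: "real ^ 'm \<Rightarrow> 'v::euclidean_space"
  assumes U: "open U" and x: "x \<in> U" and lip: "\<And>x y. x \<in> U \<Longrightarrow> y \<in> U \<Longrightarrow> norm (f x - f y) \<le> K * norm (x - y)"
    and p: "has_partial j f x"
  shows "norm (partial j f x) \<le> K"
proof -
  let ?e = "axis j 1 :: real ^ 'm"
  define D where "D = partial j f x"
  have "((\<lambda>t. f (x + t *\<^sub>R ?e) \<bullet> D) has_real_derivative D \<bullet> D) (at 0)"
    using bounded_linear.has_vector_derivative[OF bounded_linear_inner_left has_partial_vector_derivative[OF p], of D]
    by (simp add: D_def has_real_derivative_iff_has_vector_derivative)
  then have lim: "((\<lambda>t. (f (x + t *\<^sub>R ?e) \<bullet> D - f x \<bullet> D) / t) \<longlongrightarrow> D \<bullet> D) (at 0)" by (simp add: has_field_derivative_iff)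
  have "((\<lambda>t. x + t *\<^sub>R ?e) \<longlongrightarrow> x + 0 *\<^sub>R ?e) (at 0)" by (intro tendsto_intros)
  then have "\<forall>\<^sub>F t in at 0. x + t *\<^sub>R ?e \<in> U" using topological_tendstoD[OF _ U] x by simp
  moreover have "\<forall>\<^sub>F t::real in at 0. t \<noteq> 0" by (simp add: eventually_at_filter)
  ultimately have "\<forall>\<^sub>F t in at 0. (f (x + t *\<^sub>R ?e) \<bullet> D - f x \<bullet> D) / t \<le> K * norm D"
  proof eventually_elim
    case (elim t)
    have "\<bar>f (x + t *\<^sub>R ?e) \<bullet> D - f x \<bullet> D\<bar> \<le> norm (f (x + t *\<^sub>R ?e) - f x) * norm D"
      using Cauchy_Schwarz_ineq2[of "f (x + t *\<^sub>R ?e) - f x" D] by (simp add: inner_diff_left)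
    also have "\<dots> \<le> (K * \<bar>t\<bar>) * norm D"
      using lip[OF elim(1) x] by (intro mult_right_mono) (simp_all add: norm_axis_1)
    finally have "\<bar>(f (x + t *\<^sub>R ?e) \<bullet> D - f x \<bullet> D) / t\<bar> \<le> K * norm D"
      using elim(2) by (simp add: field_simps)
    then show ?case by (simp only: abs_le_iff)
  qed
  then have "D \<bullet> D \<le> K * norm D" by (intro tendsto_upperbound[OF lim]) auto
  then have "norm D * norm D \<le> K * norm D" by (simp add: power2_norm_eq_inner[symmetric] power2_eq_square)
  \<comment> \<open>This settles the case \<open>D = 0\<close>. It holds because an open set
    containing \<open>x\<close> contains a second point.\<close>
  moreover have "0 \<le> K"
  proof -
    obtain y where y: "y \<in> U" "y \<noteq> x" using not_open_singleton[of x] U x by (metis insertI1 singletonD subsetI subset_singletonD empty_iff)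
    have "0 \<le> K * norm (x - y)" using lip[OF x y(1)] norm_ge_zero order_trans by blast
    then show ?thesis using y(2) by (simp add: zero_le_mult_iff)
  qed
  ultimately show ?thesis unfolding D_def[symmetric] by (cases "D = 0") auto
qed

section \<open>Hoelder norms and their comparison with Sobolev norms\<close>

lemma holder_norm_upper:
  fixes f :: "real ^ 'm \<Rightarrow> 'v::euclidean_space"
  assumes U: "open U" "U \<noteq> {}" and f: "f \<in> holder_space U \<alpha>"
  shows "\<exists>A B. 0 \<le> A \<and> 0 \<le> B \<and> holder_norm U \<alpha> f = A + B \<and> (\<forall>x\<in>U. norm (f x) \<le> A) \<and>
    (\<forall>x\<in>U. \<forall>y\<in>U. norm (f x - f y) \<le> B * norm (x - y) powr \<alpha>)"
proof -
  let ?R = "{(x, y). x \<in> U \<and> y \<in> U \<and> x \<noteq> y}"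
  let ?q = "\<lambda>(x, y). norm (f x - f y) / norm (x - y) powr \<alpha>"
  define A where "A = (SUP x\<in>U. norm (f x))"
  define B where "B = (SUP p\<in>?R. ?q p)"
  obtain x0 where x0: "x0 \<in> U" using U(2) by blast
  \<comment> \<open>A nonempty open set has two distinct points, so the supremum of the quotients
    runs over a nonempty set and is nonnegative.\<close>
  obtain y0 where y0: "y0 \<in> U" "y0 \<noteq> x0"
    using not_open_singleton[of x0] U(1) x0 by (metis insertI1 singletonD subsetI subset_singletonD empty_iff)
  have bA: "bdd_above ((\<lambda>x. norm (f x)) ` U)" using f unfolding holder_space_def bounded_iff bdd_above_def by auto
  obtain c where c: "\<And>x y. x \<in> U \<Longrightarrow> y \<in> U \<Longrightarrow> norm (f x - f y) \<le> c * norm (x - y) powr \<alpha>"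
    using f unfolding holder_space_def by blast
  have bB: "bdd_above (?q ` ?R)"
  proof (rule bdd_aboveI2)
    fix p assume "p \<in> ?R"
    then obtain x y where p: "p = (x, y)" "x \<in> U" "y \<in> U" "x \<noteq> y" by auto
    then show "?q p \<le> c" using c[of x y] by (simp add: field_simps)
  qed
  have Ale: "norm (f x) \<le> A" if "x \<in> U" for x unfolding A_def by (rule cSUP_upper[OF that bA])
  have Ble: "norm (f x - f y) / norm (x - y) powr \<alpha> \<le> B" if "x \<in> U" "y \<in> U" "x \<noteq> y" for x y
    unfolding B_def using cSUP_upper[OF _ bB, of "(x, y)"] that by simp
  have "0 \<le> A" using Ale[OF x0] norm_ge_zero order_trans by blast
  moreover have "0 \<le> B" by (rule order_trans[OF _ Ble[OF x0 y0(1)]]) (use y0 in auto)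
  moreover have "holder_norm U \<alpha> f = A + B" using U(2) by (simp add: holder_norm_def A_def B_def)
  moreover have "norm (f x - f y) \<le> B * norm (x - y) powr \<alpha>" if "x \<in> U" "y \<in> U" for x y
    using Ble[OF that] by (cases "x = y") (simp_all add: field_simps)
  ultimately show ?thesis using Ale by blast
qed

lemma holder_norm_lower:
  fixes f :: "real ^ 'm \<Rightarrow> 'v::euclidean_space"
  assumes U: "open U" "U \<noteq> {}" and A: "\<And>x. x \<in> U \<Longrightarrow> norm (f x) \<le> A"
    and B: "\<And>x y. x \<in> U \<Longrightarrow> y \<in> U \<Longrightarrow> norm (f x - f y) \<le> B * norm (x - y) powr \<alpha>"
  shows "holder_norm U \<alpha> f \<le> A + B"
proof -
  obtain x0 where x0: "x0 \<in> U" using U(2) by blast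
  obtain y0 where y0: "y0 \<in> U" "y0 \<noteq> x0"
    using not_open_singleton[of x0] U(1) x0 by (metis insertI1 singletonD subsetI subset_singletonD empty_iff)
  have "(SUP x\<in>U. norm (f x)) \<le> A" by (rule cSUP_least[OF U(2) A])
  moreover have "(SUP p\<in>{(x, y). x \<in> U \<and> y \<in> U \<and> x \<noteq> y}. (\<lambda>(x, y). norm (f x - f y) / norm (x - y) powr \<alpha>) p) \<le> B"
  proof (rule cSUP_least)
    show "{(x, y). x \<in> U \<and> y \<in> U \<and> x \<noteq> y} \<noteq> {}" using x0 y0 by auto
    fix p assume "p \<in> {(x, y). x \<in> U \<and> y \<in> U \<and> x \<noteq> y}"
    then obtain x y where p: "p = (x, y)" "x \<in> U" "y \<in> U" "x \<noteq> y" by auto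
    then show "(\<lambda>(x, y). norm (f x - f y) / norm (x - y) powr \<alpha>) p \<le> B" using B[of x y] by (simp add: field_simps)
  qed
  ultimately show ?thesis using U(2) by (simp add: holder_norm_def)
qed

lemma holder_diff:
  fixes f g :: "real ^ 'm \<Rightarrow> 'v::euclidean_space"
  assumes f: "f \<in> holder_space U \<alpha>" and g: "g \<in> holder_space U \<alpha>"
  shows "(\<lambda>x. f x - g x) \<in> holder_space U \<alpha>"
proof -
  have c: "continuous_on (closure U) (\<lambda>x. f x - g x)" using f g by (intro continuous_intros) (auto simp: holder_space_def)
  obtain a where a: "\<forall>z\<in>f ` U. norm z \<le> a" using f unfolding holder_space_def bounded_iff by blast
  obtain b where b: "\<forall>z\<in>g ` U. norm z \<le> b" using g unfolding holder_space_def bounded_iff by blast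
  have "bounded ((\<lambda>x. f x - g x) ` U)"
    unfolding bounded_iff
  proof (intro exI ballI)
    fix z assume "z \<in> (\<lambda>x. f x - g x) ` U"
    then obtain x where "x \<in> U" "z = f x - g x" by blast
    then show "norm z \<le> a + b" using bspec[OF a, of "f x"] bspec[OF b, of "g x"] norm_triangle_ineq4[of "f x" "g x"] by simp
  qed
  moreover obtain c where c1: "\<forall>x\<in>U. \<forall>y\<in>U. norm (f x - f y) \<le> c * norm (x - y) powr \<alpha>"
    using f unfolding holder_space_def by blast
  moreover obtain d where d: "\<forall>x\<in>U. \<forall>y\<in>U. norm (g x - g y) \<le> d * norm (x - y) powr \<alpha>"
    using g unfolding holder_space_def by blast
  moreover have "norm ((f x - g x) - (f y - g y)) \<le> (c + d) * norm (x - y) powr \<alpha>" if "x \<in> U" "y \<in> U" for x y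
  proof -
    have "norm ((f x - g x) - (f y - g y)) = norm ((f x - f y) - (g x - g y))" by (simp add: algebra_simps)
    also have "\<dots> \<le> norm (f x - f y) + norm (g x - g y)" by (rule norm_triangle_ineq4)
    finally show ?thesis using c1[rule_format, OF that] d[rule_format, OF that] by (simp add: distrib_right)
  qed
  ultimately show ?thesis using c unfolding holder_space_def by blast
qed

lemma holder_norm_zero:
  assumes U: "open U"
  shows "holder_norm U \<alpha> (\<lambda>x :: real ^ 'm. f x - (f x :: 'v::euclidean_space)) = 0"
proof (cases "U = {}")
  case True
  then show ?thesis by (simp add: holder_norm_def)
next
  case False
  have "(\<lambda>x. 0 :: 'v) \<in> holder_space U \<alpha>" unfolding holder_space_def by (auto simp: image_constant_conv intro!: exI[of _ 0])
  then have "0 \<le> holder_norm U \<alpha> (\<lambda>x. 0 :: 'v)" using holder_norm_upper[OF U False] add_nonneg_nonneg by metis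
  moreover have "holder_norm U \<alpha> (\<lambda>x. 0 :: 'v) \<le> 0 + 0" by (rule holder_norm_lower[OF U False]) auto
  ultimately show ?thesis by simp
qed

lemma holder_norm_triangle:
  fixes f g h :: "real ^ 'm \<Rightarrow> 'v::euclidean_space"
  assumes U: "open U" "U \<noteq> {}" and f: "f \<in> holder_space U \<alpha>" and g: "g \<in> holder_space U \<alpha>" and h: "h \<in> holder_space U \<alpha>"
  shows "holder_norm U \<alpha> (\<lambda>x. f x - h x) \<le> holder_norm U \<alpha> (\<lambda>x. f x - g x) + holder_norm U \<alpha> (\<lambda>x. g x - h x)"
proof -
  obtain A B where 1: "0 \<le> A" "0 \<le> B" "holder_norm U \<alpha> (\<lambda>x. f x - g x) = A + B" "\<And>x. x \<in> U \<Longrightarrow> norm (f x - g x) \<le> A"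
    "\<And>x y. x \<in> U \<Longrightarrow> y \<in> U \<Longrightarrow> norm ((f x - g x) - (f y - g y)) \<le> B * norm (x - y) powr \<alpha>"
    using holder_norm_upper[OF U holder_diff[OF f g]] by blast
  obtain A' B' where 2: "0 \<le> A'" "0 \<le> B'" "holder_norm U \<alpha> (\<lambda>x. g x - h x) = A' + B'" "\<And>x. x \<in> U \<Longrightarrow> norm (g x - h x) \<le> A'"
    "\<And>x y. x \<in> U \<Longrightarrow> y \<in> U \<Longrightarrow> norm ((g x - h x) - (g y - h y)) \<le> B' * norm (x - y) powr \<alpha>"
    using holder_norm_upper[OF U holder_diff[OF g h]] by blast
  have "holder_norm U \<alpha> (\<lambda>x. f x - h x) \<le> (A + A') + (B + B')"
  proof (rule holder_norm_lower[OF U])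
    show "norm (f x - h x) \<le> A + A'" if "x \<in> U" for x
      using 1(4)[OF that] 2(4)[OF that] norm_triangle_ineq[of "f x - g x" "g x - h x"] by simp
    show "norm ((f x - h x) - (f y - h y)) \<le> (B + B') * norm (x - y) powr \<alpha>" if "x \<in> U" "y \<in> U" for x y
      using 1(5)[OF that] 2(5)[OF that] norm_triangle_ineq[of "(f x - g x) - (f y - g y)" "(g x - h x) - (g y - h y)"]
      by (simp add: distrib_right algebra_simps)
  qed
  then show ?thesis using 1(3) 2(3) by simp
qed

lemma holder_one_lipschitz:
  fixes f :: "real ^ 'm \<Rightarrow> 'v::euclidean_space"
  assumes "f \<in> holder_space U 1"
  obtains K where "0 \<le> K" "\<And>x y. x \<in> U \<Longrightarrow> y \<in> U \<Longrightarrow> norm (f x - f y) \<le> K * norm (x - y)"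
proof -
  obtain c where c: "\<And>x y. x \<in> U \<Longrightarrow> y \<in> U \<Longrightarrow> norm (f x - f y) \<le> c * norm (x - y) powr 1"
    using assms unfolding holder_space_def by blast
  have "norm (f x - f y) \<le> max 0 c * norm (x - y)" if "x \<in> U" "y \<in> U" for x y
    using c[OF that] mult_right_mono[of c "max 0 c" "norm (x - y)"] by simp
  then show ?thesis using that[of "max 0 c"] by simp
qed

text \<open>On a bounded set constants are integrable, and partial derivatives are bounded by the
  Lipschitz constant. The factor counts the function and its partial derivatives. This continuous
  embedding reduces continuity from the Lipschitz norm to continuity between Sobolev spaces.\<close>

lemma holder_in_sobolev:
  fixes f :: "real ^ 'm \<Rightarrow> 'v::euclidean_space"
  assumes U: "open U" "bounded U" and q: "1 \<le> q" and f: "f \<in> holder_space U 1"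
  shows "f \<in> sobolev_space U q"
    and "U \<noteq> {} \<Longrightarrow> sobolev_norm U q f \<le> real (Suc CARD('m)) * (Lq_norm U q (\<lambda>x. 1 :: real) * holder_norm U 1 f)"
proof -
  have q0: "0 < q" using q by simp
  obtain K where K: "0 \<le> K" "\<And>x y. x \<in> U \<Longrightarrow> y \<in> U \<Longrightarrow> norm (f x - f y) \<le> K * norm (x - y)"
    using holder_one_lipschitz[OF f] by blast
  note P = lipschitz_on_open_weak_partial[OF U(1) K]
  have aeU: "(AE x in lborel. x \<in> U \<longrightarrow> p x) \<Longrightarrow> AE x in lebesgue_on U. p x" for p
    using AE_lebesgue_on_iff[OF borel_open[OF U(1)]] by blast
  have one: "(\<lambda>x. 1 :: real) \<in> Lq_space U q"
  proof -
    have "finite_measure (lebesgue_on U)"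
      by (rule finite_measure_lebesgue_on) (simp add: U bounded_set_imp_lmeasurable)
    then show ?thesis by (simp add: Lq_space_def finite_measure.integrable_const)
  qed
  have fm: "f \<in> borel_measurable (lebesgue_on U)"
    using P(2) by (intro locally_integrable_measurable[OF U(1)]) (simp add: is_weak_partial_def)
  have pm: "partial j f \<in> borel_measurable (lebesgue_on U)" for j
    using P(2)[of j] by (intro locally_integrable_measurable[OF U(1)]) (simp add: is_weak_partial_def)
  have dom: "h \<in> Lq_space U q \<and> Lq_norm U q h \<le> c * Lq_norm U q (\<lambda>x. 1 :: real)"
    if "h \<in> borel_measurable (lebesgue_on U)" "0 \<le> c" "AE x in lebesgue_on U. norm (h x) \<le> c" for h :: "real ^ 'm \<Rightarrow> 'v" and c
    using Lq_dominated[OF q0 that(1) one that(2)] that(3) by simp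
  obtain a where a: "\<forall>z\<in>f ` U. norm z \<le> a" using f unfolding holder_space_def bounded_iff by blast
  have "AE x in lebesgue_on U. norm (f x) \<le> max 0 a" by (rule AE_I2) (use a in \<open>fastforce simp: le_max_iff_disj\<close>)
  then have fL: "f \<in> Lq_space U q" using dom[OF fm, of "max 0 a"] by simp
  have pb: "AE x in lebesgue_on U. norm (partial j f x) \<le> k"
    if k: "\<And>x y. x \<in> U \<Longrightarrow> y \<in> U \<Longrightarrow> norm (f x - f y) \<le> k * norm (x - y)" for k j
  proof -
    have "AE x in lebesgue_on U. x \<in> U" using AE_space[of "lebesgue_on U"] by simp
    moreover have "AE x in lebesgue_on U. has_partial j f x" by (rule aeU) (rule P(1))
    ultimately show ?thesis
    proof eventually_elim
      case (elim x)
      show ?case by (rule partial_norm_le[OF U(1) elim(1) k elim(2)])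
    qed
  qed
  have pL: "partial j f \<in> Lq_space U q" for j using dom[OF pm K(1) pb[OF K(2)]] by blast
  show "f \<in> sobolev_space U q" unfolding sobolev_space_def using fL pL P(2) by blast
  assume ne: "U \<noteq> {}"
  obtain A B where AB: "0 \<le> A" "0 \<le> B" "holder_norm U 1 f = A + B" "\<And>x. x \<in> U \<Longrightarrow> norm (f x) \<le> A"
    "\<And>x y. x \<in> U \<Longrightarrow> y \<in> U \<Longrightarrow> norm (f x - f y) \<le> B * norm (x - y) powr 1"
    using holder_norm_upper[OF U(1) ne f] by blast
  let ?m = "Lq_norm U q (\<lambda>x. 1 :: real)"
  have AB': "A \<le> A + B" "B \<le> A + B" using AB by simp_all
  have "AE x in lebesgue_on U. norm (f x) \<le> A" by (rule AE_I2) (use AB(4) in simp)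
  then have "Lq_norm U q f \<le> A * ?m" using dom[OF fm AB(1)] by blast
  also have "\<dots> \<le> (A + B) * ?m" by (rule mult_right_mono[OF AB'(1) Lq_norm_nonneg])
  finally have 1: "Lq_norm U q f \<le> (A + B) * ?m" .
  have 2: "Lq_norm U q (weak_partial U j f) \<le> (A + B) * ?m" for j
  proof -
    have eq: "Lq_norm U q (weak_partial U j f) = Lq_norm U q (partial j f)"
      by (rule Lq_cong_AE(2)[OF q0 Lq_spaceD(1)[OF sobolevD(3)[OF U(1) q0]] pL weak_partial_eq_AE[OF U(1) P(2)]]) fact
    have "AE x in lebesgue_on U. norm (partial j f x) \<le> B"
      by (rule pb) (use AB(5) in simp)
    then have "Lq_norm U q (partial j f) \<le> B * ?m" using dom[OF pm AB(2)] by blast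
    also have "\<dots> \<le> (A + B) * ?m" by (rule mult_right_mono[OF AB'(2) Lq_norm_nonneg])
    finally show ?thesis by (simp add: eq)
  qed
  have "(\<Sum>j\<in>(UNIV :: 'm set). Lq_norm U q (weak_partial U j f)) \<le> (\<Sum>j\<in>(UNIV :: 'm set). (A + B) * ?m)"
    by (rule sum_mono) (rule 2)
  then show "sobolev_norm U q f \<le> real (Suc CARD('m)) * (?m * holder_norm U 1 f)"
    using 1 by (simp add: sobolev_norm_def AB(3) algebra_simps)
qed

text \<open>Split \<open>t\<close> into the powers of exponents \<open>1 - \<alpha>\<close> and
  \<alpha>, and use one bound for each factor.\<close>

lemma powr_interpolation:
  fixes t :: real
  assumes "0 \<le> t" "t \<le> a" "t \<le> b" "0 < \<alpha>" "\<alpha> \<le> 1"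
  shows "t \<le> a powr (1 - \<alpha>) * b powr \<alpha>"
proof -
  have "t = t powr (1 - \<alpha>) * t powr \<alpha>" using assms(1) by (simp add: powr_add[symmetric])
  also have "\<dots> \<le> a powr (1 - \<alpha>) * b powr \<alpha>" using assms by (intro mult_mono powr_mono2) auto
  finally show ?thesis .
qed

section \<open>Composition in Hoelder spaces and convergence of classical derivatives\<close>

context dc_map
begin

lemma holder_space_compose:
  fixes f :: "real ^ 'm \<Rightarrow> 'v"
  assumes U: "bounded U" and \<alpha>: "0 < \<alpha>" "\<alpha> \<le> 1" and f: "f \<in> holder_space U 1"
  shows "(\<lambda>x. T (f x)) \<in> holder_space U \<alpha>"
proof -
  obtain K where K: "0 \<le> K" "\<And>x y. x \<in> U \<Longrightarrow> y \<in> U \<Longrightarrow> norm (f x - f y) \<le> K * norm (x - y)"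
    using holder_one_lipschitz[OF f] by blast
  obtain R where R: "\<forall>x\<in>U. norm x \<le> R" using U unfolding bounded_iff by blast
  have "continuous_on (closure U) (\<lambda>x. T (f x))"
    by (rule continuous_on_compose2[OF T_continuous]) (use f in \<open>auto simp: holder_space_def\<close>)
  moreover obtain b where b: "\<forall>z\<in>f ` U. norm z \<le> b" using f unfolding holder_space_def bounded_iff by blast
  have "bounded ((\<lambda>x. T (f x)) ` U)"
    unfolding bounded_iff
  proof (intro exI ballI)
    fix z assume "z \<in> (\<lambda>x. T (f x)) ` U"
    then obtain x where x: "x \<in> U" "z = T (f x)" by blast
    have "norm (T (f x)) \<le> C * norm (f x)" by (rule T_bound)
    also have "\<dots> \<le> C * b" using b x by (intro mult_left_mono C_nonneg) simp
    finally show "norm z \<le> C * b" by (simp add: x)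
  qed
  moreover have "norm (T (f x) - T (f y)) \<le> (C * K * (2 * R) powr (1 - \<alpha>)) * norm (x - y) powr \<alpha>" if "x \<in> U" "y \<in> U" for x y
  proof -
    \<comment> \<open>The diameter bound trades the Lipschitz estimate for a Hoelder estimate by
      interpolating the distance between \<open>2 * R\<close> and itself.\<close>
    have "norm (x - y) \<le> 2 * R" using bspec[OF R that(1)] bspec[OF R that(2)] norm_triangle_ineq4[of x y] by simp
    then have p: "norm (x - y) \<le> (2 * R) powr (1 - \<alpha>) * norm (x - y) powr \<alpha>" by (intro powr_interpolation \<alpha>) auto
    have "norm (T (f x) - T (f y)) \<le> C * norm (f x - f y)" by (rule T_lip)
    also have "\<dots> \<le> C * (K * norm (x - y))" by (intro mult_left_mono C_nonneg K(2) that)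
    also have "\<dots> \<le> C * (K * ((2 * R) powr (1 - \<alpha>) * norm (x - y) powr \<alpha>))" by (intro mult_left_mono C_nonneg K(1) p)
    finally show ?thesis by (simp add: mult.assoc)
  qed
  ultimately show ?thesis unfolding holder_space_def by blast
qed

theorem lipschitz_sobolev_continuous:
  fixes U :: "(real ^ 'm) set"
  assumes U: "open U" "bounded U" and q: "1 \<le> q"
  shows "continuous_map (holder_topology U 1) (lipschitz_sobolev_topology U q) (\<lambda>f :: real ^ 'm \<Rightarrow> 'v. \<lambda>x. T (f x))"
  unfolding holder_topology_def lipschitz_sobolev_topology_def
proof (rule seminorm_topology_continuous_map)
  note HS = holder_in_sobolev(1)[OF U q]
  fix f :: "real ^ 'm \<Rightarrow> 'v" assume f: "f \<in> holder_space U 1"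
  show "(\<lambda>x. T (f x)) \<in> holder_space U 1" by (rule holder_space_compose[OF U(2) _ _ f]) auto
  show "holder_norm U 1 (\<lambda>x. f x - f x) = 0" by (rule holder_norm_zero[OF U(1)])
  fix e :: real assume e: "0 < e"
  obtain \<delta> where \<delta>: "0 < \<delta>"
    "\<forall>g\<in>sobolev_space U q. sobolev_norm U q (\<lambda>x. g x - f x) < \<delta> \<longrightarrow> sobolev_norm U q (\<lambda>x. T (g x) - T (f x)) < e"
    using sobolev_norm_continuous[OF U(1) q HS[OF f] e] by blast
  define c where "c = real (Suc CARD('m)) * Lq_norm U q (\<lambda>x :: real ^ 'm. 1 :: real)"
  have c: "0 \<le> c" by (simp add: c_def Lq_norm_nonneg)
  show "\<exists>\<delta>>0. \<forall>g\<in>holder_space U 1. holder_norm U 1 (\<lambda>x. g x - f x) < \<delta> \<longrightarrow> sobolev_norm U q (\<lambda>x. T (g x) - T (f x)) < e"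
  proof (intro exI conjI ballI impI)
    \<comment> \<open>Adding 1 allows \<open>c = 0\<close> and makes
      \<open>c * (\<delta> / (c + 1))\<close> strictly less than \<delta>.\<close>
    show "0 < \<delta> / (c + 1)" using \<delta> c by simp
    fix g assume g: "g \<in> holder_space U 1" and n: "holder_norm U 1 (\<lambda>x. g x - f x) < \<delta> / (c + 1)"
    have "sobolev_norm U q (\<lambda>x. g x - f x) < \<delta>"
    proof (cases "U = {}")
      case True
      have "Lq_norm U q h = 0" for h :: "real ^ 'm \<Rightarrow> 'v"
      proof -
        have "(LINT x|lebesgue_on U. norm (h x) powr q) = (LINT x|lebesgue_on U. 0)"
          by (rule Bochner_Integration.integral_cong) (simp_all add: True)
        then show ?thesis using q by (simp add: Lq_norm_def)
      qed
      then show ?thesis using \<delta> by (simp add: sobolev_norm_def)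
    next
      case False
      have "sobolev_norm U q (\<lambda>x. g x - f x) \<le> c * holder_norm U 1 (\<lambda>x. g x - f x)"
        using holder_in_sobolev(2)[OF U q holder_diff[OF g f] False] by (simp add: c_def mult.assoc)
      also have "\<dots> \<le> c * (\<delta> / (c + 1))" using n c by (intro mult_left_mono) auto
      also have "\<dots> < \<delta>" using c \<delta>(1) by (simp add: field_simps)
      finally show ?thesis .
    qed
    then show "sobolev_norm U q (\<lambda>x. T (g x) - T (f x)) < e" using \<delta>(2) HS[OF g] by blast
  qed
next
  note HS = holder_in_sobolev(1)[OF U q]
  fix f :: "real ^ 'm \<Rightarrow> 'w" assume f: "f \<in> holder_space U 1"
  show "sobolev_norm U q (\<lambda>x. f x - f x) = 0" by (rule sobolev_norm_zero[OF U(1) q HS[OF f]])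
  fix g h :: "real ^ 'm \<Rightarrow> 'w" assume gh: "g \<in> holder_space U 1" "h \<in> holder_space U 1"
  show "sobolev_norm U q (\<lambda>x. f x - h x) \<le> sobolev_norm U q (\<lambda>x. f x - g x) + sobolev_norm U q (\<lambda>x. g x - h x)"
    by (rule sobolev_norm_triangle[OF U(1) q HS[OF f] HS[OF gh(1)] HS[OF gh(2)]])
qed

text \<open>The difference of the compositions is uniformly of order \<delta>, while its Lipschitz
  seminorm is merely bounded. Interpolation gives a seminorm of order \<delta> to the power
  \<open>1 - \<alpha>\<close>, a gain that disappears at exponent 1.\<close>

theorem holder_continuous:
  fixes U :: "(real ^ 'm) set"
  assumes U: "open U" "U \<noteq> {}" "bounded U" and \<alpha>: "0 < \<alpha>" "\<alpha> < 1"
  shows "continuous_map (holder_topology U 1) (holder_topology U \<alpha>) (\<lambda>f :: real ^ 'm \<Rightarrow> 'v. \<lambda>x. T (f x))"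
  unfolding holder_topology_def
proof (rule seminorm_topology_continuous_map)
  have \<alpha>': "\<alpha> \<le> 1" using \<alpha> by simp
  fix f :: "real ^ 'm \<Rightarrow> 'v" assume f: "f \<in> holder_space U 1"
  show "(\<lambda>x. T (f x)) \<in> holder_space U \<alpha>" by (rule holder_space_compose[OF U(3) \<alpha>(1) \<alpha>' f])
  show "holder_norm U 1 (\<lambda>x. f x - f x) = 0" by (rule holder_norm_zero[OF U(1)])
  fix e :: real assume e: "0 < e"
  obtain K where K: "0 \<le> K" "\<And>x y. x \<in> U \<Longrightarrow> y \<in> U \<Longrightarrow> norm (f x - f y) \<le> K * norm (x - y)"
    using holder_one_lipschitz[OF f] by blast
  \<comment> \<open>For \<delta> below 1, \<open>f\<close> has Lipschitz constant \<open>K\<close>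
    and \<open>g\<close> at most \<open>K + 1\<close>; composition with \<open>T\<close> multiplies
    the sum by \<open>C\<close>.\<close>
  define M where "M = C * (2 * K + 1)"
  have M: "0 \<le> M" using C_nonneg K(1) by (simp add: M_def)
  \<comment> \<open>The uniform part plus the interpolated seminorm. The factor 2 arises because the
    seminorm compares values at two points, each of norm at most
    \<open>C * \<delta>\<close>.\<close>
  let ?b = "\<lambda>\<delta>. C * \<delta> + (2 * C * \<delta>) powr (1 - \<alpha>) * M powr \<alpha>"
  have p: "((\<lambda>\<delta>. (2 * C * \<delta>) powr (1 - \<alpha>)) \<longlongrightarrow> (2 * C * 0) powr (1 - \<alpha>)) (at_right 0)"
  proof (rule tendsto_powr')
    have "\<forall>\<^sub>F \<delta> in at_right 0. 0 \<le> 2 * C * \<delta>"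
      using eventually_at_right_less[of "0 :: real"] by eventually_elim (simp add: C_nonneg)
    then show "2 * C * 0 \<noteq> 0 \<or> 0 < 1 - \<alpha> \<and> (\<forall>\<^sub>F \<delta> in at_right 0. 0 \<le> 2 * C * \<delta>)" using \<alpha> by simp
  qed (intro tendsto_intros)+
  have "(?b \<longlongrightarrow> C * 0 + (2 * C * 0) powr (1 - \<alpha>) * M powr \<alpha>) (at_right 0)"
    by (intro tendsto_add tendsto_mult tendsto_const tendsto_ident_at p)
  then have "(?b \<longlongrightarrow> 0) (at_right 0)" by simp
  then have "\<forall>\<^sub>F \<delta> in at_right 0. ?b \<delta> < e" using e by (rule order_tendstoD(2))
  moreover have "\<forall>\<^sub>F \<delta> in at_right (0::real). 0 < \<delta> \<and> \<delta> < 1"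
    using eventually_at_right_real[of 0 "1 :: real"] by simp
  ultimately have "\<forall>\<^sub>F \<delta> in at_right 0. ?b \<delta> < e \<and> 0 < \<delta> \<and> \<delta> < 1" by eventually_elim simp
  then obtain \<delta> where \<delta>: "?b \<delta> < e" "0 < \<delta>" "\<delta> < 1" using eventually_happens' trivial_limit_at_right_real by blast
  show "\<exists>\<delta>>0. \<forall>g\<in>holder_space U 1. holder_norm U 1 (\<lambda>x. g x - f x) < \<delta> \<longrightarrow> holder_norm U \<alpha> (\<lambda>x. T (g x) - T (f x)) < e"
  proof (intro exI conjI ballI impI)
    show "0 < \<delta>" by (rule \<delta>)
    fix g assume g: "g \<in> holder_space U 1" and n: "holder_norm U 1 (\<lambda>x. g x - f x) < \<delta>"
    obtain A B where AB: "0 \<le> A" "0 \<le> B" "holder_norm U 1 (\<lambda>x. g x - f x) = A + B" "\<And>x. x \<in> U \<Longrightarrow> norm (g x - f x) \<le> A"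
      "\<And>x y. x \<in> U \<Longrightarrow> y \<in> U \<Longrightarrow> norm ((g x - f x) - (g y - f y)) \<le> B * norm (x - y) powr 1"
      using holder_norm_upper[OF U(1,2) holder_diff[OF g f]] by blast
    have AB': "A \<le> \<delta>" "B \<le> 1" using AB(1-3) n \<delta> by linarith+
    have 1: "norm (T (g x) - T (f x)) \<le> C * \<delta>" if "x \<in> U" for x
    proof -
      have "norm (T (g x) - T (f x)) \<le> C * norm (g x - f x)" by (rule T_lip)
      also have "\<dots> \<le> C * \<delta>" using AB(4)[OF that] AB'(1) by (intro mult_left_mono C_nonneg) simp
      finally show ?thesis .
    qed
    have 2: "norm ((T (g x) - T (f x)) - (T (g y) - T (f y))) \<le> ((2 * C * \<delta>) powr (1 - \<alpha>) * M powr \<alpha>) * norm (x - y) powr \<alpha>"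
      if xy: "x \<in> U" "y \<in> U" for x y
    proof -
      let ?D = "(T (g x) - T (f x)) - (T (g y) - T (f y))"
      have "norm ?D \<le> 2 * C * \<delta>"
        using 1[OF xy(1)] 1[OF xy(2)] norm_triangle_ineq4[of "T (g x) - T (f x)" "T (g y) - T (f y)"] by simp
      moreover have "norm ?D \<le> M * norm (x - y)"
      proof -
        have "norm (g x - g y) \<le> norm ((g x - f x) - (g y - f y)) + norm (f x - f y)"
          using norm_triangle_ineq[of "(g x - f x) - (g y - f y)" "f x - f y"] by (simp add: algebra_simps)
        also have "\<dots> \<le> B * norm (x - y) + K * norm (x - y)"
          using AB(5)[OF xy] K(2)[OF xy] by simp
        also have "\<dots> \<le> 1 * norm (x - y) + K * norm (x - y)" using AB'(2) by (intro add_right_mono mult_right_mono) auto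
        finally have g': "norm (g x - g y) + norm (f x - f y) \<le> (2 * K + 1) * norm (x - y)"
          using K(2)[OF xy] by (simp add: algebra_simps)
        have "?D = (T (g x) - T (g y)) - (T (f x) - T (f y))" by simp
        then have "norm ?D \<le> norm (T (g x) - T (g y)) + norm (T (f x) - T (f y))" using norm_triangle_ineq4 by metis
        also have "\<dots> \<le> C * norm (g x - g y) + C * norm (f x - f y)" by (intro add_mono T_lip)
        also have "\<dots> = C * (norm (g x - g y) + norm (f x - f y))" by (simp add: distrib_left)
        also have "\<dots> \<le> C * ((2 * K + 1) * norm (x - y))" by (intro mult_left_mono C_nonneg g')
        finally show ?thesis by (simp add: M_def mult.assoc)
      qed
      ultimately have "norm ?D \<le> (2 * C * \<delta>) powr (1 - \<alpha>) * (M * norm (x - y)) powr \<alpha>"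
        by (intro powr_interpolation \<alpha> \<alpha>') auto
      then show ?thesis using M by (simp add: powr_mult mult.assoc)
    qed
    have "holder_norm U \<alpha> (\<lambda>x. T (g x) - T (f x)) \<le> ?b \<delta>" by (rule holder_norm_lower[OF U(1,2) 1 2])
    then show "holder_norm U \<alpha> (\<lambda>x. T (g x) - T (f x)) < e" using \<delta>(1) by simp
  qed
next
  fix f :: "real ^ 'm \<Rightarrow> 'w" assume f: "f \<in> holder_space U \<alpha>"
  show "holder_norm U \<alpha> (\<lambda>x. f x - f x) = 0" by (rule holder_norm_zero[OF U(1)])
  fix g h :: "real ^ 'm \<Rightarrow> 'w" assume gh: "g \<in> holder_space U \<alpha>" "h \<in> holder_space U \<alpha>"
  show "holder_norm U \<alpha> (\<lambda>x. f x - h x) \<le> holder_norm U \<alpha> (\<lambda>x. f x - g x) + holder_norm U \<alpha> (\<lambda>x. g x - h x)"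
    by (rule holder_norm_triangle[OF U(1,2) f gh])
qed

text \<open>\<open>DT\<close> describes \<open>T\<close> along straight lines, whereas
  \<open>f\<close> moves along a curve that is merely tangent to one. As \<open>T\<close> is
  Lipschitz, the error between curve and tangent stays of lower order than \<open>t\<close>.\<close>

lemma T_partial:
  fixes f :: "real ^ 'm \<Rightarrow> 'v"
  assumes p: "has_partial j f x" and s: "smooth_at (f x) (partial j f x)"
  shows "has_partial j (\<lambda>x. T (f x)) x" "partial j (\<lambda>x. T (f x)) x = DT (f x) (partial j f x)"
proof -
  let ?e = "axis j 1 :: real ^ 'm" and ?z = "partial j f x"
  let ?w = "\<lambda>t. f (x + t *\<^sub>R ?e) - (f x + t *\<^sub>R ?z)"
  let ?h = "\<lambda>t. T (f (x + t *\<^sub>R ?e)) - T (f x + t *\<^sub>R ?z)"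
  have "((\<lambda>t. f x + t *\<^sub>R ?z) has_vector_derivative ?z) (at 0)"
    by (auto intro!: derivative_eq_intros)
  from has_vector_derivative_diff[OF has_partial_vector_derivative[OF p] this]
  have "(?w has_vector_derivative 0) (at 0)" by simp
  then have "((\<lambda>t. norm (?w t) / norm t) \<longlongrightarrow> 0) (at 0)"
    by (simp add: has_vector_derivative_def has_derivative_at)
  then have Cw: "((\<lambda>t. C * (norm (?w t) / norm t)) \<longlongrightarrow> 0) (at 0)" by (rule tendsto_mult_right_zero)
  have "((\<lambda>t. norm (?h t) / norm t) \<longlongrightarrow> 0) (at 0)"
  proof (rule Lim_null_comparison[OF always_eventually Cw], rule allI)
    fix t :: real
    have "norm (?h t) / norm t \<le> C * norm (?w t) / norm t" by (intro divide_right_mono T_lip) simp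
    then show "norm (norm (?h t) / norm t) \<le> C * (norm (?w t) / norm t)" by simp
  qed
  then have h: "(?h has_vector_derivative 0) (at 0)"
    by (simp add: has_vector_derivative_def has_derivative_at bounded_linear_zero)
  have "((\<lambda>t. T (f (x + t *\<^sub>R ?e))) has_vector_derivative DT (f x) ?z) (at 0)"
    using has_vector_derivative_add[OF h T_has_vector_derivative[OF s]] by simp
  then show "has_partial j (\<lambda>x. T (f x)) x" "partial j (\<lambda>x. T (f x)) x = DT (f x) ?z"
    unfolding has_partial_def partial_def by (rule differentiableI_vector, rule vector_derivative_at)
qed

text \<open>The norm of the difference bounds both the values and, through the Lipschitz seminorm,
  the partial derivatives at every good point. So point and direction converge, and stability of
  \<open>DT\<close> applies outside one null set common to the limit and all members of the
  sequence.\<close>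

theorem partial_convergence:
  fixes A :: "nat \<Rightarrow> real ^ 'm \<Rightarrow> 'v"
  assumes U: "open U" and A: "\<And>n. A n \<in> holder_space U 1" and f: "f \<in> holder_space U 1"
    and lim: "\<And>e. 0 < e \<Longrightarrow> \<forall>\<^sub>F n in sequentially. holder_norm U 1 (\<lambda>x. A n x - f x) < e"
  shows "AE x in lebesgue_on U. (\<forall>n. has_partial j (\<lambda>x. T (A n x)) x) \<and> has_partial j (\<lambda>x. T (f x)) x \<and>
    (\<lambda>n. partial j (\<lambda>x. T (A n x)) x) \<longlonglongrightarrow> partial j (\<lambda>x. T (f x)) x"
proof -
  have good: "AE x in lborel. x \<in> U \<longrightarrow> has_partial j g x \<and> smooth_at (g x) (partial j g x)"
    if g: "g \<in> holder_space U 1" for g :: "real ^ 'm \<Rightarrow> 'v"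
  proof -
    obtain K where K: "0 \<le> K" "\<And>x y. x \<in> U \<Longrightarrow> y \<in> U \<Longrightarrow> norm (g x - g y) \<le> K * norm (x - y)"
      using holder_one_lipschitz[OF g] by blast
    note P = lipschitz_on_open_weak_partial[OF U K, of j]
    have "AE x in lborel. x \<in> U \<longrightarrow> has_partial j g x" by (rule P(1))
    moreover have "AE x in lborel. x \<in> U \<longrightarrow> smooth_at (g x) (partial j g x)" by (rule chain_rule(1)[OF U P(2)])
    ultimately show ?thesis by eventually_elim simp
  qed
  have "AE x in lborel. \<forall>n. x \<in> U \<longrightarrow> has_partial j (A n) x \<and> smooth_at (A n x) (partial j (A n) x)"
    unfolding AE_all_countable using good[OF A] by blast
  with good[OF f] have "AE x in lborel. x \<in> U \<longrightarrow> (\<forall>n. has_partial j (\<lambda>x. T (A n x)) x) \<and> has_partial j (\<lambda>x. T (f x)) x \<and>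
    (\<lambda>n. partial j (\<lambda>x. T (A n x)) x) \<longlonglongrightarrow> partial j (\<lambda>x. T (f x)) x"
  proof eventually_elim
    case (elim x)
    show ?case
    proof
      assume x: "x \<in> U"
      then have ne: "U \<noteq> {}" by blast
      have pf: "has_partial j f x" "smooth_at (f x) (partial j f x)" using elim(1) x by simp_all
      have pA: "has_partial j (A n) x" "smooth_at (A n x) (partial j (A n) x)" for n using elim(2) x by simp_all
      have bounds: "norm (A n x - f x) \<le> holder_norm U 1 (\<lambda>x. A n x - f x)"
        "norm (partial j (A n) x - partial j f x) \<le> holder_norm U 1 (\<lambda>x. A n x - f x)" for n
      proof -
        obtain a b where ab: "0 \<le> a" "0 \<le> b" "holder_norm U 1 (\<lambda>x. A n x - f x) = a + b" "\<And>x. x \<in> U \<Longrightarrow> norm (A n x - f x) \<le> a"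
          "\<And>x y. x \<in> U \<Longrightarrow> y \<in> U \<Longrightarrow> norm ((A n x - f x) - (A n y - f y)) \<le> b * norm (x - y) powr 1"
          using holder_norm_upper[OF U ne holder_diff[OF A f]] by blast
        show "norm (A n x - f x) \<le> holder_norm U 1 (\<lambda>x. A n x - f x)" using ab(1-3) ab(4)[OF x] by simp
        have d: "((\<lambda>t. A n (x + t *\<^sub>R axis j 1) - f (x + t *\<^sub>R axis j 1)) has_vector_derivative partial j (A n) x - partial j f x) (at 0)"
          by (intro has_vector_derivative_diff has_partial_vector_derivative pA pf)
        have "norm (partial j (\<lambda>x. A n x - f x) x) \<le> b"
        proof (rule partial_norm_le[OF U x])
          show "norm ((A n x - f x) - (A n y - f y)) \<le> b * norm (x - y)" if "x \<in> U" "y \<in> U" for x y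
            using ab(5)[OF that] by simp
          show "has_partial j (\<lambda>x. A n x - f x) x" unfolding has_partial_def by (rule differentiableI_vector[OF d])
        qed
        moreover have "partial j (\<lambda>x. A n x - f x) x = partial j (A n) x - partial j f x"
          unfolding partial_def[of j "\<lambda>x. A n x - f x"] by (rule vector_derivative_at[OF d])
        ultimately show "norm (partial j (A n) x - partial j f x) \<le> holder_norm U 1 (\<lambda>x. A n x - f x)" using ab(1-3) by simp
      qed
      have conv: "Y \<longlonglongrightarrow> y" if "\<And>n. norm (Y n - y) \<le> holder_norm U 1 (\<lambda>x. A n x - f x)" for Y :: "nat \<Rightarrow> 'v" and y
      proof (rule tendstoI)
        fix e :: real assume "0 < e"
        from lim[OF this] show "\<forall>\<^sub>F n in sequentially. dist (Y n) y < e"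
        proof eventually_elim
          case (elim n)
          then show ?case using that[of n] by (simp add: dist_norm)
        qed
      qed
      have "(\<lambda>n. DT (A n x) (partial j (A n) x)) \<longlonglongrightarrow> DT (f x) (partial j f x)"
        by (rule DT_stable[OF conv[OF bounds(1)] conv[OF bounds(2)] pA(2) pf(2)])
      then show "(\<forall>n. has_partial j (\<lambda>x. T (A n x)) x) \<and> has_partial j (\<lambda>x. T (f x)) x \<and>
        (\<lambda>n. partial j (\<lambda>x. T (A n x)) x) \<longlonglongrightarrow> partial j (\<lambda>x. T (f x)) x"
        using T_partial[OF pA] T_partial[OF pf] by simp
    qed
  qed
  then show ?thesis using AE_lebesgue_on_iff[OF borel_open[OF U]] by blast
qed

end

section \<open>The singular value map\<close>

text \<open>The locale indexes components by basis vectors, and \<open>idx\<close> recovers the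
  coordinate. The component is a difference of consecutive Ky Fan norms of order at most the number
  of columns, which is why that number serves as the common Lipschitz constant.\<close>

lemma singular_values_dc_map:
  defines "idx \<equiv> \<lambda>b. THE i. b = (axis i 1 :: real ^ ('d :: {finite,linorder}))"
  shows "dc_map (singular_values :: complex ^ ('d :: {finite,linorder}) ^ 'D \<Rightarrow> _)
    (\<lambda>b. kyfan (Suc (card {j. j < idx b}))) (\<lambda>b. kyfan (card {j. j < idx b})) (real CARD('d))"
proof
  fix b :: "real ^ ('d :: {finite,linorder})"
  have le: "Suc (card {j. j < idx b}) \<le> CARD('d)" by (rule card_less_CARD)
  then have le': "card {j. j < idx b} \<le> CARD('d)" by simp
  show "convex_on UNIV (kyfan (Suc (card {j. j < idx b})) :: complex ^ ('d :: {finite,linorder}) ^ 'D \<Rightarrow> real)"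
    "convex_on UNIV (kyfan (card {j. j < idx b}) :: complex ^ ('d :: {finite,linorder}) ^ 'D \<Rightarrow> real)"
    by (rule kyfan_convex[OF le] kyfan_convex[OF le'])+
  show "(real CARD('d))-lipschitz_on UNIV (kyfan (Suc (card {j. j < idx b})) :: complex ^ ('d :: {finite,linorder}) ^ 'D \<Rightarrow> real)"
    by (rule lipschitz_on_le[OF kyfan_lipschitz[OF le]]) (use le in \<open>simp only: of_nat_le_iff\<close>)
  show "(real CARD('d))-lipschitz_on UNIV (kyfan (card {j. j < idx b}) :: complex ^ ('d :: {finite,linorder}) ^ 'D \<Rightarrow> real)"
    by (rule lipschitz_on_le[OF kyfan_lipschitz[OF le']]) (use le' in \<open>simp only: of_nat_le_iff\<close>)
  fix A :: "complex ^ ('d :: {finite,linorder}) ^ 'D"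
  assume "b \<in> Basis"
  then obtain i where i: "b = axis i 1" by (auto simp: Basis_vec_def)
  have "idx b = i" unfolding idx_def i by (rule the_equality) (simp_all add: axis_eq_axis)
  then show "singular_values A \<bullet> b = kyfan (Suc (card {j. j < idx b})) A - kyfan (card {j. j < idx b}) A"
    by (simp add: i inner_axis singular_values_kyfan)
next
  show "singular_values (0 :: complex ^ ('d :: {finite,linorder}) ^ 'D) = 0"
    using card_less_CARD[where ?'d = 'd] by (simp add: vec_eq_iff singular_values_kyfan kyfan_zero Suc_leD)
qed

lemma sigma_star_eq: "sigma_star A = (\<lambda>x. singular_values (A x))"
  by (simp add: sigma_star_def comp_def)

text \<open>The matrix field with the single nonzero entry \<open>x\<^sub>k - p\<^sub>k - s\<close> has the largest singular value
  \<open>\<bar>x\<^sub>k - p\<^sub>k - s\<bar>\<close>. Shifting the corner of the absolute value changes its Lipschitz seminorm by 2.\<close>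

lemma sigma_star_not_lipschitz_continuous:
  fixes U :: "(real ^ 'm) set"
  assumes U: "open U" "bounded U" "U \<noteq> {}"
  shows "\<not> continuous_map (holder_topology U 1) (holder_topology U 1)
    (sigma_star :: (real ^ 'm \<Rightarrow> complex ^ ('d :: {finite,linorder}) ^ 'D) \<Rightarrow> _)"
proof
  assume cont: "continuous_map (holder_topology U 1) (holder_topology U 1)
    (sigma_star :: (real ^ 'm \<Rightarrow> complex ^ ('d :: {finite,linorder}) ^ 'D) \<Rightarrow> _)"
  interpret dc_map "singular_values :: complex ^ ('d :: {finite,linorder}) ^ 'D \<Rightarrow> _"
    "\<lambda>b. kyfan (Suc (card {j. j < (THE i. b = (axis i 1 :: real ^ ('d :: {finite,linorder})))}))"
    "\<lambda>b. kyfan (card {j. j < (THE i. b = (axis i 1 :: real ^ ('d :: {finite,linorder})))})" "real CARD('d)"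
    by (rule singular_values_dc_map)
  obtain p where p: "p \<in> U" using U(3) by blast
  obtain k :: 'm where "k \<in> UNIV" by blast
  let ?e = "axis k 1 :: real ^ 'm"
  obtain i :: 'D where "i \<in> UNIV" by blast
  \<comment> \<open>The least index has position 0, so the component at \<open>i0\<close> is the
    largest singular value.\<close>
  define i0 where "i0 = Min (UNIV :: 'd set)"
  have card0: "{j. j < i0} = {}" unfolding i0_def by (auto simp: not_less)
  define E :: "complex ^ ('d :: {finite,linorder}) ^ 'D" where "E = (\<chi> k l. if k = i \<and> l = i0 then of_real 1 else 0)"
  have sv: "singular_values (a *\<^sub>R E) $ i0 = \<bar>a\<bar>" for a
  proof -
    have "a *\<^sub>R E = (\<chi> k l. if k = i \<and> l = i0 then of_real a else 0)" by (simp add: E_def vec_eq_iff of_real_def)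
    then have "kyfan 1 (a *\<^sub>R E) = \<bar>a\<bar>" by (simp only: kyfan_one_single)
    moreover have "kyfan 0 (a *\<^sub>R E) = 0" by (rule kyfan_def[THEN trans]) simp
    ultimately show ?thesis by (simp only: singular_values_kyfan card0 card.empty One_nat_def diff_0_right)
  qed
  define f where "f s x = (x $ k - p $ k - s) *\<^sub>R E" for s :: real and x :: "real ^ 'm"
  have f: "f s \<in> holder_space U 1" for s
  proof -
    have c: "continuous_on S (f s)" for S unfolding f_def by (intro continuous_intros)
    have "compact (f s ` closure U)" by (rule compact_continuous_image[OF c]) (simp add: U compact_closure)
    then have "bounded (f s ` U)" by (rule bounded_subset[OF compact_imp_bounded image_mono[OF closure_subset]])
    moreover have "norm (f s x - f s y) \<le> norm E * norm (x - y) powr 1" for x y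
    proof -
      have "f s x - f s y = ((x - y) $ k) *\<^sub>R E" by (simp add: f_def scaleR_left_diff_distrib)
      then have "norm (f s x - f s y) = \<bar>(x - y) $ k\<bar> * norm E" by (simp only: norm_scaleR)
      also have "\<dots> \<le> norm (x - y) * norm E" by (intro mult_right_mono component_le_norm_cart) simp
      finally show ?thesis by (simp add: mult.commute)
    qed
    ultimately show ?thesis using c unfolding holder_space_def by blast
  qed
  have sf: "sigma_star (f s) \<in> holder_space U 1" for s
    unfolding sigma_star_eq by (rule holder_space_compose[OF U(2) _ _ f]) auto
  let ?V = "{g \<in> holder_space U 1. holder_norm U 1 (\<lambda>x. g x - sigma_star (f 0) x) < 1}"
  have top: "topspace (holder_topology U 1) = (holder_space U 1 :: (real ^ 'm \<Rightarrow> complex ^ ('d :: {finite,linorder}) ^ 'D) set)"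
    unfolding holder_topology_def by (rule seminorm_topology_topspace) (rule holder_norm_zero[OF U(1)])
  let ?W = "{g \<in> holder_space U 1. sigma_star (g :: real ^ 'm \<Rightarrow> complex ^ ('d :: {finite,linorder}) ^ 'D) \<in> ?V}"
  have V: "openin (holder_topology U 1) ?V"
    unfolding holder_topology_def by (rule seminorm_topology_ball[OF sf zero_less_one])
  have W: "openin (seminorm_topology (holder_space U 1) (holder_norm U 1)) ?W"
    unfolding holder_topology_def[symmetric]
    by (rule openin_continuous_map_preimage[OF cont V, unfolded top])
  have fW: "f 0 \<in> ?W"
    using f sf holder_norm_zero[OF U(1), of 1 "sigma_star (f 0)"] by simp
  \<comment> \<open>Continuity makes the preimage of the unit ball open; this turns it into a ball
    around \<open>f 0\<close>, in which a contradictory \<open>f s\<close> can be placed.\<close>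
  obtain r where r: "0 < r" "{g \<in> holder_space U 1. holder_norm U 1 (\<lambda>x. g x - f 0 x) < r} \<subseteq> ?W"
    using seminorm_topology_openD[where S = "holder_space U 1" and N = "holder_norm U 1", OF holder_norm_triangle[OF U(1,3)] W fW f] by blast
  obtain d where d: "0 < d" "ball p d \<subseteq> U" using U(1) p open_contains_ball by blast
  define c where "c = norm E + 1"
  \<comment> \<open>The first bound keeps \<open>p + s *\<^sub>R ?e\<close> inside \<open>U\<close>,
    the second keeps \<open>f s\<close> within distance \<open>r\<close> of \<open>f 0\<close>.
    Using \<open>norm E + 1\<close> in place of \<open>norm E\<close> makes the divisor
    positive.\<close>
  define s where "s = min (d / 2) (r / (2 * c))"
  have E: "0 < c" unfolding c_def using norm_ge_zero[of E] by linarith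
  have s: "0 < s" "s < d" using d(1) r(1) E by (auto simp: s_def)
  have "s * norm E \<le> s * c" using s by (simp add: c_def)
  also have "\<dots> \<le> r / (2 * c) * c" using E by (intro mult_right_mono) (simp_all add: s_def)
  also have "\<dots> = r / 2" using E by simp
  also have "\<dots> < r" using r(1) by simp
  finally have sE: "s * norm E < r" .
  have "f s x - f 0 x = (- s) *\<^sub>R E" for x by (simp add: f_def scaleR_left_diff_distrib)
  then have "holder_norm U 1 (\<lambda>x. f s x - f 0 x) \<le> s * norm E + 0"
    using s by (intro holder_norm_lower[OF U(1,3)]) (simp_all only: norm_scaleR, simp_all)
  then have "holder_norm U 1 (\<lambda>x. f s x - f 0 x) < r" using sE by linarith
  then have "f s \<in> ?W" using f by (intro subsetD[OF r(2)] CollectI conjI)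
  then have small: "holder_norm U 1 (\<lambda>x. sigma_star (f s) x - sigma_star (f 0) x) < 1" by simp
  obtain A B where AB: "0 \<le> A" "0 \<le> B" "holder_norm U 1 (\<lambda>x. sigma_star (f s) x - sigma_star (f 0) x) = A + B"
    "\<And>x y. x \<in> U \<Longrightarrow> y \<in> U \<Longrightarrow> norm ((sigma_star (f s) x - sigma_star (f 0) x) - (sigma_star (f s) y - sigma_star (f 0) y)) \<le> B * norm (x - y) powr 1"
    using holder_norm_upper[OF U(1,3) holder_diff[OF sf sf]] by blast
  have q: "p + s *\<^sub>R ?e \<in> U" by (rule subsetD[OF d(2)]) (use s in \<open>simp add: dist_norm norm_axis_1\<close>)
  let ?D = "(sigma_star (f s) p - sigma_star (f 0) p) - (sigma_star (f s) (p + s *\<^sub>R ?e) - sigma_star (f 0) (p + s *\<^sub>R ?e))"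
  have comp: "sigma_star (f a) x $ i0 = \<bar>x $ k - p $ k - a\<bar>" for a x by (simp only: sigma_star_eq f_def sv)
  \<comment> \<open>At \<open>p\<close> the difference of the two absolute values is
    \<open>s\<close>, at the shifted point it is \<open>- s\<close>. The change of
    \<open>2 * s\<close> over a distance \<open>s\<close> forces a Lipschitz constant of at least
    2.\<close>
  have "?D $ i0 = 2 * s" using s by (simp add: comp axis_def)
  then have "2 * s \<le> norm ?D" using component_le_norm_cart[of ?D i0] s by simp
  also have "\<dots> \<le> B * s" using AB(4)[OF p q] s by (simp add: norm_axis_1)
  finally have "2 \<le> B" using s by simp
  then show False using small AB by simp
qed

theorem theorem1p17:
  fixes U :: "(real ^ 'm) set"
  assumes "CARD('d :: {finite,linorder}) \<le> CARD('D :: finite)"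
    and "open U" and "bounded U"
  shows "(\<forall>q \<ge> 1. continuous_map (sobolev_topology U q) (sobolev_topology U q)
      (sigma_star :: (real ^ 'm \<Rightarrow> complex ^ ('d :: {finite,linorder}) ^ 'D) \<Rightarrow> _)) \<and>
    (\<forall>q \<ge> 1. continuous_map (holder_topology U 1) (lipschitz_sobolev_topology U q)
      (sigma_star :: (real ^ 'm \<Rightarrow> complex ^ ('d :: {finite,linorder}) ^ 'D) \<Rightarrow> _)) \<and>
    (lipschitz_domain U \<longrightarrow>
      (\<forall>\<alpha>. 0 < \<alpha> \<and> \<alpha> < 1 \<longrightarrow> continuous_map (holder_topology U 1) (holder_topology U \<alpha>)
        (sigma_star :: (real ^ 'm \<Rightarrow> complex ^ ('d :: {finite,linorder}) ^ 'D) \<Rightarrow> _)) \<and>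
      \<not> continuous_map (holder_topology U 1) (holder_topology U 1)
        (sigma_star :: (real ^ 'm \<Rightarrow> complex ^ ('d :: {finite,linorder}) ^ 'D) \<Rightarrow> _)) \<and>
    (\<forall>(A :: nat \<Rightarrow> real ^ 'm \<Rightarrow> complex ^ ('d :: {finite,linorder}) ^ 'D) A\<^sub>0.
      (\<forall>n. A n \<in> holder_space U 1) \<and> limitin (holder_topology U 1) A A\<^sub>0 sequentially \<longrightarrow>
      (\<forall>j. AE x in lebesgue_on U.
        (\<forall>n. has_partial j (sigma_star (A n)) x) \<and> has_partial j (sigma_star A\<^sub>0) x \<and>
        (\<lambda>n. partial j (sigma_star (A n)) x) \<longlonglongrightarrow> partial j (sigma_star A\<^sub>0) x))"
proof -
  note U = assms(2,3)
  interpret dc_map "singular_values :: complex ^ ('d :: {finite,linorder}) ^ 'D \<Rightarrow> _"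
    "\<lambda>b. kyfan (Suc (card {j. j < (THE i. b = (axis i 1 :: real ^ ('d :: {finite,linorder})))}))"
    "\<lambda>b. kyfan (card {j. j < (THE i. b = (axis i 1 :: real ^ ('d :: {finite,linorder})))})" "real CARD('d)"
    by (rule singular_values_dc_map)
  have eq: "(sigma_star :: (real ^ 'm \<Rightarrow> complex ^ ('d :: {finite,linorder}) ^ 'D) \<Rightarrow> _) = (\<lambda>f x. singular_values (f x))"
    by (rule ext) (rule sigma_star_eq)
  show ?thesis
  proof (intro conjI allI impI; (elim conjE)?)
    show "continuous_map (sobolev_topology U q) (sobolev_topology U q) (sigma_star :: (real ^ 'm \<Rightarrow> complex ^ ('d :: {finite,linorder}) ^ 'D) \<Rightarrow> _)"
      if "1 \<le> q" for q
      unfolding eq by (rule sobolev_continuous[OF U(1) that])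
    show "continuous_map (holder_topology U 1) (lipschitz_sobolev_topology U q) (sigma_star :: (real ^ 'm \<Rightarrow> complex ^ ('d :: {finite,linorder}) ^ 'D) \<Rightarrow> _)"
      if "1 \<le> q" for q
      unfolding eq by (rule lipschitz_sobolev_continuous[OF U that])
    show "continuous_map (holder_topology U 1) (holder_topology U \<alpha>) (sigma_star :: (real ^ 'm \<Rightarrow> complex ^ ('d :: {finite,linorder}) ^ 'D) \<Rightarrow> _)"
      if "lipschitz_domain U" "0 < \<alpha>" "\<alpha> < 1" for \<alpha>
      unfolding eq using that(1) by (intro holder_continuous U that) (simp add: lipschitz_domain_def)
    show "\<not> continuous_map (holder_topology U 1) (holder_topology U 1) (sigma_star :: (real ^ 'm \<Rightarrow> complex ^ ('d :: {finite,linorder}) ^ 'D) \<Rightarrow> _)"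
      if "lipschitz_domain U"
      using that by (intro sigma_star_not_lipschitz_continuous U) (simp add: lipschitz_domain_def)
    fix A :: "nat \<Rightarrow> real ^ 'm \<Rightarrow> complex ^ ('d :: {finite,linorder}) ^ 'D" and A\<^sub>0 j
    assume A: "\<forall>n. A n \<in> holder_space U 1" and lim: "limitin (holder_topology U 1) A A\<^sub>0 sequentially"
    note L = seminorm_topology_limitin[OF holder_norm_zero[OF U(1)] lim[unfolded holder_topology_def]]
    show "AE x in lebesgue_on U. (\<forall>n. has_partial j (sigma_star (A n)) x) \<and> has_partial j (sigma_star A\<^sub>0) x \<and>
        (\<lambda>n. partial j (sigma_star (A n)) x) \<longlonglongrightarrow> partial j (sigma_star A\<^sub>0) x"
      unfolding sigma_star_eq by (rule partial_convergence[OF U(1) _ L(1)[OF zero_less_one] L(2)]) (use A in auto)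
  qed
qed

end
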